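(* Let $0\le\mathfrak a<\mathfrak b$, $\mathfrak c\ge0$, $\beta\ge0$, $\gamma\ge-\frac12$, $r\in\mathbb N$, and let $f\in L^p(\mathsf W^{\beta,\gamma}_{\mathfrak a,\mathfrak b,\mathfrak c},\Lambda_{\mathfrak a,\mathfrak b,\mathfrak c})$ if $1\le p<\infty$, $f\in C(\Lambda_{\mathfrak a,\mathfrak b,\mathfrak c})$ if $p=\infty$. Then there is a constant $c$ independent of $f$ and $n$ such that for $n=1,2,\dots$: (i) $E_n(f)_p\le c\,K_r(f;n^{-1})_p$; (ii) $K_r(f;n^{-1})_p\le c\,n^{-r}\sum_{k=0}^n(k+1)^{r-1}E_k(f)_p$.
   Context: $\Omega_{\mathfrak a,\mathfrak b,\mathfrak c}=\{(u,v):|u|\le1,\ \mathfrak a+(\mathfrak c-\mathfrak a)u^2\le v^2\le\mathfrak b+(\mathfrak c-\mathfrak b)u^2\}$ and $\Lambda_{\mathfrak a,\mathfrak b,\mathfrak c}=\{(u,v)\in\Omega_{\mathfrak a,\mathfrak b,\mathfrak c}:v\ge0\}$, with weight $\mathsf W^{\beta,\gamma}_{\mathfrak a,\mathfrak b,\mathfrak c}(u,v)=|v|\Big(\frac{-\mathfrak a+(\mathfrak a-\mathfrak c)u^2+v^2}{\mathfrak b-\mathfrak a}\Big)^{\beta-\frac12}\Big(\frac{\mathfrak b-(\mathfrak b-\mathfrak c)u^2-v^2}{\mathfrak b-\mathfrak a}\Big)^{\gamma}$. $\|\cdot\|_p$ is the $L^p$ norm on $\Lambda_{\mathfrak a,\mathfrak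 b,\mathfrak c}$ with respect to $\mathsf W^{\beta,\gamma}_{\mathfrak a,\mathfrak b,\mathfrak c}(u,v)\,du\,dv$ (uniform norm if $p=\infty$). $\Pi^{\circ,\mathsf E}_n$ is the space of polynomials of degree at most $n$ in two variables that are even in the second variable, and $E_n(f)_p=\inf_{g\in\Pi^{\circ,\mathsf E}_n}\|f-g\|_p$. $\mathcal V^{\circ,\mathsf E}_n$ is the space of polynomials of degree $n$, even in the second variable, orthogonal in $L^2(\mathsf W^{\beta,\gamma}_{\mathfrak a,\mathfrak b,\mathfrak c},\Omega_{\mathfrak a,\mathfrak b,\mathfrak c})$ to all polynomials of lower degree, and $\operatorname{proj}_n$ is the orthogonal projection of $L^2(\mathsf W^{\beta,\gamma}_{\mathfrak a,\mathfrak b,\mathfrak c},\Lambda_{\mathfrak a,\mathfrak b,\mathfrak c})$ onto it. The fractional operator $(-\mathfrak D)^{r/2}$ is defined spectrally by $\operatorname{proj}_n\big((-\mathfrak D)^{r/2}g\big)=\big(n(n+2\beta+2\gamma+2)\big)^{r/2}\operatorname{proj}_n g$ for all $n$ (the numbers $-n(n+2\beta+2\gamma+2)$ being the eigenvalues of the second-order differential operator $\mathfrak D$ on $\mathcal V^{\circ,\mathsf E}_n$). The K-functional is $K_r(f;\rho)_p=\inf_{g\in C^r(\Lambda_{\mathfrak a,\mathfrak b,\mathfrak c})}\{\|f-g\|_p+\rho^r\|(-\mathfrak D)^{r/2}g\|_p\}$. *)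

theory Defs
  imports "HOL-Analysis.Analysis"
begin

definition Omega :: "real \<Rightarrow> real \<Rightarrow> real \<Rightarrow> (real \<times> real) set" where
  "Omega a b c = {(u, v). \<bar>u\<bar> \<le> 1 \<and> a + (c - a) * u^2 \<le> v^2 \<and> v^2 \<le> b + (c - b) * u^2}"

definition Lambda :: "real \<Rightarrow> real \<Rightarrow> real \<Rightarrow> (real \<times> real) set" where
  "Lambda a b c = {(u, v). (u, v) \<in> Omega a b c \<and> v \<ge> 0}"

definition Wt :: "real \<Rightarrow> real \<Rightarrow> real \<Rightarrow> real \<Rightarrow> real \<Rightarrow> real \<times> real \<Rightarrow> real" where
  "Wt a b c \<beta> \<gamma> = (\<lambda>(u, v). \<bar>v\<bar>
      * ((- a + (a - c) * u^2 + v^2) / (b - a)) powr (\<beta> - 1/2)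
      * ((b - (b - c) * u^2 - v^2) / (b - a)) powr \<gamma>)"

definition wmeas :: "real \<Rightarrow> real \<Rightarrow> real \<Rightarrow> real \<Rightarrow> real \<Rightarrow> (real \<times> real) set \<Rightarrow> (real \<times> real) measure" where
  "wmeas a b c \<beta> \<gamma> S = density (restrict_space lborel S) (\<lambda>x. ennreal (Wt a b c \<beta> \<gamma> x))"

definition lpnorm :: "real \<Rightarrow> real \<Rightarrow> real \<Rightarrow> real \<Rightarrow> real \<Rightarrow> ennreal \<Rightarrow> (real \<times> real \<Rightarrow> real) \<Rightarrow> ennreal" where
  "lpnorm a b c \<beta> \<gamma> p f =
     (if p = \<infinity> then (SUP x\<in>Lambda a b c. ennreal \<bar>f x\<bar>)
      else (let I = (\<integral>\<^sup>+ x. ennreal (\<bar>f x\<bar> powr enn2real p) \<partial>wmeas a b c \<beta> \<gamma> (Lambda a b c))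
            in if I = \<infinity> then \<infinity> else ennreal (enn2real I powr (1 / enn2real p))))"

definition Lp_class :: "real \<Rightarrow> real \<Rightarrow> real \<Rightarrow> real \<Rightarrow> real \<Rightarrow> ennreal \<Rightarrow> (real \<times> real \<Rightarrow> real) \<Rightarrow> bool" where
  "Lp_class a b c \<beta> \<gamma> p f =
     (if p = \<infinity> then continuous_on (Lambda a b c) f
      else f \<in> borel_measurable (wmeas a b c \<beta> \<gamma> (Lambda a b c)) \<and>
           (\<integral>\<^sup>+ x. ennreal (\<bar>f x\<bar> powr enn2real p) \<partial>wmeas a b c \<beta> \<gamma> (Lambda a b c)) < \<infinity>)"

definition poly2 :: "nat \<Rightarrow> (nat \<Rightarrow> nat \<Rightarrow> real) \<Rightarrow> real \<times> real \<Rightarrow> real" where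
  "poly2 n cf = (\<lambda>(u, v). \<Sum>i\<le>n. \<Sum>j\<le>n. if i + j \<le> n then cf i j * u ^ i * v ^ j else 0)"

definition PolyAll :: "nat \<Rightarrow> (real \<times> real \<Rightarrow> real) set" where
  "PolyAll n = {poly2 n cf | cf. True}"

definition PolyE :: "nat \<Rightarrow> (real \<times> real \<Rightarrow> real) set" where
  "PolyE n = {poly2 n cf | cf. \<forall>i j. odd j \<longrightarrow> cf i j = 0}"

definition Vspace :: "real \<Rightarrow> real \<Rightarrow> real \<Rightarrow> real \<Rightarrow> real \<Rightarrow> nat \<Rightarrow> (real \<times> real \<Rightarrow> real) set" where
  "Vspace a b c \<beta> \<gamma> n = {q \<in> PolyE n. \<forall>m<n. \<forall>P\<in>PolyAll m.
      (\<integral>x. q x * P x \<partial>wmeas a b c \<beta> \<gamma> (Omega a b c)) = 0}"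

definition proj :: "real \<Rightarrow> real \<Rightarrow> real \<Rightarrow> real \<Rightarrow> real \<Rightarrow> nat \<Rightarrow> (real \<times> real \<Rightarrow> real) \<Rightarrow> real \<times> real \<Rightarrow> real" where
  "proj a b c \<beta> \<gamma> n h = (THE q. q \<in> Vspace a b c \<beta> \<gamma> n \<and>
      (\<forall>P\<in>Vspace a b c \<beta> \<gamma> n. (\<integral>x. (h x - q x) * P x \<partial>wmeas a b c \<beta> \<gamma> (Lambda a b c)) = 0))"

text \<open>h = (-D)^{r/2} g, defined spectrally.\<close>
definition fracop :: "real \<Rightarrow> real \<Rightarrow> real \<Rightarrow> real \<Rightarrow> real \<Rightarrow> nat \<Rightarrow> (real \<times> real \<Rightarrow> real) \<Rightarrow> (real \<times> real \<Rightarrow> real) \<Rightarrow> bool" where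
  "fracop a b c \<beta> \<gamma> r g h =
     (h \<in> borel_measurable (wmeas a b c \<beta> \<gamma> (Lambda a b c)) \<and>
      (\<forall>m. \<forall>P\<in>PolyAll m. integrable (wmeas a b c \<beta> \<gamma> (Lambda a b c)) (\<lambda>x. h x * P x)) \<and>
      (\<forall>n. proj a b c \<beta> \<gamma> n h =
           (\<lambda>x. (real n * (real n + 2 * \<beta> + 2 * \<gamma> + 2)) powr (real r / 2) * proj a b c \<beta> \<gamma> n g x)))"

fun Ck :: "nat \<Rightarrow> (real \<times> real) set \<Rightarrow> (real \<times> real \<Rightarrow> real) \<Rightarrow> bool" where
  "Ck 0 U f = continuous_on U f"
| "Ck (Suc k) U f = (\<exists>f1 f2. (\<forall>x\<in>U. (f has_derivative (\<lambda>h. f1 x * fst h + f2 x * snd h)) (at x))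
                        \<and> Ck k U f1 \<and> Ck k U f2)"

definition Cr_on :: "(real \<times> real) set \<Rightarrow> nat \<Rightarrow> (real \<times> real \<Rightarrow> real) \<Rightarrow> bool" where
  "Cr_on S r g = (\<exists>U G. open U \<and> S \<subseteq> U \<and> Ck r U G \<and> (\<forall>x\<in>S. G x = g x))"

definition Kfun :: "real \<Rightarrow> real \<Rightarrow> real \<Rightarrow> real \<Rightarrow> real \<Rightarrow> ennreal \<Rightarrow> nat \<Rightarrow> (real \<times> real \<Rightarrow> real) \<Rightarrow> real \<Rightarrow> ennreal" where
  "Kfun a b c \<beta> \<gamma> p r f \<rho> =
     (Inf {lpnorm a b c \<beta> \<gamma> p (\<lambda>x. f x - g x) + ennreal (\<rho> ^ r) * lpnorm a b c \<beta> \<gamma> p h | g h.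
          Cr_on (Lambda a b c) r g \<and> fracop a b c \<beta> \<gamma> r g h})"

definition Ebest :: "real \<Rightarrow> real \<Rightarrow> real \<Rightarrow> real \<Rightarrow> real \<Rightarrow> ennreal \<Rightarrow> nat \<Rightarrow> (real \<times> real \<Rightarrow> real) \<Rightarrow> ennreal" where
  "Ebest a b c \<beta> \<gamma> p n f = (INF g\<in>PolyE n. lpnorm a b c \<beta> \<gamma> p (\<lambda>x. f x - g x))"

end

theory Submission
  imports Defs "HOL-Probability.Probability" "HOL-Complex_Analysis.Complex_Analysis"
begin

text \<open>With \<open>l = \<beta> + \<gamma> + 1\<close>, the reproducing kernel of the polynomials of degree \<open>n\<close> is the average of
  a multiple of the Gegenbauer polynomial of index \<open>l\<close> over a product of two symmetric beta measures. Hence the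
  Poisson sums of the orthogonal expansion have positive kernels of mass one and contract every \<open>L\<^sup>p\<close>, and
  the Cesaro sums of high order and length \<open>N\<close> are dominated by the Poisson kernel of radius \<open>N / (N + 1)\<close>, by a
  Cauchy estimate for the generating function. These two bounds alone imply the Bernstein
  and Jackson inequalities for the fractional operator on polynomials. Part (i) follows by approximating a smooth
  function with de la Vallee Poussin means, which commute with the fractional operator; part (ii) follows by
  telescoping near-best approximations of degree \<open>2 ^ i\<close> and applying the Bernstein inequality to each difference.\<close>

section \<open>Multipliers bounded by Cesaro and Poisson sums\<close>

text \<open>The obstacle is the root in the fractional operator for odd r:
  \<open>sqrt (k * (k + 2 * l))\<close> is out of reach of finite differences of Cesaro multipliers.
  It is factored as \<open>(k + 2 * l) * sqrt (1 - 2 * l / (k + 2 * l))\<close>. The linear factor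
  amounts to an exchange of the Cesaro orders d and d + 1; the fraction under the root is a
  resolvent of the Poisson semigroup, hence a contraction, and the root is a limit of polynomials in
  it. For a fixed polynomial Q a multiplier m is measured by the norm of the sum of m k times the
  k-th component of Q; this seminorm sees finitely many entries of m only, so pointwise limits of
  multipliers are harmless. Since only kernel bounds enter, the constants depend on neither p nor
  the degree of Q. On the geometric side nothing is differentiated: the second-order operator is
  given by its values on monomials in coordinates with U^2 + Y + Z = 1, and its symmetry is read off
  the recursions of the moments. That the zonal kernels reproduce polynomials follows from the
  Poisson kernel being an approximate identity, without dimension counts or norms of orthogonal
  polynomials.\<close>

definition ces :: "nat \<Rightarrow> nat \<Rightarrow> nat \<Rightarrow> real" where
  "ces d N k = (if k \<le> N then real ((N - k + d) choose d) else 0)"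

text \<open>The \<open>ces\<close> stay unnormalised because they arise as coefficients of powers of
  1 / (1 - z) and because their differences in N are exact; the division here makes the value at k =
  0 equal to 1.\<close>

definition cesmean :: "nat \<Rightarrow> nat \<Rightarrow> nat \<Rightarrow> real" where
  "cesmean d N k = ces d N k / real ((N + d) choose d)"

lemma cesmean_eq_0: "N < k \<Longrightarrow> cesmean d N k = 0"
  by (simp add: cesmean_def ces_def)

lemma choose_shift_Suc:
  "real ((x + Suc d) choose Suc d) * (real d + 1) = real ((x + d) choose d) * (real x + real d + 1)"
proof -
  have "Suc d * (Suc (x + d) choose Suc d) = Suc (x + d) * ((x + d) choose d)"
    using Suc_times_binomial_eq[of "x + d" d] by simp
  then have "real (Suc d * (Suc (x + d) choose Suc d)) = real (Suc (x + d) * ((x + d) choose d))"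
    by (rule arg_cong)
  then show ?thesis by (simp add: algebra_simps)
qed

lemma choose_shift_add1:
  "real ((Suc x + d) choose d) * (real x + 1) = real ((x + d) choose d) * (real x + real d + 1)"
proof -
  have "Suc (x + d) * ((x + d) choose d) = (Suc (x + d) choose d) * Suc x"
    using binomial_absorb_comp[of "Suc (x + d)" d] by (simp add: mult.commute)
  then have "real (Suc (x + d) * ((x + d) choose d)) = real ((Suc (x + d) choose d) * Suc x)"
    by (rule arg_cong)
  then show ?thesis by (simp add: algebra_simps)
qed

text \<open>Kernel estimates produce (N + 1)^d, normalisation the binomial coefficient; the two are
  comparable up to a constant depending only on d.\<close>

lemma power_le_choose: "(real N + 1) ^ d \<le> real d ^ d * real ((N + d) choose d)"
proof -
  have "(real N + 1) ^ d * fact d \<le> pochhammer (real N + 1) d * real d ^ d"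
  proof -
    have "(real N + 1) ^ d \<le> pochhammer (real N + 1) d"
    proof -
      have "(\<Prod>i<d. real N + 1) \<le> (\<Prod>i<d. real N + 1 + real i)"
        by (rule prod_mono) auto
      then show ?thesis by (simp add: pochhammer_prod lessThan_atLeast0)
    qed
    moreover have "(fact d :: real) \<le> real d ^ d"
      using fact_le_power[of d] by (metis of_nat_fact of_nat_le_iff of_nat_power order_refl)
    ultimately show ?thesis by (intro mult_mono) (auto intro: pochhammer_nonneg)
  qed
  moreover have "real ((N + d) choose d) * fact d = pochhammer (real N + 1) d"
    by (simp add: binomial_gbinomial gbinomial_pochhammer')
  ultimately have "(real N + 1) ^ d * fact d \<le> (real ((N + d) choose d) * fact d) * real d ^ d"
    by simp
  then have "(real N + 1) ^ d * fact d \<le> (real d ^ d * real ((N + d) choose d)) * fact d"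
    by (simp only: mult_ac)
  then show ?thesis by (rule mult_right_le_imp_le) simp
qed

text \<open>For k \<le> N the means of orders d + 1 and d have the quotient 1 - k / (N + d + 1).
  Multiplication by the index thus costs a factor of order N and one Cesaro order: the germ of the
  Bernstein inequality.\<close>

lemma cesmean_mult_index:
  "real k * cesmean d N k = (real N + real d + 1) * (cesmean d N k - cesmean (Suc d) N k)"
proof (cases "k \<le> N")
  case True
  then obtain x where N: "N = k + x" using le_Suc_ex by blast
  define A where "A = real ((N + d) choose d)"
  define B where "B = real ((x + d) choose d)"
  have A: "A > 0" by (simp add: A_def)
  have 1: "real ((N + Suc d) choose Suc d) = A * (real N + real d + 1) / (real d + 1)"
    using choose_shift_Suc[of N d]
    by (simp add: A_def eq_divide_eq del: binomial_Suc_Suc add_Suc_right)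
  have 2: "real ((x + Suc d) choose Suc d) = B * (real x + real d + 1) / (real d + 1)"
    using choose_shift_Suc[of x d]
    by (simp add: B_def eq_divide_eq del: binomial_Suc_Suc add_Suc_right)
  have "cesmean (Suc d) N k = (B * (real x + real d + 1) / (real d + 1)) / (A * (real N + real d + 1) / (real d + 1))"
    unfolding cesmean_def ces_def 1 using N 2 by (simp del: binomial_Suc_Suc add_Suc_right)
  moreover have "(B * (real x + real d + 1) / (real d + 1)) / (A * (real N + real d + 1) / (real d + 1))
      = B * (real x + real d + 1) / (A * (real N + real d + 1))"
    by simp
  moreover have "cesmean d N k = B / A"
    using N by (simp add: cesmean_def ces_def A_def B_def)
  moreover have "real k * (B / A) = (real N + real d + 1) * (B / A - B * (real x + real d + 1) / (A * (real N + real d + 1)))"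
  proof -
    define s where "s = real N + real d + 1"
    have s: "s > 0" "real x + real d + 1 = s - real k" by (simp_all add: s_def N)
    have "real k * (B / A) = s * (B / A - B * (s - real k) / (A * s))"
      using A s(1) by (simp add: field_simps)
    then show ?thesis unfolding s(2) s_def[symmetric] .
  qed
  ultimately show ?thesis by simp
qed (simp add: cesmean_eq_0)

text \<open>The counterpart for Jackson: the increment in n is divisible by k, and the cofactor is a
  mean of one order less times O(1 / n^2). Summation over all larger n therefore represents (1 -
  mean) / k by an absolutely convergent series of size O(1 / n).\<close>

lemma cesmean_diff:
  assumes "n \<ge> 1"
  shows "cesmean (Suc d) n k - cesmean (Suc d) (n - 1) k
    = real k * ((real d + 1) * cesmean d n k / (real n * (real n + real d + 1)))"
proof -
  obtain n' where n': "n = Suc n'" using assms by (cases n) auto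
  define A where "A = real ((n + d) choose d)"
  define s where "s = real n + real d + 1"
  have A: "A > 0" by (simp add: A_def)
  have s: "s > 0" "real d + 1 > 0" "real n > 0" using assms by (simp_all add: s_def)
  have A1: "real ((n + Suc d) choose Suc d) = A * s / (real d + 1)"
    using choose_shift_Suc[of n d]
    by (simp add: A_def s_def eq_divide_eq del: binomial_Suc_Suc add_Suc_right)
  have A2: "real ((n' + Suc d) choose Suc d) = A * real n / (real d + 1)"
  proof -
    have "real ((n + Suc d) choose Suc d) * real n = real ((n' + Suc d) choose Suc d) * s"
      using choose_shift_add1[of n' "Suc d"]
      by (simp add: n' s_def add_ac del: binomial_Suc_Suc add_Suc_right)
    then have "A * s / (real d + 1) * real n = real ((n' + Suc d) choose Suc d) * s" unfolding A1 .
    then have "(A * real n / (real d + 1)) * s = real ((n' + Suc d) choose Suc d) * s"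
      by (simp add: mult_ac del: binomial_Suc_Suc add_Suc_right)
    with s(1) show ?thesis by (metis less_irrefl mult_right_cancel)
  qed
  have J0: "cesmean (Suc d) (n - 1) k = ces (Suc d) n' k / (A * real n / (real d + 1))"
    unfolding A2[symmetric] by (simp add: cesmean_def n')
  consider "k < n" | "k = n" | "k > n" by linarith
  then show ?thesis
  proof cases
    case 1
    then obtain x where x: "n' = k + x" using n' le_Suc_ex[of k n'] by auto
    then have nk: "n = k + Suc x" using n' by simp
    define B where "B = real ((Suc x + d) choose d)"
    have B1: "real ((Suc x + Suc d) choose Suc d) = B * (s - real k) / (real d + 1)"
      using choose_shift_Suc[of "Suc x" d]
      by (simp add: B_def s_def nk eq_divide_eq algebra_simps del: binomial_Suc_Suc add_Suc_right)
    have B2: "real ((x + Suc d) choose Suc d) = B * (real n - real k) / (real d + 1)"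
    proof -
      have sk: "s - real k > 0" by (simp add: s_def nk)
      have "real ((Suc x + Suc d) choose Suc d) * (real n - real k) = real ((x + Suc d) choose Suc d) * (s - real k)"
        using choose_shift_add1[of x "Suc d"]
        by (simp add: nk s_def add_ac del: binomial_Suc_Suc add_Suc_right)
      then have "B * (s - real k) / (real d + 1) * (real n - real k) = real ((x + Suc d) choose Suc d) * (s - real k)"
        unfolding B1 .
      then have "(B * (real n - real k) / (real d + 1)) * (s - real k) = real ((x + Suc d) choose Suc d) * (s - real k)"
        by (simp add: algebra_simps del: binomial_Suc_Suc add_Suc_right)
      with sk show ?thesis by (metis less_irrefl mult_right_cancel)
    qed
    have "cesmean (Suc d) n k = (B * (s - real k) / (real d + 1)) / (A * s / (real d + 1))"
      unfolding cesmean_def A1 B1[symmetric] by (simp add: ces_def nk del: binomial_Suc_Suc add_Suc_right)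
    moreover have "cesmean (Suc d) (n - 1) k = (B * (real n - real k) / (real d + 1)) / (A * real n / (real d + 1))"
      unfolding J0 B2[symmetric] by (simp add: ces_def x del: binomial_Suc_Suc add_Suc_right)
    moreover have "cesmean d n k = B / A"
      unfolding cesmean_def A_def[symmetric] by (simp add: ces_def nk B_def)
    moreover have "(B * (s - real k) / (real d + 1)) / (A * s / (real d + 1))
        - (B * (real n - real k) / (real d + 1)) / (A * real n / (real d + 1))
      = real k * ((real d + 1) * (B / A) / (real n * s))"
    proof -
      have sn: "real d + 1 = s - real n" by (simp add: s_def)
      have "(B * (s - real k) / e) / (A * s / e) - (B * (real n - real k) / e) / (A * real n / e)
        = real k * ((s - real n) * (B / A) / (real n * s))" if "e > 0" for e
        using A s that by (simp add: divide_simps) (simp add: algebra_simps)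
      from this[OF s(2)] show ?thesis unfolding sn .
    qed
    ultimately show ?thesis unfolding s_def by simp
  next
    case 2
    have c1: "cesmean (Suc d) n k = 1 / (A * s / (real d + 1))"
      unfolding cesmean_def A1 by (simp add: ces_def 2)
    have c2: "cesmean d n k = 1 / A"
      unfolding cesmean_def A_def[symmetric] by (simp add: ces_def 2)
    have c3: "cesmean (Suc d) (n - 1) k = 0" using 2 n' by (simp add: cesmean_eq_0)
    show ?thesis using A s unfolding c1 c2 c3 unfolding s_def[symmetric] 2 by simp
  qed (use n' in \<open>simp add: cesmean_eq_0\<close>)
qed

text \<open>The \<open>d\<close>-th difference of the unnormalised Cesaro multipliers of order \<open>d\<close> is constant up to \<open>N\<close>
  and vanishes beyond \<open>N + d * h\<close>: up to normalisation it is a de la Vallee Poussin multiplier.\<close>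

primrec vpd :: "nat \<Rightarrow> nat \<Rightarrow> nat \<Rightarrow> nat \<Rightarrow> nat \<Rightarrow> real" where
  "vpd h d 0 N k = ces d N k"
| "vpd h d (Suc e) N k = vpd h d e (N + h) k - vpd h d e N k"

primrec fdiff :: "nat \<Rightarrow> nat \<Rightarrow> (nat \<Rightarrow> real) \<Rightarrow> nat \<Rightarrow> real" where
  "fdiff h 0 f x = f x"
| "fdiff h (Suc e) f x = fdiff h e f (x + h) - fdiff h e f x"

lemma fdiff_Suc_inner: "fdiff h (Suc e) f x = fdiff h e (\<lambda>y. f (y + h) - f y) x"
  by (induction e arbitrary: x) simp_all

lemma fdiff_sum_shift:
  "fdiff h e (\<lambda>y. \<Sum>l<(n::nat). f (y + l + 1)) x = (\<Sum>l<n. fdiff h e f (x + l + 1))"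
  by (induction e arbitrary: x) (simp_all add: sum_subtractf algebra_simps)

text \<open>The polynomial has degree d and leading coefficient 1 / d!, so its d-th difference is
  constant. In the induction a single difference of step h is a sum of h binomials of lower order,
  by Pascal's rule.\<close>

lemma fdiff_choose: "fdiff h d (\<lambda>x. real ((x + d) choose d)) x = real h ^ d"
proof (induction d arbitrary: x)
  case (Suc d)
  have *: "real ((y + n + Suc d) choose Suc d) - real ((y + Suc d) choose Suc d)
      = (\<Sum>l<n. real ((y + l + 1 + d) choose d))" for y n
    by (induction n) (simp_all add: algebra_simps)
  have "fdiff h (Suc d) (\<lambda>x. real ((x + Suc d) choose Suc d)) x
      = fdiff h d (\<lambda>y. \<Sum>l<h. real ((y + l + 1 + d) choose d)) x"
    unfolding fdiff_Suc_inner * ..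
  also have "\<dots> = (\<Sum>l<h. fdiff h d (\<lambda>x. real ((x + d) choose d)) (x + l + 1))"
    by (rule fdiff_sum_shift)
  also have "\<dots> = real h ^ Suc d" by (simp add: Suc.IH)
  finally show ?case .
qed simp

text \<open>The differences only increase N, so for k \<le> N the truncation in \<open>ces\<close>
  never acts and the polynomial in N - k can be differenced instead.\<close>

lemma vpd_eq_fdiff: "k \<le> N \<Longrightarrow> vpd h d e N k = fdiff h e (\<lambda>x. real ((x + d) choose d)) (N - k)"
proof (induction e arbitrary: N)
  case (Suc e)
  have "vpd h d e (N + h) k = fdiff h e (\<lambda>x. real ((x + d) choose d)) (N + h - k)"
    using Suc.prems by (intro Suc.IH) simp
  moreover have "N + h - k = N - k + h" using Suc.prems by simp
  ultimately show ?case using Suc.IH[OF Suc.prems] by (simp only: vpd.simps fdiff.simps)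
qed (simp add: ces_def)

lemma vpd_value: "k \<le> N \<Longrightarrow> vpd h d d N k = real h ^ d"
  by (simp add: vpd_eq_fdiff fdiff_choose)

text \<open>In the application \<open>\<nu> m\<close> is the norm of the multiplier m applied to a
  fixed polynomial; \<open>fin_dep\<close> records that the polynomial has only finitely many
  components.\<close>

locale mult_seminorm =
  fixes \<nu> :: "(nat \<Rightarrow> real) \<Rightarrow> real"
  assumes tri: "\<nu> (\<lambda>k. m k + m' k) \<le> \<nu> m + \<nu> m'"
    and hom: "\<nu> (\<lambda>k. c * m k) = \<bar>c\<bar> * \<nu> m"
    and fin_dep: "\<exists>n. \<forall>m m'. (\<forall>k\<le>n. m k = m' k) \<longrightarrow> \<nu> m = \<nu> m'"
begin

lemma zero: "\<nu> (\<lambda>k. 0) = 0"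
  using hom[of 0 "\<lambda>k. 0"] by simp

lemma nonneg: "0 \<le> \<nu> m"
  using tri[of m "\<lambda>k. -1 * m k"] hom[of "-1" m] zero by simp

lemma tri_diff: "\<nu> (\<lambda>k. m k - m' k) \<le> \<nu> m + \<nu> m'"
  using tri[of m "\<lambda>k. -1 * m' k"] hom[of "-1" m'] by simp

lemma sum_le: "finite A \<Longrightarrow> \<nu> (\<lambda>k. \<Sum>i\<in>A. m i k) \<le> (\<Sum>i\<in>A. \<nu> (m i))"
proof (induction A rule: finite_induct)
  case (insert x F)
  then show ?case using tri[of "m x" "\<lambda>k. \<Sum>i\<in>F. m i k"] by simp
qed (simp add: zero)

text \<open>By \<open>fin_dep\<close> the seminorm lives on a finite-dimensional space and is
  dominated there by a weighted sum of the absolute values of the entries.\<close>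

lemma continuous:
  assumes "\<And>k. (\<lambda>i. m i k) \<longlonglongrightarrow> m' k"
  shows "(\<lambda>i. \<nu> (m i)) \<longlonglongrightarrow> \<nu> m'"
proof -
  obtain n where n: "\<And>m m'. (\<forall>k\<le>n. m k = m' k) \<Longrightarrow> \<nu> m = \<nu> m'"
    using fin_dep by blast
  define u where "u j = \<nu> (\<lambda>k. if k = j then 1 else 0)" for j :: nat
  have bound: "\<nu> m \<le> (\<Sum>j\<le>n. \<bar>m j\<bar> * u j)" for m
  proof -
    have "\<nu> m = \<nu> (\<lambda>k. \<Sum>j\<le>n. m j * (if k = j then 1 else 0))"
      by (rule n) (simp add: if_distrib[of "times _"] eq_commute cong: if_cong)
    also have "\<dots> \<le> (\<Sum>j\<le>n. \<nu> (\<lambda>k. m j * (if k = j then 1 else 0)))"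
      by (rule sum_le) simp
    finally show ?thesis by (simp only: hom u_def)
  qed
  have "(\<lambda>i. \<Sum>j\<le>n. \<bar>m i j - m' j\<bar> * u j) \<longlonglongrightarrow> (\<Sum>j\<le>n. \<bar>m' j - m' j\<bar> * u j)"
    by (intro tendsto_intros assms)
  then have lim: "(\<lambda>i. \<Sum>j\<le>n. \<bar>m i j - m' j\<bar> * u j) \<longlonglongrightarrow> 0" by simp
  have "\<bar>\<nu> (m i) - \<nu> m'\<bar> \<le> (\<Sum>j\<le>n. \<bar>m i j - m' j\<bar> * u j)" for i
  proof -
    have "\<nu> (m i) \<le> \<nu> m' + \<nu> (\<lambda>k. m i k - m' k)"
      using tri[of m' "\<lambda>k. m i k - m' k"] by simp
    moreover have "\<nu> m' \<le> \<nu> (m i) + \<nu> (\<lambda>k. m i k - m' k)"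
      using tri_diff[of "m i" "\<lambda>k. m i k - m' k"] by simp
    ultimately show ?thesis using bound[of "\<lambda>k. m i k - m' k"] by linarith
  qed
  then have "(\<lambda>i. \<nu> (m i) - \<nu> m') \<longlonglongrightarrow> 0"
    by (intro Lim_null_comparison[OF _ lim]) (auto intro!: always_eventually)
  then show ?thesis by (simp add: LIM_zero_iff)
qed

text \<open>An operator bound for multiplication by m, tested on all sequences: unlike
  \<open>\<nu> m\<close> itself, it behaves well under products of multipliers.\<close>

definition bdd :: "(nat \<Rightarrow> real) \<Rightarrow> real \<Rightarrow> bool" where
  "bdd m B \<longleftrightarrow> (\<forall>m'. \<nu> (\<lambda>k. m k * m' k) \<le> B * \<nu> m')"

lemma bddD: "bdd m B \<Longrightarrow> \<nu> (\<lambda>k. m k * m' k) \<le> B * \<nu> m'"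
  by (simp add: bdd_def)

lemma bdd_mono: "bdd m B \<Longrightarrow> B \<le> B' \<Longrightarrow> bdd m B'"
  unfolding bdd_def by (meson mult_right_mono nonneg order_trans)

lemma bdd_one: "bdd (\<lambda>k. 1) 1"
  by (simp add: bdd_def)

lemma bdd_add: "bdd m B \<Longrightarrow> bdd m' B' \<Longrightarrow> bdd (\<lambda>k. m k + m' k) (B + B')"
  unfolding bdd_def distrib_right
proof
  fix m''
  assume "\<forall>m''. \<nu> (\<lambda>k. m k * m'' k) \<le> B * \<nu> m''" "\<forall>m''. \<nu> (\<lambda>k. m' k * m'' k) \<le> B' * \<nu> m''"
  then show "\<nu> (\<lambda>k. m k * m'' k + m' k * m'' k) \<le> B * \<nu> m'' + B' * \<nu> m''"
    by (intro order_trans[OF tri] add_mono) auto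
qed

lemma bdd_cmult: "bdd m B \<Longrightarrow> bdd (\<lambda>k. c * m k) (\<bar>c\<bar> * B)"
  unfolding bdd_def mult.assoc hom by (simp add: mult_left_mono)

lemma bdd_diff: "bdd m B \<Longrightarrow> bdd m' B' \<Longrightarrow> bdd (\<lambda>k. m k - m' k) (B + B')"
  using bdd_add[of m B "\<lambda>k. -1 * m' k" B'] bdd_cmult[of m' B' "-1"] by simp

lemma bdd_mult:
  assumes "bdd m B" "bdd m' B'" "0 \<le> B"
  shows "bdd (\<lambda>k. m k * m' k) (B * B')"
  unfolding bdd_def mult.assoc
proof
  fix m''
  have "\<nu> (\<lambda>k. m k * (m' k * m'' k)) \<le> B * \<nu> (\<lambda>k. m' k * m'' k)"
    by (rule bddD[OF assms(1)])
  also have "\<dots> \<le> B * (B' * \<nu> m'')"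
    by (rule mult_left_mono[OF bddD[OF assms(2)] assms(3)])
  finally show "\<nu> (\<lambda>k. m k * (m' k * m'' k)) \<le> B * (B' * \<nu> m'')" .
qed

lemma bdd_sum:
  assumes "finite A" "\<And>i. i \<in> A \<Longrightarrow> bdd (m i) (B i)"
  shows "bdd (\<lambda>k. \<Sum>i\<in>A. m i k) (\<Sum>i\<in>A. B i)"
  using assms
proof (induction A rule: finite_induct)
  case empty
  then show ?case by (simp add: bdd_def zero)
next
  case (insert x F)
  then show ?case using bdd_add[of "m x" "B x" "\<lambda>k. \<Sum>i\<in>F. m i k" "\<Sum>i\<in>F. B i"] by simp
qed

lemma bdd_limit:
  assumes "\<And>i. bdd (m i) B" "\<And>k. (\<lambda>i. m i k) \<longlonglongrightarrow> m' k"
  shows "bdd m' B"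
  unfolding bdd_def
proof
  fix m''
  have "(\<lambda>i. \<nu> (\<lambda>k. m i k * m'' k)) \<longlonglongrightarrow> \<nu> (\<lambda>k. m' k * m'' k)"
    by (rule continuous) (intro tendsto_intros assms)
  then show "\<nu> (\<lambda>k. m' k * m'' k) \<le> B * \<nu> m''"
    by (rule LIMSEQ_le_const2) (use bddD[OF assms(1)] in blast)
qed

text \<open>Visser's iteration for \<open>1 - sqrt (1 - y)\<close>: every iterate has norm at most 1.\<close>

lemma bdd_sqrt:
  assumes y: "bdd y 1" "\<And>k. 0 \<le> y k" "\<And>k. y k \<le> 1"
  shows "bdd (\<lambda>k. sqrt (1 - y k)) 2"
proof -
  define w where "w = rec_nat (\<lambda>k. 0) (\<lambda>i w k. (y k + w k * w k) / 2)"
  have w0: "w 0 = (\<lambda>k. 0)" and wS: "w (Suc i) = (\<lambda>k. (y k + w i k * w i k) / 2)" for i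
    by (simp_all add: w_def)
  have bw: "bdd (w i) 1" for i
  proof (induction i)
    case 0
    show ?case by (simp add: w0 bdd_def zero nonneg)
  next
    case (Suc i)
    have "bdd (\<lambda>k. (1/2) * (y k + w i k * w i k)) (\<bar>1/2\<bar> * (1 + 1 * 1))"
      by (intro bdd_cmult bdd_add bdd_mult y Suc) simp
    then show ?case by (simp add: wS)
  qed
  have lim: "(\<lambda>i. w i k) \<longlonglongrightarrow> 1 - sqrt (1 - y k)" for k
  proof -
    have rng: "0 \<le> w i k \<and> w i k \<le> 1 \<and> w i k \<le> w (Suc i) k" for i
    proof (induction i)
      case 0
      then show ?case using y(2)[of k] by (simp add: w0 wS)
    next
      case (Suc i)
      have "w (Suc i) k * w (Suc i) k \<ge> w i k * w i k"
        using Suc by (intro mult_mono) auto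
      moreover have "w i k * w i k \<le> 1 * 1" using Suc by (intro mult_mono) auto
      ultimately show ?case using Suc y(2)[of k] y(3)[of k] by (simp add: wS)
    qed
    then have "incseq (\<lambda>i. w i k)" by (intro incseq_SucI) blast
    then obtain L where L: "(\<lambda>i. w i k) \<longlonglongrightarrow> L"
      using incseq_convergent[of "\<lambda>i. w i k" 1] rng by blast
    have "(\<lambda>i. w (Suc i) k) \<longlonglongrightarrow> (y k + L * L) / 2"
      unfolding wS by (intro tendsto_intros L) simp
    moreover have "(\<lambda>i. w (Suc i) k) \<longlonglongrightarrow> L" using L by (rule LIMSEQ_Suc)
    ultimately have "L = (y k + L * L) / 2" by (rule LIMSEQ_unique[symmetric])
    then have "(1 - L)\<^sup>2 = 1 - y k" by (simp add: power2_eq_square field_simps)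
    \<comment> \<open>Of the fixed points 1 - sqrt (1 - y) and 1 + sqrt (1 - y) of the iteration,
      this bound selects the smaller.\<close>
    moreover have "L \<le> 1" using L by (rule LIMSEQ_le_const2) (use rng in blast)
    ultimately have "1 - L = sqrt (1 - y k)" by (metis diff_ge_0_iff_ge real_sqrt_unique)
    then have "L = 1 - sqrt (1 - y k)" by simp
    with L show ?thesis by simp
  qed
  have "bdd (\<lambda>k. 1 - sqrt (1 - y k)) 1"
    by (rule bdd_limit[OF bw lim])
  from bdd_diff[OF bdd_one this] show ?thesis by simp
qed

end

text \<open>Two consecutive Cesaro orders are assumed because the identities for multiplication by
  the index and for increments in the length connect orders d and d + 1. The eigenvalues are k * (k
  + 2 * lam).\<close>

locale cesaro_seminorm = mult_seminorm +
  fixes \<delta> :: nat and C lam :: real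
  assumes lam_pos: "0 < lam" and C: "0 \<le> C"
    and poisson: "\<And>r. 0 \<le> r \<Longrightarrow> r < 1 \<Longrightarrow> bdd (\<lambda>k. r ^ k) 1"
    and cesaro: "\<And>d N. d = \<delta> \<or> d = Suc \<delta> \<Longrightarrow> bdd (ces d N) (C * (real N + 1) ^ d)"
begin

definition Cm :: real where "Cm = C * (real \<delta> + 1) ^ Suc \<delta>"

lemma Cm_nonneg: "0 \<le> Cm" using C by (simp add: Cm_def)

lemma bdd_cesmean:
  assumes "d = \<delta> \<or> d = Suc \<delta>"
  shows "bdd (cesmean d N) Cm"
proof -
  define A where "A = real ((N + d) choose d)"
  have A: "A > 0" by (simp add: A_def)
  have "real d ^ d \<le> (real \<delta> + 1) ^ Suc \<delta>"
  proof -
    have "real d ^ d \<le> (real \<delta> + 1) ^ d" using assms by (intro power_mono) auto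
    also have "\<dots> \<le> (real \<delta> + 1) ^ Suc \<delta>" using assms by (intro power_increasing) auto
    finally show ?thesis .
  qed
  then have "(real N + 1) ^ d \<le> (real \<delta> + 1) ^ Suc \<delta> * A"
    using power_le_choose[of N d] A unfolding A_def
    by (meson dual_order.trans less_imp_le mult_right_mono)
  then have "\<bar>1 / A\<bar> * (C * (real N + 1) ^ d) \<le> Cm"
    using A C mult_left_mono[of "(real N + 1) ^ d" "(real \<delta> + 1) ^ Suc \<delta> * A" C]
    by (simp add: Cm_def divide_le_eq mult_ac del: power_Suc)
  moreover have "bdd (\<lambda>k. 1 / A * ces d N k) (\<bar>1 / A\<bar> * (C * (real N + 1) ^ d))"
    by (intro bdd_cmult cesaro assms)
  moreover have "(\<lambda>k. 1 / A * ces d N k) = cesmean d N"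
    by (simp add: cesmean_def A_def fun_eq_iff)
  ultimately show ?thesis using bdd_mono by metis
qed

lemma bdd_index_ces:
  "bdd (\<lambda>k. real k * ces \<delta> N k) (2 * Cm * (real N + real \<delta> + 1) * real ((N + \<delta>) choose \<delta>))"
proof -
  define A where "A = real ((N + \<delta>) choose \<delta>)"
  have A: "A > 0" by (simp add: A_def)
  have "bdd (\<lambda>k. (A * (real N + real \<delta> + 1)) * (cesmean \<delta> N k - cesmean (Suc \<delta>) N k))
      (\<bar>A * (real N + real \<delta> + 1)\<bar> * (Cm + Cm))"
    by (intro bdd_cmult bdd_diff bdd_cesmean) auto
  moreover have "(A * (real N + real \<delta> + 1)) * (cesmean \<delta> N k - cesmean (Suc \<delta>) N k)
      = real k * ces \<delta> N k" for k
    using A unfolding mult.assoc cesmean_mult_index[symmetric]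
    by (simp add: cesmean_def[of \<delta>] flip: A_def)
  ultimately show ?thesis using A by (simp add: A_def[symmetric] mult.commute mult.left_commute)
qed

text \<open>\<open>sqrt (k * (k + 2 * lam)) = (k + 2 * lam) * sqrt (1 - resolvent k)\<close> reduces half-integral powers
  of the eigenvalues to the resolvent.\<close>

definition resolvent :: "nat \<Rightarrow> real" where
  "resolvent k = 2 * lam / (real k + 2 * lam)"

text \<open>The generator of a contraction semigroup is dissipative, which bounds its resolvent.\<close>

lemma bdd_resolvent: "bdd resolvent 1"
  unfolding bdd_def
proof
  fix m'
  define t where "t = 1 / (2 * lam)"
  have t: "t > 0" using lam_pos by (simp add: t_def)
  define m where "m k = resolvent k * m' k" for k
  \<comment> \<open>Since resolvent k = 1 / (1 + t * k), the claim becomes that the factor 1 + t * k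
    cannot decrease the seminorm.\<close>
  have m': "m' = (\<lambda>k. (1 + t * real k) * m k)"
    using lam_pos by (auto simp: fun_eq_iff m_def resolvent_def t_def field_simps add_pos_pos
        add_nonneg_eq_0_iff)
  define \<rho> where "\<rho> i = 1 - 1 / (real i + 2)" for i :: nat
  have \<rho>: "0 \<le> \<rho> i" "\<rho> i < 1" for i by (auto simp: \<rho>_def field_simps)
  have \<rho>1: "\<rho> \<longlonglongrightarrow> 1" unfolding \<rho>_def by real_asymp
  have ge: "\<nu> m \<le> \<nu> (\<lambda>k. (1 + t * ((1 - \<rho> i ^ k) / (1 - \<rho> i))) * m k)" for i
  proof -
    \<comment> \<open>The unbounded index k is replaced by the difference quotient (1 - \<rho>^k) /
      (1 - \<rho>). The part s * \<rho>^k * m is bounded by s times the seminorm of m, which cancels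
      against the left side.\<close>
    define s where "s = t / (1 - \<rho> i)"
    have s: "s \<ge> 0" using t \<rho>(2)[of i] by (simp add: s_def)
    have eq: "(\<lambda>k. (1 + s) * m k) = (\<lambda>k. (1 + t * ((1 - \<rho> i ^ k) / (1 - \<rho> i))) * m k + s * (\<rho> i ^ k * m k))"
    proof
      fix k
      have "t * ((1 - \<rho> i ^ k) / (1 - \<rho> i)) = s * (1 - \<rho> i ^ k)" by (simp add: s_def)
      then show "(1 + s) * m k = (1 + t * ((1 - \<rho> i ^ k) / (1 - \<rho> i))) * m k + s * (\<rho> i ^ k * m k)"
        by (simp only: ring_distribs)
    qed
    have "(1 + s) * \<nu> m = \<nu> (\<lambda>k. (1 + s) * m k)"
      using s by (simp add: hom)
    also have "\<dots> \<le> \<nu> (\<lambda>k. (1 + t * ((1 - \<rho> i ^ k) / (1 - \<rho> i))) * m k) + \<nu> (\<lambda>k. s * (\<rho> i ^ k * m k))"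
      unfolding eq by (rule tri)
    also have "\<nu> (\<lambda>k. s * (\<rho> i ^ k * m k)) \<le> s * \<nu> m"
      using bddD[OF poisson[OF \<rho>[of i]], of m] s by (simp add: hom mult_left_mono)
    finally show ?thesis by (simp add: algebra_simps)
  qed
  have deriv: "(\<lambda>i. (1 - \<rho> i ^ k) / (1 - \<rho> i)) \<longlonglongrightarrow> real k" for k
  proof -
    have "(1 - \<rho> i ^ k) / (1 - \<rho> i) = (\<Sum>j<k. \<rho> i ^ j)" for i
      using \<rho>(2)[of i] by (simp add: sum_gp_strict)
    moreover have "(\<lambda>i. \<Sum>j<k. \<rho> i ^ j) \<longlonglongrightarrow> (\<Sum>j<k. 1 ^ j)"
      by (intro tendsto_intros \<rho>1)
    ultimately show ?thesis by simp
  qed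
  have "(\<lambda>i. \<nu> (\<lambda>k. (1 + t * ((1 - \<rho> i ^ k) / (1 - \<rho> i))) * m k)) \<longlonglongrightarrow> \<nu> (\<lambda>k. (1 + t * real k) * m k)"
    by (rule continuous) (intro tendsto_intros deriv)
  then have "\<nu> m \<le> \<nu> m'"
    unfolding m' by (rule LIMSEQ_le_const) (use ge in blast)
  then show "\<nu> (\<lambda>k. resolvent k * m' k) \<le> 1 * \<nu> m'"
    unfolding m_def[abs_def] by (simp only: mult_1)
qed

lemma bdd_sqrt_resolvent: "bdd (\<lambda>k. sqrt (1 - resolvent k)) 2"
  by (rule bdd_sqrt[OF bdd_resolvent]) (use lam_pos in \<open>auto simp: resolvent_def\<close>)

text \<open>The first identity serves multiplication by the root of the eigenvalue (Bernstein), the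
  second the division by it (Jackson).\<close>

lemma sqrt_resolvent:
  "sqrt (real k * (real k + 2 * lam)) = (real k + 2 * lam) * sqrt (1 - resolvent k)"
  "sqrt (1 - resolvent k) * sqrt (real k * (real k + 2 * lam)) = real k"
proof -
  have p: "real k + 2 * lam > 0" using lam_pos by simp
  have "1 - resolvent k = real k / (real k + 2 * lam)"
    using p by (simp add: resolvent_def field_simps)
  then have s: "sqrt (1 - resolvent k) = sqrt (real k) / sqrt (real k + 2 * lam)"
    by (simp add: real_sqrt_divide)
  have q: "sqrt (real k + 2 * lam) * sqrt (real k + 2 * lam) = real k + 2 * lam" using p by simp
  have q': "sqrt (real k + 2 * lam) > 0" using p by simp
  show "sqrt (real k * (real k + 2 * lam)) = (real k + 2 * lam) * sqrt (1 - resolvent k)"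
  proof -
    have "(real k + 2 * lam) * (sqrt (real k) / sqrt (real k + 2 * lam))
      = (sqrt (real k + 2 * lam) * sqrt (real k + 2 * lam)) * (sqrt (real k) / sqrt (real k + 2 * lam))"
      unfolding q ..
    also have "\<dots> = sqrt (real k + 2 * lam) * sqrt (real k)"
    proof -
      have "(q * q) * (a / q) = q * a" if "q > 0" for q a :: real using that by simp
      then show ?thesis using q' by blast
    qed
    finally show ?thesis by (simp add: s real_sqrt_mult)
  qed
  show "sqrt (1 - resolvent k) * sqrt (real k * (real k + 2 * lam)) = real k"
  proof -
    have "(a / q) * (a * q) = a * a" if "q > 0" for q a :: real using that by simp
    from this[OF q', of "sqrt (real k)"] show ?thesis by (simp add: s real_sqrt_mult)
  qed
qed

section \<open>Jackson's inequality for multipliers\<close>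

definition Kj :: real where "Kj = 2 * ((real \<delta> + 1) * Cm)"

text \<open>The quotient that has to be a bounded multiplier of size O(1 / n). At k = 0 numerator
  and denominator both vanish; the value 0 is the one reached by the limit in
  \<open>bdd_jackson_mult\<close>.\<close>

definition jackson_mult :: "nat \<Rightarrow> nat \<Rightarrow> real" where
  "jackson_mult n k = (if k = 0 then 0 else (1 - cesmean (Suc \<delta>) n k) / sqrt (real k * (real k + 2 * lam)))"

text \<open>Comparison with the telescoping terms 1 / (i - 1) - 1 / i.\<close>

lemma sum_inverse_squares_le:
  "n \<ge> 1 \<Longrightarrow> (\<Sum>i=Suc n..n + M. 1 / (real i * (real i + real d + 1))) \<le> 1 / real n"
proof -
  assume n: "n \<ge> 1"
  have "(\<Sum>i=Suc n..n + M. 1 / (real i * (real i + real d + 1))) \<le> 1 / real n - 1 / real (n + M)"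
  proof (induction M)
    case (Suc M)
    have "1 / (real (n + Suc M) * (real (n + Suc M) + real d + 1)) \<le> 1 / (real (n + Suc M) * (real (n + M)))"
      using n by (intro divide_left_mono mult_left_mono mult_pos_pos) auto
    also have "\<dots> = 1 / real (n + M) - 1 / real (n + Suc M)"
      using n by (simp add: field_simps)
    finally have "1 / (real (n + Suc M) * (real (n + Suc M) + real d + 1)) \<le> 1 / real (n + M) - 1 / real (n + Suc M)" .
    moreover have "(\<Sum>i=Suc n..n + Suc M. 1 / (real i * (real i + real d + 1)))
      = (\<Sum>i=Suc n..n + M. 1 / (real i * (real i + real d + 1))) + 1 / (real (n + Suc M) * (real (n + Suc M) + real d + 1))"
      by (simp add: sum.cl_ivl_Suc)
    ultimately show ?case using Suc by linarith
  qed simp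
  moreover have "1 / real (n + M) \<ge> 0" by simp
  ultimately show ?thesis by linarith
qed

lemma cesmean_limit: "(\<lambda>M. cesmean d (n + M) k) \<longlonglongrightarrow> 1"
proof (induction d)
  case 0
  have "cesmean 0 (n + M) k = 1" if "M \<ge> k" for M
    using that by (simp add: cesmean_def ces_def)
  then show ?case by (intro tendsto_eventually eventually_sequentiallyI)
next
  case (Suc d)
  have eq: "cesmean (Suc d) N k = cesmean d N k * (1 - real k / (real N + real d + 1))" for N
    using cesmean_mult_index[of k d N] by (simp add: field_simps)
  have "(\<lambda>M. 1 - real k / (real (n + M) + real d + 1)) \<longlonglongrightarrow> 1" by real_asymp
  from tendsto_mult[OF Suc this] show ?case unfolding eq by simp
qed

text \<open>The finite sum D is the difference of the means of lengths n + M and n, divided by k;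
  its bound is uniform in M thanks to the weights of order 1 / i^2. Multiplying by sqrt (1 -
  resolvent k) turns 1 / k into the inverse root of the eigenvalue, and then M tends to
  infinity.\<close>

lemma bdd_jackson_mult:
  assumes n: "n \<ge> 1"
  shows "bdd (jackson_mult n) (Kj / real n)"
proof -
  define D where "D M k = (\<Sum>i=Suc n..n + M. ((real \<delta> + 1) / (real i * (real i + real \<delta> + 1))) * cesmean \<delta> i k)" for M k
  have D: "bdd (D M) ((real \<delta> + 1) * Cm / real n)" for M
  proof -
    have "bdd (D M) (\<Sum>i=Suc n..n + M. \<bar>(real \<delta> + 1) / (real i * (real i + real \<delta> + 1))\<bar> * Cm)"
      unfolding D_def by (intro bdd_sum bdd_cmult bdd_cesmean) auto
    moreover have "(\<Sum>i=Suc n..n + M. \<bar>(real \<delta> + 1) / (real i * (real i + real \<delta> + 1))\<bar> * Cm)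
      = (real \<delta> + 1) * Cm * (\<Sum>i=Suc n..n + M. 1 / (real i * (real i + real \<delta> + 1)))"
      by (simp add: sum_distrib_left)
    moreover have "\<dots> \<le> (real \<delta> + 1) * Cm * (1 / real n)"
      using Cm_nonneg by (intro mult_left_mono sum_inverse_squares_le n mult_nonneg_nonneg) auto
    ultimately have "bdd (D M) ((real \<delta> + 1) * Cm * (1 / real n))" using bdd_mono by simp
    then show ?thesis by simp
  qed
  have kD: "real k * D M k = cesmean (Suc \<delta>) (n + M) k - cesmean (Suc \<delta>) n k" for M k
  proof (induction M)
    case (Suc M)
    have "D (Suc M) k = D M k + ((real \<delta> + 1) / (real (n + Suc M) * (real (n + Suc M) + real \<delta> + 1))) * cesmean \<delta> (n + Suc M) k"
      unfolding D_def by (simp add: sum.cl_ivl_Suc)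
    then show ?case using Suc cesmean_diff[of "n + Suc M" \<delta> k] by (simp add: algebra_simps)
  qed (simp add: D_def)
  have B: "bdd (\<lambda>k. sqrt (1 - resolvent k) * D M k) (Kj / real n)" for M
    using bdd_mult[OF bdd_sqrt_resolvent D[of M]] by (simp add: Kj_def)
  show ?thesis
  proof (rule bdd_limit[OF B])
    fix k
    show "(\<lambda>M. sqrt (1 - resolvent k) * D M k) \<longlonglongrightarrow> jackson_mult n k"
    proof (cases "k = 0")
      case True
      then have "sqrt (1 - resolvent k) = 0" using lam_pos by (simp add: resolvent_def)
      then show ?thesis using True by (simp add: jackson_mult_def)
    next
      case False
      define s where "s = sqrt (real k * (real k + 2 * lam))"
      have s: "s > 0" using False lam_pos by (simp add: s_def)
      have "sqrt (1 - resolvent k) * D M k = (cesmean (Suc \<delta>) (n + M) k - cesmean (Suc \<delta>) n k) / s" for M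
      proof -
        have "sqrt (1 - resolvent k) = real k / s"
          using sqrt_resolvent(2)[of k] s by (simp add: s_def field_simps)
        then show ?thesis using kD[of k M] by (simp add: field_simps)
      qed
      moreover have "(\<lambda>M. (cesmean (Suc \<delta>) (n + M) k - cesmean (Suc \<delta>) n k) / s)
          \<longlonglongrightarrow> (1 - cesmean (Suc \<delta>) n k) / s"
        using s by (intro tendsto_intros cesmean_limit) simp
      ultimately show ?thesis using False by (simp add: jackson_mult_def s_def)
    qed
  qed
qed

text \<open>The case r = 0 has to be excluded: at k = 0 the real power \<open>0 powr 0\<close> is 0,
  while the natural power is 1.\<close>

lemma eigenvalue_powr:
  assumes "r \<ge> 1"
  shows "(real k * (real k + 2 * lam)) powr (real r / 2) = sqrt (real k * (real k + 2 * lam)) ^ r"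
proof (cases "k = 0")
  case False
  then have "real k * (real k + 2 * lam) > 0" using lam_pos by simp
  then have "sqrt (real k * (real k + 2 * lam)) ^ r = ((real k * (real k + 2 * lam)) powr (1 / 2)) powr real r"
    by (simp only: powr_half_sqrt less_imp_le powr_realpow real_sqrt_gt_zero)
  then show ?thesis by (simp only: powr_powr) simp
qed (use assms in simp)

text \<open>The r-th power of the quotient is bounded by the r-th power of its bound. Since 1 - (1 -
  mean)^r still vanishes beyond n, iterating the remainder of the mean gives approximants of degree
  n for every r.\<close>

theorem jackson_ineq:
  assumes n: "n \<ge> 1" and r: "r \<ge> 1"
  shows "\<nu> (\<lambda>k. (1 - cesmean (Suc \<delta>) n k) ^ r * m k)
    \<le> (Kj / real n) ^ r * \<nu> (\<lambda>k. (real k * (real k + 2 * lam)) powr (real r / 2) * m k)"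
proof -
  have K: "0 \<le> Kj / real n" using Cm_nonneg by (simp add: Kj_def)
  have pw: "bdd (\<lambda>k. jackson_mult n k ^ r) ((Kj / real n) ^ r)" for r
  proof (induction r)
    case (Suc r)
    then show ?case using bdd_mult[OF bdd_jackson_mult[OF n] Suc K] by simp
  qed (simp add: bdd_one)
  have *: "1 - cesmean (Suc \<delta>) n k = jackson_mult n k * sqrt (real k * (real k + 2 * lam))" for k
  proof (cases "k = 0")
    case True
    then show ?thesis
      by (simp add: jackson_mult_def cesmean_def ces_def del: binomial_Suc_Suc add_Suc_right)
  next
    case False
    then show ?thesis using lam_pos by (simp add: jackson_mult_def)
  qed
  show ?thesis
    using bddD[OF pw, of r "\<lambda>k. sqrt (real k * (real k + 2 * lam)) ^ r * m k"]
    by (simp add: eigenvalue_powr[OF r] * power_mult_distrib mult.assoc)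
qed

section \<open>Bernstein's inequality for multipliers\<close>

lemma bdd_vpd:
  assumes "\<And>N. N \<le> Nm \<Longrightarrow> bdd (\<lambda>k. q k * ces \<delta> N k) B"
  shows "N + e * h \<le> Nm \<Longrightarrow> bdd (\<lambda>k. q k * vpd h \<delta> e N k) (2 ^ e * B)"
proof (induction e arbitrary: N)
  case 0
  then show ?case using assms by simp
next
  case (Suc e)
  have "bdd (\<lambda>k. q k * vpd h \<delta> e (N + h) k - q k * vpd h \<delta> e N k) (2 ^ e * B + 2 ^ e * B)"
    using Suc by (intro bdd_diff Suc.IH) auto
  then show ?case by (simp add: algebra_simps)
qed

text \<open>The leading 2 bounds sqrt (1 - resolvent k), each 2^\<delta> the \<delta>-fold
  difference; the two summands belong to k and 2 * lam in the factor k + 2 * lam.\<close>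

definition Kb :: real where
  "Kb = 2 * (2 ^ \<delta> * (2 * Cm * (2 * real \<delta> + 2) * (2 * real \<delta> + 1) ^ \<delta>)
     + 2 * lam * (2 ^ \<delta> * (C * (real \<delta> + 2) ^ \<delta>)))"

text \<open>The normalised \<open>vpd\<close> is 1 up to n and vanishes beyond n + \<delta> * n, so
  the factor k + 2 * lam costs only a constant times n.\<close>

lemma bernstein_mult:
  assumes n: "n \<ge> 1"
  shows "bdd (\<lambda>k. sqrt (real k * (real k + 2 * lam)) * (vpd n \<delta> \<delta> n k / real n ^ \<delta>)) (Kb * real n)"
proof -
  \<comment> \<open>The longest Cesaro sum occurring in the \<delta>-fold difference with step
    n.\<close>
  define N1 where "N1 = n + \<delta> * n"
  have n1: "real n \<ge> 1" using n by simp
  have N1: "real N1 + 1 \<le> (real \<delta> + 2) * real n" using n1 by (simp add: N1_def algebra_simps)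
  have N2: "real N1 + real \<delta> + 1 \<le> (2 * real \<delta> + 2) * real n"
  proof -
    have "real \<delta> * 1 \<le> real \<delta> * real n" by (rule mult_left_mono[OF n1]) simp
    then show ?thesis using n1 by (simp add: N1_def algebra_simps)
  qed
  have N3: "real N1 + real \<delta> \<le> (2 * real \<delta> + 1) * real n"
  proof -
    have "real \<delta> * 1 \<le> real \<delta> * real n" by (rule mult_left_mono[OF n1]) simp
    then show ?thesis using n1 by (simp add: N1_def algebra_simps)
  qed
  have ch: "real ((N + \<delta>) choose \<delta>) \<le> ((2 * real \<delta> + 1) * real n) ^ \<delta>" if "N \<le> N1" for N
  proof -
    have "real ((N + \<delta>) choose \<delta>) \<le> real ((N + \<delta>) ^ \<delta>)"
      using binomial_le_pow[of \<delta> "N + \<delta>"] by (simp only: of_nat_le_iff)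
    also have "\<dots> \<le> ((2 * real \<delta> + 1) * real n) ^ \<delta>"
      unfolding of_nat_power by (rule power_mono) (use N3 that in auto)
    finally show ?thesis .
  qed
  have b1: "bdd (\<lambda>k. real k * vpd n \<delta> \<delta> n k)
      (2 ^ \<delta> * (2 * Cm * ((2 * real \<delta> + 2) * real n) * ((2 * real \<delta> + 1) * real n) ^ \<delta>))"
  proof (rule bdd_vpd[where Nm = N1])
    fix N assume N: "N \<le> N1"
    show "bdd (\<lambda>k. real k * ces \<delta> N k) (2 * Cm * ((2 * real \<delta> + 2) * real n) * ((2 * real \<delta> + 1) * real n) ^ \<delta>)"
      by (rule bdd_mono[OF bdd_index_ces])
        (use N N2 ch[OF N] Cm_nonneg in \<open>intro mult_mono; auto\<close>)
  qed (simp add: N1_def)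
  have b2: "bdd (\<lambda>k. 1 * vpd n \<delta> \<delta> n k) (2 ^ \<delta> * (C * ((real \<delta> + 2) * real n) ^ \<delta>))"
  proof (rule bdd_vpd[where Nm = N1])
    fix N assume N: "N \<le> N1"
    have "(real N + 1) ^ \<delta> \<le> ((real \<delta> + 2) * real n) ^ \<delta>"
      by (rule power_mono) (use N N1 in auto)
    then have "bdd (ces \<delta> N) (C * ((real \<delta> + 2) * real n) ^ \<delta>)"
      using C by (intro bdd_mono[OF cesaro]) (auto simp: mult_left_mono)
    then show "bdd (\<lambda>k. 1 * ces \<delta> N k) (C * ((real \<delta> + 2) * real n) ^ \<delta>)" by simp
  qed (simp add: N1_def)
  have b3: "bdd (\<lambda>k. sqrt (1 - resolvent k) * ((1 / real n ^ \<delta>) * (real k * vpd n \<delta> \<delta> n k + (2 * lam) * (1 * vpd n \<delta> \<delta> n k))))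
    (2 * (\<bar>1 / real n ^ \<delta>\<bar> * (2 ^ \<delta> * (2 * Cm * ((2 * real \<delta> + 2) * real n) * ((2 * real \<delta> + 1) * real n) ^ \<delta>)
      + \<bar>2 * lam\<bar> * (2 ^ \<delta> * (C * ((real \<delta> + 2) * real n) ^ \<delta>)))))"
    by (intro bdd_mult bdd_sqrt_resolvent bdd_cmult bdd_add b1 b2) simp
  have e3: "2 * (\<bar>1 / real n ^ \<delta>\<bar> * (2 ^ \<delta> * (2 * Cm * ((2 * real \<delta> + 2) * real n) * ((2 * real \<delta> + 1) * real n) ^ \<delta>)
      + \<bar>2 * lam\<bar> * (2 ^ \<delta> * (C * ((real \<delta> + 2) * real n) ^ \<delta>))))
    = 2 * (2 ^ \<delta> * (2 * Cm * (2 * real \<delta> + 2) * (2 * real \<delta> + 1) ^ \<delta>) * real n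
        + 2 * lam * (2 ^ \<delta> * (C * (real \<delta> + 2) ^ \<delta>)))"
  proof -
    have "2 * (\<bar>1 / p\<bar> * (e * (2 * Cm * (g * q) * (u * p)) + \<bar>2 * lam\<bar> * (e * (C * (v * p)))))
      = 2 * (e * (2 * Cm * g * u) * q + 2 * lam * (e * (C * v)))" if "p > 0" for p e g q u v :: real
      using that lam_pos by (simp add: field_simps)
    moreover have "real n ^ \<delta> > 0" using n1 by simp
    ultimately show ?thesis unfolding power_mult_distrib[of _ "real n"] by blast
  qed
  have l3: "2 * (2 ^ \<delta> * (2 * Cm * (2 * real \<delta> + 2) * (2 * real \<delta> + 1) ^ \<delta>) * real n
        + 2 * lam * (2 ^ \<delta> * (C * (real \<delta> + 2) ^ \<delta>))) \<le> Kb * real n"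
  proof -
    have "2 * lam * (2 ^ \<delta> * (C * (real \<delta> + 2) ^ \<delta>)) * 1 \<le> 2 * lam * (2 ^ \<delta> * (C * (real \<delta> + 2) ^ \<delta>)) * real n"
      by (rule mult_left_mono[OF n1]) (use lam_pos C in simp)
    then show ?thesis unfolding Kb_def by (simp add: algebra_simps)
  qed
  have "bdd (\<lambda>k. sqrt (1 - resolvent k) * ((1 / real n ^ \<delta>) * (real k * vpd n \<delta> \<delta> n k + (2 * lam) * (1 * vpd n \<delta> \<delta> n k)))) (Kb * real n)"
    by (rule bdd_mono[OF b3]) (simp only: e3 l3)
  moreover have "sqrt (1 - resolvent k) * ((1 / real n ^ \<delta>) * (real k * vpd n \<delta> \<delta> n k + (2 * lam) * (1 * vpd n \<delta> \<delta> n k)))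
     = sqrt (real k * (real k + 2 * lam)) * (vpd n \<delta> \<delta> n k / real n ^ \<delta>)" for k
    unfolding sqrt_resolvent(1) by (simp add: field_simps)
  ultimately show ?thesis by (simp only:)
qed

text \<open>On a sequence supported in {0..n} the de la Vallee Poussin multiplier acts as 1, so it
  can be inserted next to each of the r factors sqrt (k * (k + 2 * lam)), one at a time.\<close>

theorem bernstein_ineq:
  assumes n: "n \<ge> 1" and r: "r \<ge> 1" and supp: "\<And>k. n < k \<Longrightarrow> m k = 0"
  shows "\<nu> (\<lambda>k. (real k * (real k + 2 * lam)) powr (real r / 2) * m k) \<le> (Kb * real n) ^ r * \<nu> m"
proof -
  have Kb: "0 \<le> Kb * real n" using lam_pos C Cm_nonneg by (simp add: Kb_def)
  have *: "\<nu> (\<lambda>k. sqrt (real k * (real k + 2 * lam)) ^ r * m k) \<le> (Kb * real n) ^ r * \<nu> m" for r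
  proof (induction r)
    case (Suc r)
    have "\<nu> (\<lambda>k. sqrt (real k * (real k + 2 * lam)) ^ Suc r * m k)
      = \<nu> (\<lambda>k. (sqrt (real k * (real k + 2 * lam)) * (vpd n \<delta> \<delta> n k / real n ^ \<delta>))
            * (sqrt (real k * (real k + 2 * lam)) ^ r * m k))"
    proof -
      have "sqrt (real k * (real k + 2 * lam)) ^ Suc r * m k
        = (sqrt (real k * (real k + 2 * lam)) * (vpd n \<delta> \<delta> n k / real n ^ \<delta>))
            * (sqrt (real k * (real k + 2 * lam)) ^ r * m k)" for k
        using supp[of k] vpd_value[of k n n \<delta>] n by (cases "k \<le> n") auto
      then show ?thesis by simp
    qed
    also have "\<dots> \<le> (Kb * real n) * \<nu> (\<lambda>k. sqrt (real k * (real k + 2 * lam)) ^ r * m k)"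
      by (rule bddD[OF bernstein_mult[OF n]])
    also have "\<dots> \<le> (Kb * real n) * ((Kb * real n) ^ r * \<nu> m)"
      by (rule mult_left_mono[OF Suc Kb])
    finally show ?case by simp
  qed simp
  then show ?thesis by (simp add: eigenvalue_powr[OF r])
qed

end

section \<open>The Poisson kernel and Cesaro sums of zonal polynomials\<close>

text \<open>\<open>gc l k m / fact m\<close> is the coefficient of \<open>x ^ m\<close> in the Gegenbauer polynomial \<open>gp l k\<close>;
  the factor \<open>1 + k / l\<close> in \<open>zc\<close> turns the generating function of these polynomials into the Poisson kernel \<open>pk\<close>.\<close>

definition gc :: "real \<Rightarrow> nat \<Rightarrow> nat \<Rightarrow> real" where
  "gc l k m = (if m \<le> k \<and> even (k - m)
     then (-1) ^ ((k - m) div 2) * pochhammer l (k - (k - m) div 2) * 2 ^ m / fact ((k - m) div 2) else 0)"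

lemma gc_split: "gc l (m + 2 * j) m = (-1) ^ j * pochhammer l (m + j) * 2 ^ m / fact j"
proof -
  have "m + 2 * j - j = m + j" by simp
  then show ?thesis by (simp add: gc_def add.commute[of j m])
qed

lemma gc_eq_0: "k < m \<Longrightarrow> gc l k m = 0"
  by (simp add: gc_def)

text \<open>The coefficient form of the Gegenbauer recursion (k + 2) C_(k+2) = 2 (k + 1 + l) x
  C_(k+1) - (k + 2 l) C_k. The factor m comes from the normalisation by m! and annihilates the
  truncated index m - 1 at m = 0.\<close>

lemma gc_three_term:
  "(real k + 2) * gc l (k + 2) m
    = 2 * (real k + 1 + l) * (real m * gc l (k + 1) (m - 1)) - (real k + 2 * l) * gc l k m"
proof (cases "m \<le> k + 2 \<and> even (k + 2 - m)")
  case True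
  then obtain j where j: "k + 2 - m = 2 * j" by (meson evenE)
  then have k2: "k + 2 = m + 2 * j" using True by simp
  have A: "gc l (k + 2) m = (-1) ^ j * pochhammer l (m + j) * 2 ^ m / fact j"
    unfolding k2 by (rule gc_split)
  have "m \<ge> 1 \<or> j \<ge> 1" using k2 by auto
  then obtain s where s: "m + j = Suc s" by (metis One_nat_def Suc_le_D add_Suc add_Suc_right)
  \<comment> \<open>With s = m + j - 1 all three terms are multiples of X, and the recursion reduces
    to an identity of scalar factors.\<close>
  define X where "X = (-1) ^ j * pochhammer l s * 2 ^ m / fact j"
  have A': "gc l (k + 2) m = X * (l + real s)"
    unfolding A s by (simp add: X_def pochhammer_Suc)
  have B: "2 * (real m * gc l (k + 1) (m - 1)) = real m * X"
  proof (cases m)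
    case (Suc m')
    have "k + 1 = m' + 2 * j" using k2 Suc by simp
    then have "gc l (k + 1) m' = (-1) ^ j * pochhammer l (m' + j) * 2 ^ m' / fact j"
      by (simp only: gc_split)
    moreover have "m' + j = s" using s Suc by simp
    ultimately show ?thesis using Suc by (simp add: X_def)
  qed simp
  have C: "gc l k m = - real j * X"
  proof (cases j)
    case 0
    then show ?thesis using k2 by (simp add: gc_eq_0)
  next
    case (Suc j')
    have "k = m + 2 * j'" using k2 Suc by simp
    then have "gc l k m = (-1) ^ j' * pochhammer l (m + j') * 2 ^ m / fact j'"
      by (simp only: gc_split)
    moreover have "m + j' = s" using s Suc by simp
    moreover have "e * p * q / f = - N * ((- 1) * e * p * q / (N * f))" if "N > 0" for e p q f N :: real
      using that by simp
    from this[of "real (Suc j')" "(- 1) ^ j'" "pochhammer l s" "2 ^ m" "fact j'"]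
    have "(- 1) ^ j' * pochhammer l s * 2 ^ m / fact j' = - real j * X"
      unfolding X_def Suc power_Suc fact_Suc by (simp only: of_nat_0_less_iff zero_less_Suc)
    ultimately show ?thesis by simp
  qed
  have rk: "real k + 2 = real m + 2 * real j" using k2 by (metis of_nat_add of_nat_mult of_nat_numeral)
  have rs: "real s = real m + real j - 1" using s by (metis add_diff_cancel_right' of_nat_1 of_nat_add plus_1_eq_Suc add.commute)
  have rk': "real k = real m + 2 * real j - 2" using rk by simp
  have "(real k + 2) * (X * (l + real s)) = (real k + 1 + l) * (real m * X) - (real k + 2 * l) * (- real j * X)"
    unfolding rk' rs by (simp add: algebra_simps)
  then show ?thesis unfolding A' C B[symmetric] by simp
next
  case False
  have "gc l (k + 2) m = 0" unfolding gc_def by (rule if_not_P[OF False])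
  moreover have "gc l k m = 0" using False by (auto simp: gc_def)
  moreover have "real m * gc l (k + 1) (m - 1) = 0"
  proof (cases m)
    case (Suc m')
    then have "\<not> (m' \<le> k + 1 \<and> even (k + 1 - m'))" using False by auto
    then show ?thesis using Suc by (auto simp: gc_def)
  qed simp
  ultimately show ?thesis by simp
qed

definition gp :: "real \<Rightarrow> nat \<Rightarrow> real \<Rightarrow> real" where
  "gp l k x = (\<Sum>m\<le>k. gc l k m / fact m * x ^ m)"

lemma gp_extend: "k \<le> M \<Longrightarrow> gp l k x = (\<Sum>m\<le>M. gc l k m / fact m * x ^ m)"
  unfolding gp_def by (rule sum.mono_neutral_left) (auto simp: gc_eq_0)

lemma gp_0: "gp l 0 x = 1"
  by (simp add: gp_def gc_def)

lemma gp_1: "gp l 1 x = 2 * l * x"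
  by (simp add: gp_def gc_def)

lemma gp_three_term:
  "(real k + 2) * gp l (k + 2) x = 2 * (real k + 1 + l) * x * gp l (k + 1) x - (real k + 2 * l) * gp l k x"
proof -
  have shift: "x * gp l (k + 1) x = (\<Sum>m\<le>k + 2. real m * gc l (k + 1) (m - 1) / fact m * x ^ m)"
  proof -
    have "(\<Sum>m\<le>k + 2. real m * gc l (k + 1) (m - 1) / fact m * x ^ m)
      = (\<Sum>m\<le>k + 1. real (Suc m) * gc l (k + 1) m / fact (Suc m) * x ^ Suc m)"
      using sum.atMost_Suc_shift[of "\<lambda>m. real m * gc l (k + 1) (m - 1) / fact m * x ^ m" "k + 1"]
      by (simp del: sum.atMost_Suc)
    also have "\<dots> = (\<Sum>m\<le>k + 1. x * (gc l (k + 1) m / fact m * x ^ m))"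
      by (rule sum.cong) (auto simp: field_simps simp del: of_nat_Suc)
    finally show ?thesis by (simp only: gp_def sum_distrib_left)
  qed
  have "(real k + 2) * gp l (k + 2) x = (\<Sum>m\<le>k + 2. ((real k + 2) * gc l (k + 2) m) / fact m * x ^ m)"
    unfolding gp_def sum_distrib_left by (rule sum.cong) simp_all
  also have "\<dots> = (\<Sum>m\<le>k + 2. 2 * (real k + 1 + l) * (real m * gc l (k + 1) (m - 1) / fact m * x ^ m)
      - (real k + 2 * l) * (gc l k m / fact m * x ^ m))"
    unfolding gc_three_term by (rule sum.cong) (simp_all add: diff_divide_distrib left_diff_distrib)
  also have "\<dots> = 2 * (real k + 1 + l) * (x * gp l (k + 1) x) - (real k + 2 * l) * gp l k x"
    unfolding shift gp_extend[of k "k + 2", OF le_add1] by (simp only: sum_subtractf sum_distrib_left)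
  finally show ?thesis by simp
qed

definition zc :: "real \<Rightarrow> nat \<Rightarrow> nat \<Rightarrow> real" where
  "zc l k m = (1 + real k / l) * gc l k m"

lemma zc_eq_0: "k < m \<Longrightarrow> zc l k m = 0"
  by (simp add: zc_def gc_eq_0)

text \<open>The Gegenbauer equation (1 - x^2) y'' - (2 l + 1) x y' + k (k + 2 l) y = 0, read off the
  coefficients of x^m / m!. In this form it combines with \<open>kern_DD\<close> to make the kernels
  \<open>Zk\<close> eigenfunctions.\<close>

lemma zc_two_step:
  "zc l k (m + 2) = (real m * (real m + 2 * l) - real k * (real k + 2 * l)) * zc l k m"
proof -
  have "gc l k (m + 2) = (real m * (real m + 2 * l) - real k * (real k + 2 * l)) * gc l k m"
  proof (cases "m \<le> k \<and> even (k - m)")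
    case True
    then obtain j where "k - m = 2 * j" by (meson evenE)
    then have k: "k = m + 2 * j" using True by simp
    show ?thesis
    proof (cases j)
      case 0
      then show ?thesis using k by (simp add: gc_eq_0)
    next
      case (Suc i)
      have "k = (m + 2) + 2 * i" using k Suc by simp
      then have "gc l k (m + 2) = (-1) ^ i * pochhammer l (m + 2 + i) * 2 ^ (m + 2) / fact i"
        by (simp only: gc_split)
      moreover have "gc l k m = (-1) ^ Suc i * pochhammer l (m + Suc i) * 2 ^ m / fact (Suc i)"
        unfolding k Suc by (rule gc_split)
      moreover have "pochhammer l (m + 2 + i) = pochhammer l (m + Suc i) * (l + real m + real (Suc i))"
        by (simp add: pochhammer_Suc)
      moreover have "real k = real m + 2 * real (Suc i)" using k Suc by simp
      moreover have "e * (p * (l + real m + N)) * (q * 4) / f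
          = (real m * (real m + 2 * l) - (real m + 2 * N) * (real m + 2 * N + 2 * l))
            * ((- e) * p * q / (N * f))" if "f > 0" "N > 0" for e p q f N :: real
        using that by (simp add: field_simps)
      from this[of "fact i" "real (Suc i)"]
      have "(-1) ^ i * (pochhammer l (m + Suc i) * (l + real m + real (Suc i))) * (2 ^ m * 4) / fact i
          = (real m * (real m + 2 * l) - (real m + 2 * real (Suc i)) * (real m + 2 * real (Suc i) + 2 * l))
            * ((- ((-1) ^ i)) * pochhammer l (m + Suc i) * 2 ^ m / (real (Suc i) * fact i))"
        by (simp del: of_nat_Suc)
      moreover have "(2::real) ^ (m + 2) = 2 ^ m * 4" by (simp add: power_add)
      moreover have "(-1 :: real) ^ Suc i = - ((-1) ^ i)" "fact (Suc i) = real (Suc i) * fact i" by simp_all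
      ultimately show ?thesis by (simp only:)
    qed
  next
    case False
    then show ?thesis by (auto simp: gc_def)
  qed
  then show ?thesis by (simp add: zc_def)
qed

definition Zp :: "real \<Rightarrow> nat \<Rightarrow> real \<Rightarrow> real" where
  "Zp l k x = (\<Sum>m\<le>k. zc l k m / fact m * x ^ m)"

lemma Zp_gp: "Zp l k x = (1 + real k / l) * gp l k x"
  by (simp add: Zp_def gp_def zc_def sum_distrib_left mult.assoc)

section \<open>The Poisson kernel as a holomorphic function of the radius\<close>

definition pk :: "real \<Rightarrow> real \<Rightarrow> real \<Rightarrow> real" where
  "pk l r x = (1 - r\<^sup>2) * (1 - 2 * r * x + r\<^sup>2) powr (- (l + 1))"

definition pw :: "real \<Rightarrow> complex \<Rightarrow> complex" where
  "pw x z = 1 - 2 * of_real x * z + z\<^sup>2"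

definition pkc :: "real \<Rightarrow> real \<Rightarrow> complex \<Rightarrow> complex" where
  "pkc l x z = (1 - z\<^sup>2) * pw x z powr (- of_real (l + 1))"

lemma pw_factor:
  assumes "\<bar>x\<bar> \<le> 1"
  obtains e where "cmod e = 1" "\<And>z. pw x z = (1 - z * e) * (1 - z * cnj e)"
proof
  define e where "e = Complex x (sqrt (1 - x\<^sup>2))"
  have x2: "x\<^sup>2 \<le> 1" using assms by (simp add: abs_square_le_1)
  show c: "cmod e = 1" using x2 by (simp add: e_def cmod_def)
  have "e + cnj e = 2 * of_real x" by (simp add: e_def complex_eq_iff)
  moreover have "e * cnj e = 1" using complex_norm_square[of e] c by simp
  moreover have "(1 - z * e) * (1 - z * cnj e) = 1 - (e + cnj e) * z + (e * cnj e) * z\<^sup>2" for z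
    by (simp add: algebra_simps power2_eq_square)
  ultimately show "pw x z = (1 - z * e) * (1 - z * cnj e)" for z
    by (simp only: pw_def mult_1)
qed

text \<open>Both factors 1 - z e and 1 - z cnj e have positive real part, so the argument of their
  product stays strictly between -pi and pi. Hence the principal power in \<open>pkc\<close> is
  holomorphic on the disc.\<close>

lemma pw_notin_nonpos_Reals:
  assumes "\<bar>x\<bar> \<le> 1" "cmod z < 1"
  shows "pw x z \<notin> \<real>\<^sub>\<le>\<^sub>0"
proof
  assume neg: "pw x z \<in> \<real>\<^sub>\<le>\<^sub>0"
  obtain e where e: "cmod e = 1" "pw x z = (1 - z * e) * (1 - z * cnj e)"
    using pw_factor[OF assms(1)] by metis
  define p q where "p = 1 - z * e" and "q = 1 - z * cnj e"
  have "Re (z * e) < 1" "Re (z * cnj e) < 1"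
    using assms(2) e(1) complex_Re_le_cmod[of "z * e"] complex_Re_le_cmod[of "z * cnj e"]
    by (simp_all add: norm_mult)
  then have pq: "Re p > 0" "Re q > 0" by (simp_all add: p_def q_def)
  have "Re p * Im q + Im p * Re q = 0" "Re p * Re q - Im p * Im q \<le> 0"
    using neg unfolding e(2) by (simp_all add: complex_nonpos_Reals_iff p_def q_def)
  then have "Im q = - (Im p * Re q / Re p)" using pq by (simp add: field_simps)
  with \<open>Re p * Re q - Im p * Im q \<le> 0\<close> have "Re p * Re q + Im p * Im p * Re q / Re p \<le> 0"
    by (simp add: algebra_simps)
  moreover have "Re p * Re q > 0" "Im p * Im p * Re q / Re p \<ge> 0" using pq by simp_all
  ultimately show False by linarith
qed

lemma pw_real_lower:
  fixes x r :: real
  assumes "\<bar>x\<bar> \<le> 1" "0 \<le> r" "r < 1"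
  shows "(1 - r)\<^sup>2 \<le> 1 - 2 * r * x + r\<^sup>2"
proof -
  have "r * x \<le> r * 1" by (rule mult_left_mono) (use assms in auto)
  then show ?thesis by (simp add: power2_eq_square algebra_simps)
qed

lemma pk_pos: "\<bar>x\<bar> \<le> 1 \<Longrightarrow> 0 \<le> r \<Longrightarrow> r < 1 \<Longrightarrow> 0 \<le> pk l r x"
  by (simp add: pk_def abs_square_le_1 less_imp_le)

lemma pk_le:
  assumes "l > 0" "\<bar>x\<bar> \<le> 1" "0 \<le> r" "r < 1"
  shows "pk l r x \<le> ((1 - r)\<^sup>2) powr (- (l + 1))"
proof -
  have "pk l r x \<le> 1 * ((1 - r)\<^sup>2) powr (- (l + 1))"
    unfolding pk_def
    by (intro mult_mono powr_mono2' pw_real_lower) (use assms in \<open>auto simp: abs_square_le_1\<close>)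
  then show ?thesis by simp
qed

text \<open>A complex radius is compared with the real radius of the same modulus: |1 - r e| \<le> B
  |1 - z e| with B = 1 + |z - r| / (1 - r), because |1 - z e| \<ge> 1 - r. The two linear factors to
  the power l + 1 contribute B^(2 l + 2), the numerator 1 - z^2 one more B.\<close>

lemma pkc_bound:
  assumes l: "l > 0" and x: "\<bar>x\<bar> \<le> 1" and z: "cmod z = r" "r < 1"
  shows "cmod (pkc l x z) \<le> (1 + cmod (z - of_real r) / (1 - r)) powr (2 * l + 3) * pk l r x"
proof -
  have r0: "0 \<le> r" using z(1) by (metis norm_ge_zero)
  define B where "B = 1 + cmod (z - of_real r) / (1 - r)"
  have B1: "B \<ge> 1" using z by (simp add: B_def)
  obtain e where e: "cmod e = 1" "\<And>z. pw x z = (1 - z * e) * (1 - z * cnj e)"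
    using pw_factor[OF x] by metis
  have fac: "cmod (1 - of_real r * e) \<le> B * cmod (1 - z * e)" if "cmod e = 1" for e
  proof -
    have "1 - cmod (z * e) \<le> cmod (1 - z * e)"
      using norm_triangle_ineq2[of 1 "z * e"] by simp
    then have "1 - r \<le> cmod (1 - z * e)" using that z by (simp add: norm_mult)
    then have 1: "(cmod (z - of_real r) / (1 - r)) * (1 - r) \<le> (cmod (z - of_real r) / (1 - r)) * cmod (1 - z * e)"
      using z by (intro mult_left_mono) auto
    have "cmod (1 - of_real r * e) \<le> cmod (1 - z * e) + cmod ((z - of_real r) * e)"
      using norm_triangle_ineq[of "1 - z * e" "(z - of_real r) * e"] by (simp add: algebra_simps)
    also have "cmod ((z - of_real r) * e) = (cmod (z - of_real r) / (1 - r)) * (1 - r)"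
      using that z by (simp add: norm_mult)
    finally show ?thesis using 1 by (simp add: B_def algebra_simps)
  qed
  define w where "w = 1 - 2 * r * x + r\<^sup>2"
  have w0: "w > 0"
    using pw_real_lower[OF x r0 z(2)] z by (smt (verit) w_def zero_less_power)
  have wr: "w = cmod (pw x (of_real r))"
  proof -
    have "pw x (of_real r) = of_real w" by (simp add: pw_def w_def)
    then show ?thesis using w0 by simp
  qed
  have wB: "w / B\<^sup>2 \<le> cmod (pw x z)"
  proof -
    have "w \<le> (B * cmod (1 - z * e)) * (B * cmod (1 - z * cnj e))"
      unfolding wr e(2) norm_mult by (intro mult_mono fac) (use e(1) B1 in auto)
    also have "\<dots> = B\<^sup>2 * cmod (pw x z)" by (simp add: e(2) norm_mult power2_eq_square)
    finally show ?thesis using B1 by (simp add: field_simps)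
  qed
  have "cmod (pw x z powr (- of_real (l + 1))) = cmod (pw x z) powr (- (l + 1))"
    by (subst norm_powr_real_powr') auto
  also have "\<dots> \<le> (w / B\<^sup>2) powr (- (l + 1))"
    by (rule powr_mono2') (use l w0 B1 wB in auto)
  also have "\<dots> = B powr (2 * l + 2) * w powr (- (l + 1))"
  proof -
    have "(w / B\<^sup>2) powr (- (l + 1)) = w powr (- (l + 1)) / (B\<^sup>2) powr (- (l + 1))"
      using w0 B1 by (simp add: powr_divide)
    also have "(B\<^sup>2) powr (- (l + 1)) = B powr (- (2 * l + 2))"
    proof -
      have "B\<^sup>2 = B powr 2" using B1 by simp
      then have "(B\<^sup>2) powr (- (l + 1)) = B powr (2 * (- (l + 1)))" by (simp only: powr_powr)
      moreover have "2 * (- (l + 1)) = - (2 * l + 2)" by simp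
      ultimately show ?thesis by simp
    qed
    also have "w powr (- (l + 1)) / B powr (- (2 * l + 2)) = B powr (2 * l + 2) * w powr (- (l + 1))"
      by (subst powr_minus_divide[of B]) simp
    finally show ?thesis .
  qed
  finally have 1: "cmod (pw x z powr (- of_real (l + 1))) \<le> B powr (2 * l + 2) * w powr (- (l + 1))" .
  have 2: "cmod (1 - z\<^sup>2) \<le> B * (1 - r\<^sup>2)"
  proof -
    have "cmod (1 - z\<^sup>2) \<le> cmod (1 - (of_real r)\<^sup>2) + cmod ((z - of_real r) * (z + of_real r))"
      using norm_triangle_ineq4[of "1 - (of_real r)\<^sup>2" "(z - of_real r) * (z + of_real r)"]
      by (simp add: algebra_simps power2_eq_square)
    also have "cmod (1 - (of_real r)\<^sup>2) = 1 - r\<^sup>2"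
    proof -
      have "r\<^sup>2 \<le> 1" using r0 z(2) by (simp add: abs_square_le_1)
      moreover have "1 - (complex_of_real r)\<^sup>2 = of_real (1 - r\<^sup>2)" by simp
      ultimately show ?thesis by (simp only: norm_of_real)
    qed
    also have "cmod ((z - of_real r) * (z + of_real r)) \<le> cmod (z - of_real r) * (1 + r)"
    proof -
      have "cmod (z + of_real r) \<le> 1 + r"
        using norm_triangle_ineq[of z "of_real r"] z r0 by simp
      then show ?thesis unfolding norm_mult by (rule mult_left_mono) simp
    qed
    also have "1 - r\<^sup>2 + cmod (z - of_real r) * (1 + r) = B * (1 - r\<^sup>2)"
      using z(2) by (simp add: B_def field_simps power2_eq_square)
    finally show ?thesis by simp
  qed
  have "cmod (pkc l x z) \<le> (B * (1 - r\<^sup>2)) * (B powr (2 * l + 2) * w powr (- (l + 1)))"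
    unfolding pkc_def norm_mult by (intro mult_mono 1 2) (use B1 r0 z in \<open>auto simp: abs_square_le_1\<close>)
  also have "\<dots> = (B powr 1 * B powr (2 * l + 2)) * pk l r x"
    using B1 by (simp add: pk_def w_def)
  also have "B powr 1 * B powr (2 * l + 2) = B powr (2 * l + 3)"
    by (subst powr_add[symmetric]) (simp add: algebra_simps)
  finally show ?thesis by (simp add: B_def)
qed

lemma pkc_of_real:
  assumes "\<bar>x\<bar> \<le> 1" "0 \<le> r" "r < 1"
  shows "pkc l x (of_real r) = of_real (pk l r x)"
proof -
  have "pw x (of_real r) = of_real (1 - 2 * r * x + r\<^sup>2)" by (simp add: pw_def)
  moreover have "0 \<le> 1 - 2 * r * x + r\<^sup>2"
    using pw_real_lower[OF assms] by (smt (verit) zero_le_power2)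
  ultimately have "pw x (of_real r) powr (- of_real (l + 1)) = of_real ((1 - 2 * r * x + r\<^sup>2) powr (- (l + 1)))"
    using powr_of_real[of "1 - 2 * r * x + r\<^sup>2" "- (l + 1)"] by (simp only: of_real_minus)
  then show ?thesis unfolding pkc_def pk_def by (simp only: of_real_mult of_real_diff of_real_power of_real_1)
qed

lemma pkc_holomorphic: "\<bar>x\<bar> \<le> 1 \<Longrightarrow> pkc l x holomorphic_on ball 0 1"
  unfolding pkc_def[abs_def] pw_def
  by (intro holomorphic_intros) (use pw_notin_nonpos_Reals in \<open>auto simp: pw_def\<close>)

text \<open>The function g = pw^(-l) satisfies pw g' = 2 l (x - z) g, whose coefficient form is the
  recursion of \<open>gp\<close>; so the expansion of g follows without summing a series. The
  combination g + z g' / l equals \<open>pkc\<close> and multiplies the k-th coefficient by 1 + k /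
  l.\<close>

lemma pkc_fps:
  assumes l: "l > 0" and x: "\<bar>x\<bar> \<le> 1"
  shows "pkc l x has_fps_expansion Abs_fps (\<lambda>k. of_real (Zp l k x))"
proof -
  define g where "g z = pw x z powr (- of_real l)" for z
  have hol: "g holomorphic_on ball 0 1"
    unfolding g_def[abs_def] pw_def
    by (intro holomorphic_intros) (use pw_notin_nonpos_Reals[OF x] in \<open>auto simp: pw_def\<close>)
  define F where "F = fps_expansion g 0"
  have gF: "g has_fps_expansion F"
    unfolding F_def by (rule has_fps_expansion_fps_expansion[OF _ _ hol]) auto
  have dg: "(g has_field_derivative (2 * of_real l * (of_real x - z)) * pw x z powr (- of_real (l + 1))) (at z)"
    if "z \<in> ball 0 1" for z
  proof -
    have nz: "pw x z \<notin> \<real>\<^sub>\<le>\<^sub>0" using pw_notin_nonpos_Reals[OF x] that by simp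
    have "(pw x has_field_derivative (2 * z - 2 * of_real x)) (at z)"
      unfolding pw_def[abs_def] by (auto intro!: derivative_eq_intros)
    then have "(g has_field_derivative ((- of_real l) * pw x z powr (- of_real l - 1)) * (2 * z - 2 * of_real x)) (at z)"
      unfolding g_def[abs_def]
      by (rule DERIV_chain2[where f = "\<lambda>w. w powr (- of_real l)" and g = "pw x", OF has_field_derivative_powr[OF nz]])
    moreover have "- of_real l - 1 = - complex_of_real (l + 1)" by simp
    ultimately show ?thesis by (simp add: algebra_simps)
  qed
  have nb: "\<forall>\<^sub>F z in nhds (0::complex). z \<in> ball 0 1"
    by (rule eventually_nhds_in_open) auto
  have deriv: "deriv g z = (2 * of_real l * (of_real x - z)) * pw x z powr (- of_real (l + 1))" if "z \<in> ball 0 1" for z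
    by (rule DERIV_imp_deriv[OF dg[OF that]])
  have pw1: "pw x z * pw x z powr (- of_real (l + 1)) = g z" if "z \<in> ball 0 1" for z
  proof -
    have "pw x z \<noteq> 0" using pw_notin_nonpos_Reals[OF x] that by force
    then have "pw x z powr 1 = pw x z" by simp
    moreover have "pw x z powr 1 * pw x z powr (- of_real (l + 1)) = pw x z powr (1 + - of_real (l + 1))"
      by (simp only: powr_add)
    moreover have "1 + - complex_of_real (l + 1) = - of_real l" by simp
    ultimately show ?thesis by (simp only: g_def)
  qed
  have dgF: "deriv g has_fps_expansion fps_deriv F"
    by (rule has_fps_expansion_deriv[OF gF])
  have X: "(\<lambda>z::complex. z) has_fps_expansion fps_X" by (rule has_fps_expansion_fps_X)
  define c where "c = complex_of_real x"
  have L: "(\<lambda>z. (1 - 2 * c * z + z * z) * deriv g z) has_fps_expansion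
      (1 - fps_const (2 * c) * fps_X + fps_X * fps_X) * fps_deriv F"
    by (intro has_fps_expansion_mult has_fps_expansion_add has_fps_expansion_diff
        has_fps_expansion_cmult_left has_fps_expansion_1 X dgF)
  have R: "(\<lambda>z. (2 * of_real l * (c - z)) * g z) has_fps_expansion
      (fps_const (2 * of_real l) * (fps_const c - fps_X)) * F"
    by (intro has_fps_expansion_mult has_fps_expansion_diff
        has_fps_expansion_cmult_left has_fps_expansion_const X gF)
  have eqLR: "(1 - 2 * c * z + z * z) * deriv g z = (2 * of_real l * (c - z)) * g z" if "z \<in> ball 0 1" for z
  proof -
    have "1 - 2 * c * z + z * z = pw x z" by (simp add: pw_def c_def power2_eq_square)
    then show ?thesis using deriv[OF that] pw1[OF that] by (simp add: c_def mult_ac)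
  qed
  have "(\<lambda>z. (1 - 2 * c * z + z * z) * deriv g z) has_fps_expansion
      (fps_const (2 * of_real l) * (fps_const c - fps_X)) * F"
    using R by (rule iffD2[OF has_fps_expansion_cong, rotated 2]) (use nb eqLR in \<open>auto elim!: eventually_mono\<close>)
  then have ode: "(1 - fps_const (2 * c) * fps_X + fps_X * fps_X) * fps_deriv F
      = (fps_const (2 * of_real l) * (fps_const c - fps_X)) * F"
    using L fps_expansion_unique_complex by blast
  have ode': "fps_deriv F - fps_const (2 * c) * (fps_X * fps_deriv F) + fps_X * (fps_X * fps_deriv F)
      = fps_const (2 * of_real l * c) * F - fps_const (2 * of_real l) * (fps_X * F)"
    using ode by (simp add: algebra_simps flip: fps_const_mult)
  have F0: "fps_nth F 0 = 1"
    using has_fps_expansion_imp_0_eq_fps_nth_0[OF gF] by (simp add: g_def pw_def)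
  have F1: "fps_nth F 1 = 2 * of_real l * c"
    using arg_cong[OF ode', of "\<lambda>f. fps_nth f 0"] F0 by simp
  have F2: "(of_nat k + 2) * fps_nth F (k + 2)
      = 2 * (of_nat k + 1 + of_real l) * c * fps_nth F (k + 1) - (of_nat k + 2 * of_real l) * fps_nth F k" for k
  proof -
    have "fps_nth (fps_X * (fps_X * fps_deriv F)) (Suc k) = of_nat k * fps_nth F k"
      by (cases k) auto
    moreover have "fps_nth (fps_deriv F - fps_const (2 * c) * (fps_X * fps_deriv F) + fps_X * (fps_X * fps_deriv F)) (Suc k)
      = (of_nat k + 2) * fps_nth F (k + 2) - 2 * c * ((of_nat k + 1) * fps_nth F (k + 1))
        + fps_nth (fps_X * (fps_X * fps_deriv F)) (Suc k)"
      by (simp add: add.commute)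
    moreover have "fps_nth (fps_const (2 * of_real l * c) * F - fps_const (2 * of_real l) * (fps_X * F)) (Suc k)
      = 2 * of_real l * c * fps_nth F (k + 1) - 2 * of_real l * fps_nth F k"
      by simp
    ultimately have "(of_nat k + 2) * fps_nth F (k + 2) - 2 * c * ((of_nat k + 1) * fps_nth F (k + 1)) + of_nat k * fps_nth F k
      = 2 * of_real l * c * fps_nth F (k + 1) - 2 * of_real l * fps_nth F k"
      unfolding ode' by simp
    then show ?thesis by (simp add: algebra_simps)
  qed
  have Fn: "fps_nth F k = of_real (gp l k x)" for k
  proof (induction k rule: less_induct)
    case (less k)
    consider "k = 0" | "k = 1" | j where "k = j + 2" by (metis add_2_eq_Suc' less_2_cases not_less_eq not0_implies_Suc numeral_2_eq_2 One_nat_def)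
    then show ?case
    proof cases
      case 1
      then show ?thesis by (simp add: F0 gp_0)
    next
      case 2
      then show ?thesis by (simp only: F1 gp_1 c_def of_real_mult of_real_numeral)
    next
      case 3
      have "(of_nat j + 2) * fps_nth F (j + 2) = of_real ((real j + 2) * gp l (j + 2) x)"
        unfolding F2 gp_three_term using less 3 by (simp add: c_def)
      then have "(of_nat j + 2) * fps_nth F (j + 2) = (of_nat j + 2) * of_real (gp l (j + 2) x)" by simp
      moreover have "(of_nat j + 2 :: complex) \<noteq> 0"
        by (metis of_nat_add of_nat_numeral of_nat_eq_0_iff add_is_0 zero_neq_numeral)
      ultimately show ?thesis using 3 by simp
    qed
  qed
  have e1: "(\<lambda>z. g z + (1 / of_real l) * (z * deriv g z)) has_fps_expansion F + fps_const (1 / of_real l) * (fps_X * fps_deriv F)"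
    by (intro has_fps_expansion_add has_fps_expansion_mult has_fps_expansion_cmult_left X gF dgF)
  have e2: "F + fps_const (1 / of_real l) * (fps_X * fps_deriv F) = Abs_fps (\<lambda>k. of_real (Zp l k x))"
  proof (rule fps_ext)
    fix k
    show "fps_nth (F + fps_const (1 / of_real l) * (fps_X * fps_deriv F)) k = fps_nth (Abs_fps (\<lambda>k. of_real (Zp l k x))) k"
      by (cases k) (simp_all add: Fn Zp_gp algebra_simps add_divide_distrib)
  qed
  have e3: "pkc l x z = g z + (1 / of_real l) * (z * deriv g z)" if z: "z \<in> ball 0 1" for z
  proof -
    define W where "W = pw x z powr (- of_real (l + 1))"
    have "g z + (1 / of_real l) * (z * deriv g z) = (pw x z + 2 * z * (of_real x - z)) * W"
      unfolding pw1[OF z, symmetric] deriv[OF z] W_def[symmetric] using l by (simp add: field_simps)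
    also have "pw x z + 2 * z * (of_real x - z) = 1 - z\<^sup>2"
      by (simp add: pw_def power2_eq_square algebra_simps)
    finally show ?thesis by (simp add: pkc_def W_def)
  qed
  have "\<forall>\<^sub>F z in nhds 0. pkc l x z = g z + (1 / of_real l) * (z * deriv g z)"
    using nb by (rule eventually_mono) (rule e3)
  from iffD2[OF has_fps_expansion_cong[OF this refl] e1] show ?thesis unfolding e2 .
qed

lemma fps_nth_deriv: "f has_fps_expansion F \<Longrightarrow> fps_nth F k = (deriv ^^ k) f 0 / fact k" for f :: "complex \<Rightarrow> complex"
  by (rule fps_nth_fps_expansion)

lemma pk_sums:
  assumes l: "l > 0" and x: "\<bar>x\<bar> \<le> 1" and r: "0 \<le> r" "r < 1"
  shows "(\<lambda>k. r ^ k * Zp l k x) sums pk l r x"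
proof -
  have "(\<lambda>k. (deriv ^^ k) (pkc l x) 0 / fact k * (of_real r - 0) ^ k) sums pkc l x (of_real r)"
    by (rule holomorphic_power_series[OF pkc_holomorphic[OF x]]) (use r in simp)
  then have "(\<lambda>k. of_real (Zp l k x) * of_real r ^ k) sums complex_of_real (pk l r x)"
    by (simp add: pkc_of_real[OF x r] flip: fps_nth_deriv[OF pkc_fps[OF l x]])
  then have "(\<lambda>k. complex_of_real (r ^ k * Zp l k x)) sums complex_of_real (pk l r x)"
    by (simp add: mult.commute)
  then show ?thesis by (simp only: sums_of_real_iff)
qed

text \<open>Cauchy's estimate on the circle of radius \<rho>. The point is that M is chosen before
  x, as \<open>pkc_bound\<close> and \<open>pk_le\<close> give a bound uniform on [-1, 1].\<close>

lemma Zp_growth: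
  assumes l: "l > 0" and \<rho>: "0 < \<rho>" "\<rho> < 1"
  obtains M where "\<And>x k. \<bar>x\<bar> \<le> 1 \<Longrightarrow> \<bar>Zp l k x\<bar> \<le> M / \<rho> ^ k"
proof -
  define M where "M = (1 + 2 / (1 - \<rho>)) powr (2 * l + 3) * ((1 - \<rho>)\<^sup>2) powr (- (l + 1))"
  show ?thesis
  proof (rule that[of M])
  fix x :: real and k
  assume x: "\<bar>x\<bar> \<le> 1"
  have bd: "norm (pkc l x z) \<le> M" if "norm (0 - z) = \<rho>" for z
  proof -
    have z: "cmod z = \<rho>" using that by simp
    have "cmod (z - of_real \<rho>) \<le> 2"
      using norm_triangle_ineq4[of z "of_real \<rho>"] z \<rho> by simp
    then have "(1 + cmod (z - of_real \<rho>) / (1 - \<rho>)) powr (2 * l + 3) * pk l \<rho> x \<le> M"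
      unfolding M_def using \<rho> l
      by (intro mult_mono powr_mono2 pk_le add_left_mono divide_right_mono x pk_pos) auto
    then show ?thesis using pkc_bound[OF l x z \<rho>(2)] by linarith
  qed
  have "norm ((deriv ^^ k) (pkc l x) 0) \<le> fact k * M / \<rho> ^ k"
  proof (rule Cauchy_inequality)
    show "pkc l x holomorphic_on ball 0 \<rho>"
      by (rule holomorphic_on_subset[OF pkc_holomorphic[OF x]]) (use \<rho> in auto)
    show "continuous_on (cball 0 \<rho>) (pkc l x)"
      by (rule holomorphic_on_imp_continuous_on[OF holomorphic_on_subset[OF pkc_holomorphic[OF x]]])
        (use \<rho> in auto)
  qed (use \<rho> bd in auto)
  moreover have "of_real (Zp l k x) = (deriv ^^ k) (pkc l x) 0 / fact k"
    using fps_nth_deriv[OF pkc_fps[OF l x], of k] by simp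
  then have "\<bar>Zp l k x\<bar> = norm ((deriv ^^ k) (pkc l x) 0) / fact k"
    by (metis norm_divide norm_fact norm_of_real)
  ultimately have "\<bar>Zp l k x\<bar> \<le> (fact k * M / \<rho> ^ k) / fact k"
    by (simp only: divide_right_mono fact_ge_zero)
  then show "\<bar>Zp l k x\<bar> \<le> M / \<rho> ^ k" by simp
  qed
qed

lemma pk_uniform_tail:
  assumes l: "l > 0" and r: "0 \<le> r" "r < 1"
  obtains e where "e \<longlonglongrightarrow> 0"
    "\<And>x L. \<bar>x\<bar> \<le> 1 \<Longrightarrow> \<bar>pk l r x - (\<Sum>k<L. r ^ k * Zp l k x)\<bar> \<le> e L"
proof -
  \<comment> \<open>Strictly between r and 1, so that powers of r / \<rho> give a summable majorant
    independent of x.\<close>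
  define \<rho> where "\<rho> = (1 + r) / 2"
  have \<rho>: "0 < \<rho>" "\<rho> < 1" "r < \<rho>" using r by (auto simp: \<rho>_def)
  obtain M where M: "\<And>x k. \<bar>x\<bar> \<le> 1 \<Longrightarrow> \<bar>Zp l k x\<bar> \<le> M / \<rho> ^ k"
    using Zp_growth[OF l \<rho>(1,2)] by blast
  define q where "q = r / \<rho>"
  have q: "0 \<le> q" "q < 1" using r \<rho> by (auto simp: q_def)
  have tm: "\<bar>r ^ k * Zp l k x\<bar> \<le> M * q ^ k" if "\<bar>x\<bar> \<le> 1" for x k
  proof -
    have "\<bar>r ^ k * Zp l k x\<bar> \<le> r ^ k * (M / \<rho> ^ k)"
      unfolding abs_mult using r M[OF that, of k] by (intro mult_mono) auto
    then show ?thesis by (simp add: q_def power_divide mult.commute)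
  qed
  have sq: "summable (\<lambda>k. M * q ^ k)" using q by (intro summable_mult summable_geometric) simp
  show ?thesis
  proof
    show "(\<lambda>L. \<Sum>k. M * q ^ (k + L)) \<longlonglongrightarrow> 0"
      by (rule suminf_exist_split2[OF sq])
    fix x :: real and L assume x: "\<bar>x\<bar> \<le> 1"
    have s: "(\<lambda>k. r ^ k * Zp l k x) sums pk l r x" by (rule pk_sums[OF l x r])
    have "pk l r x - (\<Sum>k<L. r ^ k * Zp l k x) = (\<Sum>k. r ^ (k + L) * Zp l (k + L) x)"
      using suminf_minus_initial_segment[OF sums_summable[OF s], of L] sums_unique[OF s] by simp
    also have "\<bar>\<dots>\<bar> \<le> (\<Sum>k. M * q ^ (k + L))"
    proof -
      have sq': "summable (\<lambda>k. M * q ^ (k + L))" using sq by (rule summable_ignore_initial_segment)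
      have "norm (\<Sum>k. r ^ (k + L) * Zp l (k + L) x) \<le> (\<Sum>k. M * q ^ (k + L))"
        by (rule norm_suminf_le[OF _ sq']) (use tm[OF x] in simp)
      then show ?thesis by simp
    qed
    finally show "\<bar>pk l r x - (\<Sum>k<L. r ^ k * Zp l k x)\<bar> \<le> (\<Sum>k. M * q ^ (k + L))" .
  qed
qed

text \<open>On the circle the conjugate of u is r^2 / u, hence |1 - u|^2 = (1 - u) (u - r^2) / u,
  and the integral becomes Cauchy's formula for 1 / (1 - u) at the point r^2.\<close>

lemma circle_integral_inverse_square:
  assumes r: "0 < r" "r < 1"
  shows "((\<lambda>t. 1 / (cmod (1 - circlepath 0 r t))\<^sup>2) has_integral 1 / (1 - r\<^sup>2)) {0..1}"
proof -
  define h where "h u = 1 / (1 - u) / (u - of_real (r\<^sup>2))" for u :: complex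
  have "(h has_contour_integral (2 * of_real pi * \<i> * (1 / (1 - of_real (r\<^sup>2))))) (circlepath 0 r)"
    unfolding h_def
  proof (rule Cauchy_integral_circlepath_simple)
    show "(\<lambda>u. 1 / (1 - u)) holomorphic_on cball 0 r"
      by (intro holomorphic_intros) (use r in auto)
    show "cmod (of_real (r\<^sup>2) - 0) < r"
      using r mult_strict_left_mono[of r 1 r] by (simp add: norm_power norm_mult power2_eq_square)
  qed
  then have "((\<lambda>t. h (circlepath 0 r t) * vector_derivative (circlepath 0 r) (at t)) has_integral
      (2 * of_real pi * \<i> * (1 / (1 - of_real (r\<^sup>2))))) {0..1}"
    by (simp add: has_contour_integral)
  moreover have "h (circlepath 0 r t) * vector_derivative (circlepath 0 r) (at t)
      = (2 * of_real pi * \<i>) * of_real (1 / (cmod (1 - circlepath 0 r t))\<^sup>2)" for t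
  proof -
    define u where "u = circlepath 0 r t"
    have u: "u = of_real r * exp (2 * of_real pi * \<i> * of_real t)"
      by (simp add: u_def circlepath)
    have cu: "cmod u = r" using r by (simp add: u norm_mult)
    have nz: "u \<noteq> 0" "1 - u \<noteq> 0" using cu r by auto
    have uc: "u * cnj u = of_real (r\<^sup>2)" by (metis complex_norm_square cu)
    have f1: "u - of_real (r\<^sup>2) = u * (1 - cnj u)" unfolding uc[symmetric] by (simp add: algebra_simps)
    have f2: "of_real ((cmod (1 - u))\<^sup>2) = (1 - u) * (1 - cnj u)"
      using complex_norm_square[of "1 - u"] by (simp only: complex_cnj_diff complex_cnj_one)
    have f3: "1 - cnj u \<noteq> 0" using nz(2) by (metis complex_cnj_cancel_iff complex_cnj_diff complex_cnj_one complex_cnj_zero)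
    have f4: "vector_derivative (circlepath 0 r) (at t) = 2 * of_real pi * \<i> * u"
      by (simp add: vector_derivative_circlepath u)
    show ?thesis
      unfolding f4 h_def u_def[symmetric] f1 of_real_divide f2 of_real_1 using nz f3 by simp
  qed
  ultimately have "((\<lambda>t. (2 * of_real pi * \<i>) * of_real (1 / (cmod (1 - circlepath 0 r t))\<^sup>2)) has_integral
      (2 * of_real pi * \<i>) * (1 / (1 - of_real (r\<^sup>2)))) {0..1}"
    by simp
  then have "((\<lambda>t. (1 / (2 * of_real pi * \<i>)) * ((2 * of_real pi * \<i>) * of_real (1 / (cmod (1 - circlepath 0 r t))\<^sup>2))) has_integral
      (1 / (2 * of_real pi * \<i>)) * ((2 * of_real pi * \<i>) * (1 / (1 - of_real (r\<^sup>2))))) {0..1}"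
    by (rule has_integral_mult_right)
  then have "((\<lambda>t. complex_of_real (1 / (cmod (1 - circlepath 0 r t))\<^sup>2)) has_integral complex_of_real (1 / (1 - r\<^sup>2))) {0..1}"
    by simp
  then have "((Re \<circ> (\<lambda>t. complex_of_real (1 / (cmod (1 - circlepath 0 r t))\<^sup>2))) has_integral Re (complex_of_real (1 / (1 - r\<^sup>2)))) {0..1}"
    by (rule has_integral_linear[OF _ bounded_linear_Re])
  then show ?thesis by (simp add: o_def)
qed

text \<open>Keeping the weight 1 / |1 - z|^2 under the integral costs 1 / (1 - r^2) instead of the 1
  / (1 - r)^2 of a supremum bound; the saved power yields exactly (N + 1)^d in
  \<open>ces_kernel_bound\<close>.\<close>

lemma coeff_bound_circle:
  assumes f: "f holomorphic_on ball 0 1" "f has_fps_expansion F" and r: "0 < r" "r < 1"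
    and bd: "\<And>z. cmod z = r \<Longrightarrow> cmod (f z) \<le> A / (cmod (1 - z))\<^sup>2"
  shows "cmod (fps_nth F N) \<le> A / (r ^ N * (1 - r\<^sup>2))"
proof -
  define g where "g u = f u / u ^ Suc N" for u
  have hol: "f holomorphic_on cball 0 r" by (rule holomorphic_on_subset[OF f(1)]) (use r in auto)
  have g: "g contour_integrable_on circlepath 0 r"
    and c: "(deriv ^^ N) f 0 = fact N / (2 * of_real pi * \<i>) * contour_integral (circlepath 0 r) g"
    using Cauchy_higher_derivative_integral_circlepath[of 0 r f 0 N] hol r
    by (auto simp: g_def[abs_def] holomorphic_on_imp_continuous_on holomorphic_on_subset[OF hol] ball_subset_cball)
  have "cmod (contour_integral (circlepath 0 r) g) \<le> 2 * pi * (A / r ^ N) * (1 / (1 - r\<^sup>2))"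
  proof -
    have I: "((\<lambda>t. 2 * pi * (A / r ^ N) * (1 / (cmod (1 - circlepath 0 r t))\<^sup>2)) has_integral
        2 * pi * (A / r ^ N) * (1 / (1 - r\<^sup>2))) {0..1}"
      by (rule has_integral_mult_right[OF circle_integral_inverse_square[OF r]])
    have "norm (integral {0..1} (\<lambda>t. g (circlepath 0 r t) * vector_derivative (circlepath 0 r) (at t)))
      \<le> integral {0..1} (\<lambda>t. 2 * pi * (A / r ^ N) * (1 / (cmod (1 - circlepath 0 r t))\<^sup>2))"
    proof (rule integral_norm_bound_integral)
      show "(\<lambda>t. g (circlepath 0 r t) * vector_derivative (circlepath 0 r) (at t)) integrable_on {0..1}"
        using g by (simp add: contour_integrable_on)
      show "(\<lambda>t. 2 * pi * (A / r ^ N) * (1 / (cmod (1 - circlepath 0 r t))\<^sup>2)) integrable_on {0..1}"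
        using I by blast
      fix t :: real
      define u where "u = circlepath 0 r t"
      have u: "u = of_real r * exp (2 * of_real pi * \<i> * of_real t)"
        by (simp add: u_def circlepath)
      have cu: "cmod u = r" using r by (simp add: u norm_mult)
      have "vector_derivative (circlepath 0 r) (at t) = 2 * of_real pi * \<i> * u"
        by (simp add: vector_derivative_circlepath u)
      then have "norm (g u * vector_derivative (circlepath 0 r) (at t)) = 2 * pi * (cmod (f u) / r ^ N)"
        using cu r by (auto simp: g_def norm_mult norm_divide norm_power)
      also have "\<dots> \<le> 2 * pi * (A / (cmod (1 - u))\<^sup>2 / r ^ N)"
        using bd[OF cu] r by (intro mult_left_mono divide_right_mono) auto
      finally show "norm (g (circlepath 0 r t) * vector_derivative (circlepath 0 r) (at t))
          \<le> 2 * pi * (A / r ^ N) * (1 / (cmod (1 - circlepath 0 r t))\<^sup>2)"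
        by (simp add: u_def mult_ac)
    qed
    then show ?thesis using integral_unique[OF I] by (simp add: contour_integral_integral)
  qed
  moreover have "fps_nth F N = contour_integral (circlepath 0 r) g / (2 * of_real pi * \<i>)"
    using fps_nth_deriv[OF f(2), of N] c by simp
  then have "cmod (fps_nth F N) = cmod (contour_integral (circlepath 0 r) g) / (2 * pi)"
    by (simp add: norm_divide norm_mult)
  ultimately have "cmod (fps_nth F N) \<le> (2 * pi * (A / r ^ N) * (1 / (1 - r\<^sup>2))) / (2 * pi)"
    by (simp only: divide_right_mono pi_ge_zero mult_nonneg_nonneg zero_le_numeral)
  then show ?thesis by simp
qed

text \<open>The power of 3 is the price for comparing z with its modulus; exp 1 bounds r^(-N) for r
  = N / (N + 1).\<close>

definition cker :: "real \<Rightarrow> real" where "cker l = 3 powr (2 * l + 3) * exp 1"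

text \<open>The sum is the N-th coefficient of pkc(z) / (1 - z)^(d + 1), estimated on the circle of
  radius r = N / (N + 1), where 1 - r = 1 / (N + 1). There \<open>pkc\<close> is at most (3 |1 - z|
  / (1 - r))^(2 l + 3) times the real kernel, and d \<ge> 2 l + 4 lets the denominator absorb this
  growth and still leave 1 / |1 - z|^2.\<close>

theorem ces_kernel_bound:
  assumes l: "l > 0" and x: "\<bar>x\<bar> \<le> 1" and d: "2 * l + 4 \<le> real d"
  shows "\<bar>\<Sum>k\<le>N. ces d N k * Zp l k x\<bar> \<le> cker l * (real N + 1) ^ d * pk l (real N / (real N + 1)) x"
proof (cases "N = 0")
  case True
  \<comment> \<open>For N = 0 the circle degenerates; the sum and the kernel at radius 0 are both
    1.\<close>
  have "1 \<le> cker l" unfolding cker_def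
    using l mult_mono[of 1 "3 powr (2 * l + 3)" 1 "exp 1 :: real"] by (simp add: ge_one_powr_ge_zero)
  with True show ?thesis by (simp add: ces_def Zp_gp gp_0 pk_def)
next
  case False
  define r where "r = real N / (real N + 1)"
  have r: "0 < r" "r < 1" using False by (auto simp: r_def field_simps)
  have r1: "1 - r = 1 / (real N + 1)" by (simp add: r_def field_simps)
  define E where "E = 2 * l + 3"
  define f where "f z = pkc l x z * inverse ((1 - z) ^ Suc d)" for z
  define F where "F = Abs_fps (\<lambda>k. complex_of_real (Zp l k x)) * inverse ((1 - fps_X) ^ Suc d)"
  have fF: "f has_fps_expansion F"
    unfolding f_def[abs_def] F_def
    by (intro has_fps_expansion_mult has_fps_expansion_inverse has_fps_expansion_power
        has_fps_expansion_diff has_fps_expansion_1 has_fps_expansion_fps_X pkc_fps l x) simp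
  have hol: "f holomorphic_on ball 0 1"
    unfolding f_def[abs_def] by (intro holomorphic_intros pkc_holomorphic x) auto
  have coeff: "fps_nth F N = of_real (\<Sum>k\<le>N. ces d N k * Zp l k x)"
  proof -
    have inv: "fps_nth (inverse ((1 - fps_X) ^ Suc d)) j = (of_nat ((j + d) choose d) :: complex)" for j
      using arg_cong[OF one_minus_const_fps_X_neg_power'[of "Suc d" "1 :: complex"], of "\<lambda>f. fps_nth f j"]
      by (simp add: binomial_symmetric[of j "d + j"] add.commute)
    have "fps_nth F N = (\<Sum>k = 0..N. of_real (Zp l k x) * of_nat ((N - k + d) choose d))"
      unfolding F_def fps_mult_nth inv by simp
    also have "\<dots> = of_real (\<Sum>k\<le>N. ces d N k * Zp l k x)"
      unfolding of_real_sum by (rule sum.cong) (auto simp: ces_def)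
    finally show ?thesis .
  qed
  \<comment> \<open>The exponent of the surplus power of |1 - z|; being nonpositive, it allows |1 -
    z| to be replaced by its lower bound 1 - r.\<close>
  have dE: "E + 2 - real (Suc d) \<le> 0" using d by (simp add: E_def)
  define A where "A = 3 powr E * (1 - r) powr (1 - real d) * pk l r x"
  have bd: "cmod (f z) \<le> A / (cmod (1 - z))\<^sup>2" if z: "cmod z = r" for z
  proof -
    define q where "q = cmod (1 - z)"
    have q: "1 - r \<le> q" using norm_triangle_ineq2[of 1 z] z by (simp add: q_def)
    have q0: "q > 0" using q r by linarith
    have "cmod (z - of_real r) \<le> 2 * q"
    proof -
      have "cmod (z - of_real r) \<le> cmod (1 - of_real r) + cmod (1 - z)"
        using norm_triangle_ineq4[of "1 - of_real r" "1 - z"] by simp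
      moreover have "cmod (1 - of_real r) = 1 - r"
        using r by (metis abs_of_pos diff_gt_0_iff_gt norm_of_real of_real_1 of_real_diff)
      ultimately show ?thesis using q by (simp add: q_def)
    qed
    then have "((1 - r) + cmod (z - of_real r)) / (1 - r) \<le> 3 * q / (1 - r)"
      using q r by (intro divide_right_mono) auto
    then have "1 + cmod (z - of_real r) / (1 - r) \<le> 3 * q / (1 - r)"
      using r by (simp add: add_divide_distrib)
    then have B: "(1 + cmod (z - of_real r) / (1 - r)) powr E \<le> (3 * q / (1 - r)) powr E"
      using r l by (intro powr_mono2) (auto simp: E_def add_nonneg_nonneg)
    have "cmod (f z) = cmod (pkc l x z) / q ^ Suc d"
      by (simp add: f_def norm_mult norm_inverse norm_power q_def divide_inverse del: power_Suc)
    also have "\<dots> \<le> (3 * q / (1 - r)) powr E * pk l r x / q ^ Suc d"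
      using order_trans[OF pkc_bound[OF l x z r(2)] mult_right_mono[OF B[unfolded E_def] pk_pos[OF x]]] r q0
      by (intro divide_right_mono) (auto simp: E_def)
    also have "\<dots> = 3 powr E * (1 - r) powr (- E) * pk l r x * (q powr E / q ^ Suc d)"
    proof -
      have "(3 * q / (1 - r)) powr E = 3 powr E * (1 - r) powr (- E) * q powr E"
        using r q0 by (simp add: powr_divide powr_mult powr_minus_divide)
      then show ?thesis by simp
    qed
    also have "q powr E / q ^ Suc d = q powr (E + 2 - real (Suc d)) / q\<^sup>2"
    proof -
      have 1: "q ^ Suc d = q powr real (Suc d)" by (rule powr_realpow[OF q0, symmetric])
      have 2: "q\<^sup>2 = q powr 2" using q0 by simp
      have "q powr 2 > 0" using q0 by simp
      then show ?thesis unfolding 1 2 powr_diff powr_add by (simp del: powr_gt_zero)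
    qed
    also have "3 powr E * (1 - r) powr (- E) * pk l r x * (q powr (E + 2 - real (Suc d)) / q\<^sup>2)
       \<le> 3 powr E * (1 - r) powr (- E) * pk l r x * ((1 - r) powr (E + 2 - real (Suc d)) / q\<^sup>2)"
      using dE q r by (intro mult_left_mono divide_right_mono powr_mono2' mult_nonneg_nonneg pk_pos x) auto
    also have "\<dots> = 3 powr E * ((1 - r) powr (- E) * (1 - r) powr (E + 2 - real (Suc d))) * pk l r x / q\<^sup>2"
      by simp
    also have "(1 - r) powr (- E) * (1 - r) powr (E + 2 - real (Suc d)) = (1 - r) powr (1 - real d)"
      by (simp flip: powr_add)
    finally show ?thesis by (simp add: A_def q_def)
  qed
  have "cmod (fps_nth F N) \<le> A / (r ^ N * (1 - r\<^sup>2))"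
    by (rule coeff_bound_circle[OF hol fF r bd])
  also have "\<dots> \<le> A * (exp 1 * (real N + 1))"
  proof -
    have A0: "A \<ge> 0" unfolding A_def using r x by (intro mult_nonneg_nonneg pk_pos) auto
    have "1 / r ^ N \<le> exp 1"
    proof -
      have "1 / r ^ N = (1 + 1 / real N) ^ N"
        using False by (simp add: r_def field_simps power_divide)
      also have "\<dots> \<le> exp (1 / real N) ^ N"
        using False by (intro power_mono exp_ge_add_one_self) simp
      also have "\<dots> = exp 1" using False by (simp flip: exp_of_nat_mult)
      finally show ?thesis .
    qed
    moreover have "1 / (1 - r\<^sup>2) \<le> real N + 1"
    proof -
      have "r\<^sup>2 \<le> r" using r by (simp add: power2_eq_square)
      then have "1 / (1 - r\<^sup>2) \<le> 1 / (1 - r)" using r by (intro divide_left_mono) (auto intro!: mult_pos_pos)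
      then show ?thesis by (simp add: r1)
    qed
    moreover have "r\<^sup>2 < 1" using r by (simp add: power_less_one_iff abs_square_less_1)
    ultimately have "(1 / r ^ N) * (1 / (1 - r\<^sup>2)) \<le> exp 1 * (real N + 1)"
      by (intro mult_mono) auto
    from mult_left_mono[OF this A0] show ?thesis by simp
  qed
  also have "A * (exp 1 * (real N + 1)) = cker l * ((1 - r) powr (1 - real d) * (real N + 1)) * pk l r x"
    by (simp add: A_def cker_def E_def)
  also have "(1 - r) powr (1 - real d) * (real N + 1) = (real N + 1) ^ d"
  proof -
    have "(1 - r) powr (1 - real d) = (real N + 1) powr (real d - 1)"
      unfolding r1 by (simp add: powr_divide powr_diff)
    moreover have "(real N + 1) powr (real d - 1) * (real N + 1) powr 1 = (real N + 1) powr (real d - 1 + 1)"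
      by (rule powr_add[symmetric])
    moreover have "(real N + 1) powr (real d - 1 + 1) = (real N + 1) ^ d" by (simp add: powr_realpow)
    ultimately show ?thesis by simp
  qed
  finally show ?thesis unfolding coeff r_def[symmetric] norm_of_real .
qed

section \<open>Symmetric beta measures and moments of the weight\<close>

lemma power_mult_powr: "0 \<le> x \<Longrightarrow> x ^ j * x powr s = x powr (real j + s)" for x :: real
  by (cases "x = 0") (simp_all add: powr_add powr_realpow)

lemma nn_integral_Beta:
  assumes "x > 0" "y > 0"
  shows "(\<integral>\<^sup>+t. ennreal (t powr (x - 1) * (1 - t) powr (y - 1) * indicator {0..1} t) \<partial>lborel) = ennreal (Beta x y)"
proof -
  have "(\<integral>\<^sup>+t. ennreal (t powr (x - 1) * (1 - t) powr (y - 1) * indicator {0..1} t) \<partial>lborel)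
    = (\<integral>\<^sup>+t. ennreal (t powr (x - 1) * (1 - t) powr (y - 1)) * indicator {0..1} t \<partial>lborel)"
    by (intro nn_integral_cong) (auto simp: indicator_def)
  also have "\<dots> = ennreal (Beta x y)"
    by (rule nn_integral_has_integral_lebesgue'[OF _ has_integral_Beta_real[OF assms]]) simp
  finally show ?thesis .
qed

text \<open>Substitution t = u^2 on [0, 1] and reflection. The point u = 0 is discarded: for i = 0
  the two integrands differ there, as 0 to any real power is 0.\<close>

lemma nn_integral_symmetric_Beta:
  assumes e: "e > -1"
  shows "(\<integral>\<^sup>+u. ennreal (u ^ (2 * i) * (1 - u\<^sup>2) powr e * indicator {-1..1} u) \<partial>lborel)
    = ennreal (Beta (real i + 1/2) (e + 1))"
proof -
  define f where "f t = t powr (real i + 1/2 - 1) * (1 - t) powr (e + 1 - 1)" for t :: real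
  define h where "h u = u ^ (2 * i) * (1 - u\<^sup>2) powr e" for u :: real
  have [measurable]: "f \<in> borel_measurable borel" "h \<in> borel_measurable borel"
    unfolding f_def[abs_def] h_def[abs_def] by measurable
  have nz: "AE u in lborel. u \<noteq> (0::real)" by (rule AE_lborel_singleton)
  have "ennreal (Beta (real i + 1/2) (e + 1)) = (\<integral>\<^sup>+t. ennreal (f t * indicator {(0::real)\<^sup>2..1\<^sup>2} t) \<partial>lborel)"
    unfolding f_def using nn_integral_Beta[of "real i + 1/2" "e + 1"] e by simp
  also have "\<dots> = (\<integral>\<^sup>+u. ennreal (f (u\<^sup>2) * (2 * u) * indicator {0..1} u) \<partial>lborel)"
    by (rule nn_integral_substitution[of "\<lambda>u. u\<^sup>2" 0 1 f "\<lambda>u. 2 * u"])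
      (auto intro!: derivative_eq_intros continuous_intros simp: set_borel_measurable_def)
  also have "\<dots> = (\<integral>\<^sup>+u. 2 * ennreal (h u * indicator {0..1} u) \<partial>lborel)"
  proof (rule nn_integral_cong_AE, rule AE_mp[OF nz], rule AE_I2, rule impI)
    fix u :: real assume "u \<noteq> 0"
    show "ennreal (f (u\<^sup>2) * (2 * u) * indicator {0..1} u) = 2 * ennreal (h u * indicator {0..1} u)"
    proof (cases "u \<in> {0..1}")
      case True
      then have u: "0 < u" using \<open>u \<noteq> 0\<close> by auto
      have "u\<^sup>2 = u powr 2" using u by simp
      then have "(u\<^sup>2) powr (real i + 1/2 - 1) * u = u powr (2 * (real i + 1/2 - 1)) * u powr 1"
        using u by (simp only: powr_powr) simp
      also have "\<dots> = u powr (2 * (real i + 1/2 - 1) + 1)" by (rule powr_add[symmetric])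
      also have "2 * (real i + 1/2 - 1) + 1 = real (2 * i)" by simp
      also have "u powr real (2 * i) = u ^ (2 * i)" by (rule powr_realpow[OF u])
      finally have 1: "(u\<^sup>2) powr (real i + 1/2 - 1) * u = u ^ (2 * i)" .
      have "f (u\<^sup>2) * (2 * u) = 2 * (((u\<^sup>2) powr (real i + 1/2 - 1) * u) * (1 - u\<^sup>2) powr e)"
        by (simp add: f_def)
      then have "f (u\<^sup>2) * (2 * u) = 2 * h u" unfolding 1 h_def .
      then have "ennreal (f (u\<^sup>2) * (2 * u)) = ennreal 2 * ennreal (h u)"
        by (simp only: ennreal_mult' zero_le_numeral)
      then show ?thesis using True by simp
    qed simp
  qed
  also have "\<dots> = 2 * (\<integral>\<^sup>+u. ennreal (h u * indicator {0..1} u) \<partial>lborel)"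
    by (rule nn_integral_cmult) measurable
  finally have 1: "ennreal (Beta (real i + 1/2) (e + 1)) = 2 * (\<integral>\<^sup>+u. ennreal (h u * indicator {0..1} u) \<partial>lborel)" .
  have refl: "(\<integral>\<^sup>+u. ennreal (h u * indicator {-1..0} u) \<partial>lborel) = (\<integral>\<^sup>+u. ennreal (h u * indicator {0..1} u) \<partial>lborel)"
  proof -
    have "(\<integral>\<^sup>+u. ennreal (h u * indicator {-1..0} u) \<partial>lborel)
      = ennreal \<bar>-1\<bar> * (\<integral>\<^sup>+u. ennreal (h (0 + (-1) * u) * indicator {-1..0} (0 + (-1) * u)) \<partial>lborel)"
      by (rule nn_integral_real_affine) simp_all
    also have "\<dots> = (\<integral>\<^sup>+u. ennreal (h u * indicator {0..1} u) \<partial>lborel)"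
      by (simp add: h_def) (intro nn_integral_cong, auto simp: indicator_def)
    finally show ?thesis .
  qed
  have "(\<integral>\<^sup>+u. ennreal (u ^ (2 * i) * (1 - u\<^sup>2) powr e * indicator {-1..1} u) \<partial>lborel)
    = (\<integral>\<^sup>+u. ennreal (h u * indicator {-1..0} u) + ennreal (h u * indicator {0..1} u) \<partial>lborel)"
    by (rule nn_integral_cong_AE, rule AE_mp[OF nz], rule AE_I2) (auto simp: h_def indicator_def)
  also have "\<dots> = (\<integral>\<^sup>+u. ennreal (h u * indicator {-1..0} u) \<partial>lborel) + (\<integral>\<^sup>+u. ennreal (h u * indicator {0..1} u) \<partial>lborel)"
    by (rule nn_integral_add) measurable
  also have "\<dots> = ennreal (Beta (real i + 1/2) (e + 1))"
    unfolding refl 1 by (simp add: mult_2)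
  finally show ?thesis .
qed

text \<open>The even moments are those of the density \<open>(1 - s\<^sup>2) powr (\<kappa> - 1)\<close> on \<open>[-1, 1]\<close>, which degenerates
  to the two-point measure at \<open>\<plusminus> 1\<close> for \<open>\<kappa> = 0\<close>.\<close>

lemma ex_symmetric_beta_measure:
  fixes \<kappa> :: real
  assumes "\<kappa> \<ge> 0"
  obtains N :: "real measure" where "prob_space N" "sets N = sets borel" "AE s in N. \<bar>s\<bar> \<le> 1"
    "\<And>q. odd q \<Longrightarrow> (\<integral>s. s ^ q \<partial>N) = 0"
    "\<And>q. (real q + 1 + 2 * \<kappa>) * (\<integral>s. s ^ (q + 2) \<partial>N) = (real q + 1) * (\<integral>s. s ^ q \<partial>N)"
proof (cases "\<kappa> = 0")
  case True
  define p where "p = pmf_of_set {1, -1 :: real}"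
  define N where "N = distr (measure_pmf p) borel (\<lambda>s. s)"
  have I: "(\<integral>s. s ^ q \<partial>N) = (1 + (-1) ^ q) / 2" for q
    unfolding N_def p_def by (subst integral_distr) (auto simp: integral_pmf_of_set)
  show ?thesis
  proof (rule that[of N])
    show "prob_space N" unfolding N_def by (rule measure_pmf.prob_space_distr) simp
    show "AE s in N. \<bar>s\<bar> \<le> 1" unfolding N_def p_def
      by (subst AE_distr_iff) (auto simp: AE_measure_pmf_iff)
    show "sets N = sets borel" by (simp add: N_def)
    show "(real q + 1 + 2 * \<kappa>) * (\<integral>s. s ^ (q + 2) \<partial>N) = (real q + 1) * (\<integral>s. s ^ q \<partial>N)" for q
      unfolding I by (simp add: True)
  qed (simp_all add: I)
next
  case False
  then have k: "\<kappa> > 0" using assms by simp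
  define B where "B = Beta (1/2) \<kappa>"
  have B: "B > 0" using k by (simp add: B_def Beta_def Gamma_real_pos)
  define d where "d s = (1 - s\<^sup>2) powr (\<kappa> - 1) * indicator {-1..1} s / B" for s :: real
  have [measurable]: "d \<in> borel_measurable borel" unfolding d_def[abs_def] by measurable
  have d0: "d s \<ge> 0" for s using B by (simp add: d_def)
  define N where "N = density lborel (\<lambda>s. ennreal (d s))"
  have nn: "(\<integral>\<^sup>+s. ennreal (d s * s ^ (2 * i)) \<partial>lborel) = ennreal (Beta (real i + 1/2) \<kappa> / B)" for i
  proof -
    have "(\<integral>\<^sup>+s. ennreal (d s * s ^ (2 * i)) \<partial>lborel)
      = (\<integral>\<^sup>+s. ennreal (1 / B) * ennreal (s ^ (2 * i) * (1 - s\<^sup>2) powr (\<kappa> - 1) * indicator {-1..1} s) \<partial>lborel)"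
      using B by (intro nn_integral_cong, subst ennreal_mult'[symmetric]) (auto simp: d_def mult_ac)
    also have "\<dots> = ennreal (1 / B) * ennreal (Beta (real i + 1/2) \<kappa>)"
      using nn_integral_symmetric_Beta[of "\<kappa> - 1" i] k by (subst nn_integral_cmult) auto
    also have "\<dots> = ennreal (Beta (real i + 1/2) \<kappa> / B)"
      using B by (subst ennreal_mult'[symmetric]) auto
    finally show ?thesis .
  qed
  have dens: "(\<integral>s. s ^ q \<partial>N) = (\<integral>s. d s * s ^ q \<partial>lborel)" for q
    unfolding N_def by (subst integral_density) (auto simp: d0)
  have even: "(\<integral>s. s ^ (2 * i) \<partial>N) = Beta (real i + 1/2) \<kappa> / B" for i
  proof -
    have "Beta (real i + 1/2) \<kappa> / B \<ge> 0" using k B by (simp add: Beta_def Gamma_real_pos less_imp_le)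
    then show ?thesis unfolding dens
      by (subst integral_eq_nn_integral) (auto simp: nn d0)
  qed
  have odd: "(\<integral>s. s ^ q \<partial>N) = 0" if "odd q" for q
  proof -
    have "(\<integral>s. d s * s ^ q \<partial>lborel) = \<bar>-1\<bar> *\<^sub>R (\<integral>s. d (0 + (-1) * s) * (0 + (-1) * s) ^ q \<partial>lborel)"
      by (rule lborel_integral_real_affine) simp
    also have "\<dots> = (\<integral>s. - (d s * s ^ q) \<partial>lborel)"
    proof -
      have "d (- s) = d s" for s by (auto simp: d_def indicator_def)
      then show ?thesis using that by simp
    qed
    finally show ?thesis unfolding dens by simp
  qed
  show ?thesis
  proof (rule that[of N])
    show "prob_space N"
    proof
      have "emeasure N (space N) = (\<integral>\<^sup>+s. ennreal (d s * s ^ (2 * 0)) \<partial>lborel)"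
        unfolding N_def by (subst emeasure_density) auto
      then show "emeasure N (space N) = 1" unfolding nn using B by (simp add: B_def)
    qed
    show "AE s in N. \<bar>s\<bar> \<le> 1"
      unfolding N_def by (subst AE_density) (auto simp: d_def indicator_def)
    show "(real q + 1 + 2 * \<kappa>) * (\<integral>s. s ^ (q + 2) \<partial>N) = (real q + 1) * (\<integral>s. s ^ q \<partial>N)" for q
    proof (cases "even q")
      case True
      then obtain i where q: "q = 2 * i" by (elim evenE)
      have "(real i + 1/2 + \<kappa>) * Beta (real i + 1/2 + 1) \<kappa> = (real i + 1/2) * Beta (real i + 1/2) \<kappa>"
        by (rule Beta_plus1_left) (auto elim!: nonpos_Ints_cases')
      then have "(2 * real i + 1 + 2 * \<kappa>) * Beta (real (Suc i) + 1/2) \<kappa> = (2 * real i + 1) * Beta (real i + 1/2) \<kappa>"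
        by (simp add: algebra_simps)
      moreover have "q + 2 = 2 * Suc i" using q by simp
      ultimately show ?thesis unfolding q by (simp only: even) (simp add: field_simps)
    next
      case False
      then show ?thesis using odd[of q] odd[of "q + 2"] by simp
    qed
    show "sets N = sets borel" by (simp add: N_def)
  qed (rule odd)
qed

section \<open>Measurability of the domain and the weight\<close>

lemma sets_Omega [measurable]: "Omega a b c \<in> sets borel"
  and sets_Lambda [measurable]: "Lambda a b c \<in> sets borel"
proof -
  have "Omega a b c = {x. \<bar>fst x\<bar> \<le> 1} \<inter> {x. a + (c - a) * (fst x)\<^sup>2 \<le> (snd x)\<^sup>2} \<inter> {x. (snd x)\<^sup>2 \<le> b + (c - b) * (fst x)\<^sup>2}"
    by (auto simp: Omega_def)
  moreover have "closed \<dots>" by (intro closed_Int closed_Collect_le continuous_intros)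
  ultimately have O: "closed (Omega a b c)" by simp
  then show "Omega a b c \<in> sets borel" by (rule borel_closed)
  have "Lambda a b c = Omega a b c \<inter> {x. 0 \<le> snd x}" by (auto simp: Lambda_def)
  moreover have "closed (Omega a b c \<inter> {x. 0 \<le> snd x})"
    by (intro closed_Int O closed_Collect_le continuous_intros)
  ultimately show "Lambda a b c \<in> sets borel" by (simp add: borel_closed)
qed

lemma Wt_nonneg: "0 \<le> Wt a b c \<beta> \<gamma> x"
  by (simp add: Wt_def split: prod.split)

lemma Wt_measurable [measurable]: "Wt a b c \<beta> \<gamma> \<in> borel_measurable borel"
proof -
  have [measurable]: "fst \<in> borel_measurable (borel :: (real \<times> real) measure)"
    "snd \<in> borel_measurable (borel :: (real \<times> real) measure)"
    by (intro borel_measurable_continuous_onI continuous_intros)+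
  show ?thesis unfolding Wt_def case_prod_beta by measurable
qed

lemma space_wmeas [simp]: "space (wmeas a b c \<beta> \<gamma> S) = S"
  by (simp add: wmeas_def space_restrict_space)

lemma measurable_wmeas_eq: "borel_measurable (wmeas a b c \<beta> \<gamma> S) = borel_measurable (restrict_space borel S)"
proof -
  have "sets (restrict_space (lborel :: (real \<times> real) measure) S) = sets (restrict_space borel S)"
    by (rule sets_restrict_space_cong) simp
  then show ?thesis unfolding wmeas_def by (intro measurable_cong_sets) simp_all
qed

lemma nn_integral_wmeas:
  assumes S: "S \<in> sets borel" and f: "f \<in> borel_measurable borel"
  shows "(\<integral>\<^sup>+x. f x \<partial>wmeas a b c \<beta> \<gamma> S) = (\<integral>\<^sup>+x. ennreal (Wt a b c \<beta> \<gamma> x) * f x * indicator S x \<partial>lborel)"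
proof -
  have [measurable]: "f \<in> borel_measurable (restrict_space lborel S)"
    by (rule measurable_restrict_space1) (use f in simp)
  have [measurable]: "Wt a b c \<beta> \<gamma> \<in> borel_measurable (restrict_space lborel S)"
    by (rule measurable_restrict_space1) simp
  show ?thesis unfolding wmeas_def
    by (subst nn_integral_density) (use S in \<open>simp_all add: nn_integral_restrict_space\<close>)
qed

lemma integral_wmeas:
  fixes f :: "real \<times> real \<Rightarrow> real"
  assumes S: "S \<in> sets borel" and f: "f \<in> borel_measurable borel"
  shows "(\<integral>x. f x \<partial>wmeas a b c \<beta> \<gamma> S) = (\<integral>x. indicator S x * (Wt a b c \<beta> \<gamma> x * f x) \<partial>lborel)"
proof -
  have [measurable]: "f \<in> borel_measurable (restrict_space lborel S)"
    by (rule measurable_restrict_space1) (use f in simp)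
  have [measurable]: "Wt a b c \<beta> \<gamma> \<in> borel_measurable (restrict_space lborel S)"
    by (rule measurable_restrict_space1) simp
  show ?thesis unfolding wmeas_def
    by (subst integral_density) (use S in \<open>simp_all add: integral_restrict_space Wt_nonneg\<close>)
qed

lemma lborel_reflect:
  fixes s t :: real
  assumes st: "s \<in> {1, -1}" "t \<in> {1, -1}" and f: "f \<in> borel_measurable borel"
  shows "(\<integral>x. f x \<partial>lborel) = (\<integral>x. f (s * fst x, t * snd x) \<partial>lborel :: real)"
proof -
  define T where "T x = (s * fst x, t * snd x)" for x :: "real \<times> real"
  have [measurable]: "T \<in> borel_measurable borel" unfolding T_def[abs_def] by (simp add: borel_prod[symmetric])
  \<comment> \<open>The function of j is s on the basis vector (1, 0) and t on (0, 1), so the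
    diagonal change of variables is the reflection T.\<close>
  have "lborel = density (distr lborel borel (\<lambda>x :: real \<times> real. (0 + (\<Sum>j\<in>Basis. (case_prod (\<lambda>p q. p * s + q * t) j * (x \<bullet> j)) *\<^sub>R j))))
      (\<lambda>_. (\<Prod>j\<in>Basis. \<bar>case_prod (\<lambda>p q. p * s + q * t) j\<bar>))"
    by (rule lborel_affine_euclidean) (use st in \<open>auto simp: Basis_prod_def\<close>)
  also have "(\<Prod>j\<in>(Basis :: (real \<times> real) set). \<bar>case_prod (\<lambda>p q. p * s + q * t) j\<bar>) = 1"
    by (rule prod.neutral) (use st in \<open>auto simp: Basis_prod_def\<close>)
  also have "(\<lambda>x :: real \<times> real. (0 + (\<Sum>j\<in>Basis. (case_prod (\<lambda>p q. p * s + q * t) j * (x \<bullet> j)) *\<^sub>R j))) = T"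
    by (auto simp: fun_eq_iff T_def Basis_prod_def sum.union_disjoint image_image sum.insert_if)
  finally have *: "lborel = distr lborel borel T" by (simp add: density_1)
  have "(\<integral>x. f x \<partial>lborel) = (\<integral>x. f x \<partial>distr lborel borel T)" by (subst * ) (rule refl)
  also have "\<dots> = (\<integral>x. f (T x) \<partial>lborel)" by (rule integral_distr) (use f in simp_all)
  finally show ?thesis by (simp add: T_def)
qed

section \<open>The domain in the coordinates U, Y, Z and its moments\<close>

locale jacobi_domain =
  fixes a b c \<beta> \<gamma> :: real
  assumes a: "0 \<le> a" and ab: "a < b" and c: "0 \<le> c" and beta: "0 \<le> \<beta>" and gamma: "- 1/2 \<le> \<gamma>"
begin

abbreviation \<Lambda> :: "(real \<times> real) set" where "\<Lambda> \<equiv> Lambda a b c"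

abbreviation M :: "(real \<times> real) measure" where "M \<equiv> wmeas a b c \<beta> \<gamma> \<Lambda>"

text \<open>U, sqrt Y, sqrt Z play the role of sphere coordinates: U^2 + Y + Z = 1, the domain is
  given by v, Y, Z \<ge> 0, and up to |v| the weight is Y^(\<beta> - 1/2) Z^\<gamma>. The parameters
  a, b, c then enter the moments only through the factor (b - a) / 2.\<close>

definition U :: "real \<times> real \<Rightarrow> real" where "U x = fst x"

definition Y :: "real \<times> real \<Rightarrow> real" where "Y x = ((snd x)\<^sup>2 - a - (c - a) * (fst x)\<^sup>2) / (b - a)"

definition Z :: "real \<times> real \<Rightarrow> real" where "Z x = (b - (b - c) * (fst x)\<^sup>2 - (snd x)\<^sup>2) / (b - a)"

text \<open>Chosen so that the eigenvalues read n * (n + 2 * l); it is also the index of the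
  Gegenbauer polynomials.\<close>

definition l :: real where "l = \<beta> + \<gamma> + 1"

lemma l_pos: "0 < l" using beta gamma by (simp add: l_def)

lemma UYZ: "(U x)\<^sup>2 + Y x + Z x = 1"
proof -
  have "Y x + Z x = ((b - a) * (1 - (U x)\<^sup>2)) / (b - a)"
    unfolding Y_def Z_def U_def by (simp add: add_divide_distrib[symmetric] algebra_simps)
  then show ?thesis using ab by simp
qed

lemma Lambda_iff: "x \<in> \<Lambda> \<longleftrightarrow> 0 \<le> snd x \<and> 0 \<le> Y x \<and> 0 \<le> Z x"
proof -
  have 1: "0 \<le> Y x \<longleftrightarrow> a + (c - a) * (fst x)\<^sup>2 \<le> (snd x)\<^sup>2"
    "0 \<le> Z x \<longleftrightarrow> (snd x)\<^sup>2 \<le> b + (c - b) * (fst x)\<^sup>2"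
    using ab by (auto simp: Y_def Z_def zero_le_divide_iff algebra_simps)
  have "\<bar>U x\<bar> \<le> 1" if "0 \<le> Y x" "0 \<le> Z x"
    using UYZ[of x] that by (simp add: abs_square_le_1[symmetric])
  then show ?thesis unfolding Lambda_def Omega_def
    using 1 by (auto simp: U_def case_prod_beta)
qed

lemma Wt_eq: "Wt a b c \<beta> \<gamma> x = \<bar>snd x\<bar> * Y x powr (\<beta> - 1/2) * Z x powr \<gamma>"
  unfolding Wt_def Y_def Z_def case_prod_beta
  by (simp add: algebra_simps)

lemma continuous_UYZ [continuous_intros]:
  "continuous_on A U" "continuous_on A Y" "continuous_on A Z"
  unfolding U_def[abs_def] Y_def[abs_def] Z_def[abs_def] by (intro continuous_intros; use ab in simp)+

lemma measurable_UYZ [measurable]: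
  "U \<in> borel_measurable borel" "Y \<in> borel_measurable borel" "Z \<in> borel_measurable borel"
  by (intro borel_measurable_continuous_onI continuous_UYZ)+

text \<open>For fixed u the substitution t = (v^2 - A) / H maps the vertical section onto [0, 1],
  with the factor |v| of the weight as Jacobian. Y and Z become (1 - u^2) t and (1 - u^2) (1 - t),
  which leaves a Beta integral and a power of 1 - u^2.\<close>

lemma nn_inner:
  assumes u: "\<bar>u\<bar> < 1"
  shows "(\<integral>\<^sup>+v. ennreal (Wt a b c \<beta> \<gamma> (u, v)) * ennreal (u ^ (2 * i) * Y (u, v) ^ j * Z (u, v) ^ k) * indicator \<Lambda> (u, v) \<partial>lborel)
    = ennreal (((b - a) / 2 * Beta (real j + \<beta> + 1/2) (real k + \<gamma> + 1))
        * (u ^ (2 * i) * (1 - u\<^sup>2) powr (real j + real k + \<beta> + \<gamma> + 1/2)))"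
proof -
  define A where "A = a + (c - a) * u\<^sup>2"
  define w where "w = 1 - u\<^sup>2"
  have w: "w > 0" using u by (simp add: w_def abs_square_less_1)
  define H where "H = (b - a) * w"
  have H: "H > 0" using w ab by (simp add: H_def)
  have A: "A \<ge> 0"
  proof -
    have "A = a * w + c * u\<^sup>2" by (simp add: A_def w_def algebra_simps)
    then show ?thesis using a c w by simp
  qed
  define f where "f t = t powr (real j + \<beta> + 1/2 - 1) * (1 - t) powr (real k + \<gamma> + 1 - 1)" for t :: real
  define g where "g v = (v\<^sup>2 - A) / H" for v
  have [measurable]: "f \<in> borel_measurable borel" unfolding f_def[abs_def] by measurable
  have YZ: "Y (u, v) = w * g v" "Z (u, v) = w * (1 - g v)" for v
  proof -
    have "Y (u, v) = (v\<^sup>2 - A) / (b - a)" by (simp add: Y_def A_def algebra_simps)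
    then show 1: "Y (u, v) = w * g v" using w by (simp add: g_def H_def)
    show "Z (u, v) = w * (1 - g v)" using UYZ[of "(u, v)"] unfolding 1 by (simp add: U_def w_def algebra_simps)
  qed
  define K where "K = u ^ (2 * i) * w powr (real j + real k + \<beta> + \<gamma> + 1/2) * ((b - a) / 2)"
  have K0: "K \<ge> 0" using ab by (simp add: K_def)
  have ind: "indicator \<Lambda> (u, v) = indicator {sqrt A..sqrt (A + H)} v" for v
  proof -
    have "(u, v) \<in> \<Lambda> \<longleftrightarrow> 0 \<le> v \<and> 0 \<le> g v \<and> g v \<le> 1"
      unfolding Lambda_iff YZ using w by (simp add: zero_le_mult_iff)
    also have "\<dots> \<longleftrightarrow> 0 \<le> v \<and> A \<le> v\<^sup>2 \<and> v\<^sup>2 \<le> A + H"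
      using H by (simp add: g_def zero_le_divide_iff divide_le_eq algebra_simps)
    also have "\<dots> \<longleftrightarrow> sqrt A \<le> v \<and> v \<le> sqrt (A + H)"
    proof (cases "0 \<le> v")
      case True
      then have "sqrt (v\<^sup>2) = v" by simp
      then show ?thesis using True real_sqrt_le_iff[of A "v\<^sup>2"] real_sqrt_le_iff[of "v\<^sup>2" "A + H"] by simp
    next
      case False
      have "\<not> sqrt A \<le> v" using False real_sqrt_ge_zero[OF A] by linarith
      with False show ?thesis by blast
    qed
    finally show ?thesis by (simp add: indicator_def)
  qed
  have pt: "Wt a b c \<beta> \<gamma> (u, v) * (u ^ (2 * i) * Y (u, v) ^ j * Z (u, v) ^ k) = K * (f (g v) * (2 * v / H))"
    if v: "v \<in> {sqrt A..sqrt (A + H)}" for v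
  proof -
    have "(u, v) \<in> \<Lambda>" using ind[of v] v by (metis indicator_eq_1_iff indicator_simps(1))
    then have v0: "0 \<le> v" and g: "0 \<le> g v" "0 \<le> 1 - g v"
      unfolding Lambda_iff YZ using w by (auto simp: zero_le_mult_iff)
    have p: "w powr (real j + (\<beta> - 1/2)) * w powr (real k + \<gamma>) * w = w powr (real j + real k + \<beta> + \<gamma> + 1/2)"
    proof -
      have "w powr (real j + (\<beta> - 1/2)) * w powr (real k + \<gamma>) * w powr 1 = w powr (real j + (\<beta> - 1/2) + (real k + \<gamma>) + 1)"
        by (simp only: powr_add)
      then show ?thesis using w by (simp add: algebra_simps)
    qed
    have "Wt a b c \<beta> \<gamma> (u, v) * (u ^ (2 * i) * Y (u, v) ^ j * Z (u, v) ^ k)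
      = u ^ (2 * i) * v * (Y (u, v) ^ j * Y (u, v) powr (\<beta> - 1/2)) * (Z (u, v) ^ k * Z (u, v) powr \<gamma>)"
      using v0 by (simp add: Wt_eq mult_ac)
    also have "\<dots> = u ^ (2 * i) * v * (w * g v) powr (real j + (\<beta> - 1/2)) * (w * (1 - g v)) powr (real k + \<gamma>)"
      unfolding YZ using w g by (simp add: power_mult_powr)
    also have "\<dots> = (u ^ (2 * i) * (w powr (real j + (\<beta> - 1/2)) * w powr (real k + \<gamma>) * w) * ((b - a) / 2))
         * (f (g v) * (2 * v / H))"
    proof -
      have "2 * v / H = (v / w) * (2 / (b - a))" by (simp add: H_def mult.commute)
      moreover have "f (g v) = g v powr (real j + (\<beta> - 1/2)) * (1 - g v) powr (real k + \<gamma>)"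
        by (simp add: f_def algebra_simps)
      ultimately show ?thesis using w g ab by (simp add: powr_mult)
    qed
    finally show ?thesis unfolding p K_def .
  qed
  have "(\<integral>\<^sup>+v. ennreal (Wt a b c \<beta> \<gamma> (u, v)) * ennreal (u ^ (2 * i) * Y (u, v) ^ j * Z (u, v) ^ k) * indicator \<Lambda> (u, v) \<partial>lborel)
     = (\<integral>\<^sup>+v. ennreal K * ennreal (f (g v) * (2 * v / H) * indicator {sqrt A..sqrt (A + H)} v) \<partial>lborel)"
  proof (rule nn_integral_cong)
    fix v
    show "ennreal (Wt a b c \<beta> \<gamma> (u, v)) * ennreal (u ^ (2 * i) * Y (u, v) ^ j * Z (u, v) ^ k) * indicator \<Lambda> (u, v)
      = ennreal K * ennreal (f (g v) * (2 * v / H) * indicator {sqrt A..sqrt (A + H)} v)"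
      unfolding ind using pt[of v] K0
      by (cases "v \<in> {sqrt A..sqrt (A + H)}") (simp_all add: Wt_nonneg flip: ennreal_mult')
  qed
  also have "\<dots> = ennreal K * (\<integral>\<^sup>+v. ennreal (f (g v) * (2 * v / H) * indicator {sqrt A..sqrt (A + H)} v) \<partial>lborel)"
    unfolding g_def by (rule nn_integral_cmult) measurable
  also have "(\<integral>\<^sup>+v. ennreal (f (g v) * (2 * v / H) * indicator {sqrt A..sqrt (A + H)} v) \<partial>lborel)
     = (\<integral>\<^sup>+t. ennreal (f t * indicator {g (sqrt A)..g (sqrt (A + H))} t) \<partial>lborel)"
  proof (rule nn_integral_substitution[symmetric])
    show "0 \<le> 2 * v / H" if "v \<in> {sqrt A..sqrt (A + H)}" for v
    proof -
      have "0 \<le> v" using that real_sqrt_ge_zero[OF A] by (metis atLeastAtMost_iff order_trans)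
      then show ?thesis using H by simp
    qed
  qed (use A H in \<open>auto simp: set_borel_measurable_def g_def intro!: derivative_eq_intros continuous_intros\<close>)
  also have "g (sqrt A) = 0" using A by (simp add: g_def)
  also have "g (sqrt (A + H)) = 1" using A H by (simp add: g_def)
  also have "(\<integral>\<^sup>+t. ennreal (f t * indicator {0..1} t) \<partial>lborel) = ennreal (Beta (real j + \<beta> + 1/2) (real k + \<gamma> + 1))"
    unfolding f_def by (rule nn_integral_Beta) (use beta gamma in auto)
  also have "ennreal K * \<dots> = ennreal (K * Beta (real j + \<beta> + 1/2) (real k + \<gamma> + 1))"
    by (rule ennreal_mult'[symmetric, OF K0])
  finally show ?thesis by (simp add: K_def w_def mult_ac)
qed

definition Bmom :: "nat \<Rightarrow> nat \<Rightarrow> nat \<Rightarrow> real" where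
  "Bmom i j k = ((b - a) / 2 * Beta (real j + \<beta> + 1/2) (real k + \<gamma> + 1)) * Beta (real i + 1/2) (real j + real k + l + 1/2)"

lemma Beta_pos: "x > 0 \<Longrightarrow> y > 0 \<Longrightarrow> Beta x y > (0::real)"
  by (simp add: Beta_def Gamma_real_pos)

lemma Bmom_pos: "Bmom i j k > 0"
  unfolding Bmom_def using ab beta gamma by (intro mult_pos_pos Beta_pos) (auto simp: l_def)

lemma nn_moment: "(\<integral>\<^sup>+x. ennreal (U x ^ (2 * i) * Y x ^ j * Z x ^ k) \<partial>M) = ennreal (Bmom i j k)"
proof -
  define C where "C = (b - a) / 2 * Beta (real j + \<beta> + 1/2) (real k + \<gamma> + 1)"
  have C0: "C \<ge> 0" unfolding C_def using ab beta gamma by (intro mult_nonneg_nonneg less_imp_le[OF Beta_pos]) auto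
  define e where "e = real j + real k + \<beta> + \<gamma> + 1/2"
  have e: "e > -1" using beta gamma by (simp add: e_def)
  let ?F = "\<lambda>x. ennreal (Wt a b c \<beta> \<gamma> x) * ennreal (U x ^ (2 * i) * Y x ^ j * Z x ^ k) * indicator \<Lambda> x"
  have [measurable]: "?F \<in> borel_measurable borel" by measurable
  have "(\<integral>\<^sup>+x. ennreal (U x ^ (2 * i) * Y x ^ j * Z x ^ k) \<partial>M) = integral\<^sup>N lborel ?F"
    by (rule nn_integral_wmeas) measurable
  also have "\<dots> = integral\<^sup>N (lborel \<Otimes>\<^sub>M lborel) ?F" by (simp only: lborel_prod)
  also have "\<dots> = (\<integral>\<^sup>+u. \<integral>\<^sup>+v. ?F (u, v) \<partial>lborel \<partial>lborel)"
    by (rule lborel.nn_integral_fst[symmetric]) (simp add: lborel_prod)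
  also have "\<dots> = (\<integral>\<^sup>+u. ennreal C * ennreal (u ^ (2 * i) * (1 - u\<^sup>2) powr e * indicator {-1..1} u) \<partial>lborel)"
  proof (rule nn_integral_cong_AE)
    \<comment> \<open>At these two values the section degenerates and \<open>nn_inner\<close> does
      not apply.\<close>
    have "AE u in lborel. u \<noteq> (1::real)" "AE u in lborel. u \<noteq> (-1::real)" by (rule AE_lborel_singleton)+
    then show "AE u in lborel. (\<integral>\<^sup>+v. ?F (u, v) \<partial>lborel)
        = ennreal C * ennreal (u ^ (2 * i) * (1 - u\<^sup>2) powr e * indicator {-1..1} u)"
    proof eventually_elim
      fix u :: real assume u: "u \<noteq> 1" "u \<noteq> -1"
      show "(\<integral>\<^sup>+v. ?F (u, v) \<partial>lborel) = ennreal C * ennreal (u ^ (2 * i) * (1 - u\<^sup>2) powr e * indicator {-1..1} u)"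
      proof (cases "\<bar>u\<bar> < 1")
        case True
        then have "u \<in> {-1..1}" by auto
        moreover have "(\<integral>\<^sup>+v. ?F (u, v) \<partial>lborel) = ennreal (C * (u ^ (2 * i) * (1 - u\<^sup>2) powr e))"
          using nn_inner[OF True, of i j k] by (simp add: U_def C_def e_def)
        moreover have "ennreal (C * (u ^ (2 * i) * (1 - u\<^sup>2) powr e)) = ennreal C * ennreal (u ^ (2 * i) * (1 - u\<^sup>2) powr e)"
          by (rule ennreal_mult'[OF C0])
        ultimately show ?thesis by simp
      next
        case False
        then have "u \<notin> {-1..1}" using u by auto
        moreover have "(u, v) \<notin> \<Lambda>" for v using False u by (auto simp: Lambda_def Omega_def)
        ultimately show ?thesis by simp
      qed
    qed
  qed
  also have "\<dots> = ennreal C * ennreal (Beta (real i + 1/2) (e + 1))"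
    by (subst nn_integral_cmult) (simp_all add: nn_integral_symmetric_Beta[OF e])
  also have "\<dots> = ennreal (Bmom i j k)"
  proof -
    have "e + 1 = real j + real k + l + 1/2" by (simp add: e_def l_def)
    then have "Bmom i j k = C * Beta (real i + 1/2) (e + 1)" by (simp only: Bmom_def C_def)
    then show ?thesis using C0 by (simp only: ennreal_mult')
  qed
  finally show ?thesis .
qed

sublocale finite_measure M
proof
  have "emeasure M (space M) = (\<integral>\<^sup>+x. ennreal (U x ^ (2 * 0) * Y x ^ 0 * Z x ^ 0) \<partial>M)" by simp
  then show "emeasure M (space M) \<noteq> \<infinity>" unfolding nn_moment by simp
qed

definition mass :: real where "mass = measure M \<Lambda>"

lemma mass_pos: "mass > 0"
proof -
  have "emeasure M (space M) = (\<integral>\<^sup>+x. ennreal (U x ^ (2 * 0) * Y x ^ 0 * Z x ^ 0) \<partial>M)" by simp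
  then have "emeasure M \<Lambda> = ennreal (Bmom 0 0 0)" unfolding nn_moment by simp
  then show ?thesis using Bmom_pos[of 0 0 0] by (simp add: mass_def measure_def)
qed

definition mom :: "nat \<Rightarrow> nat \<Rightarrow> nat \<Rightarrow> real" where
  "mom i j k = (\<integral>x. U x ^ i * Y x ^ j * Z x ^ k \<partial>M)"

text \<open>The reflection of u preserves the domain, the weight, Y and Z, and changes the sign of
  U.\<close>

lemma mom_odd: "odd i \<Longrightarrow> mom i j k = 0"
proof -
  assume i: "odd i"
  define F where "F x = indicator \<Lambda> x * (Wt a b c \<beta> \<gamma> x * (U x ^ i * Y x ^ j * Z x ^ k))" for x
  have [measurable]: "F \<in> borel_measurable borel" unfolding F_def[abs_def] by measurable
  have "F (-1 * fst x, 1 * snd x) = - F x" for x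
  proof -
    have "U (-1 * fst x, 1 * snd x) = - U x" "Y (-1 * fst x, 1 * snd x) = Y x" "Z (-1 * fst x, 1 * snd x) = Z x"
      by (simp_all add: U_def Y_def Z_def)
    then show ?thesis unfolding F_def Wt_eq indicator_def Lambda_iff using i by simp
  qed
  then have "(\<integral>x. F x \<partial>lborel) = (\<integral>x. - F x \<partial>lborel)"
    using lborel_reflect[of "-1" 1 F] by simp
  then have "(\<integral>x. F x \<partial>lborel) = 0" by simp
  moreover have "mom i j k = (\<integral>x. F x \<partial>lborel)"
    unfolding mom_def F_def by (rule integral_wmeas) measurable
  ultimately show ?thesis by simp
qed

lemma mom_even: "mom (2 * i) j k = Bmom i j k"
proof -
  have [measurable]: "(\<lambda>x. U x ^ (2 * i) * Y x ^ j * Z x ^ k) \<in> borel_measurable M"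
    unfolding measurable_wmeas_eq by (rule measurable_restrict_space1) measurable
  have "AE x in M. 0 \<le> U x ^ (2 * i) * Y x ^ j * Z x ^ k"
    by (rule AE_I2) (auto simp: Lambda_iff)
  then show ?thesis unfolding mom_def
    by (subst integral_eq_nn_integral) (use Bmom_pos[of i j k] in \<open>simp_all add: nn_moment less_imp_le\<close>)
qed

lemma Beta_shift_left: "x > 0 \<Longrightarrow> (x + y) * Beta (x + 1) y = x * Beta x y" for x y :: real
  by (rule Beta_plus1_left) (auto elim!: nonpos_Ints_cases')

lemma Beta_shift_right: "y > 0 \<Longrightarrow> (x + y) * Beta x (y + 1) = y * Beta x y" for x y :: real
  by (rule Beta_plus1_right) (auto elim!: nonpos_Ints_cases')

text \<open>With the total degree m = i + 2 j + 2 k, the factor on the left is m + 2 l + 2 here and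
  in \<open>mom_Y\<close> and \<open>mom_Z\<close>, as for monomials on a weighted sphere. Together
  with the vanishing odd moments, these recursions are all that the symmetry of the operator uses of
  the weight.\<close>

lemma mom_U: "(real i + 2 * real j + 2 * real k + 2 * l + 2) * mom (i + 2) j k = (real i + 1) * mom i j k"
proof (cases "even i")
  case True
  then obtain h where i: "i = 2 * h" by (elim evenE)
  then have i2: "i + 2 = 2 * Suc h" by simp
  have "(real h + 1/2 + (real j + real k + l + 1/2)) * Beta (real h + 1/2 + 1) (real j + real k + l + 1/2)
      = (real h + 1/2) * Beta (real h + 1/2) (real j + real k + l + 1/2)"
    by (rule Beta_shift_left) simp
  moreover have "real (Suc h) + 1/2 = real h + 1/2 + 1" by simp
  moreover have "(real i + 2 * real j + 2 * real k + 2 * l + 2) = 2 * (real h + 1/2 + (real j + real k + l + 1/2))"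
    "real i + 1 = 2 * (real h + 1/2)" by (simp_all add: i)
  ultimately show ?thesis unfolding i2 unfolding i mom_even Bmom_def by (simp only: mult_ac)
qed (simp add: mom_odd)

lemma mom_Y: "(real i + 2 * real j + 2 * real k + 2 * l + 2) * mom i (j + 1) k = (2 * real j + 1 + 2 * \<beta>) * mom i j k"
proof (cases "even i")
  case True
  then obtain h where i: "i = 2 * h" by (elim evenE)
  define x s y where "x = real j + \<beta> + 1/2" and "s = real j + real k + l + 1/2" and "y = real k + \<gamma> + 1"
  have s: "x > 0" "s > 0" "s = x + y" using beta l_pos by (auto simp: x_def s_def y_def l_def)
  have 1: "(real h + 1/2 + s) * Beta (real h + 1/2) (s + 1) = s * Beta (real h + 1/2) s"
    by (rule Beta_shift_right) (use s in simp)
  have 2: "s * Beta (x + 1) y = x * Beta x y" unfolding s(3) by (rule Beta_shift_left) (use s in simp)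
  have 3: "Bmom h (j + 1) k = (b - a) / 2 * Beta (x + 1) y * Beta (real h + 1/2) (s + 1)"
    "Bmom h j k = (b - a) / 2 * Beta x y * Beta (real h + 1/2) s"
    by (simp_all add: Bmom_def x_def y_def s_def add_ac)
  have "(real h + 1/2 + s) * Bmom h (j + 1) k = (b - a) / 2 * Beta (x + 1) y * ((real h + 1/2 + s) * Beta (real h + 1/2) (s + 1))"
    unfolding 3 by (simp only: mult_ac)
  also have "\<dots> = (b - a) / 2 * (s * Beta (x + 1) y) * Beta (real h + 1/2) s"
    unfolding 1 by (simp only: mult_ac)
  also have "\<dots> = x * Bmom h j k" unfolding 2 3 by (simp only: mult_ac)
  finally have "(2 * (real h + 1/2 + s)) * Bmom h (j + 1) k = (2 * x) * Bmom h j k"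
    by (simp only: mult.assoc)
  moreover have "2 * (real h + 1/2 + s) = real i + 2 * real j + 2 * real k + 2 * l + 2" "2 * x = 2 * real j + 1 + 2 * \<beta>"
    by (simp_all add: i s_def x_def)
  moreover have "mom i j' k = Bmom h j' k" for j' unfolding i by (rule mom_even)
  ultimately show ?thesis by (simp only:)
qed (simp add: mom_odd)

lemma mom_Z: "(real i + 2 * real j + 2 * real k + 2 * l + 2) * mom i j (k + 1) = (2 * real k + 2 + 2 * \<gamma>) * mom i j k"
proof (cases "even i")
  case True
  then obtain h where i: "i = 2 * h" by (elim evenE)
  define x s y where "x = real j + \<beta> + 1/2" and "s = real j + real k + l + 1/2" and "y = real k + \<gamma> + 1"
  have s: "y > 0" "s > 0" "s = x + y" using gamma l_pos by (auto simp: x_def s_def y_def l_def)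
  have 1: "(real h + 1/2 + s) * Beta (real h + 1/2) (s + 1) = s * Beta (real h + 1/2) s"
    by (rule Beta_shift_right) (use s in simp)
  have 2: "s * Beta x (y + 1) = y * Beta x y" unfolding s(3) by (rule Beta_shift_right) (use s in simp)
  have 3: "Bmom h j (k + 1) = (b - a) / 2 * Beta x (y + 1) * Beta (real h + 1/2) (s + 1)"
    "Bmom h j k = (b - a) / 2 * Beta x y * Beta (real h + 1/2) s"
    by (simp_all add: Bmom_def x_def y_def s_def add_ac)
  have "(real h + 1/2 + s) * Bmom h j (k + 1) = (b - a) / 2 * Beta x (y + 1) * ((real h + 1/2 + s) * Beta (real h + 1/2) (s + 1))"
    unfolding 3 by (simp only: mult_ac)
  also have "\<dots> = (b - a) / 2 * (s * Beta x (y + 1)) * Beta (real h + 1/2) s"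
    unfolding 1 by (simp only: mult_ac)
  also have "\<dots> = y * Bmom h j k" unfolding 2 3 by (simp only: mult_ac)
  finally have "(2 * (real h + 1/2 + s)) * Bmom h j (k + 1) = (2 * y) * Bmom h j k"
    by (simp only: mult.assoc)
  moreover have "2 * (real h + 1/2 + s) = real i + 2 * real j + 2 * real k + 2 * l + 2" "2 * y = 2 * real k + 2 + 2 * \<gamma>"
    by (simp_all add: i s_def y_def)
  moreover have "mom i j k' = Bmom h j k'" for k' unfolding i by (rule mom_even)
  ultimately show ?thesis by (simp only:)
qed (simp add: mom_odd)

end

section \<open>Polynomials even in the second variable\<close>

lemma poly2_eq: "poly2 n cf x = (\<Sum>i\<le>n. \<Sum>j\<le>n. if i + j \<le> n then cf i j * fst x ^ i * snd x ^ j else 0)"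
  by (simp add: poly2_def case_prod_beta)

lemma poly2_add: "poly2 n cf x + poly2 n cg x = poly2 n (\<lambda>i j. cf i j + cg i j) x"
  unfolding poly2_eq sum.distrib[symmetric] by (intro sum.cong refl) (simp add: distrib_right)

lemma poly2_cmult: "k * poly2 n cf x = poly2 n (\<lambda>i j. k * cf i j) x"
  unfolding poly2_eq sum_distrib_left by (intro sum.cong refl) simp

lemma poly2_mono:
  assumes "i + j \<le> n"
  shows "poly2 n (\<lambda>i' j'. if i' = i \<and> j' = j then 1 else 0) x = fst x ^ i * snd x ^ j"
proof -
  have "poly2 n (\<lambda>i' j'. if i' = i \<and> j' = j then 1 else 0) x
    = (\<Sum>i'\<le>n. \<Sum>j'\<le>n. if j' = j then (if i' = i then fst x ^ i * snd x ^ j else 0) else 0)"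
    unfolding poly2_eq by (intro sum.cong refl) (use assms in auto)
  then show ?thesis using assms by simp
qed

lemma continuous_on_poly2: "continuous_on A (poly2 n cf)"
proof -
  have "continuous_on A (\<lambda>x. if i + j \<le> n then cf i j * fst x ^ i * snd x ^ j else 0)" for i j
    by (cases "i + j \<le> n") (auto intro!: continuous_intros)
  then show ?thesis unfolding poly2_eq[abs_def] by (intro continuous_on_sum)
qed

lemma PolyE_add: "f \<in> PolyE n \<Longrightarrow> g \<in> PolyE n \<Longrightarrow> (\<lambda>x. f x + g x) \<in> PolyE n"
  unfolding PolyE_def by (clarsimp simp: poly2_add) (metis (no_types, lifting) add_0)

lemma PolyE_cmult: "f \<in> PolyE n \<Longrightarrow> (\<lambda>x. k * f x) \<in> PolyE n"
  unfolding PolyE_def by (clarsimp simp: poly2_cmult) (metis (no_types, lifting) mult_zero_right)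

lemma PolyE_monomial: "even j \<Longrightarrow> i + j \<le> n \<Longrightarrow> (\<lambda>x. fst x ^ i * snd x ^ j) \<in> PolyE n"
  unfolding PolyE_def
  by (intro CollectI exI[of _ "\<lambda>i' j'. if i' = i \<and> j' = j then 1 else 0"]) (auto simp: fun_eq_iff poly2_mono)

lemma PolyE_zero: "(\<lambda>x. 0) \<in> PolyE n"
  using PolyE_cmult[OF PolyE_monomial[of 0 0 n], of 0] by simp

lemma PolyE_sum: "(\<And>i. i \<in> A \<Longrightarrow> f i \<in> PolyE n) \<Longrightarrow> (\<lambda>x. \<Sum>i\<in>A. f i x) \<in> PolyE n"
  by (induction A rule: infinite_finite_induct) (auto intro: PolyE_zero PolyE_add)

lemma PolyE_diff: "f \<in> PolyE n \<Longrightarrow> g \<in> PolyE n \<Longrightarrow> (\<lambda>x. f x - g x) \<in> PolyE n"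
  using PolyE_add[of f n "\<lambda>x. (-1) * g x"] PolyE_cmult[of g n "-1"] by simp

text \<open>Linear induction over even monomials. Membership in \<open>PolyE n\<close> is passed to
  the additive step because later inductions need it for integrability.\<close>

lemma PolyE_induct [consumes 1, case_names mono zero add cmult]:
  assumes f: "f \<in> PolyE n"
    and mono: "\<And>i j. i + 2 * j \<le> n \<Longrightarrow> P (\<lambda>x. fst x ^ i * snd x ^ (2 * j))"
    and zero: "P (\<lambda>x. 0)"
    and add: "\<And>f g. f \<in> PolyE n \<Longrightarrow> g \<in> PolyE n \<Longrightarrow> P f \<Longrightarrow> P g \<Longrightarrow> P (\<lambda>x. f x + g x)"
    and cmult: "\<And>k f. f \<in> PolyE n \<Longrightarrow> P f \<Longrightarrow> P (\<lambda>x. k * f x)"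
  shows "P f"
proof -
  obtain cf where cf: "f = poly2 n cf" "\<And>i j. odd j \<Longrightarrow> cf i j = 0"
    using f by (auto simp: PolyE_def)
  have sum: "(\<And>i. i \<in> A \<Longrightarrow> P (f i) \<and> f i \<in> PolyE n) \<Longrightarrow> P (\<lambda>x. \<Sum>i\<in>A. f i x) \<and> (\<lambda>x. \<Sum>i\<in>A. f i x) \<in> PolyE n"
    for f :: "nat \<Rightarrow> _" and A
    by (induction A rule: infinite_finite_induct) (auto intro: zero add PolyE_zero PolyE_add)
  have "P (\<lambda>x. if i + j \<le> n then cf i j * fst x ^ i * snd x ^ j else 0)
      \<and> (\<lambda>x. if i + j \<le> n then cf i j * fst x ^ i * snd x ^ j else 0) \<in> PolyE n" for i j
  proof (cases "i + j \<le> n \<and> even j")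
    case True
    then obtain h where "j = 2 * h" by (auto elim: evenE)
    then show ?thesis
      using True cmult[of "\<lambda>x. fst x ^ i * snd x ^ j" "cf i j"] PolyE_monomial[of j i n] mono[of i h]
        PolyE_cmult[OF PolyE_monomial[of j i n], of "cf i j"]
      by (simp add: mult.assoc)
  next
    case False
    then have "(\<lambda>x. if i + j \<le> n then cf i j * fst x ^ i * snd x ^ j else 0) = (\<lambda>x::real\<times>real. 0)"
      using cf(2)[of j i] by auto
    then show ?thesis by (simp only: zero PolyE_zero simp_thms)
  qed
  then have "P (\<lambda>x. \<Sum>i\<le>n. \<Sum>j\<le>n. if i + j \<le> n then cf i j * fst x ^ i * snd x ^ j else 0)"
    by (intro sum[THEN conjunct1] sum)
  then show ?thesis unfolding cf(1) poly2_eq[abs_def] .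
qed

lemma PolyE_mono: "f \<in> PolyE n \<Longrightarrow> n \<le> m \<Longrightarrow> f \<in> PolyE m"
proof (induction f rule: PolyE_induct)
  case (mono i j)
  then show ?case by (intro PolyE_monomial) auto
qed (auto intro: PolyE_zero PolyE_add PolyE_cmult)

lemma PolyE_mult_monomial:
  "f \<in> PolyE n \<Longrightarrow> i + 2 * j \<le> m \<Longrightarrow> (\<lambda>x. fst x ^ i * snd x ^ (2 * j) * f x) \<in> PolyE (m + n)"
proof (induction f rule: PolyE_induct)
  case (mono i' j')
  then have "(\<lambda>x :: real \<times> real. fst x ^ (i + i') * snd x ^ (2 * (j + j'))) \<in> PolyE (m + n)"
    by (intro PolyE_monomial) auto
  then show ?case by (simp add: power_add mult_ac)
next
  case (add f g)
  then show ?case using PolyE_add by (fastforce simp: distrib_left)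
next
  case (cmult k f)
  then show ?case using PolyE_cmult[of _ _ k] by (fastforce simp: mult_ac)
qed (auto intro: PolyE_zero)

lemma PolyE_mult: "g \<in> PolyE m \<Longrightarrow> f \<in> PolyE n \<Longrightarrow> (\<lambda>x. g x * f x) \<in> PolyE (m + n)"
proof (induction g rule: PolyE_induct)
  case (mono i j)
  then show ?case by (intro PolyE_mult_monomial)
next
  case (add f' g)
  then show ?case using PolyE_add by (fastforce simp: distrib_right)
next
  case (cmult k f')
  then show ?case using PolyE_cmult[of _ _ k] by (fastforce simp: mult_ac)
qed (auto intro: PolyE_zero)

lemma PolyE_const: "(\<lambda>x. k) \<in> PolyE n"
  using PolyE_cmult[OF PolyE_monomial[of 0 0 n], of k] by simp

lemma PolyE_power: "f \<in> PolyE m \<Longrightarrow> (\<lambda>x. f x ^ k) \<in> PolyE (k * m)"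
  by (induction k) (auto intro: PolyE_const PolyE_mult)

lemma PolyE_subset_PolyAll: "PolyE n \<subseteq> PolyAll n"
  by (auto simp: PolyE_def PolyAll_def)

lemma PolyE_continuous: "f \<in> PolyE n \<Longrightarrow> continuous_on A f"
  by (auto simp: PolyE_def intro: continuous_on_poly2)

lemma PolyE_measurable: "f \<in> PolyE n \<Longrightarrow> f \<in> borel_measurable borel"
  by (intro borel_measurable_continuous_onI PolyE_continuous)

lemma PolyE_reflect: "f \<in> PolyE n \<Longrightarrow> f (u, - v) = f (u, v)"
  by (induction f rule: PolyE_induct) auto

text \<open>Of the odd part only continuity and oddness are kept, enough to cancel its integrals
  over Omega.\<close>

lemma PolyAll_split:
  assumes "P \<in> PolyAll m"
  obtains Q R where "Q \<in> PolyE m" "continuous_on UNIV R" "\<And>u v. R (u, - v) = - R (u, v)" "\<And>x. P x = Q x + R x"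
proof -
  obtain cf where cf: "P = poly2 m cf" using assms by (auto simp: PolyAll_def)
  define ce co where "ce i j = (if even j then cf i j else 0)" and "co i j = (if odd j then cf i j else 0)" for i j
  have "poly2 m ce \<in> PolyE m" unfolding PolyE_def by (auto simp: ce_def)
  moreover have "poly2 m co (u, - v) = - poly2 m co (u, v)" for u v
    unfolding poly2_eq sum_negf[symmetric] by (intro sum.cong refl) (auto simp: co_def)
  moreover have "P x = poly2 m ce x + poly2 m co x" for x
  proof -
    have "(\<lambda>i j. ce i j + co i j) = cf" by (auto simp: fun_eq_iff ce_def co_def)
    then show ?thesis unfolding poly2_add cf by simp
  qed
  ultimately show ?thesis using that continuous_on_poly2 by blast
qed

text \<open>For fixed u in A, infinitely many zeros in v kill the coefficients of all powers of v;
  these are polynomials in u with infinitely many zeros.\<close>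

lemma poly2_zero_grid:
  assumes "infinite A" and "\<And>u. u \<in> A \<Longrightarrow> infinite (B u)"
    and zero: "\<And>u v. u \<in> A \<Longrightarrow> v \<in> B u \<Longrightarrow> poly2 n cf (u, v) = 0"
  shows "poly2 n cf x = 0"
proof -
  define k where "k i j = (if i + j \<le> n then cf i j else 0)" for i j
  have p: "poly2 n cf (u, v) = (\<Sum>j\<le>n. (\<Sum>i\<le>n. k i j * u ^ i) * v ^ j)" for u v
    unfolding poly2_eq sum_distrib_right
    by (subst sum.swap) (intro sum.cong refl, simp add: k_def)
  have row: "(\<Sum>i\<le>n. k i j * u ^ i) = 0" if u: "u \<in> A" and "j \<le> n" for u j
  proof -
    have "B u \<subseteq> {v. (\<Sum>j\<le>n. (\<Sum>i\<le>n. k i j * u ^ i) * v ^ j) = 0}" using zero[OF u] by (auto simp: p)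
    then have "infinite {v. (\<Sum>j\<le>n. (\<Sum>i\<le>n. k i j * u ^ i) * v ^ j) = 0}"
      using assms(2)[OF u] infinite_super by blast
    then show ?thesis using polyfun_finite_roots[of "\<lambda>j. \<Sum>i\<le>n. k i j * u ^ i" n] that(2) by blast
  qed
  have col: "k i j = 0" if "i \<le> n" "j \<le> n" for i j
  proof -
    have "A \<subseteq> {u. (\<Sum>i\<le>n. k i j * u ^ i) = 0}" using row that by auto
    then have "infinite {u. (\<Sum>i\<le>n. k i j * u ^ i) = 0}" using assms(1) infinite_super by blast
    then show ?thesis using polyfun_finite_roots[of "\<lambda>i. k i j" n] that(1) by blast
  qed
  have "poly2 n cf (fst x, snd x) = 0" unfolding p using col by simp
  then show ?thesis by simp
qed

section \<open>Even polynomials on the domain and orthogonality over Omega\<close>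

context jacobi_domain
begin

lemma compact_Lambda: "compact \<Lambda>"
proof -
  have "\<Lambda> = {x. 0 \<le> snd x} \<inter> {x. 0 \<le> Y x} \<inter> {x. 0 \<le> Z x}" by (auto simp: Lambda_iff)
  moreover have "closed \<dots>" by (intro closed_Int closed_Collect_le continuous_intros)
  moreover have "bounded \<Lambda>"
  proof -
    have "\<Lambda> \<subseteq> {-1..1} \<times> {0..1 + b + c}"
    proof
      fix x assume x: "x \<in> \<Lambda>"
      then have 1: "\<bar>fst x\<bar> \<le> 1" "0 \<le> snd x" "(snd x)\<^sup>2 \<le> b + (c - b) * (fst x)\<^sup>2"
        by (auto simp: Lambda_def Omega_def)
      have f2: "(fst x)\<^sup>2 \<le> 1" using 1(1) by (simp add: abs_square_le_1)
      have "b + (c - b) * (fst x)\<^sup>2 = b * (1 - (fst x)\<^sup>2) + c * (fst x)\<^sup>2" by (simp add: algebra_simps)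
      also have "\<dots> \<le> b * 1 + c * 1"
        using a ab c f2 by (intro add_mono mult_left_mono) auto
      also have "\<dots> \<le> (1 + b + c)\<^sup>2"
      proof -
        have "s \<le> (1 + s)\<^sup>2" if "0 \<le> s" for s :: real
          using that by (simp add: power2_eq_square algebra_simps)
        from this[of "b + c"] show ?thesis using a ab c by (simp add: add.assoc)
      qed
      finally have "snd x \<le> 1 + b + c"
        using 1(3) a ab c by (intro power2_le_imp_le[of "snd x"]) auto
      then show "x \<in> {-1..1} \<times> {0..1 + b + c}" using 1 by (simp add: mem_Times_iff abs_le_iff)
    qed
    then show ?thesis by (rule bounded_subset[rotated]) (intro bounded_Times bounded_closed_interval)
  qed
  ultimately show ?thesis by (simp add: compact_eq_bounded_closed)
qed

lemma measurable_M: "f \<in> borel_measurable borel \<Longrightarrow> f \<in> borel_measurable M"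
  unfolding measurable_wmeas_eq by (rule measurable_restrict_space1)

lemma measurable_M_continuous: "continuous_on \<Lambda> f \<Longrightarrow> f \<in> borel_measurable M" for f :: "_ \<Rightarrow> real"
  unfolding measurable_wmeas_eq by (rule borel_measurable_continuous_on_restrict)

lemma integrable_M_continuous:
  fixes f :: "real \<times> real \<Rightarrow> real"
  assumes "continuous_on \<Lambda> f"
  shows "integrable M f"
proof -
  have "compact (f ` \<Lambda>)" by (rule compact_continuous_image[OF assms compact_Lambda])
  then obtain B where B: "\<And>x. x \<in> \<Lambda> \<Longrightarrow> norm (f x) \<le> B"
    using compact_imp_bounded[of "f ` \<Lambda>"] by (auto simp: bounded_iff)
  show ?thesis
    by (rule integrable_const_bound[where B = B]) (use B measurable_M_continuous[OF assms] in auto)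
qed

lemma PolyE_integrable: "f \<in> PolyE n \<Longrightarrow> integrable M f"
  by (intro integrable_M_continuous PolyE_continuous)

lemma PolyE_U: "U \<in> PolyE 1"
  unfolding U_def[abs_def] using PolyE_monomial[of 0 1 1] by simp

lemma PolyE_Y: "Y \<in> PolyE 2"
proof -
  have "(\<lambda>x. (1 / (b - a)) * (fst x ^ 0 * snd x ^ 2 + (- (a + 0 * fst x) + (- (c - a)) * (fst x ^ 2 * snd x ^ 0)))) \<in> PolyE 2"
    by (intro PolyE_cmult PolyE_add PolyE_monomial) (simp_all add: PolyE_const)
  moreover have "Y = (\<lambda>x. (1 / (b - a)) * (fst x ^ 0 * snd x ^ 2 + (- (a + 0 * fst x) + (- (c - a)) * (fst x ^ 2 * snd x ^ 0))))"
    using ab by (auto simp: fun_eq_iff Y_def field_simps)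
  ultimately show ?thesis by simp
qed

lemma PolyE_Z: "Z \<in> PolyE 2"
proof -
  have "(\<lambda>x. 1 - (U x ^ 2 + Y x)) \<in> PolyE 2"
    by (intro PolyE_diff PolyE_add PolyE_Y PolyE_const PolyE_power[OF PolyE_U, of 2, simplified])
  moreover have "Z = (\<lambda>x. 1 - (U x ^ 2 + Y x))"
    using UYZ by (simp add: fun_eq_iff algebra_simps)
  ultimately show ?thesis by simp
qed

text \<open>These monomials span the even polynomials without being independent, since U^2 + Y + Z =
  1; only identities between them are used, never uniqueness of an expansion.\<close>

definition e :: "nat \<Rightarrow> nat \<Rightarrow> nat \<Rightarrow> real \<times> real \<Rightarrow> real" where
  "e i j k x = U x ^ i * Y x ^ j * Z x ^ k"

lemma PolyE_e: "i + 2 * j + 2 * k \<le> n \<Longrightarrow> e i j k \<in> PolyE n"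
proof -
  assume n: "i + 2 * j + 2 * k \<le> n"
  have "(\<lambda>x. U x ^ i * Y x ^ j * Z x ^ k) \<in> PolyE (i * 1 + j * 2 + k * 2)"
    by (intro PolyE_mult PolyE_power PolyE_U PolyE_Y PolyE_Z)
  then show ?thesis unfolding e_def[abs_def] using PolyE_mono n by (simp add: mult.commute)
qed

text \<open>Every section with |u| < 1 contains a nondegenerate interval. Projections are functions
  on the whole plane, so identities on the domain have to be extended.\<close>

lemma PolyE_zero_on_Lambda:
  assumes f: "f \<in> PolyE n" and zero: "\<And>x. x \<in> \<Lambda> \<Longrightarrow> f x = 0"
  shows "f x = 0"
proof -
  obtain cf where cf: "f = poly2 n cf" using f by (auto simp: PolyE_def)
  show ?thesis unfolding cf
  proof (rule poly2_zero_grid[of "{-1<..<1}" "\<lambda>u. {v. (u, v) \<in> \<Lambda>}"])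
    fix u :: real assume u: "u \<in> {-1<..<1}"
    define A where "A = a + (c - a) * u\<^sup>2"
    define B where "B = b + (c - b) * u\<^sup>2"
    have u2: "u\<^sup>2 < 1" using u by (auto simp: abs_square_less_1 abs_less_iff)
    have "B - A = (b - a) * (1 - u\<^sup>2)" by (simp add: A_def B_def algebra_simps)
    then have AB: "A < B" using u2 ab by (smt (verit) mult_pos_pos)
    have "A = a * (1 - u\<^sup>2) + c * u\<^sup>2" by (simp add: A_def algebra_simps)
    then have A: "0 \<le> A" using a c u2 by simp
    have "{sqrt A<..<sqrt B} \<subseteq> {v. (u, v) \<in> \<Lambda>}"
    proof
      fix v assume v: "v \<in> {sqrt A<..<sqrt B}"
      have s: "0 \<le> sqrt A" using A by simp
      have v0: "0 \<le> v" using v s by (metis greaterThanLessThan_iff less_imp_le order_trans)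
      have "A \<le> v\<^sup>2" using v by (intro sqrt_le_D) auto
      moreover have "v\<^sup>2 \<le> B"
        using power_mono[of v "sqrt B" 2] v v0 A AB by auto
      ultimately show "v \<in> {v. (u, v) \<in> \<Lambda>}" using v0 u by (auto simp: Lambda_def Omega_def A_def B_def)
    qed
    moreover have "infinite {sqrt A<..<sqrt B}" using AB by (intro infinite_Ioo) simp
    ultimately show "infinite {v. (u, v) \<in> \<Lambda>}" using infinite_super by blast
  qed (use zero cf in \<open>auto intro: infinite_Ioo\<close>)
qed

lemma PolyE_eqI:
  assumes "f \<in> PolyE n" "g \<in> PolyE n" "\<And>x. x \<in> \<Lambda> \<Longrightarrow> f x = g x"
  shows "f = g"
  using PolyE_zero_on_Lambda[OF PolyE_diff[OF assms(1,2)]] assms(3) by (auto simp: fun_eq_iff)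

lemma integrable_lborel_Lambda:
  fixes f :: "real \<times> real \<Rightarrow> real"
  assumes "continuous_on UNIV f"
  shows "integrable lborel (\<lambda>x. indicator \<Lambda> x * (Wt a b c \<beta> \<gamma> x * f x))"
proof -
  have fm: "f \<in> borel_measurable borel" by (rule borel_measurable_continuous_onI[OF assms])
  have [measurable]: "f \<in> borel_measurable (restrict_space lborel \<Lambda>)"
    by (rule measurable_restrict_space1) (use fm in simp)
  have [measurable]: "Wt a b c \<beta> \<gamma> \<in> borel_measurable (restrict_space lborel \<Lambda>)"
    by (rule measurable_restrict_space1) simp
  have "integrable M f" by (rule integrable_M_continuous[OF continuous_on_subset[OF assms]]) simp
  then have "integrable (restrict_space lborel \<Lambda>) (\<lambda>x. Wt a b c \<beta> \<gamma> x * f x)"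
    unfolding wmeas_def by (subst (asm) integrable_density) (auto simp: Wt_nonneg)
  then show ?thesis by (subst (asm) integrable_restrict_space) auto
qed

text \<open>Omega is the union of its upper half and the reflection of that half, overlapping only
  in the null set v = 0. The odd part R changes sign under the reflection and cancels.\<close>

lemma integral_Omega:
  assumes f: "f \<in> PolyE n" and P: "P \<in> PolyE m"
    and R: "continuous_on UNIV R" "\<And>u v. R (u, - v) = - R (u, v)"
  shows "(\<integral>x. f x * (P x + R x) \<partial>wmeas a b c \<beta> \<gamma> (Omega a b c)) = 2 * (\<integral>x. f x * P x \<partial>M)"
proof -
  let ?W = "Wt a b c \<beta> \<gamma>"
  define F where "F x = indicator \<Lambda> x * (?W x * (f x * (P x + R x)))" for x
  define G where "G x = indicator \<Lambda> x * (?W x * (f x * (P x - R x)))" for x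
  have cont: "continuous_on UNIV (\<lambda>x. f x * (P x + R x))" "continuous_on UNIV (\<lambda>x. f x * (P x - R x))"
    by (intro continuous_intros R(1) PolyE_continuous[OF f] PolyE_continuous[OF P])+
  have [measurable]: "(\<lambda>x. f x * (P x + R x)) \<in> borel_measurable borel" "(\<lambda>x. f x * (P x - R x)) \<in> borel_measurable borel"
    by (intro borel_measurable_continuous_onI cont)+
  have [measurable]: "G \<in> borel_measurable borel" unfolding G_def[abs_def] by measurable
  have iF: "integrable lborel F" and iG: "integrable lborel G"
    unfolding F_def[abs_def] G_def[abs_def] by (intro integrable_lborel_Lambda cont)+
  define T :: "real \<times> real \<Rightarrow> real \<times> real" where "T x = (1 * fst x, - 1 * snd x)" for x
  have symG: "(\<integral>x. G x \<partial>lborel) = (\<integral>x. G (T x) \<partial>lborel)"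
    unfolding T_def by (rule lborel_reflect) auto
  have iGT: "integrable lborel (\<lambda>x. G (T x))"
  proof -
    have [measurable]: "T \<in> borel_measurable borel"
      unfolding T_def[abs_def] by (intro borel_measurable_continuous_onI continuous_intros)
    obtain B where B: "\<And>x. x \<in> \<Lambda> \<Longrightarrow> norm (f x * (P x - R x)) \<le> B"
        using compact_imp_bounded[OF compact_continuous_image[OF continuous_on_subset[OF cont(2)] compact_Lambda]]
        by (auto simp: bounded_iff)
      define H where "H x = indicator \<Lambda> x * (?W x * 1)" for x
      have [measurable]: "H \<in> borel_measurable borel" unfolding H_def[abs_def] by measurable
      have "(\<integral>x. H x \<partial>lborel) = (\<integral>x. H (T x) \<partial>lborel)" unfolding T_def by (rule lborel_reflect) auto
      moreover have "(\<integral>x. H x \<partial>lborel) = mass"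
      proof -
        have "(\<integral>x. 1 \<partial>M) = (\<integral>x. H x \<partial>lborel)" unfolding H_def by (rule integral_wmeas) simp_all
        then show ?thesis by (simp add: mass_def)
      qed
      ultimately have "(\<integral>x. H (T x) \<partial>lborel) \<noteq> 0" using mass_pos by simp
      \<comment> \<open>A nonzero Bochner integral certifies integrability, since nonintegrable
        functions have integral 0 by convention. This supplies a dominating function for the
        reflected integrand.\<close>
      then have iH: "integrable lborel (\<lambda>x. H (T x))" using not_integrable_integral_eq by blast
      show ?thesis
      proof (rule Bochner_Integration.integrable_bound[OF integrable_mult_right[OF iH, of B]])
        show "AE x in lborel. norm (G (T x)) \<le> norm (B * H (T x))"
        proof (rule AE_I2)
          fix x
          show "norm (G (T x)) \<le> norm (B * H (T x))"
          proof (cases "T x \<in> \<Lambda>")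
            case True
            have "norm (G (T x)) = ?W (T x) * norm (f (T x) * (P (T x) - R (T x)))"
              using True by (simp add: G_def abs_mult Wt_nonneg)
            also have "\<dots> \<le> ?W (T x) * \<bar>B\<bar>"
              using B[OF True] by (intro mult_left_mono Wt_nonneg) simp
            finally show ?thesis using True by (simp add: H_def abs_mult Wt_nonneg mult.commute)
          qed (simp add: G_def)
        qed
      qed simp
  qed
  have AE0: "AE x in (lborel :: (real \<times> real) measure). snd x \<noteq> 0"
  proof -
    have "AE x in (lborel :: real measure) \<Otimes>\<^sub>M lborel. snd x \<noteq> (0 :: real)"
    proof (rule lborel_pair.AE_pair_measure)
      show "{x \<in> space ((lborel :: real measure) \<Otimes>\<^sub>M lborel). snd x \<noteq> (0 :: real)} \<in> sets ((lborel :: real measure) \<Otimes>\<^sub>M lborel)"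
        by measurable
      show "AE x in (lborel :: real measure). AE y in lborel. snd (x, y) \<noteq> (0 :: real)"
        using AE_lborel_singleton[of "0 :: real"] by simp
    qed
    then show ?thesis unfolding lborel_prod .
  qed
  have sF: "(\<integral>x. F x \<partial>lborel) + (\<integral>x. G x \<partial>lborel) = 2 * (\<integral>x. f x * P x \<partial>M)"
  proof -
    have "(\<integral>x. F x \<partial>lborel) + (\<integral>x. G x \<partial>lborel) = (\<integral>x. F x + G x \<partial>lborel)"
      by (rule Bochner_Integration.integral_add[symmetric, OF iF iG])
    also have "\<dots> = (\<integral>x. 2 * (indicator \<Lambda> x * (?W x * (f x * P x))) \<partial>lborel)"
      by (rule Bochner_Integration.integral_cong) (simp_all add: F_def G_def algebra_simps)
    also have "\<dots> = 2 * (\<integral>x. f x * P x \<partial>M)"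
      by (simp, subst integral_wmeas[symmetric])
        (auto intro!: borel_measurable_times PolyE_measurable[OF f] PolyE_measurable[OF P])
    finally show ?thesis .
  qed
  have "(\<integral>x. f x * (P x + R x) \<partial>wmeas a b c \<beta> \<gamma> (Omega a b c))
      = (\<integral>x. indicator (Omega a b c) x * (?W x * (f x * (P x + R x))) \<partial>lborel)"
    by (rule integral_wmeas) simp_all
  also have "\<dots> = (\<integral>x. F x + G (T x) \<partial>lborel)"
  proof (rule integral_cong_AE)
    show "AE x in lborel. indicator (Omega a b c) x * (?W x * (f x * (P x + R x))) = F x + G (T x)"
      using AE0
    proof eventually_elim
      fix x :: "real \<times> real" assume x: "snd x \<noteq> 0"
      obtain u v where uv: "x = (u, v)" by (cases x)
      have eq: "f (u, - v) = f (u, v)" "P (u, - v) = P (u, v)"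
        using PolyE_reflect[OF f] PolyE_reflect[OF P] by auto
      have W: "?W (u, - v) = ?W (u, v)" by (simp add: Wt_def)
      show "indicator (Omega a b c) x * (?W x * (f x * (P x + R x))) = F x + G (T x)"
        using x unfolding uv F_def G_def T_def
        by (auto simp: eq W R(2) indicator_def Lambda_def Omega_def)
    qed
    show "(\<lambda>x. F x + G (T x)) \<in> borel_measurable lborel"
      using iF iGT by (intro borel_measurable_add) auto
  qed simp
  also have "\<dots> = (\<integral>x. F x \<partial>lborel) + (\<integral>x. G (T x) \<partial>lborel)"
    by (rule Bochner_Integration.integral_add[OF iF iGT])
  also have "\<dots> = 2 * (\<integral>x. f x * P x \<partial>M)" using sF symG by simp
  finally show ?thesis .
qed

text \<open>Orthogonality over Omega to all polynomials is replaced by orthogonality over the upper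
  half to even ones, so that from here on a single measure M suffices.\<close>

lemma Vspace_iff:
  "q \<in> Vspace a b c \<beta> \<gamma> n \<longleftrightarrow> q \<in> PolyE n \<and> (\<forall>m<n. \<forall>P\<in>PolyE m. (\<integral>x. q x * P x \<partial>M) = 0)"
proof (cases "q \<in> PolyE n")
  case q: True
  have "(\<forall>P\<in>PolyAll m. (\<integral>x. q x * P x \<partial>wmeas a b c \<beta> \<gamma> (Omega a b c)) = 0)
     \<longleftrightarrow> (\<forall>P\<in>PolyE m. (\<integral>x. q x * P x \<partial>M) = 0)" for m
  proof (intro iffI ballI)
    fix P assume H: "\<forall>P\<in>PolyAll m. (\<integral>x. q x * P x \<partial>wmeas a b c \<beta> \<gamma> (Omega a b c)) = 0" and P: "P \<in> PolyE m"
    have "(\<integral>x. q x * (P x + 0) \<partial>wmeas a b c \<beta> \<gamma> (Omega a b c)) = 2 * (\<integral>x. q x * P x \<partial>M)"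
      by (rule integral_Omega[OF q P]) simp_all
    moreover have "(\<integral>x. q x * P x \<partial>wmeas a b c \<beta> \<gamma> (Omega a b c)) = 0" using H P PolyE_subset_PolyAll by blast
    ultimately show "(\<integral>x. q x * P x \<partial>M) = 0" by simp
  next
    fix P assume H: "\<forall>P\<in>PolyE m. (\<integral>x. q x * P x \<partial>M) = 0" and P: "P \<in> PolyAll m"
    obtain Q R where QR: "Q \<in> PolyE m" "continuous_on UNIV R" "\<And>u v. R (u, - v) = - R (u, v)" "\<And>x. P x = Q x + R x"
      by (rule PolyAll_split[OF P]) blast
    show "(\<integral>x. q x * P x \<partial>wmeas a b c \<beta> \<gamma> (Omega a b c)) = 0"
      unfolding QR(4) integral_Omega[OF q QR(1-3)] using H QR(1) by simp
  qed
  then show ?thesis unfolding Vspace_def using q by auto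
qed (simp add: Vspace_def)

end

section \<open>Reproducing kernels and the product formula\<close>

text \<open>Through the choice only the listed properties are known, so the two-point case \<kappa>
  = 0 and the continuous case are treated alike from here on.\<close>

definition bm :: "real \<Rightarrow> real measure" where
  "bm \<kappa> = (SOME N. prob_space N \<and> sets N = sets borel \<and> (AE s in N. \<bar>s\<bar> \<le> 1)
     \<and> (\<forall>q. odd q \<longrightarrow> (\<integral>s. s ^ q \<partial>N) = 0)
     \<and> (\<forall>q. (real q + 1 + 2 * \<kappa>) * (\<integral>s. s ^ (q + 2) \<partial>N) = (real q + 1) * (\<integral>s. s ^ q \<partial>N)))"

lemma bm:
  assumes "\<kappa> \<ge> 0"
  shows "prob_space (bm \<kappa>)" "sets (bm \<kappa>) = sets borel" "AE s in bm \<kappa>. \<bar>s\<bar> \<le> 1"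
    "odd q \<Longrightarrow> (\<integral>s. s ^ q \<partial>bm \<kappa>) = 0"
    "(real q + 1 + 2 * \<kappa>) * (\<integral>s. s ^ (q + 2) \<partial>bm \<kappa>) = (real q + 1) * (\<integral>s. s ^ q \<partial>bm \<kappa>)"
proof -
  have "\<exists>N. prob_space N \<and> sets N = sets borel \<and> (AE s in N. \<bar>s\<bar> \<le> 1)
     \<and> (\<forall>q. odd q \<longrightarrow> (\<integral>s. s ^ q \<partial>N) = 0)
     \<and> (\<forall>q. (real q + 1 + 2 * \<kappa>) * (\<integral>s. s ^ (q + 2) \<partial>N) = (real q + 1) * (\<integral>s. s ^ q \<partial>N))"
    by (rule ex_symmetric_beta_measure[OF assms]) blast
  from someI_ex[OF this] show "prob_space (bm \<kappa>)" "sets (bm \<kappa>) = sets borel" "AE s in bm \<kappa>. \<bar>s\<bar> \<le> 1"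
    "odd q \<Longrightarrow> (\<integral>s. s ^ q \<partial>bm \<kappa>) = 0"
    "(real q + 1 + 2 * \<kappa>) * (\<integral>s. s ^ (q + 2) \<partial>bm \<kappa>) = (real q + 1) * (\<integral>s. s ^ q \<partial>bm \<kappa>)"
    unfolding bm_def[symmetric] by blast+
qed

definition idx :: "nat \<Rightarrow> (nat \<times> nat \<times> nat) set" where
  "idx m = {(i, q, p). i + q + p = m}"

lemma sum_idx: "(\<Sum>(i, q, p)\<in>idx m. f i q p) = (\<Sum>i\<le>m. \<Sum>q\<le>m - i. f i q (m - i - q))"
  for f :: "nat \<Rightarrow> nat \<Rightarrow> nat \<Rightarrow> real"
proof -
  have "(\<Sum>i\<le>m. \<Sum>q\<le>m - i. f i q (m - i - q)) = (\<Sum>(i, q)\<in>Sigma {..m} (\<lambda>i. {..m - i}). f i q (m - i - q))"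
    by (rule sum.Sigma) auto
  also have "\<dots> = (\<Sum>(i, q, p)\<in>idx m. f i q p)"
    by (rule sum.reindex_bij_witness[where i = "\<lambda>(i, q, p). (i, q)" and j = "\<lambda>(i, q). (i, q, m - i - q)"])
      (auto simp: idx_def)
  finally show ?thesis ..
qed

lemma finite_idx [simp]: "finite (idx m)"
  by (rule finite_subset[of _ "{..m} \<times> {..m} \<times> {..m}"]) (auto simp: idx_def)

text \<open>Powers divided by factorials absorb the binomial coefficients, and the trinomial form
  follows by iteration.\<close>

lemma binomial_exp_form: "(x + y) ^ m / fact m = (\<Sum>i\<le>m. x ^ i / fact i * (y ^ (m - i) / fact (m - i)))"
  for x y :: real
  using exp_series_add_commuting[of x y m] by (simp add: mult.commute divide_inverse atMost_atLeast0)

lemma trinomial_exp_form: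
  "(x + y + z) ^ m / fact m = (\<Sum>(i, q, p)\<in>idx m. x ^ i / fact i * (y ^ q / fact q) * (z ^ p / fact p))"
  for x y z :: real
proof -
  have "(x + y + z) ^ m / fact m = (\<Sum>i\<le>m. x ^ i / fact i * ((y + z) ^ (m - i) / fact (m - i)))"
    using binomial_exp_form[of x "y + z" m] by (simp add: add.assoc)
  also have "\<dots> = (\<Sum>i\<le>m. \<Sum>q\<le>m - i. x ^ i / fact i * (y ^ q / fact q) * (z ^ (m - i - q) / fact (m - i - q)))"
    unfolding binomial_exp_form[of y z] by (simp only: sum_distrib_left mult.assoc)
  finally show ?thesis unfolding sum_idx .
qed

text \<open>As after two differentiations in one variable, the exponents 0 and 1 contribute nothing
  and the rest has total degree m - 2.\<close>

lemma sum_idx_shift: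
  fixes g :: "nat \<Rightarrow> nat \<Rightarrow> nat \<Rightarrow> real"
  shows "(\<And>i q p. i < 2 \<Longrightarrow> g i q p = 0) \<Longrightarrow>
      (\<Sum>(i, q, p)\<in>idx m. g i q p) = (if 2 \<le> m then (\<Sum>(i, q, p)\<in>idx (m - 2). g (i + 2) q p) else 0)"
    and "(\<And>i q p. q < 2 \<Longrightarrow> g i q p = 0) \<Longrightarrow>
      (\<Sum>(i, q, p)\<in>idx m. g i q p) = (if 2 \<le> m then (\<Sum>(i, q, p)\<in>idx (m - 2). g i (q + 2) p) else 0)"
    and "(\<And>i q p. p < 2 \<Longrightarrow> g i q p = 0) \<Longrightarrow>
      (\<Sum>(i, q, p)\<in>idx m. g i q p) = (if 2 \<le> m then (\<Sum>(i, q, p)\<in>idx (m - 2). g i q (p + 2)) else 0)"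
proof -
  assume z: "\<And>i q p. i < 2 \<Longrightarrow> g i q p = 0"
  show "(\<Sum>(i, q, p)\<in>idx m. g i q p) = (if 2 \<le> m then (\<Sum>(i, q, p)\<in>idx (m - 2). g (i + 2) q p) else 0)"
  proof (cases "2 \<le> m")
    case True
    have "(\<Sum>(i, q, p)\<in>idx (m - 2). g (i + 2) q p) = (\<Sum>(i, q, p)\<in>idx m. g i q p)"
      by (rule sum.reindex_bij_witness_not_neutral[where S' = "{}" and T' = "{x \<in> idx m. fst x < 2}"
          and i = "\<lambda>(i, q, p). (i - 2, q, p)" and j = "\<lambda>(i, q, p). (i + 2, q, p)"])
        (use True z finite_idx[of m, unfolded idx_def] in \<open>auto simp: idx_def\<close>)
    then show ?thesis using True by simp
  qed (auto intro!: sum.neutral z simp: idx_def)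
next
  assume z: "\<And>i q p. q < 2 \<Longrightarrow> g i q p = 0"
  show "(\<Sum>(i, q, p)\<in>idx m. g i q p) = (if 2 \<le> m then (\<Sum>(i, q, p)\<in>idx (m - 2). g i (q + 2) p) else 0)"
  proof (cases "2 \<le> m")
    case True
    have "(\<Sum>(i, q, p)\<in>idx (m - 2). g i (q + 2) p) = (\<Sum>(i, q, p)\<in>idx m. g i q p)"
      by (rule sum.reindex_bij_witness_not_neutral[where S' = "{}" and T' = "{x \<in> idx m. fst (snd x) < 2}"
          and i = "\<lambda>(i, q, p). (i, q - 2, p)" and j = "\<lambda>(i, q, p). (i, q + 2, p)"])
        (use True z finite_idx[of m, unfolded idx_def] in \<open>auto simp: idx_def\<close>)
    then show ?thesis using True by simp
  qed (auto intro!: sum.neutral z simp: idx_def)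
next
  assume z: "\<And>i q p. p < 2 \<Longrightarrow> g i q p = 0"
  show "(\<Sum>(i, q, p)\<in>idx m. g i q p) = (if 2 \<le> m then (\<Sum>(i, q, p)\<in>idx (m - 2). g i q (p + 2)) else 0)"
  proof (cases "2 \<le> m")
    case True
    have "(\<Sum>(i, q, p)\<in>idx (m - 2). g i q (p + 2)) = (\<Sum>(i, q, p)\<in>idx m. g i q p)"
      by (rule sum.reindex_bij_witness_not_neutral[where S' = "{}" and T' = "{x \<in> idx m. snd (snd x) < 2}"
          and i = "\<lambda>(i, q, p). (i, q, p - 2)" and j = "\<lambda>(i, q, p). (i, q, p + 2)"])
        (use True z finite_idx[of m, unfolded idx_def] in \<open>auto simp: idx_def\<close>)
    then show ?thesis using True by simp
  qed (auto intro!: sum.neutral z simp: idx_def)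
qed

section \<open>Zonal kernels as eigenfunctions\<close>

context jacobi_domain
begin

text \<open>The parameters \<beta> here and \<gamma> + 1/2 in \<open>b2\<close> are dictated by the
  weight: in terms of sqrt Y and sqrt Z, with the differentials included, its exponents are 2
  \<beta> and 2 \<gamma> + 1.\<close>

definition b1 :: "nat \<Rightarrow> real" where "b1 q = (\<integral>s. s ^ q \<partial>bm \<beta>)"

definition b2 :: "nat \<Rightarrow> real" where "b2 p = (\<integral>t. t ^ p \<partial>bm (\<gamma> + 1/2))"

lemma gamma': "0 \<le> \<gamma> + 1/2" using gamma by simp

lemma b_odd: "odd q \<Longrightarrow> b1 q = 0" "odd p \<Longrightarrow> b2 p = 0"
  unfolding b1_def b2_def by (rule bm(4)[OF beta] bm(4)[OF gamma'], assumption)+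

lemma b_two_step:
  "b1 (q + 2) * (real q + 1 + 2 * \<beta>) = b1 q * (real q + 1)"
  "b2 (p + 2) * (real p + 2 + 2 * \<gamma>) = b2 p * (real p + 1)"
proof -
  show "b1 (q + 2) * (real q + 1 + 2 * \<beta>) = b1 q * (real q + 1)"
    unfolding b1_def using bm(5)[OF beta, of q] by (simp only: mult.commute)
  have "real p + 1 + 2 * (\<gamma> + 1/2) = real p + 2 + 2 * \<gamma>" by simp
  then show "b2 (p + 2) * (real p + 2 + 2 * \<gamma>) = b2 p * (real p + 1)"
    unfolding b2_def using bm(5)[OF gamma', of p] by (simp only: mult.commute)
qed

definition N :: "(real \<times> real) measure" where "N = bm \<beta> \<Otimes>\<^sub>M bm (\<gamma> + 1/2)"

interpretation N1: prob_space "bm \<beta>" by (rule bm(1)[OF beta])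
interpretation N2: prob_space "bm (\<gamma> + 1/2)" by (rule bm(1)[OF gamma'])
interpretation NN: pair_prob_space "bm \<beta>" "bm (\<gamma> + 1/2)" ..

lemma prob_space_N: "prob_space N"
  unfolding N_def by unfold_locales

interpretation N: prob_space N by (rule prob_space_N)

lemma sets_N: "sets N = sets borel"
proof -
  have "sets N = sets (borel \<Otimes>\<^sub>M borel)"
    unfolding N_def by (rule sets_pair_measure_cong[OF bm(2)[OF beta] bm(2)[OF gamma']])
  then show ?thesis by (simp only: borel_prod)
qed

lemma measurable_N: "f \<in> borel_measurable borel \<Longrightarrow> f \<in> borel_measurable N"
  using measurable_cong_sets[OF sets_N refl] by blast

lemma AE_N: "AE st in N. \<bar>fst st\<bar> \<le> 1 \<and> \<bar>snd st\<bar> \<le> 1"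
  unfolding N_def
proof (rule NN.AE_pair_measure)
  have "{st :: real \<times> real. \<bar>fst st\<bar> \<le> 1 \<and> \<bar>snd st\<bar> \<le> 1} \<in> sets borel"
    by (intro borel_closed closed_Collect_conj closed_Collect_le continuous_intros)
  moreover have "space N = UNIV" using sets_eq_imp_space_eq[OF sets_N] by simp
  ultimately show "{st \<in> space (bm \<beta> \<Otimes>\<^sub>M bm (\<gamma> + 1/2)). \<bar>fst st\<bar> \<le> 1 \<and> \<bar>snd st\<bar> \<le> 1} \<in> sets (bm \<beta> \<Otimes>\<^sub>M bm (\<gamma> + 1/2))"
    unfolding N_def[symmetric] by (simp add: sets_N)
  show "AE x in bm \<beta>. AE y in bm (\<gamma> + 1/2). \<bar>fst (x, y)\<bar> \<le> 1 \<and> \<bar>snd (x, y)\<bar> \<le> 1"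
    using bm(3)[OF beta] by eventually_elim (use bm(3)[OF gamma'] in eventually_elim, simp)
qed

lemma N_integrable:
  fixes f :: "real \<times> real \<Rightarrow> real"
  assumes "f \<in> borel_measurable borel" "\<And>st. \<bar>fst st\<bar> \<le> 1 \<Longrightarrow> \<bar>snd st\<bar> \<le> 1 \<Longrightarrow> \<bar>f st\<bar> \<le> B"
  shows "integrable N f"
proof (rule N.integrable_const_bound[where B = B])
  show "AE st in N. norm (f st) \<le> B"
    using AE_N by eventually_elim (use assms in auto)
qed (rule measurable_N[OF assms(1)])

lemma N_integral_mono:
  fixes f g :: "real \<times> real \<Rightarrow> real"
  assumes "integrable N f" "integrable N g" "\<And>st. \<bar>fst st\<bar> \<le> 1 \<Longrightarrow> \<bar>snd st\<bar> \<le> 1 \<Longrightarrow> f st \<le> g st"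
  shows "(\<integral>st. f st \<partial>N) \<le> (\<integral>st. g st \<partial>N)"
proof (rule integral_mono_AE)
  show "AE st in N. f st \<le> g st"
    using AE_N by eventually_elim (use assms in auto)
qed (rule assms)+

lemma N_abs_integral_le:
  fixes f g :: "real \<times> real \<Rightarrow> real"
  assumes "integrable N f" "integrable N g" "\<And>st. \<bar>fst st\<bar> \<le> 1 \<Longrightarrow> \<bar>snd st\<bar> \<le> 1 \<Longrightarrow> \<bar>f st\<bar> \<le> g st"
  shows "\<bar>\<integral>st. f st \<partial>N\<bar> \<le> (\<integral>st. g st \<partial>N)"
proof -
  have "\<bar>\<integral>st. f st \<partial>N\<bar> \<le> (\<integral>st. \<bar>f st\<bar> \<partial>N)" by (rule integral_abs_bound)
  also have "\<dots> \<le> (\<integral>st. g st \<partial>N)" by (rule N_integral_mono) (use assms in auto)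
  finally show ?thesis .
qed

lemma measurable_fst_snd [measurable]:
  "(fst :: real \<times> real \<Rightarrow> real) \<in> borel_measurable borel" "(snd :: real \<times> real \<Rightarrow> real) \<in> borel_measurable borel"
  by (intro borel_measurable_continuous_onI continuous_intros)+

lemma N_moment: "(\<integral>st. fst st ^ q * snd st ^ p \<partial>N) = b1 q * b2 p"
proof -
  have i: "integrable (bm \<beta> \<Otimes>\<^sub>M bm (\<gamma> + 1/2)) (\<lambda>st. fst st ^ q * snd st ^ p)"
    unfolding N_def[symmetric]
  proof (rule N_integrable[where B = 1])
    show "\<bar>fst st ^ q * snd st ^ p\<bar> \<le> 1" if "\<bar>fst st\<bar> \<le> 1" "\<bar>snd st\<bar> \<le> 1" for st :: "real \<times> real"
      using that mult_mono[of "\<bar>fst st\<bar> ^ q" 1 "\<bar>snd st\<bar> ^ p" 1]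
      by (simp add: abs_mult power_abs power_le_one)
  qed measurable
  have "(\<integral>st. fst st ^ q * snd st ^ p \<partial>N) = (\<integral>s. \<integral>t. fst (s, t) ^ q * snd (s, t) ^ p \<partial>bm (\<gamma> + 1/2) \<partial>bm \<beta>)"
    unfolding N_def by (rule NN.integral_fst'[OF i, symmetric])
  then show ?thesis by (simp add: b1_def b2_def)
qed

text \<open>The product formula: the reproducing kernel of degree \<open>n\<close> at \<open>(x, x')\<close> is the average of the zonal
  polynomial \<open>Zp l n\<close> over the points \<open>xi x x' st\<close>, as for spherical harmonics in the coordinates
  \<open>(U, sqrt Y, sqrt Z)\<close>, whose squares add up to 1.\<close>

definition xi :: "real \<times> real \<Rightarrow> real \<times> real \<Rightarrow> real \<times> real \<Rightarrow> real" where
  "xi x x' st = U x * U x' + sqrt (Y x) * sqrt (Y x') * fst st + sqrt (Z x) * sqrt (Z x') * snd st"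

lemma measurable_xi [measurable]: "xi x x' \<in> borel_measurable borel"
  unfolding xi_def[abs_def] by measurable

text \<open>As U^2 + Y + Z = 1 at both points, 1 - xi is at least half their squared distance in (U,
  sqrt Y, sqrt Z). The Z part is dropped, because U and sqrt Y already determine a point of the
  domain.\<close>

lemma xi_le:
  assumes x: "x \<in> \<Lambda>" "x' \<in> \<Lambda>" and st: "\<bar>fst st\<bar> \<le> 1" "\<bar>snd st\<bar> \<le> 1"
  shows "((U x - U x')\<^sup>2 + (sqrt (Y x) - sqrt (Y x'))\<^sup>2) / 2 \<le> 1 - xi x x' st"
proof -
  have p: "0 \<le> Y x" "0 \<le> Z x" "0 \<le> Y x'" "0 \<le> Z x'" using x by (auto simp: Lambda_iff)
  have "sqrt (Y x) * sqrt (Y x') * fst st \<le> sqrt (Y x) * sqrt (Y x') * 1"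
    using st p by (intro mult_left_mono) auto
  moreover have "sqrt (Z x) * sqrt (Z x') * snd st \<le> sqrt (Z x) * sqrt (Z x') * 1"
    using st p by (intro mult_left_mono) auto
  moreover have "(U x - U x')\<^sup>2 = (U x)\<^sup>2 + (U x')\<^sup>2 - 2 * (U x * U x')" by (simp add: power2_diff)
  moreover have "(sqrt (Y x) - sqrt (Y x'))\<^sup>2 = Y x + Y x' - 2 * (sqrt (Y x) * sqrt (Y x'))"
    using p by (simp add: power2_diff)
  moreover have "0 \<le> (sqrt (Z x) - sqrt (Z x'))\<^sup>2" by simp
  moreover have "(sqrt (Z x) - sqrt (Z x'))\<^sup>2 = Z x + Z x' - 2 * (sqrt (Z x) * sqrt (Z x'))"
    using p by (simp add: power2_diff)
  ultimately show ?thesis using UYZ[of x] UYZ[of x'] unfolding xi_def by simp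
qed

lemma abs_xi_le:
  assumes x: "x \<in> \<Lambda>" "x' \<in> \<Lambda>" and st: "\<bar>fst st\<bar> \<le> 1" "\<bar>snd st\<bar> \<le> 1"
  shows "\<bar>xi x x' st\<bar> \<le> 1"
proof -
  have p: "0 \<le> Y x" "0 \<le> Z x" "0 \<le> Y x'" "0 \<le> Z x'" using x by (auto simp: Lambda_iff)
  have "\<bar>xi x x' st\<bar> \<le> \<bar>U x * U x'\<bar> + \<bar>sqrt (Y x) * sqrt (Y x') * fst st\<bar> + \<bar>sqrt (Z x) * sqrt (Z x') * snd st\<bar>"
    unfolding xi_def by linarith
  moreover have "\<bar>sqrt (Y x) * sqrt (Y x') * fst st\<bar> \<le> sqrt (Y x) * sqrt (Y x') * 1"
    unfolding abs_mult using st p by (intro mult_mono) auto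
  moreover have "\<bar>sqrt (Z x) * sqrt (Z x') * snd st\<bar> \<le> sqrt (Z x) * sqrt (Z x') * 1"
    unfolding abs_mult using st p by (intro mult_mono) auto
  moreover have "2 * \<bar>U x * U x'\<bar> \<le> (U x)\<^sup>2 + (U x')\<^sup>2"
    using zero_le_power2[of "\<bar>U x\<bar> - \<bar>U x'\<bar>"] by (simp add: power2_diff abs_mult)
  moreover have "0 \<le> (sqrt (Y x) - sqrt (Y x'))\<^sup>2" "0 \<le> (sqrt (Z x) - sqrt (Z x'))\<^sup>2" by simp_all
  moreover have "(sqrt (Y x) - sqrt (Y x'))\<^sup>2 = Y x + Y x' - 2 * (sqrt (Y x) * sqrt (Y x'))"
    "(sqrt (Z x) - sqrt (Z x'))\<^sup>2 = Z x + Z x' - 2 * (sqrt (Z x) * sqrt (Z x'))"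
    using p by (simp_all add: power2_diff)
  ultimately show ?thesis using UYZ[of x] UYZ[of x'] by linarith
qed

definition wt :: "nat \<Rightarrow> nat \<Rightarrow> nat \<Rightarrow> real" where
  "wt i q p = b1 q * b2 p / (fact i * fact q * fact p)"

text \<open>The average of xi^m / m!, expanded. Odd powers of sqrt Y and sqrt Z carry weight 0, so
  halving the exponents is exact and the kernel is polynomial in both points.\<close>

definition kern :: "nat \<Rightarrow> real \<times> real \<Rightarrow> real \<times> real \<Rightarrow> real" where
  "kern m x x' = (\<Sum>(i, q, p)\<in>idx m. wt i q p * e i (q div 2) (p div 2) x * e i (q div 2) (p div 2) x')"

lemma kern_integral:
  assumes x: "x \<in> \<Lambda>" "x' \<in> \<Lambda>"
  shows "(\<integral>st. xi x x' st ^ m / fact m \<partial>N) = kern m x x'"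
proof -
  have p: "0 \<le> Y x" "0 \<le> Z x" "0 \<le> Y x'" "0 \<le> Z x'" using x by (auto simp: Lambda_iff)
  define A B C where "A = U x * U x'" and "B = sqrt (Y x) * sqrt (Y x')" and "C = sqrt (Z x) * sqrt (Z x')"
  have int: "integrable N (\<lambda>st. fst st ^ q * snd st ^ p)" for q p
  proof (rule N_integrable[where B = 1])
    show "\<bar>fst st ^ q * snd st ^ p\<bar> \<le> 1" if "\<bar>fst st\<bar> \<le> 1" "\<bar>snd st\<bar> \<le> 1" for st :: "real \<times> real"
      using that mult_mono[of "\<bar>fst st\<bar> ^ q" 1 "\<bar>snd st\<bar> ^ p" 1]
      by (simp add: abs_mult power_abs power_le_one)
  qed measurable
  have "(\<integral>st. xi x x' st ^ m / fact m \<partial>N)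
    = (\<integral>st. (\<Sum>(i, q, p)\<in>idx m. (A ^ i / fact i * (B ^ q / fact q) * (C ^ p / fact p)) * (fst st ^ q * snd st ^ p)) \<partial>N)"
    unfolding xi_def A_def[symmetric] B_def[symmetric] C_def[symmetric] trinomial_exp_form
    by (intro Bochner_Integration.integral_cong refl sum.cong) (auto simp: power_mult_distrib)
  also have "\<dots> = (\<Sum>(i, q, p)\<in>idx m. (A ^ i / fact i * (B ^ q / fact q) * (C ^ p / fact p)) * (b1 q * b2 p))"
    unfolding case_prod_beta N_moment[symmetric]
    by (subst Bochner_Integration.integral_sum) (auto intro!: integrable_mult_right int simp del: N_moment)
  also have "\<dots> = kern m x x'"
    unfolding kern_def
  proof (intro sum.cong refl, clarify)
    fix i q p
    show "(A ^ i / fact i * (B ^ q / fact q) * (C ^ p / fact p)) * (b1 q * b2 p)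
      = wt i q p * e i (q div 2) (p div 2) x * e i (q div 2) (p div 2) x'"
    proof (cases "even q \<and> even p")
      case True
      then obtain j k where qp: "q = 2 * j" "p = 2 * k" by (auto elim!: evenE)
      have "B ^ q = Y x ^ j * Y x' ^ j" "C ^ p = Z x ^ k * Z x' ^ k"
        using p unfolding B_def C_def qp by (simp_all add: power_mult power_mult_distrib)
      then show ?thesis unfolding wt_def e_def qp by (simp add: A_def power_mult_distrib)
    qed (auto simp: wt_def b_odd)
  qed
  finally show ?thesis .
qed

text \<open>The image of \<open>e i j k\<close> under the differential operator with eigenvalues \<open>- n * (n + 2 * l)\<close>; wherever an
  exponent is truncated, its coefficient is zero.\<close>

definition DD :: "nat \<Rightarrow> nat \<Rightarrow> nat \<Rightarrow> real \<times> real \<Rightarrow> real" where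
  "DD i j k x = real i * (real i - 1) * e (i - 2) j k x
     + 2 * real j * (2 * real j - 1 + 2 * \<beta>) * e i (j - 1) k x
     + 2 * real k * (2 * real k + 2 * \<gamma>) * e i j (k - 1) x
     - (real i + 2 * real j + 2 * real k) * (real i + 2 * real j + 2 * real k + 2 * l) * e i j k x"

lemma wt_zero: "odd q \<or> odd p \<Longrightarrow> wt i q p = 0"
  by (auto simp: wt_def b_odd)

text \<open>The moment recursions of the two beta measures are tuned so that the coefficients
  produced by \<open>DD\<close> cancel when an exponent is lowered by two.\<close>

lemma wt_shift:
  "wt (i + 2) q p * ((real i + 2) * (real i + 1)) = wt i q p"
  "wt i (q + 2) p * ((real q + 2) * (real q + 1 + 2 * \<beta>)) = wt i q p"
  "wt i q (p + 2) * ((real p + 2) * (real p + 2 + 2 * \<gamma>)) = wt i q p"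
proof -
  have f: "fact (n + 2) = (real n + 2) * ((real n + 1) * fact n)" for n
    by (simp add: algebra_simps)
  have nz: "real n + 2 \<noteq> 0" "real n + 1 \<noteq> 0" for n by simp_all
  show "wt (i + 2) q p * ((real i + 2) * (real i + 1)) = wt i q p"
    unfolding wt_def f using nz by simp
  have "wt i (q + 2) p * ((real q + 2) * (real q + 1 + 2 * \<beta>))
      = (b1 (q + 2) * (real q + 1 + 2 * \<beta>)) * b2 p * (real q + 2) / (fact i * ((real q + 2) * ((real q + 1) * fact q)) * fact p)"
    unfolding wt_def f by (simp only: mult_ac times_divide_eq_right times_divide_eq_left)
  then show "wt i (q + 2) p * ((real q + 2) * (real q + 1 + 2 * \<beta>)) = wt i q p"
    unfolding b_two_step wt_def using nz by simp
  have "wt i q (p + 2) * ((real p + 2) * (real p + 2 + 2 * \<gamma>))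
      = b1 q * (b2 (p + 2) * (real p + 2 + 2 * \<gamma>)) * (real p + 2) / (fact i * fact q * ((real p + 2) * ((real p + 1) * fact p)))"
    unfolding wt_def f by (simp only: mult_ac times_divide_eq_right times_divide_eq_left)
  then show "wt i q (p + 2) * ((real p + 2) * (real p + 2 + 2 * \<gamma>)) = wt i q p"
    unfolding b_two_step wt_def using nz by simp
qed

text \<open>Applied in x', the degree-lowering terms of \<open>DD\<close> produce the kernel of
  degree m - 2 three times, with the factors U^2, Y and Z at the other point x, and these add up to
  1.\<close>

lemma kern_DD:
  "(\<Sum>(i, q, p)\<in>idx m. wt i q p * e i (q div 2) (p div 2) x * DD i (q div 2) (p div 2) x')
    = - (real m * (real m + 2 * l)) * kern m x x' + (if 2 \<le> m then kern (m - 2) x x' else 0)"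
proof -
  define E where "E i q p x = e i (q div 2) (p div 2) x" for i q p x
  define g1 where "g1 i q p = wt i q p * (real i * (real i - 1)) * E i q p x * E (i - 2) q p x'" for i q p
  define g2 where "g2 i q p = wt i q p * (real q * (real q - 1 + 2 * \<beta>)) * E i q p x * E i (q - 2) p x'" for i q p
  define g3 where "g3 i q p = wt i q p * (real p * (real p + 2 * \<gamma>)) * E i q p x * E i q (p - 2) x'" for i q p
  define g4 where "g4 i q p = wt i q p * E i q p x * E i q p x'" for i q p
  have split: "wt i q p * e i (q div 2) (p div 2) x * DD i (q div 2) (p div 2) x'
      = g1 i q p + g2 i q p + g3 i q p - (real m * (real m + 2 * l)) * g4 i q p" if "(i, q, p) \<in> idx m" for i q p
  proof (cases "even q \<and> even p")
    case True
    then have r: "2 * real (q div 2) = real q" "2 * real (p div 2) = real p"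
      by (metis dvd_mult_div_cancel of_nat_mult of_nat_numeral)+
    have d: "q div 2 - 1 = (q - 2) div 2" "p div 2 - 1 = (p - 2) div 2" by presburger+
    have m: "real i + real q + real p = real m" using that by (auto simp: idx_def)
    show ?thesis unfolding DD_def r d m g1_def g2_def g3_def g4_def E_def
      by (simp add: algebra_simps)
  next
    case False
    then have "wt i q p = 0" using wt_zero by blast
    then show ?thesis by (simp add: g1_def g2_def g3_def g4_def)
  qed
  have q0: "wt i q p = 0" if "q = Suc 0" for i q p using that by (simp add: wt_zero)
  have p0: "wt i q p = 0" if "p = Suc 0" for i q p using that by (simp add: wt_zero)
  have s1: "(\<Sum>(i, q, p)\<in>idx m. g1 i q p) = (if 2 \<le> m then (\<Sum>(i, q, p)\<in>idx (m - 2). g1 (i + 2) q p) else 0)"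
    by (rule sum_idx_shift(1)) (auto simp: g1_def less_2_cases_iff)
  have s2: "(\<Sum>(i, q, p)\<in>idx m. g2 i q p) = (if 2 \<le> m then (\<Sum>(i, q, p)\<in>idx (m - 2). g2 i (q + 2) p) else 0)"
    by (rule sum_idx_shift(2)) (auto simp: g2_def less_2_cases_iff q0)
  have s3: "(\<Sum>(i, q, p)\<in>idx m. g3 i q p) = (if 2 \<le> m then (\<Sum>(i, q, p)\<in>idx (m - 2). g3 i q (p + 2)) else 0)"
    by (rule sum_idx_shift(3)) (auto simp: g3_def less_2_cases_iff p0)
  have t1: "g1 (i + 2) q p = (U x)\<^sup>2 * g4 i q p" for i q p
  proof -
    have "g1 (i + 2) q p = (wt (i + 2) q p * ((real i + 2) * (real i + 1))) * E (i + 2) q p x * E i q p x'"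
      by (simp add: g1_def algebra_simps)
    moreover have "E (i + 2) q p x = (U x)\<^sup>2 * E i q p x" by (simp add: E_def e_def power_add power2_eq_square)
    ultimately show ?thesis unfolding wt_shift by (simp add: g4_def)
  qed
  have t2: "g2 i (q + 2) p = Y x * g4 i q p" for i q p
  proof -
    have "g2 i (q + 2) p = (wt i (q + 2) p * ((real q + 2) * (real q + 1 + 2 * \<beta>))) * E i (q + 2) p x * E i q p x'"
      by (simp add: g2_def algebra_simps)
    moreover have "E i (q + 2) p x = Y x * E i q p x" by (simp add: E_def e_def)
    ultimately show ?thesis unfolding wt_shift by (simp add: g4_def)
  qed
  have t3: "g3 i q (p + 2) = Z x * g4 i q p" for i q p
  proof -
    have "g3 i q (p + 2) = (wt i q (p + 2) * ((real p + 2) * (real p + 2 + 2 * \<gamma>))) * E i q (p + 2) x * E i q p x'"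
      by (simp add: g3_def algebra_simps)
    moreover have "E i q (p + 2) x = Z x * E i q p x" by (simp add: E_def e_def)
    ultimately show ?thesis unfolding wt_shift by (simp add: g4_def)
  qed
  have g4: "(\<Sum>(i, q, p)\<in>idx m. g4 i q p) = kern m x x'" for m
    by (simp add: kern_def g4_def E_def)
  have "(\<Sum>(i, q, p)\<in>idx m. wt i q p * e i (q div 2) (p div 2) x * DD i (q div 2) (p div 2) x')
     = (\<Sum>(i, q, p)\<in>idx m. g1 i q p + g2 i q p + g3 i q p - (real m * (real m + 2 * l)) * g4 i q p)"
    by (rule sum.cong) (use split in auto)
  also have "\<dots> = (\<Sum>(i, q, p)\<in>idx m. g1 i q p) + (\<Sum>(i, q, p)\<in>idx m. g2 i q p) + (\<Sum>(i, q, p)\<in>idx m. g3 i q p)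
      - (real m * (real m + 2 * l)) * (\<Sum>(i, q, p)\<in>idx m. g4 i q p)"
    unfolding case_prod_beta by (simp only: sum.distrib sum_subtractf sum_distrib_left)
  also have "\<dots> = (if 2 \<le> m then ((U x)\<^sup>2 + Y x + Z x) * (\<Sum>(i, q, p)\<in>idx (m - 2). g4 i q p) else 0)
      - (real m * (real m + 2 * l)) * kern m x x'"
    unfolding s1 s2 s3 t1 t2 t3 g4[symmetric]
    by (simp add: case_prod_beta sum_distrib_left distrib_right sum.distrib)
  also have "\<dots> = - (real m * (real m + 2 * l)) * kern m x x' + (if 2 \<le> m then kern (m - 2) x x' else 0)"
    unfolding UYZ g4 by simp
  finally show ?thesis .
qed

lemma e_mult: "e i j k x * e i' j' k' x = e (i + i') (j + j') (k + k') x"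
  by (simp add: e_def power_add)

lemma e_integral: "(\<integral>x. e i j k x \<partial>M) = mom i j k"
  by (simp add: e_def mom_def)

lemma e_integrable: "integrable M (e i j k)"
  by (rule PolyE_integrable[OF PolyE_e[OF order_refl]])

text \<open>Let m and m' be the two degrees and \<mu> the common top moment. The top terms differ by
  m (m + 2 l) - m' (m' + 2 l) = (m - m') T with T = m + m' + 2 l, times \<mu>; by the moment
  recursions the lower terms in U, Y, Z differ by i - i', 2 j - 2 j', 2 k - 2 k' times the same T
  \<mu>.\<close>

lemma DD_symmetric: "(\<integral>x. DD i j k x * e i' j' k' x \<partial>M) = (\<integral>x. e i j k x * DD i' j' k' x \<partial>M)"
proof -
  define I J K where "I = i + i'" and "J = j + j'" and "K = k + k'"
  define T where "T = real I + 2 * real J + 2 * real K + 2 * l"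
  define \<mu> where "\<mu> = mom I J K"
  define m m' where "m = real i + 2 * real j + 2 * real k" and "m' = real i' + 2 * real j' + 2 * real k'"
  have tU: "real i * (real i - 1) * mom (i - 2 + i') J K - real i' * (real i' - 1) * mom (i + (i' - 2)) J K
      = (real i - real i') * (T * \<mu>)"
  proof (cases "I \<ge> 2")
    case True
    have h1: "real i * (real i - 1) * mom (i - 2 + i') J K = real i * (real i - 1) * mom (I - 2) J K"
      using True by (cases "i < 2") (auto simp: less_2_cases_iff I_def)
    have h2: "real i' * (real i' - 1) * mom (i + (i' - 2)) J K = real i' * (real i' - 1) * mom (I - 2) J K"
      using True by (cases "i' < 2") (auto simp: less_2_cases_iff I_def)
    have h3: "T * \<mu> = (real I - 1) * mom (I - 2) J K"
      using mom_U[of "I - 2" J K] True le_add_diff_inverse2[OF True]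
      by (simp add: T_def \<mu>_def of_nat_diff add_ac del: add_2_eq_Suc')
    have h4: "real I = real i + real i'" by (simp add: I_def)
    show ?thesis unfolding h1 h2 h3 h4 by (simp add: algebra_simps)
  next
    case False
    \<comment> \<open>The recursion needs I \<ge> 2. For I = 1 the moment is odd and vanishes; for I
      = 0 all coefficients are 0.\<close>
    then have "(i = 0 \<and> i' = 0) \<or> I = 1" by (auto simp: I_def)
    then show ?thesis
    proof
      assume "I = 1"
      then have "\<mu> = 0" by (simp add: \<mu>_def mom_odd)
      moreover have "i < 2" "i' < 2" using \<open>I = 1\<close> by (auto simp: I_def)
      ultimately show ?thesis by (auto simp: less_2_cases_iff)
    qed simp
  qed
  have tY: "2 * real j * (2 * real j - 1 + 2 * \<beta>) * mom I (j - 1 + j') K - 2 * real j' * (2 * real j' - 1 + 2 * \<beta>) * mom I (j + (j' - 1)) K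
      = (2 * real j - 2 * real j') * (T * \<mu>)"
  proof (cases "J \<ge> 1")
    case True
    have h1: "2 * real j * (2 * real j - 1 + 2 * \<beta>) * mom I (j - 1 + j') K = 2 * real j * (2 * real j - 1 + 2 * \<beta>) * mom I (J - 1) K"
      by (cases "j = 0") (auto simp: J_def)
    have h2: "2 * real j' * (2 * real j' - 1 + 2 * \<beta>) * mom I (j + (j' - 1)) K = 2 * real j' * (2 * real j' - 1 + 2 * \<beta>) * mom I (J - 1) K"
      by (cases "j' = 0") (auto simp: J_def)
    have h3: "T * \<mu> = (2 * real J - 1 + 2 * \<beta>) * mom I (J - 1) K"
      using mom_Y[of I "J - 1" K] True by (simp add: T_def \<mu>_def of_nat_diff algebra_simps)
    have h4: "real J = real j + real j'" by (simp add: J_def)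
    show ?thesis unfolding h1 h2 h3 h4 by (simp add: algebra_simps)
  qed (auto simp: J_def not_le)
  have tZ: "2 * real k * (2 * real k + 2 * \<gamma>) * mom I J (k - 1 + k') - 2 * real k' * (2 * real k' + 2 * \<gamma>) * mom I J (k + (k' - 1))
      = (2 * real k - 2 * real k') * (T * \<mu>)"
  proof (cases "K \<ge> 1")
    case True
    have h1: "2 * real k * (2 * real k + 2 * \<gamma>) * mom I J (k - 1 + k') = 2 * real k * (2 * real k + 2 * \<gamma>) * mom I J (K - 1)"
      by (cases "k = 0") (auto simp: K_def)
    have h2: "2 * real k' * (2 * real k' + 2 * \<gamma>) * mom I J (k + (k' - 1)) = 2 * real k' * (2 * real k' + 2 * \<gamma>) * mom I J (K - 1)"
      by (cases "k' = 0") (auto simp: K_def)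
    have h3: "T * \<mu> = (2 * real K + 2 * \<gamma>) * mom I J (K - 1)"
      using mom_Z[of I J "K - 1"] True by (simp add: T_def \<mu>_def of_nat_diff algebra_simps)
    have h4: "real K = real k + real k'" by (simp add: K_def)
    show ?thesis unfolding h1 h2 h3 h4 by (simp add: algebra_simps)
  qed (auto simp: K_def not_le)
  have "DD i j k x * e i' j' k' x = real i * (real i - 1) * e (i - 2 + i') J K x
     + 2 * real j * (2 * real j - 1 + 2 * \<beta>) * e I (j - 1 + j') K x
     + 2 * real k * (2 * real k + 2 * \<gamma>) * e I J (k - 1 + k') x - m * (m + 2 * l) * e I J K x" for x
    unfolding DD_def m_def I_def J_def K_def by (simp only: e_mult[symmetric] ring_distribs mult.assoc)
  then have L: "(\<integral>x. DD i j k x * e i' j' k' x \<partial>M) = real i * (real i - 1) * mom (i - 2 + i') J K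
     + 2 * real j * (2 * real j - 1 + 2 * \<beta>) * mom I (j - 1 + j') K
     + 2 * real k * (2 * real k + 2 * \<gamma>) * mom I J (k - 1 + k') - m * (m + 2 * l) * \<mu>"
    by (simp add: e_integrable e_integral \<mu>_def)
  have "e i j k x * DD i' j' k' x = real i' * (real i' - 1) * e (i + (i' - 2)) J K x
     + 2 * real j' * (2 * real j' - 1 + 2 * \<beta>) * e I (j + (j' - 1)) K x
     + 2 * real k' * (2 * real k' + 2 * \<gamma>) * e I J (k + (k' - 1)) x - m' * (m' + 2 * l) * e I J K x" for x
    unfolding DD_def m'_def I_def J_def K_def by (simp add: e_mult[symmetric] algebra_simps)
  then have R: "(\<integral>x. e i j k x * DD i' j' k' x \<partial>M) = real i' * (real i' - 1) * mom (i + (i' - 2)) J K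
     + 2 * real j' * (2 * real j' - 1 + 2 * \<beta>) * mom I (j + (j' - 1)) K
     + 2 * real k' * (2 * real k' + 2 * \<gamma>) * mom I J (k + (k' - 1)) - m' * (m' + 2 * l) * \<mu>"
    by (simp add: e_integrable e_integral \<mu>_def)
  have "T = m + m' + 2 * l" by (simp add: T_def m_def m'_def I_def J_def K_def)
  then have "(real i - real i') * (T * \<mu>) + (2 * real j - 2 * real j') * (T * \<mu>) + (2 * real k - 2 * real k') * (T * \<mu>)
      = m * (m + 2 * l) * \<mu> - m' * (m' + 2 * l) * \<mu>"
    by (simp add: m_def m'_def algebra_simps)
  then show ?thesis unfolding L R using tU tY tZ by linarith
qed

text \<open>The polynomial \<open>Zp l n\<close> with x^m / m! replaced by its average. In this form
  it is visibly polynomial in both points on the whole plane, which the square roots in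
  \<open>xi\<close> would hide.\<close>

definition Zk :: "nat \<Rightarrow> real \<times> real \<Rightarrow> real \<times> real \<Rightarrow> real" where
  "Zk n x x' = (\<Sum>m\<le>n. zc l n m * kern m x x')"

lemma e_half_PolyE: "(i, q, p) \<in> idx m \<Longrightarrow> m \<le> n \<Longrightarrow> e i (q div 2) (p div 2) \<in> PolyE n"
  by (rule PolyE_e) (auto simp: idx_def)

lemma Zk_expand:
  "Zk n x x' = (\<Sum>m\<le>n. \<Sum>t\<in>idx m. zc l n m * (case t of (i, q, p) \<Rightarrow> wt i q p * e i (q div 2) (p div 2) x)
     * (case t of (i, q, p) \<Rightarrow> e i (q div 2) (p div 2) x'))"
  unfolding Zk_def kern_def sum_distrib_left by (intro sum.cong refl) (simp add: case_prod_beta mult.assoc)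

lemma Zk_PolyE: "Zk n x \<in> PolyE n"
proof -
  have "(\<lambda>x'. \<Sum>m\<le>n. \<Sum>t\<in>idx m. zc l n m * (case t of (i, q, p) \<Rightarrow> wt i q p * e i (q div 2) (p div 2) x)
     * (case t of (i, q, p) \<Rightarrow> e i (q div 2) (p div 2) x')) \<in> PolyE n"
  proof (intro PolyE_sum PolyE_cmult)
    fix m t assume "m \<in> {..n}" "t \<in> idx m"
    then show "(\<lambda>x'. case t of (i, q, p) \<Rightarrow> e i (q div 2) (p div 2) x') \<in> PolyE n"
      using e_half_PolyE by (cases t) auto
  qed
  then show ?thesis unfolding Zk_expand[symmetric] by simp
qed

lemma Zk_integral:
  assumes x: "x \<in> \<Lambda>" "x' \<in> \<Lambda>"
  shows "Zk n x x' = (\<integral>st. Zp l n (xi x x' st) \<partial>N)"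
proof -
  have int: "integrable N (\<lambda>st. xi x x' st ^ m / fact m)" for m
  proof (rule N_integrable[where B = 1])
    fix st :: "real \<times> real" assume "\<bar>fst st\<bar> \<le> 1" "\<bar>snd st\<bar> \<le> 1"
    then have "\<bar>xi x x' st\<bar> ^ m \<le> 1" by (intro power_le_one abs_xi_le x) auto
    moreover have "(1::real) \<le> fact m" by (rule fact_ge_1)
    ultimately have "\<bar>xi x x' st\<bar> ^ m \<le> fact m" by (rule order_trans)
    then show "\<bar>xi x x' st ^ m / fact m\<bar> \<le> 1"
      by (simp add: power_abs divide_le_eq abs_divide)
  qed measurable
  have "(\<integral>st. Zp l n (xi x x' st) \<partial>N) = (\<integral>st. (\<Sum>m\<le>n. zc l n m * (xi x x' st ^ m / fact m)) \<partial>N)"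
    unfolding Zp_def by simp
  also have "\<dots> = (\<Sum>m\<le>n. (\<integral>st. zc l n m * (xi x x' st ^ m / fact m) \<partial>N))"
    by (rule Bochner_Integration.integral_sum) (rule integrable_mult_right[OF int])
  also have "\<dots> = (\<Sum>m\<le>n. zc l n m * (\<integral>st. xi x x' st ^ m / fact m \<partial>N))"
    by (simp only: integral_mult_right_zero)
  finally show ?thesis unfolding kern_integral[OF x] Zk_def ..
qed

text \<open>After a shift by two, \<open>zc_two_step\<close> lets the lower terms of
  \<open>kern_DD\<close> replace the eigenvalue of m by that of n in every summand. The sum may be
  extended to n + 2 because \<open>zc\<close> vanishes there.\<close>

lemma Zk_DD:
  "(\<Sum>m\<le>n. \<Sum>t\<in>idx m. zc l n m * (case t of (i, q, p) \<Rightarrow> wt i q p * e i (q div 2) (p div 2) x)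
     * (case t of (i, q, p) \<Rightarrow> DD i (q div 2) (p div 2) x'))
   = - (real n * (real n + 2 * l)) * Zk n x x'"
proof -
  define h where "h m = (if 2 \<le> m then zc l n m * kern (m - 2) x x' else 0)" for m
  have "(\<Sum>m\<le>n. \<Sum>t\<in>idx m. zc l n m * (case t of (i, q, p) \<Rightarrow> wt i q p * e i (q div 2) (p div 2) x)
     * (case t of (i, q, p) \<Rightarrow> DD i (q div 2) (p div 2) x'))
    = (\<Sum>m\<le>n. zc l n m * (\<Sum>(i, q, p)\<in>idx m. wt i q p * e i (q div 2) (p div 2) x * DD i (q div 2) (p div 2) x'))"
    unfolding sum_distrib_left by (intro sum.cong refl) (simp add: case_prod_beta mult.assoc)
  also have "\<dots> = (\<Sum>m\<le>n. - (real m * (real m + 2 * l)) * zc l n m * kern m x x') + (\<Sum>m\<le>n. h m)"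
    unfolding kern_DD sum.distrib[symmetric] h_def by (intro sum.cong refl) (simp add: algebra_simps)
  also have "(\<Sum>m\<le>n. h m) = (\<Sum>m\<le>Suc (Suc n). h m)"
    by (simp add: h_def zc_eq_0)
  also have "\<dots> = (\<Sum>m\<le>n. h (Suc (Suc m)))"
    by (simp only: sum.atMost_Suc_shift) (simp add: h_def)
  also have "\<dots> = (\<Sum>m\<le>n. (real m * (real m + 2 * l) - real n * (real n + 2 * l)) * zc l n m * kern m x x')"
    by (intro sum.cong refl) (use zc_two_step[of l n] in \<open>simp add: h_def\<close>)
  also have "(\<Sum>m\<le>n. - (real m * (real m + 2 * l)) * zc l n m * kern m x x') + \<dots>
      = (\<Sum>m\<le>n. - (real n * (real n + 2 * l)) * (zc l n m * kern m x x'))"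
    unfolding sum.distrib[symmetric] by (intro sum.cong refl) (simp add: algebra_simps)
  finally show ?thesis by (simp only: Zk_def sum_distrib_left)
qed

lemma DD_PolyE: "DD i j k \<in> PolyE (i + 2 * j + 2 * k)"
  unfolding DD_def[abs_def]
  by (intro PolyE_diff PolyE_add PolyE_cmult PolyE_e) auto

lemma PolyE_integrable_mult: "f \<in> PolyE n \<Longrightarrow> g \<in> PolyE m \<Longrightarrow> integrable M (\<lambda>x. f x * g x)"
  by (rule PolyE_integrable[OF PolyE_mult])

lemma Zk_pair_DD:
  "(\<integral>x'. Zk n x x' * DD i j k x' \<partial>M) = - (real n * (real n + 2 * l)) * (\<integral>x'. Zk n x x' * e i j k x' \<partial>M)"
proof -
  define K where "K m t = zc l n m * (case t of (i, q, p) \<Rightarrow> wt i q p * e i (q div 2) (p div 2) x)" for m and t :: "nat \<times> nat \<times> nat"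
  define E where "E t = (case t of (i, q, p) \<Rightarrow> e i (q div 2) (p div 2))" for t :: "nat \<times> nat \<times> nat"
  define F where "F t = (case t of (i, q, p) \<Rightarrow> DD i (q div 2) (p div 2))" for t :: "nat \<times> nat \<times> nat"
  have Z: "Zk n x x' = (\<Sum>m\<le>n. \<Sum>t\<in>idx m. K m t * E t x')" for x'
    unfolding Zk_expand K_def E_def by (intro sum.cong refl) (simp add: case_prod_beta)
  have ZF: "(\<Sum>m\<le>n. \<Sum>t\<in>idx m. K m t * F t x') = - (real n * (real n + 2 * l)) * Zk n x x'" for x'
    unfolding Zk_DD[symmetric] K_def F_def by (intro sum.cong refl) (simp add: case_prod_beta)
  have iE: "integrable M (\<lambda>x'. E t x' * DD i j k x')" and iF: "integrable M (\<lambda>x'. F t x' * e i j k x')"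
    and s: "(\<integral>x'. E t x' * DD i j k x' \<partial>M) = (\<integral>x'. F t x' * e i j k x' \<partial>M)" for t
    unfolding E_def F_def case_prod_beta
    by (rule PolyE_integrable_mult[OF PolyE_e[OF order_refl] DD_PolyE]
        PolyE_integrable_mult[OF DD_PolyE PolyE_e[OF order_refl]] DD_symmetric[symmetric])+
  have "(\<integral>x'. Zk n x x' * DD i j k x' \<partial>M) = (\<Sum>m\<le>n. \<Sum>t\<in>idx m. K m t * (\<integral>x'. E t x' * DD i j k x' \<partial>M))"
    unfolding Z sum_distrib_right mult.assoc
    by (simp add: iE)
  also have "\<dots> = (\<integral>x'. (\<Sum>m\<le>n. \<Sum>t\<in>idx m. K m t * F t x') * e i j k x' \<partial>M)"
    unfolding s sum_distrib_right mult.assoc by (simp add: iF)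
  finally show ?thesis unfolding ZF mult.assoc by simp
qed

text \<open>The pairing of \<open>Zk\<close> with \<open>DD i j 0\<close> is computed twice: by
  symmetry with the eigenvalue of n, by definition with that of the degree m < n plus lower terms,
  which vanish inductively. The eigenvalues differ, so the integral is 0. Powers of Z are omitted
  because U and Y generate all even polynomials.\<close>

lemma Zk_orth_e: "i + 2 * j < n \<Longrightarrow> (\<integral>x'. Zk n x x' * e i j 0 x' \<partial>M) = 0"
proof (induction "i + 2 * j" arbitrary: i j rule: less_induct)
  case less
  define m where "m = real i + 2 * real j"
  have int: "integrable M (\<lambda>x'. Zk n x x' * e i j k x')" for i j k
    by (rule PolyE_integrable_mult[OF Zk_PolyE PolyE_e[OF order_refl]])
  have z1: "real i * (real i - 1) * (\<integral>x'. Zk n x x' * e (i - 2) j 0 x' \<partial>M) = 0"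
  proof (cases "i < 2")
    case False
    then show ?thesis using less(1)[of "i - 2" j] less(2) by simp
  qed (auto simp: less_2_cases_iff)
  have z2: "2 * real j * (2 * real j - 1 + 2 * \<beta>) * (\<integral>x'. Zk n x x' * e i (j - 1) 0 x' \<partial>M) = 0"
  proof (cases "j = 0")
    case False
    then show ?thesis using less(1)[of i "j - 1"] less(2) by simp
  qed simp
  have "(\<integral>x'. Zk n x x' * DD i j 0 x' \<partial>M)
     = (\<integral>x'. (real i * (real i - 1)) * (Zk n x x' * e (i - 2) j 0 x')
       + (2 * real j * (2 * real j - 1 + 2 * \<beta>)) * (Zk n x x' * e i (j - 1) 0 x')
       - (m * (m + 2 * l)) * (Zk n x x' * e i j 0 x') \<partial>M)"
    by (intro Bochner_Integration.integral_cong refl) (simp add: DD_def m_def algebra_simps)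
  also have "\<dots> = real i * (real i - 1) * (\<integral>x'. Zk n x x' * e (i - 2) j 0 x' \<partial>M)
       + 2 * real j * (2 * real j - 1 + 2 * \<beta>) * (\<integral>x'. Zk n x x' * e i (j - 1) 0 x' \<partial>M)
       - m * (m + 2 * l) * (\<integral>x'. Zk n x x' * e i j 0 x' \<partial>M)"
    by (simp add: int)
  finally have "- (real n * (real n + 2 * l)) * (\<integral>x'. Zk n x x' * e i j 0 x' \<partial>M)
      = - (m * (m + 2 * l)) * (\<integral>x'. Zk n x x' * e i j 0 x' \<partial>M)"
    unfolding Zk_pair_DD z1 z2 by simp
  moreover have "m * (m + 2 * l) < real n * (real n + 2 * l)"
  proof -
    have m: "0 \<le> m" "m < real n" using less(2) by (simp_all add: m_def)
    then have "m * (m + 2 * l) \<le> m * (real n + 2 * l)" by (intro mult_left_mono) auto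
    also have "\<dots> < real n * (real n + 2 * l)" using m l_pos by (intro mult_strict_right_mono) auto
    finally show ?thesis .
  qed
  ultimately show ?case by simp
qed

lemma snd_sq: "(snd x)\<^sup>2 = (b - a) * Y x + a + (c - a) * (U x)\<^sup>2"
  using ab by (simp add: Y_def U_def field_simps)

text \<open>Powers of v^2 are traded one by one for Y, 1 and U^2 without raising the degree, which
  leads from \<open>e i k 0\<close> to ordinary monomials.\<close>

lemma Zk_orth_mixed:
  "i + 2 * k + 2 * j < n \<Longrightarrow> (\<integral>x'. Zk n x x' * (e i k 0 x' * snd x' ^ (2 * j)) \<partial>M) = 0"
proof (induction j arbitrary: i k)
  case 0
  then show ?case using Zk_orth_e[of i k n x] by simp
next
  case (Suc j)
  have int: "integrable M (\<lambda>x'. Zk n x x' * (e i k 0 x' * snd x' ^ (2 * j)))" for i k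
    by (intro integrable_M_continuous continuous_intros PolyE_continuous[OF Zk_PolyE]
        PolyE_continuous[OF PolyE_e[OF order_refl]])
  have eq: "e i k 0 x' * snd x' ^ (2 * Suc j)
      = (b - a) * (e i (k + 1) 0 x' * snd x' ^ (2 * j)) + a * (e i k 0 x' * snd x' ^ (2 * j))
        + (c - a) * (e (i + 2) k 0 x' * snd x' ^ (2 * j))" for x'
  proof -
    have "snd x' ^ (2 * Suc j) = (snd x')\<^sup>2 * snd x' ^ (2 * j)" by (simp add: power2_eq_square)
    then have eq: "snd x' ^ (2 * Suc j) = ((b - a) * Y x' + a + (c - a) * (U x')\<^sup>2) * snd x' ^ (2 * j)"
      unfolding snd_sq .
    show ?thesis unfolding eq by (simp add: e_def algebra_simps power2_eq_square)
  qed
  have "(\<integral>x'. Zk n x x' * (e i k 0 x' * snd x' ^ (2 * Suc j)) \<partial>M)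
    = (\<integral>x'. (b - a) * (Zk n x x' * (e i (k + 1) 0 x' * snd x' ^ (2 * j))) + a * (Zk n x x' * (e i k 0 x' * snd x' ^ (2 * j)))
        + (c - a) * (Zk n x x' * (e (i + 2) k 0 x' * snd x' ^ (2 * j))) \<partial>M)"
    unfolding eq by (intro Bochner_Integration.integral_cong refl) (simp add: algebra_simps)
  also have "\<dots> = 0"
    using Suc.prems by (simp add: int Suc.IH)
  finally show ?case .
qed

lemma Zk_orth:
  assumes "Q \<in> PolyE m" "m < n"
  shows "(\<integral>x'. Zk n x x' * Q x' \<partial>M) = 0"
  using assms(1)
proof (induction Q rule: PolyE_induct)
  case (mono i j)
  then show ?case using Zk_orth_mixed[of i 0 j n x] assms(2) by (simp add: e_def U_def)
next
  case (add f g)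
  then show ?case using PolyE_integrable_mult[OF Zk_PolyE add(1), of n x] PolyE_integrable_mult[OF Zk_PolyE add(2), of n x]
    by (simp add: distrib_left)
next
  case (cmult k f)
  have "(\<integral>x'. Zk n x x' * (k * f x') \<partial>M) = k * (\<integral>x'. Zk n x x' * f x' \<partial>M)"
    by (simp add: mult.left_commute)
  then show ?case using cmult by simp
qed simp

section \<open>Projections as integral operators\<close>

definition T :: "nat \<Rightarrow> (real \<times> real \<Rightarrow> real) \<Rightarrow> real \<times> real \<Rightarrow> real" where
  "T n h x = (\<integral>x'. Zk n x x' * h x' \<partial>M) / mass"

text \<open>Just enough for the integrals defining T n h to exist for all n; \<open>fracop\<close>
  guarantees it for the image function without placing that function in L^p for the p at
  hand.\<close>

definition mint :: "(real \<times> real \<Rightarrow> real) \<Rightarrow> bool" where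
  "mint h \<longleftrightarrow> h \<in> borel_measurable M \<and> (\<forall>m. \<forall>P\<in>PolyE m. integrable M (\<lambda>x. h x * P x))"

lemma mint_integrable: "mint h \<Longrightarrow> P \<in> PolyE m \<Longrightarrow> integrable M (\<lambda>x. P x * h x)"
  unfolding mint_def by (subst mult.commute) blast

lemma mint_continuous: "continuous_on \<Lambda> h \<Longrightarrow> mint h"
  unfolding mint_def
  by (blast intro: measurable_M_continuous integrable_M_continuous continuous_on_mult PolyE_continuous)

lemma mint_PolyE: "h \<in> PolyE n \<Longrightarrow> mint h"
  by (intro mint_continuous PolyE_continuous)

lemma T_add: "mint g \<Longrightarrow> mint h \<Longrightarrow> T n (\<lambda>x. g x + h x) x = T n g x + T n h x"
  unfolding T_def distrib_left
  by (subst Bochner_Integration.integral_add) (auto intro: mint_integrable Zk_PolyE simp: add_divide_distrib)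

lemma T_diff: "mint g \<Longrightarrow> mint h \<Longrightarrow> T n (\<lambda>x. g x - h x) x = T n g x - T n h x"
  unfolding T_def right_diff_distrib
  by (subst Bochner_Integration.integral_diff) (auto intro: mint_integrable Zk_PolyE simp: diff_divide_distrib)

lemma T_cmult: "T n (\<lambda>x. k * h x) x = k * T n h x"
  unfolding T_def by (simp add: mult.left_commute)

text \<open>Separates the variables: T n h becomes visibly a polynomial on the whole plane, with
  integrals of h in its coefficients.\<close>

lemma T_expand:
  assumes h: "mint h"
  shows "T n h x = (\<Sum>m\<le>n. \<Sum>t\<in>idx m. (case t of (i, q, p) \<Rightarrow> zc l n m * wt i q p / mass * (\<integral>x'. e i (q div 2) (p div 2) x' * h x' \<partial>M))
     * (case t of (i, q, p) \<Rightarrow> e i (q div 2) (p div 2) x))"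
proof -
  have int: "integrable M (\<lambda>x'. e i j k x' * h x')" for i j k
    by (rule mint_integrable[OF h PolyE_e[OF order_refl]])
  have "(\<integral>x'. Zk n x x' * h x' \<partial>M) = (\<Sum>m\<le>n. \<Sum>t\<in>idx m. zc l n m * ((case t of (i, q, p) \<Rightarrow> wt i q p * e i (q div 2) (p div 2) x)
     * (\<integral>x'. (case t of (i, q, p) \<Rightarrow> e i (q div 2) (p div 2) x') * h x' \<partial>M)))"
    unfolding Zk_expand sum_distrib_right case_prod_beta mult.assoc
    by (simp only: Bochner_Integration.integral_sum Bochner_Integration.integrable_sum integrable_mult_right int integral_mult_right_zero)
  then show ?thesis unfolding T_def
    by (simp only: sum_divide_distrib) (intro sum.cong refl, simp add: case_prod_beta)
qed

lemma T_PolyE: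
  assumes h: "mint h"
  shows "T n h \<in> PolyE n"
proof -
  have "(\<lambda>x. \<Sum>m\<le>n. \<Sum>t\<in>idx m. (case t of (i, q, p) \<Rightarrow> zc l n m * wt i q p / mass * (\<integral>x'. e i (q div 2) (p div 2) x' * h x' \<partial>M))
     * (case t of (i, q, p) \<Rightarrow> e i (q div 2) (p div 2) x)) \<in> PolyE n"
  proof (intro PolyE_sum PolyE_cmult)
    fix m t assume "m \<in> {..n}" "t \<in> idx m"
    then show "(\<lambda>x'. case t of (i, q, p) \<Rightarrow> e i (q div 2) (p div 2) x') \<in> PolyE n"
      using e_half_PolyE by (cases t) auto
  qed
  then show ?thesis unfolding T_expand[OF h, symmetric] by simp
qed

text \<open>The kernel is a sum of products of the same functions in x and x'; after
  \<open>T_expand\<close> both sides are one finite sum of products of integrals, so no Fubini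
  argument is involved.\<close>

lemma T_pair:
  assumes h: "mint h" and P: "P \<in> PolyE m"
  shows "(\<integral>x. T n h x * P x \<partial>M) = (\<integral>x. h x * T n P x \<partial>M)"
proof -
  define K where "K i t = (case t of (j, q, p) \<Rightarrow> zc l n i * wt j q p / mass)" for i and t :: "nat \<times> nat \<times> nat"
  define E where "E t = (case t of (i, q, p) \<Rightarrow> e i (q div 2) (p div 2))" for t :: "nat \<times> nat \<times> nat"
  have T: "T n g x = (\<Sum>i\<le>n. \<Sum>t\<in>idx i. K i t * (\<integral>x'. E t x' * g x' \<partial>M) * E t x)" if "mint g" for g x
    unfolding T_expand[OF that] K_def E_def by (intro sum.cong refl) (simp add: case_prod_beta)
  have E: "E t \<in> PolyE (fst t + fst (snd t) + snd (snd t))" for t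
    unfolding E_def by (cases t) (auto intro!: PolyE_e)
  have iP: "integrable M (\<lambda>x. E t x * P x)" for t by (rule PolyE_integrable_mult[OF E P])
  have ih: "integrable M (\<lambda>x. E t x * h x)" for t by (rule mint_integrable[OF h E])
  have "(\<integral>x. T n h x * P x \<partial>M) = (\<Sum>i\<le>n. \<Sum>t\<in>idx i. K i t * (\<integral>x'. E t x' * h x' \<partial>M) * (\<integral>x. E t x * P x \<partial>M))"
    unfolding T[OF h] sum_distrib_right mult.assoc by (simp add: iP)
  moreover have "(\<integral>x. h x * T n P x \<partial>M) = (\<Sum>i\<le>n. \<Sum>t\<in>idx i. K i t * (\<integral>x'. E t x' * P x' \<partial>M) * (\<integral>x. E t x * h x \<partial>M))"
    unfolding T[OF mint_PolyE[OF P]] mult.commute[of "h _"] sum_distrib_right mult.assoc by (simp add: ih)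
  ultimately show ?thesis by (simp add: mult_ac)
qed

lemma T_low_degree: "Q \<in> PolyE m \<Longrightarrow> m < n \<Longrightarrow> T n Q x = 0"
  unfolding T_def by (simp add: Zk_orth)

section \<open>Poisson integrals\<close>

definition Pk :: "real \<Rightarrow> real \<times> real \<Rightarrow> real \<times> real \<Rightarrow> real" where
  "Pk r x x' = (\<integral>st. pk l r (xi x x' st) \<partial>N)"

lemma measurable_pk [measurable]: "pk l r \<in> borel_measurable borel"
  unfolding pk_def[abs_def] by measurable

lemma measurable_Zp [measurable]: "Zp l k \<in> borel_measurable borel"
  unfolding Zp_def[abs_def] by measurable

lemma pk_xi_integrable:
  assumes "x \<in> \<Lambda>" "x' \<in> \<Lambda>" "0 \<le> r" "r < 1"
  shows "integrable N (\<lambda>st. pk l r (xi x x' st))"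
proof (rule N_integrable)
  fix st :: "real \<times> real" assume "\<bar>fst st\<bar> \<le> 1" "\<bar>snd st\<bar> \<le> 1"
  then have "\<bar>xi x x' st\<bar> \<le> 1" by (intro abs_xi_le assms)
  then show "\<bar>pk l r (xi x x' st)\<bar> \<le> ((1 - r)\<^sup>2) powr (- (l + 1))"
    using pk_le[OF l_pos _ assms(3,4)] pk_pos[OF _ assms(3,4)] by simp
qed measurable

lemma Zp_xi_integrable:
  assumes "x \<in> \<Lambda>" "x' \<in> \<Lambda>"
  shows "integrable N (\<lambda>st. Zp l k (xi x x' st))"
proof -
  have "(0 :: real) < 1/2" "1/2 < (1 :: real)" by simp_all
  note h = this
  obtain B where B: "\<And>x k. \<bar>x\<bar> \<le> 1 \<Longrightarrow> \<bar>Zp l k x\<bar> \<le> B / (1/2) ^ k"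
    by (rule Zp_growth[OF l_pos h]) blast
  show ?thesis
    by (rule N_integrable[where B = "B / (1/2) ^ k"]) (use B abs_xi_le[OF assms] in auto)
qed

lemma Pk_nonneg:
  assumes "x \<in> \<Lambda>" "x' \<in> \<Lambda>" "0 \<le> r" "r < 1"
  shows "0 \<le> Pk r x x'"
proof -
  have "(\<integral>st. 0 \<partial>N) \<le> Pk r x x'" unfolding Pk_def
    by (rule N_integral_mono[OF _ pk_xi_integrable[OF assms]]) (use abs_xi_le assms pk_pos in auto)
  then show ?thesis by simp
qed

lemma Pk_le:
  assumes "x \<in> \<Lambda>" "x' \<in> \<Lambda>" "0 \<le> r" "r < 1"
    and B: "\<And>st. \<bar>fst st\<bar> \<le> 1 \<Longrightarrow> \<bar>snd st\<bar> \<le> 1 \<Longrightarrow> pk l r (xi x x' st) \<le> B"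
  shows "Pk r x x' \<le> B"
proof -
  have "Pk r x x' \<le> (\<integral>st. B \<partial>N)" unfolding Pk_def
    by (rule N_integral_mono[OF pk_xi_integrable[OF assms(1-4)]])
      (use B finite_measure.integrable_const[OF prob_space.finite_measure[OF prob_space_N]] in auto)
  then show ?thesis using prob_space.prob_space[OF prob_space_N] by simp
qed

lemma Pk_bound:
  assumes "x \<in> \<Lambda>" "x' \<in> \<Lambda>" "0 \<le> r" "r < 1"
  shows "Pk r x x' \<le> ((1 - r)\<^sup>2) powr (- (l + 1))"
  by (rule Pk_le[OF assms]) (use pk_le[OF l_pos] abs_xi_le assms in auto)

lemma Pk_sym: "Pk r x x' = Pk r x' x"
  unfolding Pk_def xi_def by (simp add: mult.commute)

text \<open>The tail bound for \<open>pk\<close> is uniform in its argument, hence survives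
  averaging. Its uniformity yields joint measurability and the exchange of series and
  integral.\<close>

lemma Pk_tail:
  assumes r: "0 \<le> r" "r < 1"
  obtains \<epsilon> where "\<epsilon> \<longlonglongrightarrow> 0"
    "\<And>x x' L. x \<in> \<Lambda> \<Longrightarrow> x' \<in> \<Lambda> \<Longrightarrow> \<bar>Pk r x x' - (\<Sum>k<L. r ^ k * Zk k x x')\<bar> \<le> \<epsilon> L"
proof -
  obtain \<epsilon> where e: "\<epsilon> \<longlonglongrightarrow> 0"
    "\<And>x L. \<bar>x\<bar> \<le> 1 \<Longrightarrow> \<bar>pk l r x - (\<Sum>k<L. r ^ k * Zp l k x)\<bar> \<le> \<epsilon> L"
    by (rule pk_uniform_tail[OF l_pos r]) blast
  show ?thesis
  proof (rule that[OF e(1)])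
    fix x x' L assume x: "x \<in> \<Lambda>" "x' \<in> \<Lambda>"
    have "(\<Sum>k<L. r ^ k * Zk k x x') = (\<integral>st. (\<Sum>k<L. r ^ k * Zp l k (xi x x' st)) \<partial>N)"
      unfolding Zk_integral[OF x] by (simp add: Zp_xi_integrable[OF x])
    then have eq: "Pk r x x' - (\<Sum>k<L. r ^ k * Zk k x x')
      = (\<integral>st. pk l r (xi x x' st) - (\<Sum>k<L. r ^ k * Zp l k (xi x x' st)) \<partial>N)"
      unfolding Pk_def by (simp add: pk_xi_integrable[OF x r] Zp_xi_integrable[OF x])
    have "\<bar>Pk r x x' - (\<Sum>k<L. r ^ k * Zk k x x')\<bar> \<le> (\<integral>st. \<epsilon> L \<partial>N)"
      unfolding eq by (rule N_abs_integral_le)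
        (use e(2) abs_xi_le[OF x] pk_xi_integrable[OF x r] Zp_xi_integrable[OF x]
          finite_measure.integrable_const[OF prob_space.finite_measure[OF prob_space_N]] in auto)
    then show "\<bar>Pk r x x' - (\<Sum>k<L. r ^ k * Zk k x x')\<bar> \<le> \<epsilon> L"
      using prob_space.prob_space[OF prob_space_N] by simp
  qed
qed

text \<open>The bound of \<open>ces_kernel_bound\<close> is pointwise with a positive majorant and
  so survives averaging as well.\<close>

lemma ces_kernel_le:
  assumes x: "x \<in> \<Lambda>" "x' \<in> \<Lambda>" and d: "2 * l + 4 \<le> real d"
  shows "\<bar>\<Sum>k\<le>n. ces d n k * Zk k x x'\<bar> \<le> cker l * (real n + 1) ^ d * Pk (real n / (real n + 1)) x x'"
proof -
  have r: "0 \<le> real n / (real n + 1)" "real n / (real n + 1) < 1" by (auto simp: field_simps)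
  have eq: "(\<Sum>k\<le>n. ces d n k * Zk k x x') = (\<integral>st. (\<Sum>k\<le>n. ces d n k * Zp l k (xi x x' st)) \<partial>N)"
    unfolding Zk_integral[OF x] by (simp add: Zp_xi_integrable[OF x])
  have "\<bar>\<integral>st. (\<Sum>k\<le>n. ces d n k * Zp l k (xi x x' st)) \<partial>N\<bar> \<le> (\<integral>st. cker l * (real n + 1) ^ d * pk l (real n / (real n + 1)) (xi x x' st) \<partial>N)"
    by (rule N_abs_integral_le)
      (use ces_kernel_bound[OF l_pos _ d] abs_xi_le[OF x] pk_xi_integrable[OF x r] Zp_xi_integrable[OF x] in auto)
  then show ?thesis unfolding eq Pk_def by simp
qed

lemma measurable_Zk_pair: "(\<lambda>p. Zk k (fst p) (snd p)) \<in> borel_measurable (M \<Otimes>\<^sub>M M)"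
proof -
  have [measurable]: "e i j k \<in> borel_measurable M" for i j k
    by (rule measurable_M[OF PolyE_measurable[OF PolyE_e[OF order_refl]]])
  show ?thesis unfolding Zk_def kern_def case_prod_beta by measurable
qed

text \<open>A limit of polynomial kernels, so that measurability of the parameter integral in
  \<open>Pk\<close> is never addressed directly.\<close>

lemma measurable_Pk_pair:
  assumes r: "0 \<le> r" "r < 1"
  shows "(\<lambda>p. Pk r (fst p) (snd p)) \<in> borel_measurable (M \<Otimes>\<^sub>M M)"
proof -
  obtain \<epsilon> where e: "\<epsilon> \<longlonglongrightarrow> 0"
    "\<And>x x' L. x \<in> \<Lambda> \<Longrightarrow> x' \<in> \<Lambda> \<Longrightarrow> \<bar>Pk r x x' - (\<Sum>k<L. r ^ k * Zk k x x')\<bar> \<le> \<epsilon> L"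
    by (rule Pk_tail[OF r]) blast
  show ?thesis
  proof (rule borel_measurable_LIMSEQ_real)
    show "(\<lambda>p. \<Sum>k<L. r ^ k * Zk k (fst p) (snd p)) \<in> borel_measurable (M \<Otimes>\<^sub>M M)" for L
      using measurable_Zk_pair by measurable
    fix p assume "p \<in> space (M \<Otimes>\<^sub>M M)"
    then have p: "fst p \<in> \<Lambda>" "snd p \<in> \<Lambda>" by (auto simp: space_pair_measure)
    have "(\<lambda>L. Pk r (fst p) (snd p) - (\<Sum>k<L. r ^ k * Zk k (fst p) (snd p))) \<longlonglongrightarrow> 0"
      by (rule Lim_null_comparison[OF _ e(1)]) (use e(2)[OF p] in auto)
    from tendsto_diff[OF tendsto_const[of "Pk r (fst p) (snd p)"] this]
    show "(\<lambda>L. \<Sum>k<L. r ^ k * Zk k (fst p) (snd p)) \<longlonglongrightarrow> Pk r (fst p) (snd p)" by simp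
  qed
qed

lemma measurable_Pk:
  assumes r: "0 \<le> r" "r < 1" and x: "x \<in> \<Lambda>"
  shows "Pk r x \<in> borel_measurable M"
proof -
  have "(\<lambda>x'. (x, x')) \<in> M \<rightarrow>\<^sub>M M \<Otimes>\<^sub>M M" by (rule measurable_Pair1') (use x in simp)
  from measurable_compose[OF this measurable_Pk_pair[OF r]] show ?thesis by simp
qed

lemma Pk_mult_integrable:
  assumes r: "0 \<le> r" "r < 1" and x: "x \<in> \<Lambda>" and h: "integrable M h"
  shows "integrable M (\<lambda>x'. Pk r x x' * h x')"
proof (rule Bochner_Integration.integrable_bound[OF integrable_mult_right[OF h, of "((1 - r)\<^sup>2) powr (- (l + 1))"]])
  show "(\<lambda>x'. Pk r x x' * h x') \<in> borel_measurable M"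
    using measurable_Pk[OF r x] h by measurable
  show "AE x' in M. norm (Pk r x x' * h x') \<le> norm ((1 - r)\<^sup>2 powr - (l + 1) * h x')"
    by (rule AE_I2) (use Pk_bound[OF x _ r] Pk_nonneg[OF x _ r] in \<open>auto simp: abs_mult intro!: mult_right_mono\<close>)
qed

text \<open>The uniform tail allows integration term by term; degrees beyond that of Q contribute
  nothing, as T k Q vanishes there.\<close>

lemma Pk_integral:
  assumes r: "0 \<le> r" "r < 1" and x: "x \<in> \<Lambda>" and Q: "Q \<in> PolyE n"
  shows "(\<integral>x'. Pk r x x' * Q x' \<partial>M) / mass = (\<Sum>k\<le>n. r ^ k * T k Q x)"
proof -
  obtain \<epsilon> where e: "\<epsilon> \<longlonglongrightarrow> 0"
    "\<And>x x' L. x \<in> \<Lambda> \<Longrightarrow> x' \<in> \<Lambda> \<Longrightarrow> \<bar>Pk r x x' - (\<Sum>k<L. r ^ k * Zk k x x')\<bar> \<le> \<epsilon> L"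
    by (rule Pk_tail[OF r]) blast
  define K where "K = (\<integral>x'. \<bar>Q x'\<bar> \<partial>M)"
  have iZ: "integrable M (\<lambda>x'. Zk k x x' * Q x')" for k
    by (rule PolyE_integrable_mult[OF Zk_PolyE Q])
  have iP: "integrable M (\<lambda>x'. Pk r x x' * Q x')"
    by (rule Pk_mult_integrable[OF r x PolyE_integrable[OF Q]])
  have le: "\<bar>(\<integral>x'. Pk r x x' * Q x' \<partial>M) - mass * (\<Sum>k\<le>n. r ^ k * T k Q x)\<bar> \<le> \<epsilon> L * K" if L: "L > n" for L
  proof -
    have "mass * (\<Sum>k\<le>n. r ^ k * T k Q x) = mass * (\<Sum>k<L. r ^ k * T k Q x)"
      by (intro arg_cong2[where f = times] refl sum.mono_neutral_left) (use L T_low_degree[OF Q] in auto)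
    also have "\<dots> = (\<integral>x'. (\<Sum>k<L. r ^ k * Zk k x x') * Q x' \<partial>M)"
      unfolding sum_distrib_right mult.assoc T_def using mass_pos
      by (simp add: iZ sum_distrib_left)
    finally have eq: "(\<integral>x'. Pk r x x' * Q x' \<partial>M) - mass * (\<Sum>k\<le>n. r ^ k * T k Q x)
        = (\<integral>x'. (Pk r x x' - (\<Sum>k<L. r ^ k * Zk k x x')) * Q x' \<partial>M)"
      unfolding left_diff_distrib sum_distrib_right mult.assoc by (simp add: iP iZ)
    have "\<bar>(\<integral>x'. Pk r x x' * Q x' \<partial>M) - mass * (\<Sum>k\<le>n. r ^ k * T k Q x)\<bar>
        \<le> (\<integral>x'. \<bar>(Pk r x x' - (\<Sum>k<L. r ^ k * Zk k x x')) * Q x'\<bar> \<partial>M)"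
      unfolding eq by (rule integral_abs_bound)
    also have "\<dots> \<le> (\<integral>x'. \<epsilon> L * \<bar>Q x'\<bar> \<partial>M)"
    proof (rule integral_mono)
      have "integrable M (\<lambda>x'. (Pk r x x' - (\<Sum>k<L. r ^ k * Zk k x x')) * Q x')"
        unfolding left_diff_distrib sum_distrib_right mult.assoc by (simp add: iP iZ)
      then show "integrable M (\<lambda>x'. \<bar>(Pk r x x' - (\<Sum>k<L. r ^ k * Zk k x x')) * Q x'\<bar>)" by simp
      show "integrable M (\<lambda>x'. \<epsilon> L * \<bar>Q x'\<bar>)" using PolyE_integrable[OF Q] by simp
      show "\<bar>(Pk r x x' - (\<Sum>k<L. r ^ k * Zk k x x')) * Q x'\<bar> \<le> \<epsilon> L * \<bar>Q x'\<bar>" if "x' \<in> space M" for x'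
        unfolding abs_mult using e(2)[OF x, of x' L] that by (intro mult_right_mono) auto
    qed
    finally show ?thesis by (simp add: K_def)
  qed
  have "(\<lambda>L. \<epsilon> L * K) \<longlonglongrightarrow> 0" using tendsto_mult_left_zero[OF e(1)] .
  then have "\<bar>(\<integral>x'. Pk r x x' * Q x' \<partial>M) - mass * (\<Sum>k\<le>n. r ^ k * T k Q x)\<bar> \<le> 0"
    by (rule LIMSEQ_le_const) (use le in \<open>intro exI[of _ "Suc n"], auto\<close>)
  then show ?thesis using mass_pos by (simp add: field_simps)
qed

lemma Zk_0: "Zk 0 x x' = 1"
proof -
  have "idx 0 = {(0, 0, 0)}" by (auto simp: idx_def)
  moreover have "b1 0 = 1" "b2 0 = 1"
    unfolding b1_def b2_def using prob_space.prob_space[OF bm(1)[OF beta]] prob_space.prob_space[OF bm(1)[OF gamma']] by simp_all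
  ultimately show ?thesis by (simp add: Zk_def kern_def wt_def e_def zc_def gc_def)
qed

text \<open>The case Q = 1 of \<open>Pk_integral\<close>, where only \<open>Zk 0\<close>, the
  constant 1, remains.\<close>

lemma Pk_mass:
  assumes r: "0 \<le> r" "r < 1" and x: "x \<in> \<Lambda>"
  shows "(\<integral>x'. Pk r x x' \<partial>M) = mass"
  using Pk_integral[OF r x PolyE_const[of 1 0]] mass_pos
  by (simp add: T_def Zk_0 mass_def)

text \<open>The Poisson kernel is an approximate identity: away from the diagonal \<open>xi\<close> stays below 1.\<close>

lemma sum_T:
  assumes Q: "Q \<in> PolyE n" and x: "x \<in> \<Lambda>"
  shows "(\<Sum>k\<le>n. T k Q x) = Q x"
proof -
  \<comment> \<open>On the domain v \<ge> 0, so (U, sqrt Y) determines the point and Q factors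
    through these coordinates, in which \<open>xi_le\<close> measures distance.\<close>
  define G where "G w = Q (fst w, sqrt ((b - a) * (snd w)\<^sup>2 + a + (c - a) * (fst w)\<^sup>2))" for w :: "real \<times> real"
  define \<phi> where "\<phi> x = (U x, sqrt (Y x))" for x
  have G\<phi>: "Q x' = G (\<phi> x')" if "x' \<in> \<Lambda>" for x'
  proof -
    have "0 \<le> Y x'" "0 \<le> snd x'" using that by (auto simp: Lambda_iff)
    then have "(b - a) * (sqrt (Y x'))\<^sup>2 + a + (c - a) * (U x')\<^sup>2 = (snd x')\<^sup>2" by (simp add: snd_sq)
    then show ?thesis using \<open>0 \<le> snd x'\<close> by (simp add: G_def \<phi>_def) (simp add: U_def)
  qed
  have contG: "continuous_on UNIV G"
  proof -
    have "continuous_on UNIV (\<lambda>w :: real \<times> real. (fst w, sqrt ((b - a) * (snd w)\<^sup>2 + a + (c - a) * (fst w)\<^sup>2)))"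
      by (intro continuous_intros)
    from continuous_on_compose2[OF PolyE_continuous[OF Q, of UNIV] this] show ?thesis
      unfolding G_def[abs_def] by simp
  qed
  have "compact (Q ` \<Lambda>)" by (rule compact_continuous_image[OF PolyE_continuous[OF Q] compact_Lambda])
  then obtain B where B: "\<And>x. x \<in> \<Lambda> \<Longrightarrow> \<bar>Q x\<bar> \<le> B"
    using compact_imp_bounded[of "Q ` \<Lambda>"] by (auto simp: bounded_iff)
  define \<rho> where "\<rho> i = 1 - 1 / (real i + 2)" for i :: nat
  have \<rho>: "1/2 \<le> \<rho> i" "\<rho> i < 1" for i by (auto simp: \<rho>_def field_simps)
  have \<rho>1: "\<rho> \<longlonglongrightarrow> 1" unfolding \<rho>_def by real_asymp
  have "\<bar>(\<Sum>k\<le>n. T k Q x) - Q x\<bar> \<le> \<epsilon>" if \<epsilon>: "\<epsilon> > 0" for \<epsilon>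
  proof -
    have "isCont G (\<phi> x)" using contG by (metis UNIV_I continuous_on_eq_continuous_at open_UNIV)
    then obtain d where d: "d > 0" "\<And>w. dist w (\<phi> x) < d \<Longrightarrow> dist (G w) (G (\<phi> x)) < \<epsilon>"
      using \<epsilon> unfolding continuous_at_eps_delta by blast
    \<comment> \<open>Away from x, 1 - 2 r xi + r^2 = (1 - r)^2 + 2 r (1 - xi) \<ge> r d^2, which
      bounds the kernel; 2 B bounds the oscillation of Q. The factor 1 - r^2 makes \<kappa> tend to
      0.\<close>
    define \<kappa> where "\<kappa> r = 2 * B * ((1 - r\<^sup>2) * (r * d\<^sup>2) powr (- (l + 1)))" for r
    have B0: "0 \<le> B" using B[OF x] by linarith
    have est: "\<bar>(\<Sum>k\<le>n. \<rho> i ^ k * T k Q x) - Q x\<bar> \<le> \<epsilon> + \<kappa> (\<rho> i)" for i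
    proof -
      define r where "r = \<rho> i"
      have r: "0 \<le> r" "r < 1" "0 < r" using \<rho>[of i] by (auto simp: r_def)
      have iQ: "integrable M (\<lambda>x'. Pk r x x' * Q x')" and i1: "integrable M (\<lambda>x'. Pk r x x')"
        using Pk_mult_integrable[OF r(1,2) x PolyE_integrable[OF Q]] Pk_mult_integrable[OF r(1,2) x PolyE_integrable[OF PolyE_const[of 1 0]]]
        by simp_all
      have pt: "Pk r x x' * \<bar>Q x' - Q x\<bar> \<le> \<epsilon> * Pk r x x' + \<kappa> r" if x': "x' \<in> \<Lambda>" for x'
      proof (cases "dist (\<phi> x') (\<phi> x) < d")
        case True
        then have "\<bar>Q x' - Q x\<bar> \<le> \<epsilon>" using d(2)[of "\<phi> x'"] G\<phi>[OF x'] G\<phi>[OF x] by (simp add: dist_real_def)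
        moreover have "0 \<le> \<kappa> r" unfolding \<kappa>_def using B0 r by (intro mult_nonneg_nonneg) (auto simp: abs_square_le_1)
        ultimately show ?thesis using Pk_nonneg[OF x x' r(1,2)] mult_left_mono[of "\<bar>Q x' - Q x\<bar>" \<epsilon> "Pk r x x'"]
          by (simp add: mult.commute)
      next
        case False
        then have dd: "d\<^sup>2 \<le> (U x' - U x)\<^sup>2 + (sqrt (Y x') - sqrt (Y x))\<^sup>2"
        proof -
          define S where "S = (U x' - U x)\<^sup>2 + (sqrt (Y x') - sqrt (Y x))\<^sup>2"
          have "S \<ge> 0" by (simp add: S_def)
          moreover have "d \<le> sqrt S" using False by (simp add: S_def \<phi>_def dist_prod_def dist_real_def)
          then have "d\<^sup>2 \<le> (sqrt S)\<^sup>2" using d(1) by (intro power_mono) auto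
          ultimately show ?thesis by (simp add: S_def)
        qed
        have "Pk r x x' \<le> (1 - r\<^sup>2) * (r * d\<^sup>2) powr (- (l + 1))"
        proof (rule Pk_le[OF x x' r(1,2)])
          fix st :: "real \<times> real" assume st: "\<bar>fst st\<bar> \<le> 1" "\<bar>snd st\<bar> \<le> 1"
          have "d\<^sup>2 / 2 \<le> 1 - xi x x' st"
            using xi_le[OF x x' st] dd by (simp add: power2_commute)
          then have "2 * r * (d\<^sup>2 / 2) \<le> 2 * r * (1 - xi x x' st)" using r by (intro mult_left_mono) auto
          moreover have "0 \<le> (1 - r)\<^sup>2" by simp
          ultimately have "r * d\<^sup>2 \<le> 1 - 2 * r * xi x x' st + r\<^sup>2" by (simp add: power2_eq_square algebra_simps)
          then show "pk l r (xi x x' st) \<le> (1 - r\<^sup>2) * (r * d\<^sup>2) powr (- (l + 1))"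
            unfolding pk_def using r d(1) l_pos
            by (intro mult_left_mono powr_mono2') (auto simp: abs_square_le_1)
        qed
        moreover have "\<bar>Q x' - Q x\<bar> \<le> 2 * B" using B[OF x] B[OF x'] by linarith
        ultimately have "Pk r x x' * \<bar>Q x' - Q x\<bar> \<le> ((1 - r\<^sup>2) * (r * d\<^sup>2) powr (- (l + 1))) * (2 * B)"
          using Pk_nonneg[OF x x' r(1,2)] by (intro mult_mono) auto
        moreover have "0 \<le> \<epsilon> * Pk r x x'" using Pk_nonneg[OF x x' r(1,2)] \<epsilon> by simp
        ultimately show ?thesis by (simp add: \<kappa>_def mult_ac)
      qed
      have eq: "mass * ((\<Sum>k\<le>n. r ^ k * T k Q x) - Q x) = (\<integral>x'. Pk r x x' * (Q x' - Q x) \<partial>M)"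
        unfolding Pk_integral[OF r(1,2) x Q, symmetric] right_diff_distrib
        using mass_pos by (simp add: iQ i1 Pk_mass[OF r(1,2) x])
      have "\<bar>mass * ((\<Sum>k\<le>n. r ^ k * T k Q x) - Q x)\<bar> \<le> (\<integral>x'. \<bar>Pk r x x' * (Q x' - Q x)\<bar> \<partial>M)"
        unfolding eq by (rule integral_abs_bound)
      also have "\<dots> \<le> (\<integral>x'. \<epsilon> * Pk r x x' + \<kappa> r \<partial>M)"
      proof (rule integral_mono)
        have "integrable M (\<lambda>x'. Pk r x x' * (Q x' - Q x))" unfolding right_diff_distrib by (simp add: iQ i1)
        then show "integrable M (\<lambda>x'. \<bar>Pk r x x' * (Q x' - Q x)\<bar>)" by simp
        show "integrable M (\<lambda>x'. \<epsilon> * Pk r x x' + \<kappa> r)" by (simp add: i1)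
        show "\<bar>Pk r x x' * (Q x' - Q x)\<bar> \<le> \<epsilon> * Pk r x x' + \<kappa> r" if "x' \<in> space M" for x'
          using pt[of x'] that Pk_nonneg[OF x _ r(1,2), of x'] by (simp add: abs_mult)
      qed
      also have "\<dots> = mass * (\<epsilon> + \<kappa> r)"
        by (simp add: i1 Pk_mass[OF r(1,2) x] mass_def algebra_simps)
      finally have "mass * \<bar>(\<Sum>k\<le>n. r ^ k * T k Q x) - Q x\<bar> \<le> mass * (\<epsilon> + \<kappa> r)"
        using mass_pos by (simp add: abs_mult)
      then show ?thesis using mass_pos by (simp add: r_def)
    qed
    have "(\<lambda>i. \<bar>(\<Sum>k\<le>n. \<rho> i ^ k * T k Q x) - Q x\<bar>) \<longlonglongrightarrow> \<bar>(\<Sum>k\<le>n. 1 ^ k * T k Q x) - Q x\<bar>"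
      by (intro tendsto_intros \<rho>1)
    moreover have "(\<lambda>i. \<epsilon> + \<kappa> (\<rho> i)) \<longlonglongrightarrow> \<epsilon> + 2 * B * ((1 - 1\<^sup>2) * (1 * d\<^sup>2) powr (- (l + 1)))"
      unfolding \<kappa>_def by (intro tendsto_intros \<rho>1) (use d(1) in simp)
    ultimately have "\<bar>(\<Sum>k\<le>n. 1 ^ k * T k Q x) - Q x\<bar> \<le> \<epsilon> + 2 * B * ((1 - 1\<^sup>2) * (1 * d\<^sup>2) powr (- (l + 1)))"
      by (rule LIMSEQ_le) (use est in auto)
    then show ?thesis by simp
  qed
  then have "\<bar>(\<Sum>k\<le>n. T k Q x) - Q x\<bar> \<le> 0" by (rule field_le_epsilon[of _ 0, simplified])
  then show ?thesis by simp
qed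

section \<open>Identification of the orthogonal projections\<close>

lemma T_Vspace:
  assumes h: "mint h"
  shows "T n h \<in> Vspace a b c \<beta> \<gamma> n"
  unfolding Vspace_iff
proof (intro conjI allI impI ballI)
  show "T n h \<in> PolyE n" by (rule T_PolyE[OF h])
  fix m P assume "m < n" "P \<in> PolyE m"
  then show "(\<integral>x. T n h x * P x \<partial>M) = 0"
    unfolding T_pair[OF h \<open>P \<in> PolyE m\<close>] using T_low_degree by simp
qed

lemma T_Vspace_other:
  assumes q: "q \<in> Vspace a b c \<beta> \<gamma> n" and "k \<noteq> n"
  shows "T k q x = 0"
proof (cases "k < n")
  case True
  then have "(\<integral>x'. q x' * Zk k x x' \<partial>M) = 0" using q Zk_PolyE unfolding Vspace_iff by blast
  then show ?thesis by (simp add: T_def mult.commute)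
next
  case False
  then have "n < k" using assms(2) by simp
  then show ?thesis using T_low_degree[of q n k] q unfolding Vspace_iff by blast
qed

text \<open>In \<open>sum_T\<close> all components of q except the n-th vanish, so T n is idempotent
  without any normalisation of orthogonal polynomials being computed.\<close>

lemma T_Vspace_same:
  assumes q: "q \<in> Vspace a b c \<beta> \<gamma> n"
  shows "T n q = q"
proof (rule PolyE_eqI)
  show q': "q \<in> PolyE n" using q by (simp add: Vspace_iff)
  show "T n q \<in> PolyE n" by (rule T_PolyE[OF mint_PolyE[OF q']])
  fix x assume "x \<in> \<Lambda>"
  have "q x = (\<Sum>k\<le>n. T k q x)" using sum_T[OF q' \<open>x \<in> \<Lambda>\<close>] by simp
  also have "\<dots> = (\<Sum>k\<in>{n}. T k q x)"
    by (rule sum.mono_neutral_right) (use T_Vspace_other[OF q] in auto)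
  finally show "T n q x = q x" by simp
qed

lemma T_T: "mint h \<Longrightarrow> T k (T n h) = (if k = n then T n h else (\<lambda>x. 0))"
  using T_Vspace_same[OF T_Vspace] T_Vspace_other[OF T_Vspace] by auto

text \<open>Existence is \<open>T_pair\<close> with \<open>T_Vspace_same\<close>. For uniqueness a
  candidate q is tested against \<open>Zk n x\<close>, itself a member of the space, which recovers
  q pointwise.\<close>

lemma proj_eq_T:
  assumes h: "mint h"
  shows "Defs.proj a b c \<beta> \<gamma> n h = T n h"
  unfolding Defs.proj_def
proof (rule the_equality)
  have diff: "(\<integral>x. (h x - q x) * P x \<partial>M) = (\<integral>x. h x * P x \<partial>M) - (\<integral>x. q x * P x \<partial>M)"
    if "q \<in> PolyE n" "P \<in> PolyE m" for q P m
    using mint_integrable[OF h that(2)] PolyE_integrable_mult[OF that(2,1)]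
    unfolding left_diff_distrib mult.commute[of "h _"] mult.commute[of "q _"]
    by (rule Bochner_Integration.integral_diff)
  show "T n h \<in> Vspace a b c \<beta> \<gamma> n \<and> (\<forall>P\<in>Vspace a b c \<beta> \<gamma> n. (\<integral>x. (h x - T n h x) * P x \<partial>M) = 0)"
  proof (intro conjI ballI T_Vspace[OF h])
    fix P assume P: "P \<in> Vspace a b c \<beta> \<gamma> n"
    then have P': "P \<in> PolyE n" by (simp add: Vspace_iff)
    show "(\<integral>x. (h x - T n h x) * P x \<partial>M) = 0"
      unfolding diff[OF T_PolyE[OF h] P'] T_pair[OF h P'] T_Vspace_same[OF P] by simp
  qed
  fix q assume q: "q \<in> Vspace a b c \<beta> \<gamma> n \<and> (\<forall>P\<in>Vspace a b c \<beta> \<gamma> n. (\<integral>x. (h x - q x) * P x \<partial>M) = 0)"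
  then have q': "q \<in> PolyE n" by (simp add: Vspace_iff)
  show "q = T n h"
  proof
    fix x
    have "Zk n x \<in> Vspace a b c \<beta> \<gamma> n"
      unfolding Vspace_iff using Zk_PolyE Zk_orth by blast
    then have "(\<integral>x'. h x' * Zk n x x' \<partial>M) = (\<integral>x'. q x' * Zk n x x' \<partial>M)"
      using q diff[OF q' Zk_PolyE, of n x] by force
    then have "T n h x = T n q x" by (simp add: T_def mult.commute)
    then show "q x = T n h x" using T_Vspace_same q by metis
  qed
qed

end

section \<open>Norms of multiplier operators\<close>

text \<open>The common source of the Minkowski and Jensen inequalities below. The point t = 0 is
  treated apart because the convexity argument runs on the open half-line.\<close>

lemma powr_above_tangent:
  fixes t c p :: real
  assumes "p \<ge> 1" "t \<ge> 0" "c > 0"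
  shows "c powr p + p * c powr (p - 1) * (t - c) \<le> t powr p"
proof (cases "t = 0")
  case True
  have "c powr (p - 1 + 1) = c powr (p - 1) * c powr 1" by (rule powr_add)
  then have "c powr p = c powr (p - 1) * c" using powr_one[of c] assms by (simp del: powr_one powr_one_gt_zero_iff)
  then have "c powr p + p * c powr (p - 1) * (0 - c) = (1 - p) * c powr p" by (simp add: algebra_simps)
  also have "\<dots> \<le> 0" using assms by (intro mult_nonpos_nonneg) auto
  finally show ?thesis using True by simp
next
  case False
  have "(\<lambda>x. x powr p) t - (\<lambda>x. x powr p) c \<ge> (p * c powr (p - 1)) * (t - c)"
  proof (rule convex_on_imp_above_tangent[of "{0<..}"])
    show "convex_on {0<..} (\<lambda>x. x powr p)" by (rule powr_convex[OF assms(1)])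
    show "((\<lambda>x. x powr p) has_field_derivative p * c powr (p - 1)) (at c within {0<..})"
      using has_real_derivative_powr[OF assms(3), of p] by (rule has_field_derivative_at_within)
  qed (use assms False in \<open>auto simp: interior_open\<close>)
  then show ?thesis by simp
qed

lemma powr_convex_combination:
  fixes x y s p :: real
  assumes "p \<ge> 1" "x \<ge> 0" "y \<ge> 0" "0 \<le> s" "s \<le> 1"
  shows "(s * x + (1 - s) * y) powr p \<le> s * x powr p + (1 - s) * y powr p"
proof -
  define c where "c = s * x + (1 - s) * y"
  have c0: "c \<ge> 0" using assms by (simp add: c_def)
  show ?thesis
  proof (cases "c = 0")
    case True
    then show ?thesis using assms unfolding c_def[symmetric] by simp
  next
    case False
    then have c: "c > 0" using c0 by simp
    have "s * (c powr p + p * c powr (p - 1) * (x - c)) + (1 - s) * (c powr p + p * c powr (p - 1) * (y - c))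
       \<le> s * x powr p + (1 - s) * y powr p"
      using assms c by (intro add_mono mult_left_mono powr_above_tangent) auto
    moreover have "s * (A + D * (x - c)) + (1 - s) * (A + D * (y - c)) = A" for A D
    proof -
      have "s * (A + D * (x - c)) + (1 - s) * (A + D * (y - c)) = A + D * (s * x + (1 - s) * y - c)"
        by (simp add: algebra_simps)
      then show ?thesis by (simp add: c_def)
    qed
    ultimately show ?thesis unfolding c_def[symmetric] by simp
  qed
qed

section \<open>Weighted L^p norms\<close>

context jacobi_domain
begin

abbreviation nrm :: "ennreal \<Rightarrow> (real \<times> real \<Rightarrow> real) \<Rightarrow> ennreal" where
  "nrm \<equiv> lpnorm a b c \<beta> \<gamma>"

text \<open>Norm bounds are handled as bounds for the integral of the p-th power, which keeps roots
  and the infinite case of \<open>lpnorm\<close> out of the estimates.\<close>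

lemma nrm_le_iff_fin:
  assumes p: "1 \<le> p" "p \<noteq> \<infinity>" and t: "0 \<le> t"
  shows "nrm p f \<le> ennreal t \<longleftrightarrow> (\<integral>\<^sup>+x. ennreal (\<bar>f x\<bar> powr enn2real p) \<partial>M) \<le> ennreal (t powr enn2real p)"
proof -
  define P where "P = enn2real p"
  have P: "P \<ge> 1" unfolding P_def using enn2real_mono[OF p(1)] p(2) by (simp add: less_top)
  define I where "I = (\<integral>\<^sup>+x. ennreal (\<bar>f x\<bar> powr P) \<partial>M)"
  have nrm: "nrm p f = (if I = \<infinity> then \<infinity> else ennreal (enn2real I powr (1 / P)))"
    using p(2) by (simp add: lpnorm_def I_def P_def Let_def)
  show ?thesis
  proof (cases "I = \<infinity>")
    case True
    then show ?thesis unfolding nrm I_def[symmetric] P_def[symmetric] by (simp add: top_unique)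
  next
    case False
    then obtain J where J: "I = ennreal J" "0 \<le> J" by (cases I) auto
    have "J powr (1 / P) \<le> t \<longleftrightarrow> J \<le> t powr P"
    proof
      assume "J powr (1 / P) \<le> t"
      then have "(J powr (1 / P)) powr P \<le> t powr P" using P by (intro powr_mono2) auto
      then show "J \<le> t powr P" using P J(2) by (simp add: powr_powr)
    next
      assume "J \<le> t powr P"
      then have "J powr (1 / P) \<le> (t powr P) powr (1 / P)" using P J(2) by (intro powr_mono2) auto
      then show "J powr (1 / P) \<le> t" using P t by (simp add: powr_powr)
    qed
    then show ?thesis unfolding nrm I_def[symmetric] P_def[symmetric] using False t J
      by (simp add: ennreal_le_iff)
  qed
qed

lemma nrm_le_iff_inf: "0 \<le> t \<Longrightarrow> nrm \<infinity> f \<le> ennreal t \<longleftrightarrow> (\<forall>x\<in>\<Lambda>. \<bar>f x\<bar> \<le> t)"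
  by (simp add: lpnorm_def SUP_le_iff)

lemma nrm_mono:
  assumes "\<And>x. x \<in> \<Lambda> \<Longrightarrow> \<bar>f x\<bar> \<le> \<bar>g x\<bar>" "1 \<le> p"
  shows "nrm p f \<le> nrm p g"
proof (cases "nrm p g")
  case (real t)
  have "nrm p f \<le> ennreal t"
  proof (cases "p = \<infinity>")
    case True
    then have "\<forall>x\<in>\<Lambda>. \<bar>g x\<bar> \<le> t" using nrm_le_iff_inf[of t g] real by simp
    then show ?thesis using nrm_le_iff_inf[of t f] real True assms(1) order_trans by fastforce
  next
    case False
    have "(\<integral>\<^sup>+x. ennreal (\<bar>f x\<bar> powr enn2real p) \<partial>M) \<le> (\<integral>\<^sup>+x. ennreal (\<bar>g x\<bar> powr enn2real p) \<partial>M)"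
      by (intro nn_integral_mono ennreal_leI powr_mono2) (use assms in auto)
    also have "\<dots> \<le> ennreal (t powr enn2real p)"
      using nrm_le_iff_fin[OF assms(2) False, of t g] real by simp
    finally show ?thesis using nrm_le_iff_fin[OF assms(2) False, of t f] real by simp
  qed
  then show ?thesis using real by simp
qed simp

lemma nrm_cong: "(\<And>x. x \<in> \<Lambda> \<Longrightarrow> f x = g x) \<Longrightarrow> 1 \<le> p \<Longrightarrow> nrm p f = nrm p g"
  by (rule antisym; rule nrm_mono) simp_all

text \<open>With A' and B' slightly above the two norms, |f| + |g| is A' + B' times a convex
  combination of |f| / A' and |g| / B', to which convexity of the p-th power applies. The added
  \<epsilon> / 2 keeps the divisors positive.\<close>

lemma nrm_triangle:
  assumes f: "f \<in> borel_measurable M" and g: "g \<in> borel_measurable M" and p: "1 \<le> p"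
  shows "nrm p (\<lambda>x. f x + g x) \<le> nrm p f + nrm p g"
proof (cases "nrm p f = \<infinity> \<or> nrm p g = \<infinity>")
  case False
  then obtain A B where A: "nrm p f = ennreal A" "0 \<le> A" and B: "nrm p g = ennreal B" "0 \<le> B"
    by (cases "nrm p f"; cases "nrm p g") auto
  have "nrm p (\<lambda>x. f x + g x) \<le> ennreal (A + B)"
  proof (cases "p = \<infinity>")
    case True
    then have "\<forall>x\<in>\<Lambda>. \<bar>f x\<bar> \<le> A" "\<forall>x\<in>\<Lambda>. \<bar>g x\<bar> \<le> B"
      using nrm_le_iff_inf[of A f] nrm_le_iff_inf[of B g] A B by auto
    then have "\<forall>x\<in>\<Lambda>. \<bar>f x + g x\<bar> \<le> A + B" by (meson abs_triangle_ineq add_mono order_trans)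
    then show ?thesis unfolding True using nrm_le_iff_inf[of "A + B"] A(2) B(2) by simp
  next
    case fin: False
    define P where "P = enn2real p"
    have P: "P \<ge> 1" unfolding P_def using enn2real_mono[OF p] fin by (simp add: less_top)
    have eps: "nrm p (\<lambda>x. f x + g x) \<le> ennreal (A + B) + ennreal \<epsilon>" if \<epsilon>: "\<epsilon> > 0" for \<epsilon>
    proof -
      define A' B' where "A' = A + \<epsilon> / 2" and "B' = B + \<epsilon> / 2"
      have pos: "A' > 0" "B' > 0" using A B \<epsilon> by (simp_all add: A'_def B'_def add_nonneg_pos)
      define s where "s = A' / (A' + B')"
      have s: "0 \<le> s" "s \<le> 1" "1 - s = B' / (A' + B')" using pos by (auto simp: s_def field_simps)
      have pt: "\<bar>f x + g x\<bar> powr P \<le> (A' + B') powr P * (s / A' powr P * \<bar>f x\<bar> powr P + (1 - s) / B' powr P * \<bar>g x\<bar> powr P)" for x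
      proof -
        have "\<bar>f x + g x\<bar> powr P \<le> (\<bar>f x\<bar> + \<bar>g x\<bar>) powr P" using P by (intro powr_mono2) auto
        also have "\<bar>f x\<bar> + \<bar>g x\<bar> = (A' + B') * (s * (\<bar>f x\<bar> / A') + (1 - s) * (\<bar>g x\<bar> / B'))"
        proof -
          have "q * (A' / q * (F / A') + B' / q * (G / B')) = F + G" if "q > 0" for q F G
            using that pos by (simp add: distrib_left)
          from this[of "A' + B'" "\<bar>f x\<bar>" "\<bar>g x\<bar>"] show ?thesis
            unfolding s(3) unfolding s_def using pos by (simp only: add_pos_pos)
        qed
        also have "\<dots> powr P = (A' + B') powr P * (s * (\<bar>f x\<bar> / A') + (1 - s) * (\<bar>g x\<bar> / B')) powr P"
          by (rule powr_mult)
        also have "\<dots> \<le> (A' + B') powr P * (s * (\<bar>f x\<bar> / A') powr P + (1 - s) * (\<bar>g x\<bar> / B') powr P)"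
          using pos s P by (intro mult_left_mono powr_convex_combination) auto
        also have "\<dots> = (A' + B') powr P * (s / A' powr P * \<bar>f x\<bar> powr P + (1 - s) / B' powr P * \<bar>g x\<bar> powr P)"
          using pos by (simp add: powr_divide)
        finally show ?thesis .
      qed
      have If: "(\<integral>\<^sup>+x. ennreal (\<bar>f x\<bar> powr P) \<partial>M) \<le> ennreal (A' powr P)"
        unfolding P_def using nrm_le_iff_fin[OF p fin, of A' f] A \<epsilon> by (simp add: A'_def ennreal_leI)
      have Ig: "(\<integral>\<^sup>+x. ennreal (\<bar>g x\<bar> powr P) \<partial>M) \<le> ennreal (B' powr P)"
        unfolding P_def using nrm_le_iff_fin[OF p fin, of B' g] B \<epsilon> by (simp add: B'_def ennreal_leI)
      define cf cg where "cf = (A' + B') powr P * (s / A' powr P)" and "cg = (A' + B') powr P * ((1 - s) / B' powr P)"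
      have c0: "0 \<le> cf" "0 \<le> cg" using s pos by (simp_all add: cf_def cg_def)
      have "(\<integral>\<^sup>+x. ennreal (\<bar>f x + g x\<bar> powr P) \<partial>M)
        \<le> (\<integral>\<^sup>+x. ennreal cf * ennreal (\<bar>f x\<bar> powr P) + ennreal cg * ennreal (\<bar>g x\<bar> powr P) \<partial>M)"
      proof (rule nn_integral_mono)
        fix x
        have "\<bar>f x + g x\<bar> powr P \<le> cf * \<bar>f x\<bar> powr P + cg * \<bar>g x\<bar> powr P"
          using pt[of x] by (simp add: cf_def cg_def algebra_simps)
        then show "ennreal (\<bar>f x + g x\<bar> powr P) \<le> ennreal cf * ennreal (\<bar>f x\<bar> powr P) + ennreal cg * ennreal (\<bar>g x\<bar> powr P)"
          using c0 by (simp add: ennreal_leI flip: ennreal_plus ennreal_mult)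
      qed
      also have "\<dots> = ennreal cf * (\<integral>\<^sup>+x. ennreal (\<bar>f x\<bar> powr P) \<partial>M) + ennreal cg * (\<integral>\<^sup>+x. ennreal (\<bar>g x\<bar> powr P) \<partial>M)"
        using f g by (subst nn_integral_add) (auto simp: nn_integral_cmult)
      also have "\<dots> \<le> ennreal cf * ennreal (A' powr P) + ennreal cg * ennreal (B' powr P)"
        by (intro add_mono mult_left_mono If Ig) auto
      also have "\<dots> = ennreal (cf * A' powr P + cg * B' powr P)"
        using c0 by (simp add: ennreal_mult ennreal_plus)
      also have "cf * A' powr P + cg * B' powr P = (A' + B') powr P"
        using pos by (simp add: cf_def cg_def) (simp add: algebra_simps)
      finally have "nrm p (\<lambda>x. f x + g x) \<le> ennreal (A' + B')"
        unfolding P_def using nrm_le_iff_fin[OF p fin, of "A' + B'"] pos by simp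
      also have "A' + B' = (A + B) + \<epsilon>" by (simp add: A'_def B'_def)
      also have "ennreal \<dots> = ennreal (A + B) + ennreal \<epsilon>" using A B \<epsilon> by (simp add: ennreal_plus)
      finally show ?thesis .
    qed
    show ?thesis by (rule ennreal_le_epsilon) (rule eps)
  qed
  then show ?thesis using A B by (simp add: ennreal_plus)
qed auto

lemma nrm_cmult_le:
  assumes f: "f \<in> borel_measurable M" and p: "1 \<le> p" and fin: "nrm p f = ennreal t" "0 \<le> t"
  shows "nrm p (\<lambda>x. k * f x) \<le> ennreal (\<bar>k\<bar> * t)"
proof (cases "p = \<infinity>")
  case True
  then have "\<forall>x\<in>\<Lambda>. \<bar>f x\<bar> \<le> t" using nrm_le_iff_inf[of t f] fin by simp
  then have "\<forall>x\<in>\<Lambda>. \<bar>k * f x\<bar> \<le> \<bar>k\<bar> * t" by (simp add: abs_mult mult_left_mono)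
  then show ?thesis unfolding True using nrm_le_iff_inf[of "\<bar>k\<bar> * t"] fin(2) by simp
next
  case pf: False
  define P where "P = enn2real p"
  have "(\<integral>\<^sup>+x. ennreal (\<bar>k * f x\<bar> powr P) \<partial>M) = (\<integral>\<^sup>+x. ennreal (\<bar>k\<bar> powr P) * ennreal (\<bar>f x\<bar> powr P) \<partial>M)"
    by (simp add: abs_mult powr_mult ennreal_mult)
  also have "\<dots> = ennreal (\<bar>k\<bar> powr P) * (\<integral>\<^sup>+x. ennreal (\<bar>f x\<bar> powr P) \<partial>M)"
    using f by (simp add: nn_integral_cmult)
  also have "\<dots> \<le> ennreal (\<bar>k\<bar> powr P) * ennreal (t powr P)"
    unfolding P_def using nrm_le_iff_fin[OF p pf, of t f] fin by (intro mult_left_mono) auto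
  also have "\<dots> = ennreal ((\<bar>k\<bar> * t) powr P)" using fin(2) by (simp add: powr_mult ennreal_mult)
  finally show ?thesis unfolding P_def using nrm_le_iff_fin[OF p pf, of "\<bar>k\<bar> * t"] fin(2) by simp
qed

text \<open>At least 1 and at least mass^(1/p) for every p \<ge> 1, so uniform bounds become norm
  bounds with a constant independent of p.\<close>

definition mB :: real where "mB = 1 + mass"

lemma nrm_bounded_le:
  assumes B: "\<And>x. x \<in> \<Lambda> \<Longrightarrow> \<bar>f x\<bar> \<le> B" "0 \<le> B" and p: "1 \<le> p"
  shows "nrm p f \<le> ennreal (B * mB)"
proof (cases "p = \<infinity>")
  case True
  have "\<forall>x\<in>\<Lambda>. \<bar>f x\<bar> \<le> B * mB"
  proof
    fix x assume "x \<in> \<Lambda>"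
    then have "\<bar>f x\<bar> \<le> B * 1" using B by simp
    also have "\<dots> \<le> B * mB" using B(2) mass_pos by (intro mult_left_mono) (auto simp: mB_def)
    finally show "\<bar>f x\<bar> \<le> B * mB" .
  qed
  then show ?thesis unfolding True using nrm_le_iff_inf[of "B * mB"] B(2) mass_pos by (simp add: mB_def)
next
  case pf: False
  define P where "P = enn2real p"
  have P: "P \<ge> 1" unfolding P_def using enn2real_mono[OF p] pf by (simp add: less_top)
  have m1: "1 \<le> mB" using mass_pos by (simp add: mB_def)
  have "(\<integral>\<^sup>+x. ennreal (\<bar>f x\<bar> powr P) \<partial>M) \<le> (\<integral>\<^sup>+x. ennreal (B powr P) \<partial>M)"
    by (intro nn_integral_mono ennreal_leI powr_mono2) (use B P in auto)
  also have "\<dots> = ennreal (B powr P) * ennreal mass"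
    by (simp add: mass_def emeasure_eq_measure)
  also have "\<dots> = ennreal (B powr P * mass)" using mass_pos by (simp add: ennreal_mult)
  also have "\<dots> \<le> ennreal (B powr P * mB powr P)"
  proof (intro ennreal_leI mult_left_mono)
    have "mass \<le> mB powr 1" using mass_pos by (simp add: mB_def)
    also have "\<dots> \<le> mB powr P" using P m1 by (intro powr_mono) auto
    finally show "mass \<le> mB powr P" .
  qed simp
  also have "B powr P * mB powr P = (B * mB) powr P" using B(2) m1 by (simp add: powr_mult)
  finally show ?thesis unfolding P_def using nrm_le_iff_fin[OF p pf, of "B * mB"] B(2) m1 by simp
qed

lemma nrm_continuous_finite:
  assumes "continuous_on \<Lambda> f" "1 \<le> p"
  shows "nrm p f < \<infinity>"
proof -
  obtain B where B: "\<And>x. x \<in> \<Lambda> \<Longrightarrow> \<bar>f x\<bar> \<le> B"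
    using compact_imp_bounded[OF compact_continuous_image[OF assms(1) compact_Lambda]]
    by (auto simp: bounded_iff)
  have "nrm p f \<le> ennreal (max B 0 * mB)"
    by (rule nrm_bounded_le[OF _ _ assms(2)]) (use B in fastforce)+
  then show ?thesis by (metis ennreal_less_top infinity_ennreal_def le_less_trans)
qed

text \<open>The measure is finite, and for finite p the function |h| is dominated by 1 +
  |h|^p.\<close>

lemma nrm_finite_integrable:
  assumes h: "h \<in> borel_measurable M" and p: "1 \<le> p" and fin: "nrm p h < \<infinity>"
  shows "integrable M h"
    and "p \<noteq> \<infinity> \<Longrightarrow> integrable M (\<lambda>x. \<bar>h x\<bar> powr enn2real p)"
proof -
  obtain t where t: "nrm p h = ennreal t" "0 \<le> t" using fin by (cases "nrm p h") auto
  have *: "integrable M (\<lambda>x. \<bar>h x\<bar> powr enn2real p)" if pf: "p \<noteq> \<infinity>"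
  proof (rule integrableI_bounded)
    have "(\<integral>\<^sup>+x. ennreal (\<bar>h x\<bar> powr enn2real p) \<partial>M) \<le> ennreal (t powr enn2real p)"
      using nrm_le_iff_fin[OF p pf t(2), of h] t(1) by simp
    then show "(\<integral>\<^sup>+x. ennreal (norm (\<bar>h x\<bar> powr enn2real p)) \<partial>M) < \<infinity>"
      by (simp add: le_less_trans)
  qed (use h in measurable)
  then show "p \<noteq> \<infinity> \<Longrightarrow> integrable M (\<lambda>x. \<bar>h x\<bar> powr enn2real p)" .
  show "integrable M h"
  proof (cases "p = \<infinity>")
    case True
    then have "\<forall>x\<in>\<Lambda>. \<bar>h x\<bar> \<le> t" using nrm_le_iff_inf[of t h] t by simp
    then show ?thesis by (intro integrable_const_bound[where B = t]) (use h in auto)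
  next
    case False
    have P: "enn2real p \<ge> 1" using enn2real_mono[OF p] False by (simp add: less_top)
    have "integrable M (\<lambda>x. 1 + \<bar>h x\<bar> powr enn2real p)" using *[OF False] by simp
    then show ?thesis
    proof (rule Bochner_Integration.integrable_bound[OF _ h])
      show "AE x in M. norm (h x) \<le> norm (1 + \<bar>h x\<bar> powr enn2real p)"
      proof (rule AE_I2)
        fix x
        show "norm (h x) \<le> norm (1 + \<bar>h x\<bar> powr enn2real p)"
        proof (cases "\<bar>h x\<bar> \<le> 1")
          case True
          then show ?thesis by (simp add: add_increasing2)
        next
          case False
          then have "\<bar>h x\<bar> powr 1 \<le> \<bar>h x\<bar> powr enn2real p" using P by (intro powr_mono) auto
          then show ?thesis using False by simp
        qed
      qed
    qed
  qed
qed

lemma Lp_classD: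
  assumes f: "Lp_class a b c \<beta> \<gamma> p f" and p: "1 \<le> p"
  shows "f \<in> borel_measurable M" "nrm p f < \<infinity>"
proof -
  show "f \<in> borel_measurable M"
    using f measurable_M_continuous by (auto simp: Lp_class_def split: if_splits)
  show "nrm p f < \<infinity>"
  proof (cases "p = \<infinity>")
    case True
    then have "continuous_on \<Lambda> f" using f by (simp add: Lp_class_def)
    then show ?thesis by (rule nrm_continuous_finite[OF _ p])
  next
    case False
    then have "(\<integral>\<^sup>+x. ennreal (\<bar>f x\<bar> powr enn2real p) \<partial>M) < \<infinity>" using f by (simp add: Lp_class_def)
    then show ?thesis using False by (simp add: lpnorm_def Let_def)
  qed
qed

text \<open>Domination by the Poisson kernel transfers its \<open>L\<^sup>p\<close> contractivity, which is Jensen's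
  inequality for the probability measures \<open>Pk r x\<close>.\<close>

lemma nrm_kernel_le:
  assumes r: "0 \<le> r" "r < 1" and C: "0 < C" and h: "h \<in> borel_measurable M" and p: "1 \<le> p"
    and K: "\<And>x x'. x \<in> \<Lambda> \<Longrightarrow> x' \<in> \<Lambda> \<Longrightarrow> \<bar>K x x'\<bar> \<le> C * Pk r x x'"
    and g: "\<And>x. x \<in> \<Lambda> \<Longrightarrow> g x = (\<integral>x'. K x x' * h x' \<partial>M) / mass"
  shows "nrm p g \<le> ennreal C * nrm p h"
proof (cases "nrm p h = \<infinity>")
  case True
  then show ?thesis using C by (simp add: ennreal_mult_top)
next
  case False
  then have fin: "nrm p h < \<infinity>" by (simp add: less_top)
  obtain A where A: "nrm p h = ennreal A" "0 \<le> A" using False by (cases "nrm p h") auto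
  have ih: "integrable M h" by (rule nrm_finite_integrable(1)[OF h p fin])
  then have iah: "integrable M (\<lambda>x. \<bar>h x\<bar>)" by simp
  define q where "q x = (\<integral>x'. Pk r x x' * \<bar>h x'\<bar> \<partial>M) / mass" for x
  have iPh: "integrable M (\<lambda>x'. Pk r x x' * \<bar>h x'\<bar>)" if "x \<in> \<Lambda>" for x
    by (rule Pk_mult_integrable[OF r that iah])
  have iP: "integrable M (Pk r x)" if "x \<in> \<Lambda>" for x
    using Pk_mult_integrable[OF r that, of "\<lambda>_. 1"] by simp
  have q0: "0 \<le> q x" if "x \<in> \<Lambda>" for x
    unfolding q_def using mass_pos Pk_nonneg[OF that _ r] by (intro divide_nonneg_pos integral_nonneg_AE AE_I2) auto
  have gq: "\<bar>g x\<bar> \<le> C * q x" if x: "x \<in> \<Lambda>" for x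
  proof (cases "integrable M (\<lambda>x'. K x x' * h x')")
    case True
    have "\<bar>\<integral>x'. K x x' * h x' \<partial>M\<bar> \<le> (\<integral>x'. \<bar>K x x' * h x'\<bar> \<partial>M)" by (rule integral_abs_bound)
    also have "\<dots> \<le> (\<integral>x'. C * (Pk r x x' * \<bar>h x'\<bar>) \<partial>M)"
    proof (rule integral_mono)
      show "\<bar>K x x' * h x'\<bar> \<le> C * (Pk r x x' * \<bar>h x'\<bar>)" if "x' \<in> space M" for x'
        using mult_right_mono[OF K[OF x, of x'], of "\<bar>h x'\<bar>"] that by (simp add: abs_mult mult.assoc)
    qed (use True iPh[OF x] in auto)
    also have "\<dots> = C * q x * mass" using mass_pos by (simp add: q_def)
    finally show ?thesis unfolding g[OF x] using mass_pos by (simp add: abs_divide divide_le_eq)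
  next
    case nint: False
    \<comment> \<open>An integral that does not exist is 0 by convention.\<close>
    then show ?thesis unfolding g[OF x] using q0[OF x] C by (simp add: not_integrable_integral_eq)
  qed
  have "nrm p g \<le> ennreal (C * A)"
  proof (cases "p = \<infinity>")
    case True
    then have hA: "\<forall>x\<in>\<Lambda>. \<bar>h x\<bar> \<le> A" using nrm_le_iff_inf[of A h] A by simp
    have "\<bar>g x\<bar> \<le> C * A" if x: "x \<in> \<Lambda>" for x
    proof -
      have "(\<integral>x'. Pk r x x' * \<bar>h x'\<bar> \<partial>M) \<le> (\<integral>x'. Pk r x x' * A \<partial>M)"
        by (rule integral_mono) (use iPh[OF x] iP[OF x] hA Pk_nonneg[OF x _ r] in \<open>auto intro!: mult_left_mono\<close>)
      also have "\<dots> = mass * A" by (simp add: Pk_mass[OF r x])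
      finally have "q x \<le> A" using mass_pos by (simp add: q_def divide_le_eq mult.commute)
      then have "C * q x \<le> C * A" using C by (intro mult_left_mono) auto
      with gq[OF x] show ?thesis by linarith
    qed
    then show ?thesis unfolding True using nrm_le_iff_inf[of "C * A"] C A(2) by simp
  next
    case pf: False
    define P where "P = enn2real p"
    have P: "P \<ge> 1" unfolding P_def using enn2real_mono[OF p] pf by (simp add: less_top)
    have ihP: "integrable M (\<lambda>x. \<bar>h x\<bar> powr P)"
      unfolding P_def by (rule nrm_finite_integrable(2)[OF h p fin pf])
    have iPhP: "integrable M (\<lambda>x'. Pk r x x' * \<bar>h x'\<bar> powr P)" if "x \<in> \<Lambda>" for x
      by (rule Pk_mult_integrable[OF r that ihP])
    have jensen: "q x powr P \<le> (\<integral>x'. Pk r x x' * \<bar>h x'\<bar> powr P \<partial>M) / mass" if x: "x \<in> \<Lambda>" for x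
    proof (cases "q x = 0")
      case True
      then show ?thesis using mass_pos Pk_nonneg[OF x _ r] by (auto intro!: divide_nonneg_pos integral_nonneg_AE AE_I2)
    next
      case False
      then have qp: "q x > 0" using q0[OF x] by simp
      \<comment> \<open>The slope of the tangent to t^P at the mean value q x; integrated against
        the kernel, the linear part cancels.\<close>
      define D where "D = P * q x powr (P - 1)"
      have iR: "integrable M (\<lambda>x'. q x powr P * Pk r x x' + D * (Pk r x x' * \<bar>h x'\<bar> - q x * Pk r x x'))"
        using iPh[OF x] iP[OF x] by simp
      have "(\<integral>x'. q x powr P * Pk r x x' + D * (Pk r x x' * \<bar>h x'\<bar> - q x * Pk r x x') \<partial>M)
         \<le> (\<integral>x'. Pk r x x' * \<bar>h x'\<bar> powr P \<partial>M)"
      proof (rule integral_mono[OF iR iPhP[OF x]])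
        fix x' assume "x' \<in> space M"
        then have "Pk r x x' * (q x powr P + D * (\<bar>h x'\<bar> - q x)) \<le> Pk r x x' * \<bar>h x'\<bar> powr P"
          unfolding D_def using Pk_nonneg[OF x _ r, of x'] P qp by (intro mult_left_mono powr_above_tangent) auto
        then show "q x powr P * Pk r x x' + D * (Pk r x x' * \<bar>h x'\<bar> - q x * Pk r x x') \<le> Pk r x x' * \<bar>h x'\<bar> powr P"
          by (simp add: algebra_simps)
      qed
      also have "(\<integral>x'. q x powr P * Pk r x x' + D * (Pk r x x' * \<bar>h x'\<bar> - q x * Pk r x x') \<partial>M)
        = q x powr P * mass + D * (q x * mass - q x * mass)"
        using iPh[OF x] iP[OF x] mass_pos by (simp add: Pk_mass[OF r x] q_def)
      finally show ?thesis using mass_pos by (simp add: le_divide_eq)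
    qed
    define F where "F x x' = ennreal (C powr P / mass * (Pk r x x' * \<bar>h x'\<bar> powr P))" for x x'
    have mF: "case_prod F \<in> borel_measurable (M \<Otimes>\<^sub>M M)"
      unfolding F_def case_prod_beta using measurable_Pk_pair[OF r] h by measurable
    have gF: "ennreal (\<bar>g x\<bar> powr P) \<le> (\<integral>\<^sup>+x'. F x x' \<partial>M)" if x: "x \<in> \<Lambda>" for x
    proof -
      have "\<bar>g x\<bar> powr P \<le> (C * q x) powr P" using gq[OF x] P by (intro powr_mono2) auto
      also have "\<dots> = C powr P * q x powr P" using C q0[OF x] by (simp add: powr_mult)
      also have "\<dots> \<le> C powr P * ((\<integral>x'. Pk r x x' * \<bar>h x'\<bar> powr P \<partial>M) / mass)"
        by (intro mult_left_mono jensen x) simp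
      also have "\<dots> = (\<integral>x'. C powr P / mass * (Pk r x x' * \<bar>h x'\<bar> powr P) \<partial>M)" by simp
      finally have "ennreal (\<bar>g x\<bar> powr P) \<le> ennreal (\<integral>x'. C powr P / mass * (Pk r x x' * \<bar>h x'\<bar> powr P) \<partial>M)"
        by (rule ennreal_leI)
      also have "\<dots> = (\<integral>\<^sup>+x'. F x x' \<partial>M)"
        unfolding F_def
        by (rule nn_integral_eq_integral[symmetric])
          (use iPhP[OF x] mass_pos Pk_nonneg[OF x _ r] in \<open>auto intro!: AE_I2 mult_nonneg_nonneg\<close>)
      finally show ?thesis .
    qed
    interpret MM: pair_sigma_finite M M ..
    have "(\<integral>\<^sup>+x. ennreal (\<bar>g x\<bar> powr P) \<partial>M) \<le> (\<integral>\<^sup>+x. (\<integral>\<^sup>+x'. F x x' \<partial>M) \<partial>M)"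
      by (rule nn_integral_mono) (use gF in auto)
    \<comment> \<open>By symmetry the kernel also has total mass \<open>mass\<close> in its first
      variable, which evaluates the inner integral after the exchange.\<close>
    also have "\<dots> = (\<integral>\<^sup>+x'. (\<integral>\<^sup>+x. F x x' \<partial>M) \<partial>M)" by (rule MM.Fubini'[OF mF, symmetric])
    also have "\<dots> = (\<integral>\<^sup>+x'. ennreal (C powr P) * ennreal (\<bar>h x'\<bar> powr P) \<partial>M)"
    proof (rule nn_integral_cong)
      fix x' assume "x' \<in> space M"
      then have x': "x' \<in> \<Lambda>" by simp
      have "(\<integral>\<^sup>+x. F x x' \<partial>M) = (\<integral>\<^sup>+x. ennreal (C powr P / mass * \<bar>h x'\<bar> powr P * Pk r x' x) \<partial>M)"
        unfolding F_def by (simp add: Pk_sym[of r x'] mult_ac)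
      also have "\<dots> = ennreal (\<integral>x. C powr P / mass * \<bar>h x'\<bar> powr P * Pk r x' x \<partial>M)"
        by (rule nn_integral_eq_integral)
          (use iP[OF x'] mass_pos Pk_nonneg[OF x' _ r] in \<open>auto intro!: AE_I2 mult_nonneg_nonneg\<close>)
      also have "(\<integral>x. C powr P / mass * \<bar>h x'\<bar> powr P * Pk r x' x \<partial>M) = C powr P * \<bar>h x'\<bar> powr P"
        using mass_pos by (simp add: Pk_mass[OF r x'])
      finally show "(\<integral>\<^sup>+x. F x x' \<partial>M) = ennreal (C powr P) * ennreal (\<bar>h x'\<bar> powr P)"
        by (simp add: ennreal_mult)
    qed
    also have "\<dots> = ennreal (C powr P) * (\<integral>\<^sup>+x'. ennreal (\<bar>h x'\<bar> powr P) \<partial>M)"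
      using h by (simp add: nn_integral_cmult)
    also have "\<dots> \<le> ennreal (C powr P) * ennreal (A powr P)"
      unfolding P_def using nrm_le_iff_fin[OF p pf, of A h] A by (intro mult_left_mono) auto
    also have "\<dots> = ennreal ((C * A) powr P)" using C A(2) by (simp add: powr_mult ennreal_mult)
    finally show ?thesis unfolding P_def using nrm_le_iff_fin[OF p pf, of "C * A"] C A(2) by simp
  qed
  then show ?thesis using A C by (simp add: ennreal_mult)
qed

section \<open>Multiplier operators and de la Vallee Poussin means\<close>

definition Mop :: "(nat \<Rightarrow> real) \<Rightarrow> nat \<Rightarrow> (real \<times> real \<Rightarrow> real) \<Rightarrow> real \<times> real \<Rightarrow> real" where
  "Mop m n h x = (\<Sum>k\<le>n. m k * T k h x)"

lemma Mop_PolyE: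
  assumes "mint h" "\<And>k. n < k \<Longrightarrow> k \<le> L \<Longrightarrow> m k = 0"
  shows "Mop m L h \<in> PolyE n"
proof -
  have "(\<lambda>x. \<Sum>k\<le>L. m k * T k h x) \<in> PolyE n"
  proof (rule PolyE_sum)
    fix k assume k: "k \<in> {..L}"
    show "(\<lambda>x. m k * T k h x) \<in> PolyE n"
    proof (cases "k \<le> n")
      case True
      then show ?thesis by (intro PolyE_cmult PolyE_mono[OF T_PolyE[OF assms(1)]])
    next
      case False
      then have "m k = 0" using assms(2)[of k] k by simp
      then show ?thesis by (simp add: PolyE_zero)
    qed
  qed
  then show ?thesis unfolding Mop_def[abs_def] .
qed

lemma T_sum_PolyE:
  assumes "finite A" "\<And>i. i \<in> A \<Longrightarrow> g i \<in> PolyE n"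
  shows "T k (\<lambda>x. \<Sum>i\<in>A. m i * g i x) x = (\<Sum>i\<in>A. m i * T k (g i) x)"
  using assms
proof (induction A rule: finite_induct)
  case empty
  show ?case by (simp add: T_def)
next
  case (insert i A)
  have "T k (\<lambda>x. m i * g i x + (\<Sum>i\<in>A. m i * g i x)) x
      = T k (\<lambda>x. m i * g i x) x + T k (\<lambda>x. \<Sum>i\<in>A. m i * g i x) x"
    by (intro T_add mint_PolyE[of _ n] PolyE_cmult PolyE_sum) (use insert in auto)
  then show ?case using insert by (simp add: T_cmult)
qed

lemma T_Mop:
  assumes h: "mint h"
  shows "T k (Mop m n h) x = (if k \<le> n then m k * T k h x else 0)"
proof -
  have "T k (Mop m n h) x = (\<Sum>i\<le>n. m i * T k (T i h) x)"
    unfolding Mop_def[abs_def]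
    by (rule T_sum_PolyE[of _ _ n]) (auto intro: PolyE_mono[OF T_PolyE[OF h]])
  also have "\<dots> = (\<Sum>i\<le>n. if i = k then m k * T k h x else 0)"
    by (rule sum.cong) (auto simp: T_T[OF h])
  finally show ?thesis by simp
qed

lemma Mop_kernel:
  assumes h: "mint h"
  shows "Mop m n h x = (\<integral>x'. (\<Sum>k\<le>n. m k * Zk k x x') * h x' \<partial>M) / mass"
proof -
  have "integrable M (\<lambda>x'. Zk k x x' * h x')" for k by (rule mint_integrable[OF h Zk_PolyE])
  then show ?thesis
    unfolding Mop_def T_def sum_distrib_right mult.assoc by (simp add: sum_divide_distrib)
qed

lemma cker_pos: "0 < cker l" by (simp add: cker_def)

text \<open>Not restricted to polynomials, since de la Vallee Poussin means are applied to smooth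
  functions and to their images under the fractional operator.\<close>

lemma nrm_ces_le:
  assumes h: "mint h" and p: "1 \<le> p" and d: "2 * l + 4 \<le> real d"
  shows "nrm p (Mop (ces d n) n h) \<le> ennreal (cker l * (real n + 1) ^ d) * nrm p h"
proof (rule nrm_kernel_le[OF _ _ _ _ p])
  show "0 < cker l * (real n + 1) ^ d" using cker_pos by (intro mult_pos_pos zero_less_power) auto
  show "h \<in> borel_measurable M" using h by (simp add: mint_def)
  show "\<bar>\<Sum>k\<le>n. ces d n k * Zk k x x'\<bar> \<le> cker l * (real n + 1) ^ d * Pk (real n / (real n + 1)) x x'"
    if "x \<in> \<Lambda>" "x' \<in> \<Lambda>" for x x'
    by (rule ces_kernel_le[OF that d])
  show "Mop (ces d n) n h x = (\<integral>x'. (\<Sum>k\<le>n. ces d n k * Zk k x x') * h x' \<partial>M) / mass" for x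
    by (rule Mop_kernel[OF h])
qed (auto simp: field_simps)

text \<open>For polynomials the Poisson integral is a finite sum and thus of the form
  \<open>Mop\<close>.\<close>

lemma nrm_poisson_le:
  assumes Q: "Q \<in> PolyE n" and p: "1 \<le> p" and r: "0 \<le> r" "r < 1"
  shows "nrm p (Mop (\<lambda>k. r ^ k) n Q) \<le> nrm p Q"
proof -
  have "nrm p (Mop (\<lambda>k. r ^ k) n Q) \<le> ennreal 1 * nrm p Q"
    by (rule nrm_kernel_le[OF r _ _ p, where K = "Pk r"])
      (use Pk_nonneg[OF _ _ r] Pk_integral[OF r _ Q] measurable_M[OF PolyE_measurable[OF Q]] in \<open>auto simp: Mop_def\<close>)
  then show ?thesis by simp
qed

lemma Mop_measurable: "mint h \<Longrightarrow> Mop m n h \<in> borel_measurable M"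
  by (rule measurable_M[OF PolyE_measurable[OF Mop_PolyE[of h n n]]]) auto

lemma Mop_extend: "(\<And>k. n < k \<Longrightarrow> k \<le> L \<Longrightarrow> m k * T k h x = 0) \<Longrightarrow> n \<le> L \<Longrightarrow> Mop m L h x = Mop m n h x"
  unfolding Mop_def by (rule sum.mono_neutral_right) (auto simp: not_le)

definition dl :: nat where "dl = nat \<lceil>2 * l + 4\<rceil>"

lemma dl: "2 * l + 4 \<le> real dl" "2 * l + 4 \<le> real (Suc dl)"
  using l_pos by (auto simp: dl_def) linarith+

text \<open>Each difference doubles the bound, and L dominates all Cesaro lengths that
  occur.\<close>

lemma nrm_vpd_le:
  assumes h: "mint h" and p: "1 \<le> p"
  shows "n0 + j * s \<le> L \<Longrightarrow> nrm p (Mop (vpd s dl j n0) L h) \<le> ennreal (2 ^ j * (cker l * (real L + 1) ^ dl)) * nrm p h"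
proof (induction j arbitrary: n0)
  case 0
  have "Mop (vpd s dl 0 n0) L h x = Mop (ces dl n0) n0 h x" for x
  proof -
    have "Mop (vpd s dl 0 n0) L h x = Mop (ces dl n0) L h x" by (simp add: Mop_def)
    also have "\<dots> = Mop (ces dl n0) n0 h x" by (rule Mop_extend) (use 0 in \<open>auto simp: ces_def\<close>)
    finally show ?thesis .
  qed
  then have "nrm p (Mop (vpd s dl 0 n0) L h) = nrm p (Mop (ces dl n0) n0 h)" by (intro nrm_cong p)
  also have "\<dots> \<le> ennreal (cker l * (real n0 + 1) ^ dl) * nrm p h" by (rule nrm_ces_le[OF h p dl(1)])
  also have "\<dots> \<le> ennreal (2 ^ 0 * (cker l * (real L + 1) ^ dl)) * nrm p h"
    using 0 cker_pos by (intro mult_right_mono ennreal_leI) (auto intro!: mult_left_mono power_mono)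
  finally show ?case .
next
  case (Suc j)
  let ?K = "ennreal (2 ^ j * (cker l * (real L + 1) ^ dl))"
  have "Mop (vpd s dl (Suc j) n0) L h = (\<lambda>x. Mop (vpd s dl j (n0 + s)) L h x + Mop (\<lambda>k. - vpd s dl j n0 k) L h x)"
    by (simp add: fun_eq_iff Mop_def sum.distrib[symmetric] algebra_simps)
  then have s1: "nrm p (Mop (vpd s dl (Suc j) n0) L h) \<le> nrm p (Mop (vpd s dl j (n0 + s)) L h) + nrm p (Mop (\<lambda>k. - vpd s dl j n0 k) L h)"
    using nrm_triangle[OF Mop_measurable[OF h] Mop_measurable[OF h] p] by simp
  have s2: "nrm p (Mop (\<lambda>k. - vpd s dl j n0 k) L h) \<le> nrm p (Mop (vpd s dl j n0) L h)"
    by (rule nrm_mono[OF _ p]) (simp add: Mop_def sum_negf)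
  have s3: "nrm p (Mop (vpd s dl j (n0 + s)) L h) + nrm p (Mop (vpd s dl j n0) L h) \<le> ?K * nrm p h + ?K * nrm p h"
    using Suc by (intro add_mono Suc.IH) auto
  have s4: "?K * nrm p h + ?K * nrm p h = ennreal (2 ^ Suc j * (cker l * (real L + 1) ^ dl)) * nrm p h"
    using cker_pos by (simp add: distrib_right[symmetric] ennreal_plus[symmetric] del: ennreal_plus)
  show ?case
    using order_trans[OF s1 order_trans[OF add_left_mono[OF s2] s3]] unfolding s4 .
qed

definition VP :: "nat \<Rightarrow> (real \<times> real \<Rightarrow> real) \<Rightarrow> real \<times> real \<Rightarrow> real" where
  "VP n h = Mop (\<lambda>k. vpd n dl dl n k / real n ^ dl) (n + dl * n) h"

text \<open>2^dl stems from the dl differences, (dl + 2)^dl from the longest Cesaro length; the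
  remaining n^dl cancels against the normalisation in \<open>VP\<close>.\<close>

definition Cv :: real where "Cv = 2 ^ dl * (cker l * (real dl + 2) ^ dl)"

lemma Cv_pos: "0 < Cv" using cker_pos by (simp add: Cv_def)

lemma nrm_VP_le:
  assumes h: "mint h" and p: "1 \<le> p" and n: "n \<ge> 1"
  shows "nrm p (VP n h) \<le> ennreal Cv * nrm p h"
proof (cases "nrm p h")
  case (real t)
  define L where "L = n + dl * n"
  have n1: "real n \<ge> 1" using n by simp
  have L: "real L + 1 \<le> (real dl + 2) * real n" using n1 by (simp add: L_def algebra_simps)
  have "nrm p (Mop (vpd n dl dl n) L h) \<le> ennreal (2 ^ dl * (cker l * (real L + 1) ^ dl)) * nrm p h"
    by (rule nrm_vpd_le[OF h p]) (simp add: L_def)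
  also have "\<dots> \<le> ennreal (2 ^ dl * (cker l * ((real dl + 2) * real n) ^ dl)) * nrm p h"
    using cker_pos L by (intro mult_right_mono ennreal_leI mult_left_mono power_mono) auto
  also have "2 ^ dl * (cker l * ((real dl + 2) * real n) ^ dl) = Cv * real n ^ dl"
    by (simp add: Cv_def power_mult_distrib)
  also have "ennreal (Cv * real n ^ dl) * nrm p h = ennreal (Cv * real n ^ dl * t)"
    using real Cv_pos by (simp add: ennreal_mult)
  finally have b: "nrm p (Mop (vpd n dl dl n) L h) \<le> ennreal (Cv * real n ^ dl * t)" .
  then obtain s where s: "nrm p (Mop (vpd n dl dl n) L h) = ennreal s" "0 \<le> s"
    by (cases "nrm p (Mop (vpd n dl dl n) L h)") (auto simp: top_unique)
  then have s': "s \<le> Cv * real n ^ dl * t" using b real Cv_pos by (simp add: ennreal_le_iff)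
  have "VP n h = (\<lambda>x. (1 / real n ^ dl) * Mop (vpd n dl dl n) L h x)"
    by (simp add: fun_eq_iff VP_def Mop_def L_def sum_distrib_left sum_divide_distrib)
  then have "nrm p (VP n h) \<le> ennreal (\<bar>1 / real n ^ dl\<bar> * s)"
    using nrm_cmult_le[OF Mop_measurable[OF h] p s, of "1 / real n ^ dl"] by (simp only:)
  also have "\<dots> \<le> ennreal (Cv * t)"
    using s' n1 by (intro ennreal_leI) (simp add: divide_le_eq mult_ac)
  also have "\<dots> = ennreal Cv * nrm p h" using real Cv_pos by (simp add: ennreal_mult)
  finally show ?thesis .
next
  case top
  then show ?thesis using Cv_pos by (simp add: ennreal_mult_top)
qed

lemma VP_PolyE: "mint h \<Longrightarrow> VP n h \<in> PolyE (n + dl * n)"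
  unfolding VP_def by (rule Mop_PolyE) auto

text \<open>By \<open>vpd_value\<close> the multiplier is 1 up to n, where all components of Q
  live.\<close>

lemma VP_reproduces:
  assumes Q: "Q \<in> PolyE m" and "m \<le> n" "1 \<le> n" and x: "x \<in> \<Lambda>"
  shows "VP n Q x = Q x"
proof -
  have "VP n Q x = Mop (\<lambda>k. vpd n dl dl n k / real n ^ dl) m Q x"
    unfolding VP_def by (rule Mop_extend) (use assms(2) T_low_degree[OF Q] in auto)
  also have "\<dots> = (\<Sum>k\<le>m. T k Q x)"
    unfolding Mop_def by (rule sum.cong) (use assms(2,3) vpd_value[of _ n n dl] in auto)
  finally show ?thesis unfolding sum_T[OF Q x] .
qed

text \<open>Norms of polynomials are finite, so passing to real values loses nothing and the
  abstract locales apply.\<close>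

definition pnu :: "ennreal \<Rightarrow> nat \<Rightarrow> (real \<times> real \<Rightarrow> real) \<Rightarrow> (nat \<Rightarrow> real) \<Rightarrow> real" where
  "pnu p n Q m = enn2real (nrm p (Mop m n Q))"

lemma pnu:
  assumes "mint Q" "1 \<le> p"
  shows "nrm p (Mop m n Q) = ennreal (pnu p n Q m)" "0 \<le> pnu p n Q m"
proof -
  have "nrm p (Mop m n Q) < \<infinity>"
    by (rule nrm_continuous_finite[OF PolyE_continuous[OF Mop_PolyE[OF assms(1), of n n]] assms(2)]) auto
  then show "nrm p (Mop m n Q) = ennreal (pnu p n Q m)" by (simp add: pnu_def less_top)
qed (simp add: pnu_def)

lemma pnu_cesaro_seminorm:
  assumes Q: "Q \<in> PolyE n" and p: "1 \<le> p"
  shows "cesaro_seminorm (pnu p n Q) dl (cker l) l"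
proof -
  have mi: "mint Q" by (rule mint_PolyE[OF Q])
  note pn = pnu[OF mi p] and me = Mop_measurable[OF mi]
  have le: "pnu p n Q m \<le> s" if "nrm p (Mop m n Q) \<le> ennreal s" "0 \<le> s" for m s
    using that pn(1)[of m n] by (simp add: ennreal_le_iff)
  \<comment> \<open>Composition of multipliers whose sums have unrelated lengths: both sides reduce
    to the common range of k, as q vanishes beyond L.\<close>
  have MM: "Mop q L (Mop m n Q) x = Mop (\<lambda>k. q k * m k) n Q x" if "\<And>k. L < k \<Longrightarrow> q k = 0" for q L m x
  proof -
    have "Mop q L (Mop m n Q) x = (\<Sum>k\<le>L. if k \<le> n then q k * m k * T k Q x else 0)"
      unfolding Mop_def[of q] by (rule sum.cong) (auto simp: T_Mop[OF mi])
    also have "\<dots> = (\<Sum>k\<in>{..L} \<inter> {..n}. q k * m k * T k Q x)"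
      by (subst sum.inter_restrict) auto
    also have "\<dots> = Mop (\<lambda>k. q k * m k) n Q x"
      unfolding Mop_def by (rule sum.mono_neutral_left) (use that in \<open>auto simp: not_le\<close>)
    finally show ?thesis .
  qed
  interpret S: mult_seminorm "pnu p n Q"
  proof
    fix m m' :: "nat \<Rightarrow> real" and k :: real
    have "Mop (\<lambda>k. m k + m' k) n Q = (\<lambda>x. Mop m n Q x + Mop m' n Q x)"
      by (simp add: fun_eq_iff Mop_def distrib_right sum.distrib)
    then have "nrm p (Mop (\<lambda>k. m k + m' k) n Q) \<le> ennreal (pnu p n Q m + pnu p n Q m')"
      using nrm_triangle[OF me me p] pn by (simp add: ennreal_plus)
    then show "pnu p n Q (\<lambda>k. m k + m' k) \<le> pnu p n Q m + pnu p n Q m'"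
      by (rule le) (simp add: pn)
    have hom: "pnu p n Q (\<lambda>j. k * m j) \<le> \<bar>k\<bar> * pnu p n Q m" for k m
    proof -
      have "Mop (\<lambda>j. k * m j) n Q = (\<lambda>x. k * Mop m n Q x)"
        by (simp add: fun_eq_iff Mop_def sum_distrib_left mult.assoc)
      then have "nrm p (Mop (\<lambda>j. k * m j) n Q) \<le> ennreal (\<bar>k\<bar> * pnu p n Q m)"
        using nrm_cmult_le[OF me p pn] by simp
      then show ?thesis by (rule le) (simp add: pn)
    qed
    show "pnu p n Q (\<lambda>j. k * m j) = \<bar>k\<bar> * pnu p n Q m"
    proof (cases "k = 0")
      case True
      then show ?thesis using hom[of 0 m] pn(2)[of n "\<lambda>j. 0"] by simp
    next
      case False
      have "pnu p n Q (\<lambda>j. (1 / k) * (k * m j)) \<le> \<bar>1 / k\<bar> * pnu p n Q (\<lambda>j. k * m j)" by (rule hom)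
      then have "\<bar>k\<bar> * pnu p n Q m \<le> pnu p n Q (\<lambda>j. k * m j)"
        using False by (simp add: field_simps)
      then show ?thesis using hom[of k m] by simp
    qed
    show "\<exists>N. \<forall>m m'. (\<forall>k\<le>N. m k = m' k) \<longrightarrow> pnu p n Q m = pnu p n Q m'"
    proof (intro exI[of _ n] allI impI)
      fix m m' :: "nat \<Rightarrow> real" assume "\<forall>k\<le>n. m k = m' k"
      then have "Mop m n Q = Mop m' n Q" by (simp add: fun_eq_iff Mop_def)
      then show "pnu p n Q m = pnu p n Q m'" by (simp add: pnu_def)
    qed
  qed
  show ?thesis
  proof
    show "0 < l" by (rule l_pos)
    show "0 \<le> cker l" using cker_pos by simp
    have PQ: "Mop m n Q \<in> PolyE n" for m by (rule Mop_PolyE[OF mi]) simp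
    show "S.bdd (\<lambda>k. r ^ k) 1" if r: "0 \<le> r" "r < 1" for r
      unfolding S.bdd_def
    proof
      fix m :: "nat \<Rightarrow> real"
      have "Mop (\<lambda>k. r ^ k) n (Mop m n Q) = Mop (\<lambda>k. r ^ k * m k) n Q"
      proof
        fix x
        show "Mop (\<lambda>k. r ^ k) n (Mop m n Q) x = Mop (\<lambda>k. r ^ k * m k) n Q x"
          unfolding Mop_def[of "\<lambda>k. r ^ k"] Mop_def[of "\<lambda>k. r ^ k * m k"]
          by (rule sum.cong) (auto simp: T_Mop[OF mi])
      qed
      then have "nrm p (Mop (\<lambda>k. r ^ k * m k) n Q) \<le> ennreal (pnu p n Q m)"
        using nrm_poisson_le[OF PQ p r, of m] pn by simp
      then show "pnu p n Q (\<lambda>k. r ^ k * m k) \<le> 1 * pnu p n Q m"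
        using le[of "\<lambda>k. r ^ k * m k"] pn by simp
    qed
    show "S.bdd (ces d N) (cker l * (real N + 1) ^ d)" if d: "d = dl \<or> d = Suc dl" for d N
      unfolding S.bdd_def
    proof
      fix m :: "nat \<Rightarrow> real"
      have "Mop (ces d N) N (Mop m n Q) = Mop (\<lambda>k. ces d N k * m k) n Q"
        by (rule ext, rule MM) (simp add: ces_def)
      moreover have "2 * l + 4 \<le> real d" using d dl by auto
      ultimately have "nrm p (Mop (\<lambda>k. ces d N k * m k) n Q) \<le> ennreal (cker l * (real N + 1) ^ d) * ennreal (pnu p n Q m)"
        using nrm_ces_le[OF mint_PolyE[OF PQ] p, of d N m] pn by simp
      also have "\<dots> = ennreal (cker l * (real N + 1) ^ d * pnu p n Q m)"
        using cker_pos pn by (simp add: ennreal_mult)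
      finally show "pnu p n Q (\<lambda>k. ces d N k * m k) \<le> cker l * (real N + 1) ^ d * pnu p n Q m"
        by (rule le) (use cker_pos pn in simp)
    qed
  qed
qed

section \<open>Jackson and Bernstein inequalities for polynomials\<close>

definition eig :: "nat \<Rightarrow> nat \<Rightarrow> real" where
  "eig r k = (real k * (real k + 2 * l)) powr (real r / 2)"

text \<open>Built from the Cesaro order and the kernel constant only: the seminorm of the locale
  depends on p and on a polynomial, the constant does not.\<close>

definition Cj :: real where "Cj = cesaro_seminorm.Kj dl (cker l)"

definition Cb :: real where "Cb = cesaro_seminorm.Kb dl (cker l) l"

text \<open>The degree L of Q does not enter the bound; this is essential, since Q will be a de la
  Vallee Poussin mean of uncontrolled degree.\<close>

lemma poly_jackson:
  assumes Q: "Q \<in> PolyE L" and p: "1 \<le> p" and n: "1 \<le> n" and r: "1 \<le> r"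
  obtains P where "P \<in> PolyE n"
    "nrm p (\<lambda>x. Q x - P x) \<le> ennreal ((Cj / real n) ^ r) * nrm p (Mop (eig r) L Q)"
proof
  interpret S: cesaro_seminorm "pnu p L Q" dl "cker l" l by (rule pnu_cesaro_seminorm[OF Q p])
  have mi: "mint Q" by (rule mint_PolyE[OF Q])
  \<comment> \<open>One minus the r-fold remainder of the Cesaro mean; it vanishes for k > n because
    the mean does.\<close>
  define w where "w k = 1 - (1 - cesmean (Suc dl) n k) ^ r" for k
  show "Mop w L Q \<in> PolyE n"
    by (rule Mop_PolyE[OF mi]) (simp add: w_def cesmean_eq_0)
  have "nrm p (\<lambda>x. Q x - Mop w L Q x) = nrm p (Mop (\<lambda>k. (1 - cesmean (Suc dl) n k) ^ r * 1) L Q)"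
  proof (rule nrm_cong[OF _ p])
    fix x assume "x \<in> \<Lambda>"
    then have "Q x = Mop (\<lambda>k. 1) L Q x" using sum_T[OF Q] by (simp add: Mop_def)
    then show "Q x - Mop w L Q x = Mop (\<lambda>k. (1 - cesmean (Suc dl) n k) ^ r * 1) L Q x"
      by (simp add: Mop_def sum_subtractf[symmetric] w_def algebra_simps)
  qed
  also have "\<dots> \<le> ennreal ((Cj / real n) ^ r * pnu p L Q (\<lambda>k. eig r k * 1))"
    unfolding pnu[OF mi p] Cj_def eig_def by (intro ennreal_leI S.jackson_ineq[OF n r])
  also have "\<dots> = ennreal ((Cj / real n) ^ r) * ennreal (pnu p L Q (\<lambda>k. eig r k))"
    using pnu(2)[OF mi p] by (simp add: ennreal_mult'')
  also have "\<dots> = ennreal ((Cj / real n) ^ r) * nrm p (Mop (eig r) L Q)"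
    by (simp only: pnu(1)[OF mi p])
  finally show "nrm p (\<lambda>x. Q x - Mop w L Q x) \<le> ennreal ((Cj / real n) ^ r) * nrm p (Mop (eig r) L Q)" .
qed

lemma poly_bernstein:
  assumes Q: "Q \<in> PolyE n" and p: "1 \<le> p" and n: "1 \<le> n" and r: "1 \<le> r"
  shows "nrm p (Mop (eig r) n Q) \<le> ennreal ((Cb * real n) ^ r) * nrm p Q"
proof -
  interpret S: cesaro_seminorm "pnu p n Q" dl "cker l" l by (rule pnu_cesaro_seminorm[OF Q p])
  have mi: "mint Q" by (rule mint_PolyE[OF Q])
  \<comment> \<open>Meets the support condition of \<open>bernstein_ineq\<close>; \<open>Mop\<close>
    with length n does not see the cut-off.\<close>
  define i where "i k = (if k \<le> n then 1 else 0 :: real)" for k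
  have "nrm p (Mop (eig r) n Q) = nrm p (Mop (\<lambda>k. eig r k * i k) n Q)"
    by (rule arg_cong[of _ _ "nrm p"]) (simp add: fun_eq_iff Mop_def i_def)
  also have "\<dots> \<le> ennreal ((Cb * real n) ^ r * pnu p n Q i)"
    unfolding pnu[OF mi p] Cb_def eig_def
    by (intro ennreal_leI S.bernstein_ineq[OF n r]) (simp add: i_def)
  also have "\<dots> = ennreal ((Cb * real n) ^ r) * ennreal (pnu p n Q i)"
    using pnu(2)[OF mi p] by (simp add: ennreal_mult'')
  also have "ennreal (pnu p n Q i) = nrm p (Mop i n Q)" by (simp only: pnu(1)[OF mi p])
  also have "\<dots> = nrm p Q"
    by (rule nrm_cong[OF _ p]) (use sum_T[OF Q] in \<open>simp add: Mop_def i_def\<close>)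
  finally show ?thesis .
qed

end

section \<open>Best approximation and the K-functional\<close>

lemma ennreal_le_mult_Inf:
  fixes x :: ennreal
  assumes "0 < C" "\<And>s. s \<in> S \<Longrightarrow> x \<le> ennreal C * s"
  shows "x \<le> ennreal C * Inf S"
proof -
  have C: "ennreal C * ennreal (1 / C) = 1" using assms(1) by (simp add: ennreal_mult[symmetric])
  have "ennreal (1 / C) * x \<le> Inf S"
  proof (rule Inf_greatest)
    fix s assume "s \<in> S"
    then have "ennreal (1 / C) * x \<le> ennreal (1 / C) * (ennreal C * s)"
      by (intro mult_left_mono assms(2)) auto
    also have "\<dots> = s" using C by (metis mult.assoc mult.commute mult_1)
    finally show "ennreal (1 / C) * x \<le> s" .
  qed
  then have "ennreal C * (ennreal (1 / C) * x) \<le> ennreal C * Inf S" by (rule mult_left_mono) simp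
  then show ?thesis using C by (metis mult.assoc mult_1)
qed

lemma ennreal_le_limit:
  assumes "\<And>\<epsilon>. 0 < \<epsilon> \<Longrightarrow> x \<le> ennreal (A + \<epsilon> * B)" "0 \<le> A" "0 \<le> B"
  shows "x \<le> ennreal A"
proof (rule ennreal_le_epsilon)
  fix \<delta> :: real assume \<delta>: "0 < \<delta>"
  have "x \<le> ennreal (A + \<delta> / (B + 1) * B)" using \<delta> assms(3) by (intro assms(1)) simp
  also have "\<dots> \<le> ennreal (A + \<delta>)"
  proof (intro ennreal_leI add_left_mono)
    have "\<delta> * B \<le> \<delta> * (B + 1)" using \<delta> by simp
    then show "\<delta> / (B + 1) * B \<le> \<delta>" using assms(3) by (simp add: divide_le_eq)
  qed
  also have "\<dots> = ennreal A + ennreal \<delta>" using assms \<delta> by (simp add: ennreal_plus)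
  finally show "x \<le> ennreal A + ennreal \<delta>" .
qed

lemma Ck_continuous: "Ck k G f \<Longrightarrow> continuous_on G f"
proof (cases k)
  case (Suc j)
  assume "Ck k G f"
  then obtain f1 f2 where "\<forall>x\<in>G. (f has_derivative (\<lambda>h. f1 x * fst h + f2 x * snd h)) (at x)"
    unfolding Suc Ck.simps by blast
  then show ?thesis by (blast intro: continuous_at_imp_continuous_on has_derivative_continuous)
qed simp

lemma Cr_on_continuous:
  assumes "Cr_on S r g"
  shows "continuous_on S g"
proof -
  obtain G F where "S \<subseteq> G" "Ck r G F" "\<forall>x\<in>S. F x = g x"
    using assms by (auto simp: Cr_on_def)
  then show ?thesis using Ck_continuous continuous_on_subset continuous_on_cong by metis
qed

text \<open>Both partial derivatives are again polynomial functions, so \<open>Ck\<close> can be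
  iterated; this makes polynomials admissible in the K-functional.\<close>

lemma real_polynomial_function_derivative:
  assumes "real_polynomial_function f"
  shows "\<exists>f1 f2. real_polynomial_function f1 \<and> real_polynomial_function f2 \<and>
    (\<forall>x :: real \<times> real. (f has_derivative (\<lambda>h. f1 x * fst h + f2 x * snd h)) (at x))"
  using assms
proof (induction f rule: real_polynomial_function.induct)
  case (linear f)
  have eq: "f h = f (1, 0) * fst h + f (0, 1) * snd h" for h
  proof -
    have "f h = f (fst h *\<^sub>R (1, 0) + snd h *\<^sub>R (0, 1))" by simp
    also have "\<dots> = fst h *\<^sub>R f (1, 0) + snd h *\<^sub>R f (0, 1)"
      by (simp only: linear_add[OF bounded_linear.linear[OF linear]] linear_scale[OF bounded_linear.linear[OF linear]])
    finally show ?thesis by simp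
  qed
  have "(\<lambda>h. f (1, 0) * fst h + f (0, 1) * snd h) = f" by (rule ext, rule eq[symmetric])
  then have "(f has_derivative (\<lambda>h. f (1, 0) * fst h + f (0, 1) * snd h)) (at x)" for x
    using bounded_linear.has_derivative[OF linear has_derivative_ident] by simp
  then show ?case by (intro exI[of _ "\<lambda>x. f (1, 0)"] exI[of _ "\<lambda>x. f (0, 1)"]) (auto intro: real_polynomial_function.intros)
next
  case (const k)
  show ?case by (intro exI[of _ "\<lambda>x. 0"]) (auto intro: real_polynomial_function.intros)
next
  case (add f g)
  then obtain f1 f2 g1 g2 where *: "real_polynomial_function f1" "real_polynomial_function f2"
      "real_polynomial_function g1" "real_polynomial_function g2"
    and d: "\<And>x. (f has_derivative (\<lambda>h. f1 x * fst h + f2 x * snd h)) (at x)"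
      "\<And>x. (g has_derivative (\<lambda>h. g1 x * fst h + g2 x * snd h)) (at x)" by blast
  have "((\<lambda>x. f x + g x) has_derivative (\<lambda>h. (f1 x + g1 x) * fst h + (f2 x + g2 x) * snd h)) (at x)" for x
    using has_derivative_add[OF d] by (simp add: algebra_simps)
  then show ?case using * by (intro exI[of _ "\<lambda>x. f1 x + g1 x"] exI[of _ "\<lambda>x. f2 x + g2 x"])
    (auto intro: real_polynomial_function.intros)
next
  case (mult f g)
  then obtain f1 f2 g1 g2 where *: "real_polynomial_function f1" "real_polynomial_function f2"
      "real_polynomial_function g1" "real_polynomial_function g2"
    and d: "\<And>x. (f has_derivative (\<lambda>h. f1 x * fst h + f2 x * snd h)) (at x)"
      "\<And>x. (g has_derivative (\<lambda>h. g1 x * fst h + g2 x * snd h)) (at x)" by blast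
  have "((\<lambda>x. f x * g x) has_derivative (\<lambda>h. (f x * g1 x + f1 x * g x) * fst h + (f x * g2 x + f2 x * g x) * snd h)) (at x)" for x
    using has_derivative_mult[OF d] by (simp add: algebra_simps)
  then show ?case using * mult(1,2)
    by (intro exI[of _ "\<lambda>x. f x * g1 x + f1 x * g x"] exI[of _ "\<lambda>x. f x * g2 x + f2 x * g x"])
      (auto intro: real_polynomial_function.intros)
qed

lemma real_polynomial_function_Ck: "real_polynomial_function f \<Longrightarrow> Ck k G f"
proof (induction k arbitrary: f)
  case 0
  then show ?case by (simp add: continuous_on_polymonial_function real_polynomial_function_eq)
next
  case (Suc k)
  obtain f1 f2 where "real_polynomial_function f1" "real_polynomial_function f2"
    "\<forall>x. (f has_derivative (\<lambda>h. f1 x * fst h + f2 x * snd h)) (at x)"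
    using real_polynomial_function_derivative[OF Suc(2)] by blast
  then show ?case using Suc(1) by (simp del: split_paired_All) blast
qed

lemma PolyE_Cr_on:
  assumes "f \<in> PolyE n"
  shows "Cr_on S r f"
proof -
  have "real_polynomial_function f" using assms
    by (induction f rule: PolyE_induct)
      (simp_all add: real_polynomial_function.intros real_polynomial_function_power bounded_linear_fst bounded_linear_snd)
  then show ?thesis unfolding Cr_on_def
    by (intro exI[of _ UNIV] exI[of _ f]) (auto intro: real_polynomial_function_Ck)
qed

text \<open>The block 2^s < k \<le> 2^(s+1) has 2^s terms, each at least 2^(s (r - 1)) E(2^(s+1)) by
  monotonicity; the factor 2^r pays for the passage from 2^s to 2^(s+1).\<close>

lemma dyadic_sum_le:
  fixes E :: "nat \<Rightarrow> real"
  assumes E: "\<And>k. 0 \<le> E k" "\<And>i j. i \<le> j \<Longrightarrow> E j \<le> E i" and r: "1 \<le> r"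
  shows "E 0 + (\<Sum>i\<le>s. 2 ^ (i * r) * E (2 ^ i)) \<le> 2 ^ r * (\<Sum>k\<le>2 ^ s. (real k + 1) ^ (r - 1) * E k)"
proof (induction s)
  case 0
  have "1 * E 0 \<le> 2 ^ r * E 0" by (intro mult_right_mono E) simp
  moreover have "1 * E 1 \<le> (2 ^ r * 2 ^ (r - 1)) * E 1" by (intro mult_right_mono E) (simp add: power_add[symmetric])
  ultimately show ?case by (simp add: atMost_Suc algebra_simps)
next
  case (Suc s)
  have "2 ^ (Suc s * r) * E (2 ^ Suc s) = 2 ^ r * (2 ^ s * (2 ^ (s * (r - 1)) * E (2 ^ Suc s)))"
  proof -
    have "s + s * (r - 1) = s * r" using r by (cases r) auto
    then have "(2 :: real) ^ (Suc s * r) = 2 ^ r * (2 ^ s * 2 ^ (s * (r - 1)))"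
      by (simp add: power_add[symmetric])
    then show ?thesis by simp
  qed
  also have "2 ^ s * (2 ^ (s * (r - 1)) * E (2 ^ Suc s)) = (\<Sum>k\<in>{2 ^ s<..(2::nat) ^ Suc s}. 2 ^ (s * (r - 1)) * E (2 ^ Suc s))"
    by simp
  also have "\<dots> \<le> (\<Sum>k\<in>{2 ^ s<..2 ^ Suc s}. (real k + 1) ^ (r - 1) * E k)"
  proof (rule sum_mono)
    fix k :: nat assume k: "k \<in> {2 ^ s<..2 ^ Suc s}"
    have "2 ^ s \<le> real k + 1" using k by (metis add_increasing2 greaterThanAtMost_iff less_imp_le numeral_power_le_of_nat_cancel_iff zero_le_one)
    then show "2 ^ (s * (r - 1)) * E (2 ^ Suc s) \<le> (real k + 1) ^ (r - 1) * E k"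
      using k by (intro mult_mono E) (auto simp: power_mult intro: power_mono)
  qed
  finally have 1: "2 ^ (Suc s * r) * E (2 ^ Suc s) \<le> 2 ^ r * (\<Sum>k\<in>{2 ^ s<..2 ^ Suc s}. (real k + 1) ^ (r - 1) * E k)"
    by simp
  have "{..2 ^ Suc s} = {..2 ^ s} \<union> {2 ^ s<..(2::nat) ^ Suc s}" by auto
  then have "(\<Sum>k\<le>2 ^ Suc s. (real k + 1) ^ (r - 1) * E k)
    = (\<Sum>k\<le>2 ^ s. (real k + 1) ^ (r - 1) * E k) + (\<Sum>k\<in>{2 ^ s<..2 ^ Suc s}. (real k + 1) ^ (r - 1) * E k)"
    by (simp only:) (subst sum.union_disjoint, auto)
  then show ?case using Suc 1 by (simp add: distrib_left)
qed

section \<open>Comparison of best approximation with the K-functional\<close>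

context jacobi_domain
begin

text \<open>From here on the fractional operator is nothing but the multiplier \<open>eig\<close> on
  the components T k.\<close>

lemma fracopD:
  assumes fr: "fracop a b c \<beta> \<gamma> r g h" and g: "mint g"
  shows "mint h" "T k h x = eig r k * T k g x"
proof -
  show h: "mint h" unfolding mint_def using fr PolyE_subset_PolyAll unfolding fracop_def by blast
  have "Defs.proj a b c \<beta> \<gamma> k h x = (real k * (real k + 2 * \<beta> + 2 * \<gamma> + 2)) powr (real r / 2) * Defs.proj a b c \<beta> \<gamma> k g x"
    using fr unfolding fracop_def by metis
  then show "T k h x = eig r k * T k g x"
    unfolding proj_eq_T[OF g] proj_eq_T[OF h] eig_def l_def by (simp add: algebra_simps)
qed

text \<open>A polynomial has finitely many components, so a finite sum meets the spectral
  definition; beyond degree m both sides are 0.\<close>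

lemma fracop_Mop:
  assumes P: "P \<in> PolyE m"
  shows "fracop a b c \<beta> \<gamma> r P (Mop (eig r) m P)"
  unfolding fracop_def
proof (intro conjI allI ballI)
  have P': "mint P" and H: "Mop (eig r) m P \<in> PolyE m"
    using P by (auto intro: mint_PolyE Mop_PolyE)
  show "Mop (eig r) m P \<in> borel_measurable M" by (rule Mop_measurable[OF P'])
  show "integrable M (\<lambda>x. Mop (eig r) m P x * Q x)" if "Q \<in> PolyAll k" for k Q
    using that by (intro integrable_M_continuous continuous_on_mult PolyE_continuous[OF H])
      (auto simp: PolyAll_def intro: continuous_on_poly2)
  show "Defs.proj a b c \<beta> \<gamma> k (Mop (eig r) m P) =
      (\<lambda>x. (real k * (real k + 2 * \<beta> + 2 * \<gamma> + 2)) powr (real r / 2) * Defs.proj a b c \<beta> \<gamma> k P x)" for k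
    unfolding proj_eq_T[OF P'] proj_eq_T[OF mint_PolyE[OF H]] using T_low_degree[OF P]
    by (auto simp: fun_eq_iff T_Mop[OF P'] eig_def l_def algebra_simps)
qed

lemma Mop_diff: "mint g \<Longrightarrow> mint h \<Longrightarrow> Mop m n (\<lambda>x. g x - h x) x = Mop m n g x - Mop m n h x"
  unfolding Mop_def by (simp add: T_diff right_diff_distrib sum_subtractf)

text \<open>Stone-Weierstrass: even polynomials separate the points of the domain because v \<ge> 0
  there, so v^2 determines v.\<close>

lemma PolyE_dense:
  assumes g: "continuous_on \<Lambda> g" and \<epsilon>: "0 < \<epsilon>"
  obtains m Q where "Q \<in> PolyE m" "\<And>x. x \<in> \<Lambda> \<Longrightarrow> \<bar>g x - Q x\<bar> < \<epsilon>"
proof -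
  interpret R: function_ring_on "\<Union>n. PolyE n" \<Lambda>
  proof
    show "compact \<Lambda>" by (rule compact_Lambda)
    show "continuous_on \<Lambda> f" if "f \<in> (\<Union>n. PolyE n)" for f using that PolyE_continuous by blast
    show "(\<lambda>x. f x + g x) \<in> (\<Union>n. PolyE n)" if "f \<in> (\<Union>n. PolyE n)" "g \<in> (\<Union>n. PolyE n)" for f g
    proof -
      obtain m n where "f \<in> PolyE m" "g \<in> PolyE n" using \<open>f \<in> _\<close> \<open>g \<in> _\<close> by blast
      then have "(\<lambda>x. f x + g x) \<in> PolyE (max m n)" by (intro PolyE_add) (auto intro: PolyE_mono)
      then show ?thesis by blast
    qed
    show "(\<lambda>x. f x * g x) \<in> (\<Union>n. PolyE n)" if "f \<in> (\<Union>n. PolyE n)" "g \<in> (\<Union>n. PolyE n)" for f g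
      using that PolyE_mult by blast
    show "(\<lambda>_. k) \<in> (\<Union>n. PolyE n)" for k using PolyE_const by blast
    show "\<exists>f\<in>\<Union>n. PolyE n. f x \<noteq> f y" if "x \<in> \<Lambda>" "y \<in> \<Lambda>" "x \<noteq> y" for x y
    proof (cases "fst x = fst y")
      case True
      then have "snd x \<noteq> snd y" "0 \<le> snd x" "0 \<le> snd y" using that by (auto simp: prod_eq_iff Lambda_iff)
      then have "(\<lambda>x. fst x ^ 0 * snd x ^ 2) x \<noteq> (\<lambda>x. fst x ^ 0 * snd x ^ 2) y" by simp
      moreover have "(\<lambda>x. fst x ^ 0 * snd x ^ 2) \<in> (\<Union>n. PolyE n)" by (rule UN_I[OF UNIV_I], rule PolyE_monomial[of 2 0 2]) simp_all
      ultimately show ?thesis by (rule bexI)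
    next
      case False
      then have "(\<lambda>x. fst x ^ 1 * snd x ^ 0) x \<noteq> (\<lambda>x. fst x ^ 1 * snd x ^ 0) y" by simp
      moreover have "(\<lambda>x. fst x ^ 1 * snd x ^ 0) \<in> (\<Union>n. PolyE n)" by (rule UN_I[OF UNIV_I], rule PolyE_monomial[of 0 1 1]) simp_all
      ultimately show ?thesis by (rule bexI)
    qed
  qed
  show ?thesis using R.Stone_Weierstrass_basic[OF g \<epsilon>] that by blast
qed

lemma VP_approximates:
  assumes g: "continuous_on \<Lambda> g" and \<epsilon>: "0 < \<epsilon>"
  obtains L where "L \<ge> 1" "\<And>x. x \<in> \<Lambda> \<Longrightarrow> \<bar>g x - VP L g x\<bar> \<le> \<epsilon>"
proof -
  \<comment> \<open>The error of the mean is g - Q minus the mean of g - Q, hence at most 1 + Cv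
    times the error of Q.\<close>
  define \<delta> where "\<delta> = \<epsilon> / (1 + Cv)"
  have "\<delta> * (1 + Cv) = \<epsilon>" using Cv_pos by (simp add: \<delta>_def)
  then have \<delta>: "\<delta> + Cv * \<delta> = \<epsilon>" by (simp add: algebra_simps)
  have \<delta>0: "0 < \<delta>" using \<epsilon> Cv_pos by (simp add: \<delta>_def)
  obtain m Q where Q: "Q \<in> PolyE m" "\<And>x. x \<in> \<Lambda> \<Longrightarrow> \<bar>g x - Q x\<bar> < \<delta>"
    using PolyE_dense[OF g \<delta>0] by blast
  define L where "L = max 1 m"
  have L: "L \<ge> 1" "m \<le> L" by (auto simp: L_def)
  have mi: "mint g" "mint Q" "mint (\<lambda>x. g x - Q x)"
    using g PolyE_continuous[OF Q(1)] by (auto intro!: mint_continuous continuous_intros)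
  have "nrm \<infinity> (\<lambda>x. g x - Q x) \<le> ennreal \<delta>" using Q(2) \<delta>0 by (subst nrm_le_iff_inf) (auto intro: less_imp_le)
  then have "nrm \<infinity> (VP L (\<lambda>x. g x - Q x)) \<le> ennreal Cv * ennreal \<delta>"
    by (intro order_trans[OF nrm_VP_le[OF mi(3) _ L(1)]] mult_left_mono) auto
  also have "\<dots> = ennreal (Cv * \<delta>)" using Cv_pos \<delta> \<delta>0 by (simp add: ennreal_mult)
  finally have 1: "\<bar>VP L (\<lambda>x. g x - Q x) x\<bar> \<le> Cv * \<delta>" if "x \<in> \<Lambda>" for x
    using that Cv_pos \<delta>0 by (subst (asm) nrm_le_iff_inf) auto
  show ?thesis
  proof (rule that[OF L(1)])
    fix x assume x: "x \<in> \<Lambda>"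
    have "VP L (\<lambda>x. g x - Q x) x = VP L g x - Q x"
      using VP_reproduces[OF Q(1) L(2,1) x] Mop_diff[OF mi(1,2)] by (simp add: VP_def)
    then show "\<bar>g x - VP L g x\<bar> \<le> \<epsilon>" using 1[OF x] Q(2)[OF x] \<delta> by linarith
  qed
qed

text \<open>The polynomial inequality is applied to VP L g. Multipliers commute, so its image under
  the fractional operator is VP L h, of norm at most Cv times that of h whatever L is; L is
  therefore free to be chosen with VP L g uniformly \<epsilon>-close to g.\<close>

lemma jackson_smooth:
  assumes g: "continuous_on \<Lambda> g" and h: "mint h" "\<And>k x. T k h x = eig r k * T k g x"
    and p: "1 \<le> p" and n: "1 \<le> n" and r: "1 \<le> r" and \<epsilon>: "0 < \<epsilon>"
  obtains P where "P \<in> PolyE n"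
    "nrm p (\<lambda>x. g x - P x) \<le> ennreal (\<bar>Cj\<bar> ^ r * Cv) * (ennreal ((1 / real n) ^ r) * nrm p h) + ennreal (\<epsilon> * mB)"
proof -
  obtain L where L: "L \<ge> 1" "\<And>x. x \<in> \<Lambda> \<Longrightarrow> \<bar>g x - VP L g x\<bar> \<le> \<epsilon>" by (rule VP_approximates[OF g \<epsilon>]) blast
  have g': "mint g" by (rule mint_continuous[OF g])
  define K where "K = L + dl * L"
  have Q: "VP L g \<in> PolyE K" unfolding K_def by (rule VP_PolyE[OF g'])
  obtain P where P: "P \<in> PolyE n"
    "nrm p (\<lambda>x. VP L g x - P x) \<le> ennreal ((Cj / real n) ^ r) * nrm p (Mop (eig r) K (VP L g))"
    by (rule poly_jackson[OF Q p n r])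
  have "Mop (eig r) K (VP L g) = VP L h"
    by (rule ext) (simp add: VP_def K_def[symmetric] Mop_def[of "eig r"] T_Mop[OF g'], simp add: Mop_def h(2) mult_ac)
  then have "nrm p (\<lambda>x. VP L g x - P x) \<le> ennreal ((Cj / real n) ^ r) * nrm p (VP L h)"
    using P(2) by (simp only:)
  also have "\<dots> \<le> ennreal ((Cj / real n) ^ r) * (ennreal Cv * nrm p h)"
    by (intro mult_left_mono nrm_VP_le[OF h(1) p L(1)]) simp
  also have "\<dots> \<le> ennreal (\<bar>Cj\<bar> ^ r * (1 / real n) ^ r) * (ennreal Cv * nrm p h)"
  proof (intro mult_right_mono ennreal_leI)
    have "(Cj / real n) ^ r \<le> \<bar>Cj / real n\<bar> ^ r" by (metis abs_ge_self power_abs)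
    also have "\<bar>Cj / real n\<bar> = \<bar>Cj\<bar> * (1 / real n)" by simp
    finally show "(Cj / real n) ^ r \<le> \<bar>Cj\<bar> ^ r * (1 / real n) ^ r" by (simp only: power_mult_distrib)
  qed simp
  also have "\<dots> = ennreal (\<bar>Cj\<bar> ^ r * Cv) * (ennreal ((1 / real n) ^ r) * nrm p h)"
    using Cv_pos by (simp add: ennreal_mult mult_ac)
  finally have 1: "nrm p (\<lambda>x. VP L g x - P x) \<le> ennreal (\<bar>Cj\<bar> ^ r * Cv) * (ennreal ((1 / real n) ^ r) * nrm p h)" .
  have 2: "nrm p (\<lambda>x. g x - VP L g x) \<le> ennreal (\<epsilon> * mB)"
    by (rule nrm_bounded_le) (use L g \<epsilon> p PolyE_continuous[OF Q] in \<open>auto intro!: continuous_intros measurable_M_continuous\<close>)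
  have "nrm p (\<lambda>x. (g x - VP L g x) + (VP L g x - P x)) \<le> nrm p (\<lambda>x. g x - VP L g x) + nrm p (\<lambda>x. VP L g x - P x)"
    by (rule nrm_triangle) (use g p PolyE_continuous[OF Q] PolyE_continuous[OF P(1)] in \<open>auto intro!: continuous_intros measurable_M_continuous\<close>)
  also have "(\<lambda>x. (g x - VP L g x) + (VP L g x - P x)) = (\<lambda>x. g x - P x)" by simp
  also have "nrm p (\<lambda>x. g x - VP L g x) + nrm p (\<lambda>x. VP L g x - P x)
      \<le> ennreal (\<epsilon> * mB) + ennreal (\<bar>Cj\<bar> ^ r * Cv) * (ennreal ((1 / real n) ^ r) * nrm p h)"
    by (rule add_mono[OF 2 1])
  finally show ?thesis using that[OF P(1)] by (simp add: add.commute)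
qed

lemma Ebest_le: "P \<in> PolyE n \<Longrightarrow> Ebest a b c \<beta> \<gamma> p n f \<le> nrm p (\<lambda>x. f x - P x)"
  unfolding Ebest_def by (rule INF_lower)

text \<open>The 1 pays for replacing f by a competitor g, the other summand is the constant of
  \<open>jackson_smooth\<close>; its additive error is scaled by 1 / mB and removed in the
  limit.\<close>

theorem Ebest_le_Kfun:
  assumes f: "f \<in> borel_measurable M" and p: "1 \<le> p" and n: "1 \<le> n" and r: "1 \<le> r"
  shows "Ebest a b c \<beta> \<gamma> p n f \<le> ennreal (1 + \<bar>Cj\<bar> ^ r * Cv) * Kfun a b c \<beta> \<gamma> p r f (1 / real n)"
  unfolding Kfun_def
proof (rule ennreal_le_mult_Inf)
  have C: "0 \<le> \<bar>Cj\<bar> ^ r * Cv" using Cv_pos by simp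
  then show "0 < 1 + \<bar>Cj\<bar> ^ r * Cv" by linarith
  fix s assume "s \<in> {nrm p (\<lambda>x. f x - g x) + ennreal ((1 / real n) ^ r) * nrm p h | g h.
          Cr_on \<Lambda> r g \<and> fracop a b c \<beta> \<gamma> r g h}"
  then obtain g h where s: "s = nrm p (\<lambda>x. f x - g x) + ennreal ((1 / real n) ^ r) * nrm p h"
    and g: "continuous_on \<Lambda> g" and fr: "fracop a b c \<beta> \<gamma> r g h"
    by (auto dest: Cr_on_continuous)
  note fr' = fracopD[OF fr mint_continuous[OF g]]
  define X where "X = ennreal ((1 / real n) ^ r) * nrm p h"
  have mB: "0 < mB" using mass_pos by (simp add: mB_def)
  have "Ebest a b c \<beta> \<gamma> p n f \<le> nrm p (\<lambda>x. f x - g x) + ennreal (\<bar>Cj\<bar> ^ r * Cv) * X"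
  proof (rule ennreal_le_epsilon)
    fix \<epsilon> :: real assume \<epsilon>: "0 < \<epsilon>"
    then have "0 < \<epsilon> / mB" using mB by simp
    from jackson_smooth[OF g fr' p n r this]
    obtain P where P: "P \<in> PolyE n" "nrm p (\<lambda>x. g x - P x) \<le> ennreal (\<bar>Cj\<bar> ^ r * Cv) * X + ennreal \<epsilon>"
      using mB unfolding X_def by auto
    have "Ebest a b c \<beta> \<gamma> p n f \<le> nrm p (\<lambda>x. (f x - g x) + (g x - P x))" using Ebest_le[OF P(1)] by simp
    also have "\<dots> \<le> nrm p (\<lambda>x. f x - g x) + nrm p (\<lambda>x. g x - P x)"
      using f measurable_M_continuous[OF g] measurable_M_continuous[OF PolyE_continuous[OF P(1)]] p
      by (intro nrm_triangle) auto
    also have "\<dots> \<le> nrm p (\<lambda>x. f x - g x) + (ennreal (\<bar>Cj\<bar> ^ r * Cv) * X + ennreal \<epsilon>)"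
      using P(2) by (rule add_left_mono)
    finally show "Ebest a b c \<beta> \<gamma> p n f \<le> nrm p (\<lambda>x. f x - g x) + ennreal (\<bar>Cj\<bar> ^ r * Cv) * X + ennreal \<epsilon>"
      by (simp add: add.assoc)
  qed
  also have "\<dots> \<le> ennreal (1 + \<bar>Cj\<bar> ^ r * Cv) * nrm p (\<lambda>x. f x - g x) + ennreal (1 + \<bar>Cj\<bar> ^ r * Cv) * X"
  proof (intro add_mono mult_right_mono ennreal_leI)
    have "1 * nrm p (\<lambda>x. f x - g x) \<le> ennreal (1 + \<bar>Cj\<bar> ^ r * Cv) * nrm p (\<lambda>x. f x - g x)"
      using C by (intro mult_right_mono) (simp_all add: ennreal_plus)
    then show "nrm p (\<lambda>x. f x - g x) \<le> ennreal (1 + \<bar>Cj\<bar> ^ r * Cv) * nrm p (\<lambda>x. f x - g x)" by simp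
  qed auto
  also have "\<dots> = ennreal (1 + \<bar>Cj\<bar> ^ r * Cv) * s" by (simp add: s X_def distrib_left)
  finally show "Ebest a b c \<beta> \<gamma> p n f \<le> ennreal (1 + \<bar>Cj\<bar> ^ r * Cv) * s" .
qed

lemma Kfun_le:
  assumes "P \<in> PolyE m"
  shows "Kfun a b c \<beta> \<gamma> p r f \<rho> \<le> nrm p (\<lambda>x. f x - P x) + ennreal (\<rho> ^ r) * nrm p (Mop (eig r) m P)"
  unfolding Kfun_def using PolyE_Cr_on[OF assms] fracop_Mop[OF assms] by (intro Inf_lower) blast

text \<open>One link of the telescoping: the image of P is that of Q plus that of P - Q, a
  polynomial of degree m whose norm is at most A + B by comparison with f.\<close>

lemma bernstein_step:
  assumes f: "f \<in> borel_measurable M" and P: "P \<in> PolyE m" and Q: "Q \<in> PolyE k" and k: "k \<le> m"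
    and p: "1 \<le> p" and m: "1 \<le> m" and r: "1 \<le> r"
    and A: "nrm p (\<lambda>x. f x - P x) \<le> ennreal A" "0 \<le> A" and B: "nrm p (\<lambda>x. f x - Q x) \<le> ennreal B" "0 \<le> B"
    and D: "nrm p (Mop (eig r) k Q) \<le> ennreal D" "0 \<le> D"
  shows "nrm p (Mop (eig r) m P) \<le> ennreal (D + \<bar>Cb\<bar> ^ r * real m ^ r * (A + B))"
proof -
  have Qm: "Q \<in> PolyE m" by (rule PolyE_mono[OF Q k])
  have mi: "mint P" "mint Q" "mint (\<lambda>x. P x - Q x)"
    using P Qm PolyE_diff[OF P Qm] by (auto intro: mint_PolyE)
  have meas: "P \<in> borel_measurable M" "Q \<in> borel_measurable M" using mi by (auto simp: mint_def)
  have "nrm p (\<lambda>x. P x - Q x) \<le> nrm p (\<lambda>x. (f x - Q x) + (- 1) * (f x - P x))" by simp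
  also have "\<dots> \<le> nrm p (\<lambda>x. f x - Q x) + nrm p (\<lambda>x. (- 1) * (f x - P x))"
    using f meas p by (intro nrm_triangle) auto
  also have "nrm p (\<lambda>x. (- 1) * (f x - P x)) = nrm p (\<lambda>x. f x - P x)"
    by (intro antisym nrm_mono) (use p in auto)
  finally have PQ: "nrm p (\<lambda>x. P x - Q x) \<le> ennreal (A + B)"
    using order_trans[OF _ add_mono[OF B(1) A(1)]] A(2) B(2) by (simp add: ennreal_plus add.commute)
  have "Mop (eig r) m P = (\<lambda>x. Mop (eig r) k Q x + Mop (eig r) m (\<lambda>x. P x - Q x) x)"
  proof
    fix x
    have "Mop (eig r) m Q x = Mop (eig r) k Q x"
      by (rule Mop_extend[OF _ k]) (simp add: T_low_degree[OF Q])
    then show "Mop (eig r) m P x = Mop (eig r) k Q x + Mop (eig r) m (\<lambda>x. P x - Q x) x"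
      by (simp add: Mop_diff[OF mi(1,2)])
  qed
  then have "nrm p (Mop (eig r) m P) \<le> nrm p (Mop (eig r) k Q) + nrm p (Mop (eig r) m (\<lambda>x. P x - Q x))"
    using nrm_triangle[OF Mop_measurable[OF mi(2)] Mop_measurable[OF mi(3)] p, of "eig r" k "eig r" m] by simp
  also have "\<dots> \<le> ennreal D + ennreal ((Cb * real m) ^ r) * ennreal (A + B)"
    by (intro add_mono D(1) order_trans[OF poly_bernstein[OF PolyE_diff[OF P Qm] p m r]] mult_left_mono PQ) simp
  also have "\<dots> \<le> ennreal D + ennreal (\<bar>Cb\<bar> ^ r * real m ^ r) * ennreal (A + B)"
  proof (intro add_left_mono mult_right_mono ennreal_leI)
    have "(Cb * real m) ^ r \<le> \<bar>Cb * real m\<bar> ^ r" by (metis abs_ge_self power_abs)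
    then show "(Cb * real m) ^ r \<le> \<bar>Cb\<bar> ^ r * real m ^ r" by (simp add: abs_mult power_mult_distrib)
  qed simp
  also have "\<dots> = ennreal (D + \<bar>Cb\<bar> ^ r * real m ^ r * (A + B))"
    using A(2) B(2) D(2) by (simp add: ennreal_plus ennreal_mult)
  finally show ?thesis .
qed

theorem Kfun_le_Ebest:
  assumes f: "Lp_class a b c \<beta> \<gamma> p f" and p: "1 \<le> p" and n: "1 \<le> n" and r: "1 \<le> r"
  shows "Kfun a b c \<beta> \<gamma> p r f (1 / real n)
    \<le> ennreal ((2 ^ r + \<bar>Cb\<bar> ^ r * (2 ^ r + 1)) * 2 ^ r) * ennreal (1 / real n ^ r) *
          (\<Sum>k\<le>n. ennreal ((real k + 1) ^ (r - 1)) * Ebest a b c \<beta> \<gamma> p k f)"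
proof -
  note f' = Lp_classD[OF f p]
  define C where "C = \<bar>Cb\<bar> ^ r"
  have C: "0 \<le> C" by (simp add: C_def)
  define E where "E k = enn2real (Ebest a b c \<beta> \<gamma> p k f)" for k
  have fin: "Ebest a b c \<beta> \<gamma> p k f < \<infinity>" for k
    using Ebest_le[OF PolyE_zero, of p k f] f'(2) by (auto intro: le_less_trans)
  then have E: "Ebest a b c \<beta> \<gamma> p k f = ennreal (E k)" for k by (simp add: E_def)
  have E0: "0 \<le> E k" for k by (simp add: E_def)
  have E_mono: "E j \<le> E i" if "i \<le> j" for i j
  proof -
    have "Ebest a b c \<beta> \<gamma> p j f \<le> Ebest a b c \<beta> \<gamma> p i f"
      unfolding Ebest_def by (rule INF_superset_mono) (use that PolyE_mono in auto)
    then show ?thesis unfolding E using E0 by simp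
  qed
  define S where "S F = (\<Sum>k\<le>n. (real k + 1) ^ (r - 1) * F k)" for F :: "nat \<Rightarrow> real"
  define C2 where "C2 = (2 ^ r + C * (2 ^ r + 1)) * 2 ^ r"
  have C2: "0 \<le> C2" using C by (simp add: C2_def)
  obtain s where s: "2 ^ s \<le> n" "n < 2 ^ Suc s" using ex_power_ivl1[of 2 n] n by auto
  \<comment> \<open>Near-best approximants with error E k + \<epsilon> avoid the question whether
    the infimum is attained; the same \<epsilon> for all k keeps the errors monotone.\<close>
  have main: "Kfun a b c \<beta> \<gamma> p r f (1 / real n) \<le> ennreal (C2 * (1 / real n ^ r) * S (\<lambda>k. E k + \<epsilon>))"
    if \<epsilon>: "0 < \<epsilon>" for \<epsilon>
  proof -
    define F where "F k = E k + \<epsilon>" for k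
    have F0: "0 \<le> F k" for k using E0[of k] \<epsilon> by (simp add: F_def)
    have F_mono: "F j \<le> F i" if "i \<le> j" for i j using E_mono[OF that] by (simp add: F_def)
    have "\<exists>P\<in>PolyE k. nrm p (\<lambda>x. f x - P x) \<le> ennreal (F k)" for k
    proof -
      have "Ebest a b c \<beta> \<gamma> p k f < ennreal (F k)" unfolding E F_def using E0 \<epsilon> by (simp add: ennreal_lessI)
      then show ?thesis unfolding Ebest_def INF_less_iff by (blast intro: less_imp_le)
    qed
    then obtain P where P: "\<And>k. P k \<in> PolyE k" "\<And>k. nrm p (\<lambda>x. f x - P k x) \<le> ennreal (F k)" by metis
    \<comment> \<open>Telescoping along the degrees 0, 1, 2, 4, ..., starting at degree 0, which the
      operator annihilates. The error at 2^i enters two consecutive links, with the powers 2^(i r)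
      and 2^((i + 1) r), whence 2^r + 1; the last error enters only once.\<close>
    have H: "nrm p (Mop (eig r) (2 ^ t) (P (2 ^ t)))
      \<le> ennreal (C * (F 0 + (2 ^ r + 1) * (\<Sum>i<t. 2 ^ (i * r) * F (2 ^ i)) + 2 ^ (t * r) * F (2 ^ t)))" for t
    proof (induction t)
      case 0
      have "Mop (eig r) 0 (P 0) = (\<lambda>x. 0)" by (simp add: fun_eq_iff Mop_def eig_def)
      then have "nrm p (Mop (eig r) 0 (P 0)) \<le> ennreal 0"
        using nrm_bounded_le[where f = "\<lambda>x. 0" and B = 0 and p = p] p by simp
      from bernstein_step[OF f'(1) P(1) P(1) _ p _ r P(2) F0 P(2) F0 this, of 1]
      show ?case by (simp add: C_def[symmetric] algebra_simps)
    next
      case (Suc t)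
      have "0 \<le> C * (F 0 + (2 ^ r + 1) * (\<Sum>i<t. 2 ^ (i * r) * F (2 ^ i)) + 2 ^ (t * r) * F (2 ^ t))"
        using F0 C by (intro mult_nonneg_nonneg add_nonneg_nonneg sum_nonneg) auto
      from bernstein_step[OF f'(1) P(1) P(1) _ p _ r P(2) F0 P(2) F0 Suc this, of "2 ^ Suc t"]
      have "nrm p (Mop (eig r) (2 ^ Suc t) (P (2 ^ Suc t)))
        \<le> ennreal (C * (F 0 + (2 ^ r + 1) * (\<Sum>i<t. 2 ^ (i * r) * F (2 ^ i)) + 2 ^ (t * r) * F (2 ^ t))
          + C * real (2 ^ Suc t) ^ r * (F (2 ^ Suc t) + F (2 ^ t)))"
        by (simp add: C_def[symmetric])
      also have "real (2 ^ Suc t) ^ r = 2 ^ (Suc t * r)" by (simp only: of_nat_power power_mult of_nat_numeral)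
      also have "C * (F 0 + (2 ^ r + 1) * (\<Sum>i<t. 2 ^ (i * r) * F (2 ^ i)) + 2 ^ (t * r) * F (2 ^ t))
          + C * 2 ^ (Suc t * r) * (F (2 ^ Suc t) + F (2 ^ t))
        = C * (F 0 + (2 ^ r + 1) * (\<Sum>i<Suc t. 2 ^ (i * r) * F (2 ^ i)) + 2 ^ (Suc t * r) * F (2 ^ Suc t))"
        by (simp add: power_add algebra_simps)
      finally show ?case .
    qed
    define B where "B = F 0 + (\<Sum>i\<le>s. 2 ^ (i * r) * F (2 ^ i))"
    have B0: "0 \<le> B" unfolding B_def using F0 by (intro add_nonneg_nonneg sum_nonneg) auto
    have Bsum: "B = F 0 + (\<Sum>i<s. 2 ^ (i * r) * F (2 ^ i)) + 2 ^ (s * r) * F (2 ^ s)"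
      by (simp add: B_def lessThan_Suc_atMost[symmetric])
    have S0: "0 \<le> (\<Sum>i<s. 2 ^ (i * r) * F (2 ^ i))" using F0 by (intro sum_nonneg) auto
    have H': "nrm p (Mop (eig r) (2 ^ s) (P (2 ^ s))) \<le> ennreal (C * ((2 ^ r + 1) * B))"
    proof (rule order_trans[OF H], intro ennreal_leI mult_left_mono C)
      have "0 \<le> 2 ^ r * F 0" "0 \<le> 2 ^ r * (2 ^ (s * r) * F (2 ^ s))" using F0 by simp_all
      then show "F 0 + (2 ^ r + 1) * (\<Sum>i<s. 2 ^ (i * r) * F (2 ^ i)) + 2 ^ (s * r) * F (2 ^ s) \<le> (2 ^ r + 1) * B"
        unfolding Bsum by (simp add: algebra_simps)
    qed
    have nr: "0 < real n ^ r" using n by simp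
    \<comment> \<open>Since n < 2^(s + 1), the approximation error is at most 2^r n^(-r) times the
      last term of the dyadic sum.\<close>
    have Fs: "F (2 ^ s) \<le> 2 ^ r * (1 / real n ^ r) * B"
    proof -
      have "real n \<le> 2 ^ Suc s" using s(2) by (metis less_imp_le of_nat_less_iff of_nat_numeral of_nat_power)
      then have "real n ^ r \<le> 2 ^ r * 2 ^ (s * r)"
        using power_mono[of "real n" "2 ^ Suc s" r] by (simp add: power_mult_distrib power_mult)
      then have "real n ^ r * F (2 ^ s) \<le> 2 ^ r * (2 ^ (s * r) * F (2 ^ s))"
        using F0[of "2 ^ s"] by (simp add: mult.assoc[symmetric] mult_right_mono)
      also have "\<dots> \<le> 2 ^ r * B" unfolding Bsum using F0[of 0] S0 by (intro mult_left_mono) auto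
      finally show ?thesis using nr by (simp add: field_simps)
    qed
    have "B \<le> 2 ^ r * (\<Sum>k\<le>2 ^ s. (real k + 1) ^ (r - 1) * F k)"
      unfolding B_def by (rule dyadic_sum_le[OF F0 F_mono r])
    also have "\<dots> \<le> 2 ^ r * S F"
      unfolding S_def using s(1) F0 by (intro mult_left_mono sum_mono2) auto
    finally have BS: "B \<le> 2 ^ r * S F" .
    have "Kfun a b c \<beta> \<gamma> p r f (1 / real n) \<le> nrm p (\<lambda>x. f x - P (2 ^ s) x)
        + ennreal ((1 / real n) ^ r) * nrm p (Mop (eig r) (2 ^ s) (P (2 ^ s)))"
      by (rule Kfun_le[OF P(1)])
    also have "\<dots> \<le> ennreal (F (2 ^ s)) + ennreal ((1 / real n) ^ r) * ennreal (C * ((2 ^ r + 1) * B))"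
      by (intro add_mono mult_left_mono P(2) H') simp
    also have "\<dots> = ennreal (F (2 ^ s) + (1 / real n ^ r) * (C * ((2 ^ r + 1) * B)))"
      using F0 C B0 by (simp add: ennreal_plus[symmetric] ennreal_mult[symmetric] power_divide del: ennreal_plus)
    also have "\<dots> \<le> ennreal (C2 * (1 / real n ^ r) * S F)"
    proof (rule ennreal_leI)
      have "F (2 ^ s) + (1 / real n ^ r) * (C * ((2 ^ r + 1) * B)) \<le> (2 ^ r + C * (2 ^ r + 1)) * (1 / real n ^ r) * B"
        using Fs by (simp add: algebra_simps)
      also have "\<dots> \<le> (2 ^ r + C * (2 ^ r + 1)) * (1 / real n ^ r) * (2 ^ r * S F)"
        using BS C nr by (intro mult_left_mono) auto
      finally show "F (2 ^ s) + (1 / real n ^ r) * (C * ((2 ^ r + 1) * B)) \<le> C2 * (1 / real n ^ r) * S F"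
        by (simp add: C2_def mult_ac)
    qed
    finally show ?thesis unfolding F_def[abs_def] .
  qed
  \<comment> \<open>For fixed n the sum is finite, so \<epsilon> enters with a finite factor and can
    tend to 0.\<close>
  have "Kfun a b c \<beta> \<gamma> p r f (1 / real n) \<le> ennreal (C2 * (1 / real n ^ r) * S E)"
  proof (rule ennreal_le_limit)
    show "Kfun a b c \<beta> \<gamma> p r f (1 / real n) \<le> ennreal (C2 * (1 / real n ^ r) * S E + \<epsilon> * (C2 * (1 / real n ^ r) * S (\<lambda>k. 1)))"
      if "0 < \<epsilon>" for \<epsilon>
    proof -
      have "S (\<lambda>k. E k + \<epsilon>) = S E + \<epsilon> * S (\<lambda>k. 1)"
        by (simp add: S_def sum.distrib[symmetric] sum_distrib_left algebra_simps)
      then have "C2 * (1 / real n ^ r) * S (\<lambda>k. E k + \<epsilon>)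
          = C2 * (1 / real n ^ r) * S E + \<epsilon> * (C2 * (1 / real n ^ r) * S (\<lambda>k. 1))"
        by (simp only: distrib_left mult_ac)
      then show ?thesis using main[OF that] by (simp only:)
    qed
  qed (use C2 E0 in \<open>auto simp: S_def intro!: mult_nonneg_nonneg divide_nonneg_nonneg sum_nonneg\<close>)
  also have "ennreal (C2 * (1 / real n ^ r) * S E) = ennreal C2 * ennreal (1 / real n ^ r) * ennreal (S E)"
    using C2 E0 by (simp add: S_def ennreal_mult[symmetric] sum_nonneg)
  also have "ennreal (S E) = (\<Sum>k\<le>n. ennreal ((real k + 1) ^ (r - 1)) * Ebest a b c \<beta> \<gamma> p k f)"
    unfolding S_def E using E0 by (simp add: ennreal_mult[symmetric])
  finally show ?thesis unfolding C2_def C_def .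
qed

end

theorem theorem3p5:
  fixes a b c \<beta> \<gamma> :: real and r :: nat and p :: ennreal
  assumes "0 \<le> a" and "a < b" and "0 \<le> c" and "0 \<le> \<beta>" and "\<gamma> \<ge> - 1/2"
    and "r \<ge> 1" and "1 \<le> p"
  shows "\<exists>C>0. \<forall>f. Lp_class a b c \<beta> \<gamma> p f \<longrightarrow> (\<forall>n::nat. n \<ge> 1 \<longrightarrow>
     Ebest a b c \<beta> \<gamma> p n f \<le> ennreal C * Kfun a b c \<beta> \<gamma> p r f (1 / real n) \<and>
     Kfun a b c \<beta> \<gamma> p r f (1 / real n)
       \<le> ennreal C * ennreal (1 / real n ^ r) *
          (\<Sum>k\<le>n. ennreal ((real k + 1) ^ (r - 1)) * Ebest a b c \<beta> \<gamma> p k f))"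
proof -
  interpret J: jacobi_domain a b c \<beta> \<gamma> using assms by unfold_locales auto
  \<comment> \<open>Neither constant involves f, n or p.\<close>
  define A where "A = 1 + \<bar>J.Cj\<bar> ^ r * J.Cv"
  define B where "B = (2 ^ r + \<bar>J.Cb\<bar> ^ r * (2 ^ r + 1)) * 2 ^ r"
  have "0 < A" using J.Cv_pos by (auto simp: A_def intro: add_pos_nonneg)
  then have C: "0 < max A B" "ennreal A \<le> ennreal (max A B)" "ennreal B \<le> ennreal (max A B)"
    by (auto intro: ennreal_leI)
  show ?thesis
  proof (intro exI[of _ "max A B"] conjI allI impI C(1))
    fix f and n :: nat assume f: "Lp_class a b c \<beta> \<gamma> p f" and n: "n \<ge> 1"
    show "Ebest a b c \<beta> \<gamma> p n f \<le> ennreal (max A B) * Kfun a b c \<beta> \<gamma> p r f (1 / real n)"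
      using J.Ebest_le_Kfun[OF J.Lp_classD(1)[OF f assms(7)] assms(7) n assms(6)]
      unfolding A_def[symmetric] by (rule order_trans) (intro mult_right_mono C(2), simp)
    show "Kfun a b c \<beta> \<gamma> p r f (1 / real n) \<le> ennreal (max A B) * ennreal (1 / real n ^ r) *
        (\<Sum>k\<le>n. ennreal ((real k + 1) ^ (r - 1)) * Ebest a b c \<beta> \<gamma> p k f)"
      using J.Kfun_le_Ebest[OF f assms(7) n assms(6)]
      unfolding B_def[symmetric] by (rule order_trans) (intro mult_right_mono C(3), simp_all)
  qed
qed

end
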